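(* Let $\lambda\neq0$ be a fixed real constant. There is a constant $C>0$ independent of $N$ such that for every sufficiently large $N\in\mathbb{N}^+$ with $N>10$ there exists $\gamma_0\in \mathcal{C}^\infty(\mathbb{R})$ for which the following hold: 1. $\|\gamma_0\|_{B^0_{\infty,1}}\le C N^{-\frac1{10}}$. 2. There is a unique solution $\gamma\in C([0,T];\mathcal{C}^\infty(\mathbb{R}))$, with a time $T\le N^{-\frac12}$, to the Cauchy problem $$\begin{cases}\gamma_t+(G^{-1}m)\,\gamma_x=\dfrac{\gamma^2}{2}+\lambda\, G^{-1}m-\gamma\, G^{-1}m_x, & t>0,\ x\in\mathbb{R},\\[1mm] m=\gamma_x+\dfrac{\gamma^2}{2\lambda}, & t\ge 0,\ x\in\mathbb{R},\\[1mm] \gamma(0,x)=\gamma_0(x), & x\in\mathbb{R}.\end{cases}$$ 3. There exists a time $t_0\in[0,T]$ such that $\|\gamma(t_0)\|_{B^0_{\infty,1}}\ge \ln N$.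
   Context: $G=\partial_x^2-1$, so $G^{-1}f=-\tfrac12 e^{-|\cdot|}*f$ on $\mathbb{R}$, and $m_x=\partial_x m$. Nonhomogeneous Littlewood-Paley blocks: fix smooth radial functions $\chi,\varphi:\mathbb{R}\to[0,1]$ with $\chi$ supported in the ball $\{|\xi|\le \frac43\}$, $\varphi$ supported in the annulus $\{\frac34\le|\xi|\le\frac83\}$, and $\chi(\xi)+\sum_{j\ge0}\varphi(2^{-j}\xi)=1$ for all $\xi$. For a tempered distribution $u$ set $\Delta_{-1}u=\mathcal{F}^{-1}(\chi\,\mathcal{F}u)$ and $\Delta_j u=\mathcal{F}^{-1}(\varphi(2^{-j}\cdot)\mathcal{F}u)$ for $j\ge 0$. The norm of the nonhomogeneous Besov space $B^0_{\infty,1}(\mathbb{R})$ is $\|u\|_{B^0_{\infty,1}}=\sum_{j\ge-1}\|\Delta_j u\|_{L^\infty}$. *)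

theory Defs
  imports "HOL-Analysis.Analysis" "HOL-Probability.Essential_Supremum"
begin

text \<open>One derivative operator for both real-valued and complex-valued functions on the line.\<close>

definition D :: "(real \<Rightarrow> 'a::real_normed_vector) \<Rightarrow> real \<Rightarrow> 'a" where
  "D f x = vector_derivative f (at x)"

definition smooth :: "(real \<Rightarrow> 'a::real_normed_vector) \<Rightarrow> bool" where
  "smooth f \<longleftrightarrow> (\<forall>k x. (D ^^ k) f differentiable (at x))"

text \<open>
  The space of smooth functions on the line is read as the intersection over \<open>k\<close> of the Banach
  spaces of functions with bounded continuous derivatives up to order \<open>k\<close>, with the Frechet
  topology given by the norms of these spaces. Boundedness makes the convolution defining
  \<open>Ginv\<close> converge and makes every element a tempered distribution.
\<close>

definition Cinf :: "(real \<Rightarrow> real) set" where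
  "Cinf = {f. smooth f \<and> (\<forall>k. bounded (range ((D ^^ k) f)))}"

definition continuous_into_Cinf :: "real \<Rightarrow> (real \<Rightarrow> real \<Rightarrow> real) \<Rightarrow> bool" where
  "continuous_into_Cinf T g \<longleftrightarrow>
     (\<forall>t\<in>{0..T}. g t \<in> Cinf) \<and>
     (\<forall>k. \<forall>t\<in>{0..T}.
        uniform_limit UNIV (\<lambda>s. (D ^^ k) (g s)) ((D ^^ k) (g t)) (at t within {0..T}))"


section \<open>The nonhomogeneous Besov norm\<close>

definition schwartz :: "(real \<Rightarrow> complex) set" where
  "schwartz = {f. smooth f \<and> (\<forall>k l. bounded (range (\<lambda>x. of_real (x ^ k) * (D ^^ l) f x)))}"

text \<open>
  The Fourier transform is normalised with kernel \<open>exp (- \<i> x \<xi>)\<close>, the factor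
  \<open>1 / (2 * pi)\<close> being in the inverse.
\<close>

definition fourier :: "(real \<Rightarrow> complex) \<Rightarrow> real \<Rightarrow> complex" where
  "fourier f \<xi> = (LINT x|lborel. exp (- \<i> * of_real (x * \<xi>)) * f x)"

definition inverse_fourier :: "(real \<Rightarrow> complex) \<Rightarrow> real \<Rightarrow> complex" where
  "inverse_fourier f x = (LINT \<xi>|lborel. exp (\<i> * of_real (x * \<xi>)) * f \<xi>) / of_real (2 * pi)"

text \<open>
  A tempered distribution is represented by its action on test functions; only the values on
  \<open>schwartz\<close> are meaningful. All operations are defined by duality.
\<close>

type_synonym distribution = "(real \<Rightarrow> complex) \<Rightarrow> complex"

definition regular_dist :: "(real \<Rightarrow> complex) \<Rightarrow> distribution" where
  "regular_dist u = (\<lambda>\<psi>. LINT x|lborel. u x * \<psi> x)"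

definition fourier_dist :: "distribution \<Rightarrow> distribution" where
  "fourier_dist U = (\<lambda>\<psi>. U (fourier \<psi>))"

definition inverse_fourier_dist :: "distribution \<Rightarrow> distribution" where
  "inverse_fourier_dist U = (\<lambda>\<psi>. U (inverse_fourier \<psi>))"

definition mult_dist :: "(real \<Rightarrow> real) \<Rightarrow> distribution \<Rightarrow> distribution" where
  "mult_dist a U = (\<lambda>\<psi>. U (\<lambda>\<xi>. of_real (a \<xi>) * \<psi> \<xi>))"

text \<open>
  The infimum runs over the functions representing \<open>U\<close>, which agree almost everywhere, so it is
  their common essential supremum; it is \<open>\<infinity>\<close> if \<open>U\<close> is not given by a bounded function.
\<close>

definition Linf_norm :: "distribution \<Rightarrow> ennreal" where
  "Linf_norm U =
     Inf {esssup lborel (\<lambda>x. ennreal (norm (g x))) | g.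
            g \<in> borel_measurable lborel \<and> (\<forall>\<psi>\<in>schwartz. U \<psi> = regular_dist g \<psi>)}"

definition littlewood_paley :: "(real \<Rightarrow> real) \<Rightarrow> (real \<Rightarrow> real) \<Rightarrow> bool" where
  "littlewood_paley chi phi \<longleftrightarrow>
     smooth chi \<and> smooth phi \<and>
     (\<forall>\<xi>. chi (- \<xi>) = chi \<xi>) \<and> (\<forall>\<xi>. phi (- \<xi>) = phi \<xi>) \<and>
     range chi \<subseteq> {0..1} \<and> range phi \<subseteq> {0..1} \<and>
     closure {\<xi>. chi \<xi> \<noteq> 0} \<subseteq> {\<xi>. \<bar>\<xi>\<bar> \<le> 4 / 3} \<and>
     closure {\<xi>. phi \<xi> \<noteq> 0} \<subseteq> {\<xi>. 3 / 4 \<le> \<bar>\<xi>\<bar> \<and> \<bar>\<xi>\<bar> \<le> 8 / 3} \<and>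
     (\<forall>\<xi>. (\<lambda>j::nat. phi (\<xi> / 2 ^ j)) sums (1 - chi \<xi>))"

definition LP_block ::
    "(real \<Rightarrow> real) \<Rightarrow> (real \<Rightarrow> real) \<Rightarrow> int \<Rightarrow> distribution \<Rightarrow> distribution" where
  "LP_block chi phi j U =
     inverse_fourier_dist
       (mult_dist (if j = -1 then chi else (\<lambda>\<xi>. phi (2 powi (-j) * \<xi>))) (fourier_dist U))"

text \<open>The summation index is shifted by one: it runs over \<open>j = int n - 1 \<ge> -1\<close>.\<close>

definition besov_norm ::
    "(real \<Rightarrow> real) \<Rightarrow> (real \<Rightarrow> real) \<Rightarrow> (real \<Rightarrow> real) \<Rightarrow> ennreal" where
  "besov_norm chi phi u =
     (\<Sum>n. Linf_norm (LP_block chi phi (int n - 1) (regular_dist (\<lambda>x. of_real (u x)))))"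


section \<open>The Cauchy problem\<close>

text \<open>The inverse of \<open>G = D\<^sup>2 - 1\<close>, as a convolution operator.\<close>

definition Ginv :: "(real \<Rightarrow> real) \<Rightarrow> real \<Rightarrow> real" where
  "Ginv f x = - (1 / 2) * (LINT y|lborel. exp (- \<bar>x - y\<bar>) * f y)"

definition momentum :: "real \<Rightarrow> (real \<Rightarrow> real) \<Rightarrow> real \<Rightarrow> real" where
  "momentum lam g x = D g x + (g x)\<^sup>2 / (2 * lam)"

text \<open>
  Classical solution on \<open>[0,T]\<close>; the time derivative is two-sided for \<open>0 < t < T\<close> and
  left-sided at \<open>t = T\<close>.
\<close>

definition is_solution ::
    "real \<Rightarrow> (real \<Rightarrow> real) \<Rightarrow> real \<Rightarrow> (real \<Rightarrow> real \<Rightarrow> real) \<Rightarrow> bool" where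
  "is_solution lam g0 T g \<longleftrightarrow>
     continuous_into_Cinf T g \<and>
     (\<forall>t\<in>{0<..T}. \<forall>x. \<exists>gt.
        ((\<lambda>s. g s x) has_real_derivative gt) (at t within {0..T}) \<and>
        gt + Ginv (momentum lam (g t)) x * D (g t) x =
          (g t x)\<^sup>2 / 2 + lam * Ginv (momentum lam (g t)) x
            - g t x * Ginv (D (momentum lam (g t))) x) \<and>
     (\<forall>x. g 0 x = g0 x)"

end

theory Submission
  imports Defs "HOL-Complex_Analysis.Complex_Analysis" "HOL-Real_Asymp.Real_Asymp" "HOL-Probability.Probability"
begin

text \<open>
  Norm inflation comes from the term \<open>\<gamma>\<^sup>2 / 2\<close> acting on a fast oscillation whose amplitude jumps at the
  origin. Put \<open>\<gamma>\<^sub>0 = D (a (1 + l(\<Delta> x)) sin (Q x) / Q)\<close> with \<open>l\<close> the logistic function,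
  \<open>a = N powr (- 1 / 10)\<close>, \<open>\<Delta> = 2 ^ (3 N)\<close> and \<open>Q = 2 ^ (6 N)\<close>. Being concentrated at one frequency,
  \<open>\<gamma>\<^sub>0\<close> has Besov norm of order \<open>a\<close>. Along the flow \<open>q\<close> of \<open>G\<^sup>-\<^sup>1 m\<close>, with \<open>J = q_x\<close> and
  \<open>\<Gamma> = \<gamma> \<circ> q\<close>, the equations give \<open>(J \<Gamma>)_t = J \<Gamma>\<^sup>2 / 2 + \<lambda> J q_t\<close>, so that \<open>J \<Gamma>\<close> picks up
  \<open>t \<gamma>\<^sub>0\<^sup>2 / 2 + \<lambda> (q - x)\<close> up to quadratic errors. The mean value of \<open>cos\<^sup>2\<close> in \<open>\<gamma>\<^sub>0\<^sup>2\<close> is a step of height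
  \<open>3 a\<^sup>2 / 2\<close>, smoothed only at the scale \<open>1 / \<Delta>\<close>: a jump is invisible in \<open>L\<^sup>\<infinity>\<close> but contributes its
  height to every dyadic block. At \<open>t = T = N powr (- 1 / 2)\<close> each of the \<open>N\<close> blocks between
  \<open>N\<close> and \<open>2 N\<close> is of order \<open>a\<^sup>2 T = N powr (- 7 / 10)\<close>, and their sum grows like \<open>N powr (3 / 10)\<close>.

  Integration by parts removes the derivative from \<open>m\<close>, so the system for \<open>(J, \<Gamma>)\<close> is an ordinary differential
  equation with a Lipschitz right-hand side. It is solved among functions holomorphic in a strip around the
  real line, where Cauchy's estimates make all derivatives continuous in time.
\<close>

section \<open>Holomorphic functions on a strip\<close>

text \<open>The blocks used have frequencies between \<open>2 ^ N\<close> and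
  \<open>2 ^ (2 N)\<close>. Far below \<open>\<Delta>\<close> the smoothed jump looks sharp and far
  below \<open>Q\<close> the oscillation averages out, so both errors are exponentially small there.
  The term \<open>\<lambda> (q - x)\<close> is Lipschitz with a constant of order one, and a block
  at frequency at least \<open>2 ^ N\<close> damps it accordingly. Only the errors quadratic in
  amplitude and time decay polynomially, and the exponents of \<open>a\<close> and \<open>T\<close>
  are such that \<open>N\<close> of them still tend to 0.

  The obstacle is uniformity in \<open>N\<close>: the datum is of size \<open>a\<close> only on a
  strip of width \<open>1 / Q\<close>, which is exponentially thin. Bounds and Lipschitz constants
  of the Lagrangian right-hand side involve no derivative of the unknowns, so they do not see the
  width. It is spent only in Cauchy's estimates, which give regularity but no quantity that is
  compared with \<open>N\<close>.

  Uniqueness is claimed among all smooth solutions, holomorphic or not. It needs a separate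
  argument, in which integration by parts keeps derivatives off the difference of two
  solutions.\<close>

definition strip :: "real \<Rightarrow> complex set" where
  "strip r = {z. \<bar>Im z\<bar> < r}"

lemma strip_altdef: "strip r = {z. Im z < r} \<inter> {z. Im z > -r}"
  by (auto simp: strip_def)

lemma open_strip: "open (strip r)"
  unfolding strip_altdef by (intro open_Int open_halfspace_Im_lt open_halfspace_Im_gt)

lemma convex_strip: "convex (strip r)"
  unfolding strip_altdef by (intro convex_Int convex_halfspace_Im_lt convex_halfspace_Im_gt)

lemma strip_shift [simp]: "z + of_real y \<in> strip r \<longleftrightarrow> z \<in> strip r"
  by (simp add: strip_def)

lemma strip_minus [simp]: "- z \<in> strip r \<longleftrightarrow> z \<in> strip r"
  by (simp add: strip_def)

lemma strip_of_real [simp]: "complex_of_real x \<in> strip r \<longleftrightarrow> 0 < r"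
  by (simp add: strip_def)

text \<open>In Lagrangian coordinates \<open>J = q_x\<close> starts from 1. Staying within 1/2 of it
  has two uses: the real part of the integral in \<open>weight\<close> grows at least like
  \<open>y / 2\<close>, which makes \<open>fwd\<close> converge, and \<open>J\<close> stays
  invertible, so that the flow can be undone.\<close>

definition near_one :: "real \<Rightarrow> (complex \<Rightarrow> complex) \<Rightarrow> bool" where
  "near_one r J \<longleftrightarrow> J holomorphic_on strip r \<and> (\<forall>z\<in>strip r. norm (J z - 1) \<le> 1 / 2)"

text \<open>
  For \<open>J = q_x\<close> the weight is \<open>exp (q z - q (z + y))\<close>, so \<open>fwd\<close> is the half \<open>y > x\<close> of the convolution with
  \<open>- exp (- \<bar>x - y\<bar>)\<close> in Lagrangian coordinates, the density \<open>J\<close> being left to \<open>F\<close>.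
\<close>

definition weight :: "(complex \<Rightarrow> complex) \<Rightarrow> complex \<Rightarrow> real \<Rightarrow> complex" where
  "weight J z y = exp (- integral {0..y} (\<lambda>\<tau>. J (z + of_real \<tau>)))"

definition fwd :: "(complex \<Rightarrow> complex) \<Rightarrow> (complex \<Rightarrow> complex) \<Rightarrow> complex \<Rightarrow> complex" where
  "fwd J F z = - integral {0..} (\<lambda>y. weight J z y * F (z + of_real y))"

lemma holomorphic_strip_primitive:
  assumes "f holomorphic_on strip r"
  obtains q where "\<And>z. z \<in> strip r \<Longrightarrow> (q has_field_derivative f z) (at z)"
proof -
  obtain q where q: "\<And>z. z \<in> strip r \<Longrightarrow> (q has_field_derivative f z) (at z within strip r)"
    using holomorphic_convex_primitive'[OF convex_strip open_strip assms] by metis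
  have "(q has_field_derivative f z) (at z)" if "z \<in> strip r" for z
    using q[OF that] at_within_open[OF that open_strip] by simp
  then show ?thesis using that by blast
qed

lemma continuous_on_horizontal:
  assumes "f holomorphic_on strip r" "z \<in> strip r"
  shows "continuous_on S (\<lambda>\<tau>. f (z + of_real \<tau>))"
  by (rule continuous_on_compose2[OF holomorphic_on_imp_continuous_on[OF assms(1)]])
     (auto intro!: continuous_intros simp: assms)

lemma has_integral_horizontal:
  assumes q: "\<And>z. z \<in> strip r \<Longrightarrow> (q has_field_derivative J z) (at z)"
    and z: "z \<in> strip r" and y: "0 \<le> (y::real)"
  shows "((\<lambda>\<tau>. J (z + of_real \<tau>)) has_integral q (z + of_real y) - q z) {0..y}"
proof -
  have "((\<lambda>\<tau>. q (z + of_real \<tau>)) has_vector_derivative J (z + of_real \<tau>)) (at \<tau> within {0..y})" for \<tau>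
  proof -
    have 1: "((\<lambda>\<tau>. z + of_real \<tau>) has_vector_derivative 1) (at \<tau> within {0..y})"
      by (auto intro!: derivative_eq_intros)
    show ?thesis
      using field_vector_diff_chain_within[OF 1 has_field_derivative_at_within[OF q]] z
      by (simp add: o_def)
  qed
  from fundamental_theorem_of_calculus[OF y this] show ?thesis by simp
qed

lemma weight_eq:
  assumes q: "\<And>z. z \<in> strip r \<Longrightarrow> (q has_field_derivative J z) (at z)"
    and z: "z \<in> strip r" and y: "0 \<le> y"
  shows "weight J z y = exp (q z - q (z + of_real y))"
  using integral_unique[OF has_integral_horizontal[OF assms]] by (simp add: weight_def)

lemma integrable_horizontal:
  assumes "f holomorphic_on strip r" "z \<in> strip r"
  shows "(\<lambda>\<tau>. f (z + of_real \<tau>)) integrable_on {0..y::real}"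
  by (rule integrable_continuous_real[OF continuous_on_horizontal[OF assms]])

lemma norm_integral_horizontal:
  assumes "f holomorphic_on strip r" "z \<in> strip r" "0 \<le> (y::real)"
    and "\<And>z. z \<in> strip r \<Longrightarrow> norm (f z) \<le> B"
  shows "norm (integral {0..y} (\<lambda>\<tau>. f (z + of_real \<tau>))) \<le> B * y"
  using integral_bound[OF assms(3) continuous_on_horizontal[OF assms(1,2)], of B] assms by simp

lemma near_one_holo: "near_one r J \<Longrightarrow> J holomorphic_on strip r"
  by (simp add: near_one_def)

lemma near_one_Re_integral:
  assumes J: "near_one r J" and z: "z \<in> strip r" and y: "0 \<le> y"
  shows "y / 2 \<le> Re (integral {0..y} (\<lambda>\<tau>. J (z + of_real \<tau>)))"
proof -
  have h: "(\<lambda>z. J z - 1) holomorphic_on strip r"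
    using J by (auto intro!: holomorphic_intros simp: near_one_def)
  have "norm (integral {0..y} (\<lambda>\<tau>. J (z + of_real \<tau>) - 1)) \<le> 1 / 2 * y"
    using norm_integral_horizontal[OF h z y, of "1/2"] J by (auto simp: near_one_def)
  moreover have "integral {0..y} (\<lambda>\<tau>. J (z + of_real \<tau>) - 1)
      = integral {0..y} (\<lambda>\<tau>. J (z + of_real \<tau>)) - of_real y"
    using integral_diff[OF integrable_horizontal[OF near_one_holo[OF J] z] integrable_const_ivl[of 1 0 y]] y
    by (simp add: scaleR_conv_of_real)
  ultimately have *: "norm (integral {0..y} (\<lambda>\<tau>. J (z + of_real \<tau>)) - of_real y) \<le> y / 2" by simp
  have "\<bar>Re (integral {0..y} (\<lambda>\<tau>. J (z + of_real \<tau>)) - of_real y)\<bar> \<le> y / 2"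
    using abs_Re_le_cmod * order_trans by blast
  then have "\<bar>Re (integral {0..y} (\<lambda>\<tau>. J (z + of_real \<tau>))) - y\<bar> \<le> y / 2" by simp
  then show ?thesis by linarith
qed

lemma norm_weight_le:
  assumes "near_one r J" "z \<in> strip r" "0 \<le> y"
  shows "norm (weight J z y) \<le> exp (- y / 2)"
  using near_one_Re_integral[OF assms] by (simp add: weight_def)

text \<open>The mean value inequality on the half plane \<open>Re w \<le> c\<close>, which is convex
  and on which the derivative of \<open>exp\<close> is at most \<open>exp c\<close>.\<close>

lemma norm_exp_diff_le:
  fixes a b :: complex
  assumes "Re a \<le> c" "Re b \<le> c"
  shows "norm (exp a - exp b) \<le> exp c * norm (a - b)"
  by (rule field_differentiable_bound[OF convex_halfspace_Re_le[of c], where f'=exp])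
     (auto simp: assms intro!: DERIV_exp has_field_derivative_at_within)

lemma norm_weight_diff_le:
  assumes J1: "near_one r J1" and J2: "near_one r J2" and z: "z \<in> strip r" and y: "0 \<le> y"
    and d: "\<And>z. z \<in> strip r \<Longrightarrow> norm (J1 z - J2 z) \<le> d"
  shows "norm (weight J1 z y - weight J2 z y) \<le> exp (- y / 2) * (d * y)"
proof -
  let ?I = "\<lambda>J. integral {0..y} (\<lambda>\<tau>. J (z + of_real \<tau>))"
  have h: "(\<lambda>z. J1 z - J2 z) holomorphic_on strip r"
    using near_one_holo[OF J1] near_one_holo[OF J2] by (intro holomorphic_intros)
  have 1: "norm (?I J1 - ?I J2) \<le> d * y"
    using norm_integral_horizontal[OF h z y d]
      integral_diff[OF integrable_horizontal[OF near_one_holo[OF J1] z] integrable_horizontal[OF near_one_holo[OF J2] z]]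
    by simp
  have "norm (weight J1 z y - weight J2 z y) \<le> exp (- y / 2) * norm (- ?I J1 - (- ?I J2))"
    unfolding weight_def
    using near_one_Re_integral[OF J1 z y] near_one_Re_integral[OF J2 z y]
    by (intro norm_exp_diff_le) auto
  also have "norm (- ?I J1 - (- ?I J2)) = norm (?I J1 - ?I J2)"
    by (metis minus_diff_minus norm_minus_cancel)
  also have "exp (- y / 2) * norm (?I J1 - ?I J2) \<le> exp (- y / 2) * (d * y)"
    by (intro mult_left_mono 1) auto
  finally show ?thesis .
qed

lemma continuous_on_weight:
  assumes "near_one r J" "z \<in> strip r"
  shows "continuous_on {0..} (weight J z)"
proof -
  obtain q where q: "\<And>z. z \<in> strip r \<Longrightarrow> (q has_field_derivative J z) (at z)"
    using holomorphic_strip_primitive near_one_holo[OF assms(1)] by metis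
  have qh: "q holomorphic_on strip r"
    using q field_differentiable_at_within field_differentiable_def holomorphic_onI by metis
  have c: "continuous_on {0..} (\<lambda>y. exp (q z - q (z + of_real y)))"
    by (intro continuous_intros continuous_on_horizontal[OF qh assms(2)])
  show ?thesis
    by (rule continuous_on_eq[OF c]) (simp add: weight_eq[OF q assms(2)])
qed

lemma exp_minus_integral:
  fixes c a :: real
  assumes "a > 0"
  shows "(\<lambda>y. c * exp (- y * a)) integrable_on {0..}" "integral {0..} (\<lambda>y. c * exp (- y * a)) = c / a"
  using has_integral_mult_right[OF has_integral_exp_minus_to_infinity[OF assms, of 0], of c]
  by (auto simp: has_integral_iff mult.commute)

lemma integrable_dominated_exp:
  fixes f :: "real \<Rightarrow> 'a::euclidean_space"
  assumes "continuous_on {0..} f" "a > 0" "\<And>y. y \<ge> 0 \<Longrightarrow> norm (f y) \<le> c * exp (- y * a)"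
  shows "f integrable_on {0..}" "norm (integral {0..} f) \<le> c / a"
proof -
  show i: "f integrable_on {0..}"
    by (rule measurable_bounded_by_integrable_imp_integrable[OF _ exp_minus_integral(1)[OF assms(2)]])
       (use assms in \<open>auto intro!: continuous_imp_measurable_on_sets_lebesgue\<close>)
  show "norm (integral {0..} f) \<le> c / a"
    using integral_norm_bound_integral[OF i exp_minus_integral(1)[OF assms(2)], of c]
      exp_minus_integral(2)[OF assms(2)] assms(3) by auto
qed

lemma fwd_integrand:
  assumes J: "near_one r J" and F: "F holomorphic_on strip r" and z: "z \<in> strip r"
    and f: "\<And>z. z \<in> strip r \<Longrightarrow> norm (F z) \<le> f"
  shows "continuous_on {0..} (\<lambda>y. weight J z y * F (z + of_real y))"
    and "y \<ge> 0 \<Longrightarrow> norm (weight J z y * F (z + of_real y)) \<le> f * exp (- y * (1 / 2))"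
proof -
  show "continuous_on {0..} (\<lambda>y. weight J z y * F (z + of_real y))"
    by (intro continuous_intros continuous_on_weight[OF J z] continuous_on_horizontal[OF F z])
  assume y: "y \<ge> 0"
  have "norm (weight J z y) * norm (F (z + of_real y)) \<le> exp (- y / 2) * f"
    using norm_weight_le[OF J z y] f z by (intro mult_mono) auto
  then show "norm (weight J z y * F (z + of_real y)) \<le> f * exp (- y * (1 / 2))"
    by (simp add: norm_mult mult.commute)
qed

lemma norm_fwd_le:
  assumes J: "near_one r J" and F: "F holomorphic_on strip r" and z: "z \<in> strip r"
    and f: "\<And>z. z \<in> strip r \<Longrightarrow> norm (F z) \<le> f"
  shows "norm (fwd J F z) \<le> 2 * f"
  using integrable_dominated_exp(2)[OF fwd_integrand(1)[OF J F z f] _ fwd_integrand(2)[OF J F z f]]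
  by (simp add: fwd_def)

text \<open>The change of the weight costs a factor \<open>y\<close>, absorbed by giving up half of
  the decay: the integrand is dominated at rate 1/4 instead of 1/2. Integration then yields the
  factor 4, and the 4 in \<open>y \<le> 4 * exp (y / 4)\<close> raises it to 16 in the second
  term.\<close>

lemma norm_fwd_diff_le:
  assumes J1: "near_one r J1" and J2: "near_one r J2"
    and F1: "F1 holomorphic_on strip r" and F2: "F2 holomorphic_on strip r" and z: "z \<in> strip r"
    and f1: "\<And>z. z \<in> strip r \<Longrightarrow> norm (F1 z) \<le> f" and f2: "\<And>z. z \<in> strip r \<Longrightarrow> norm (F2 z) \<le> f"
    and d: "\<And>z. z \<in> strip r \<Longrightarrow> norm (J1 z - J2 z) \<le> d"
    and e: "\<And>z. z \<in> strip r \<Longrightarrow> norm (F1 z - F2 z) \<le> e"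
  shows "norm (fwd J1 F1 z - fwd J2 F2 z) \<le> 4 * e + 16 * (d * f)"
proof -
  let ?g1 = "\<lambda>y. weight J1 z y * F1 (z + of_real y)" and ?g2 = "\<lambda>y. weight J2 z y * F2 (z + of_real y)"
  have i1: "?g1 integrable_on {0..}"
    using integrable_dominated_exp(1)[OF fwd_integrand(1)[OF J1 F1 z] _ fwd_integrand(2)[OF J1 F1 z]] f1 by auto
  have i2: "?g2 integrable_on {0..}"
    using integrable_dominated_exp(1)[OF fwd_integrand(1)[OF J2 F2 z] _ fwd_integrand(2)[OF J2 F2 z]] f2 by auto
  have pos: "0 \<le> d" "0 \<le> e" "0 \<le> f"
    using d[OF z] e[OF z] f1[OF z] norm_ge_zero order_trans by blast+
  have b: "norm (?g1 y - ?g2 y) \<le> (e + 4 * (d * f)) * exp (- y * (1/4))" if y: "y \<ge> 0" for y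
  proof -
    have "?g1 y - ?g2 y = weight J1 z y * (F1 (z + of_real y) - F2 (z + of_real y))
        + (weight J1 z y - weight J2 z y) * F2 (z + of_real y)"
      by (simp add: algebra_simps)
    also have "norm \<dots> \<le> exp (- y / 2) * e + (exp (- y / 2) * (d * y)) * f"
      unfolding norm_mult[symmetric] using z y pos
      by (intro norm_triangle_le add_mono; unfold norm_mult)
         (intro mult_mono norm_weight_le[OF J1 z y] e f2 norm_weight_diff_le[OF J1 J2 z y d];
          simp)+
    also have "\<dots> \<le> exp (- y / 4) * e + exp (- y / 4) * (4 * (d * f))"
    proof (intro add_mono mult_right_mono)
      show "exp (- y / 2) \<le> exp (- y / 4)" using y by simp
      have "y \<le> 4 * exp (y / 4)" using exp_ge_add_one_self[of "y/4"] by linarith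
      then have "exp (- y / 2) * y \<le> exp (- y / 2) * (4 * exp (y / 4))" by (intro mult_left_mono) auto
      also have "\<dots> = 4 * exp (- y / 4)" by (simp add: exp_add[symmetric])
      finally have "exp (- y / 2) * y * (d * f) \<le> 4 * exp (- y / 4) * (d * f)"
        using pos by (intro mult_right_mono) auto
      then show "exp (- y / 2) * (d * y) * f \<le> exp (- y / 4) * (4 * (d * f))"
        by (simp add: mult_ac)
    qed (use pos in auto)
    finally show ?thesis by (simp add: algebra_simps)
  qed
  have "norm (integral {0..} (\<lambda>y. ?g1 y - ?g2 y)) \<le> (e + 4 * (d * f)) / (1/4)"
    by (rule integrable_dominated_exp(2)[OF continuous_on_diff[OF fwd_integrand(1)[OF J1 F1 z f1] fwd_integrand(1)[OF J2 F2 z f2]] _ b])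
       simp_all
  moreover have "fwd J1 F1 z - fwd J2 F2 z = - integral {0..} (\<lambda>y. ?g1 y - ?g2 y)"
    using integral_diff[OF i1 i2] by (simp add: fwd_def)
  ultimately show ?thesis by simp
qed

lemma integral_tendsto_infinity:
  fixes f :: "real \<Rightarrow> 'a::euclidean_space"
  assumes "continuous_on {0..} f" "a > 0" "\<And>y. y \<ge> 0 \<Longrightarrow> norm (f y) \<le> c * exp (- y * a)"
  shows "(\<lambda>n::nat. integral {0..real n} f) \<longlonglongrightarrow> integral {0..} f"
proof -
  let ?g = "\<lambda>n y. if y \<in> {0..real n} then f y else 0"
  have "(\<lambda>n. integral {0..} (?g n)) \<longlonglongrightarrow> integral {0..} f"
  proof (rule dominated_convergence(2)[OF _ exp_minus_integral(1)[OF assms(2), of c]])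
    show "?g n integrable_on {0..}" for n
      using integrable_continuous_real[of 0 "real n" f] continuous_on_subset[OF assms(1), of "{0..real n}"]
      by (subst integrable_restrict_Int) (auto simp: Int_absorb2 Int_commute intro: integrable_on_superset)
    show "norm (?g n y) \<le> c * exp (- y * a)" if "y \<in> {0..}" for n y
      using assms(3)[of y] that order_trans[OF norm_ge_zero[of "f y"] assms(3)[of y]] by auto
    show "(\<lambda>n. ?g n y) \<longlonglongrightarrow> f y" if "y \<in> {0..}" for y
    proof (rule tendsto_eventually)
      show "\<forall>\<^sub>F n in sequentially. ?g n y = f y"
        by (rule eventually_mono[OF eventually_ge_at_top[of "nat \<lceil>y\<rceil>"]]) (use that in \<open>auto simp: nat_le_iff ceiling_le_iff\<close>)
    qed
  qed
  moreover have "integral {0..} (?g n) = integral {0..real n} f" for n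
    by (subst integral_restrict_Int) (auto simp: Int_absorb2 Int_commute intro!: arg_cong[where f="\<lambda>S. integral S f"])
  ultimately show ?thesis by simp
qed

text \<open>Differentiation under the improper integral is avoided. Multiplication by
  \<open>exp (- q z)\<close> turns the integrand into the horizontal translates of one holomorphic
  function \<open>g\<close>, so the integral is the increment of a primitive \<open>G\<close> from
  \<open>z\<close> to the right end of its horizontal line.\<close>

lemma has_field_derivative_fwd:
  assumes J: "near_one r J" and F: "F holomorphic_on strip r" and z: "z \<in> strip r"
    and f: "\<And>z. z \<in> strip r \<Longrightarrow> norm (F z) \<le> f"
  shows "(fwd J F has_field_derivative J z * fwd J F z + F z) (at z)"
proof -
  obtain q where q: "\<And>z. z \<in> strip r \<Longrightarrow> (q has_field_derivative J z) (at z)"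
    using holomorphic_strip_primitive near_one_holo[OF J] by metis
  have qh: "q holomorphic_on strip r"
    using q field_differentiable_at_within field_differentiable_def holomorphic_onI by metis
  define g where "g = (\<lambda>z. exp (- q z) * F z)"
  have gh: "g holomorphic_on strip r" unfolding g_def by (intro holomorphic_intros qh F)
  obtain G where G: "\<And>z. z \<in> strip r \<Longrightarrow> (G has_field_derivative g z) (at z)"
    using holomorphic_strip_primitive gh by metis
  let ?h = "\<lambda>z y. weight J z y * F (z + of_real y)"
  have lim: "(\<lambda>n::nat. G (z + of_real (real n)) - G z) \<longlonglongrightarrow> - exp (- q z) * fwd J F z" if z: "z \<in> strip r" for z
  proof -
    have "(\<lambda>n::nat. exp (- q z) * integral {0..real n} (?h z)) \<longlonglongrightarrow> exp (- q z) * integral {0..} (?h z)"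
      by (intro tendsto_mult_left integral_tendsto_infinity[OF fwd_integrand(1)[OF J F z f] _ fwd_integrand(2)[OF J F z f]]) auto
    moreover have "exp (- q z) * integral {0..real n} (?h z) = G (z + of_real (real n)) - G z" for n :: nat
    proof -
      have "exp (- q z) * integral {0..real n} (?h z) = integral {0..real n} (\<lambda>y. exp (- q z) * ?h z y)"
        by simp
      also have "\<dots> = integral {0..real n} (\<lambda>y. g (z + of_real y))"
        by (rule integral_cong) (auto simp: weight_eq[OF q z] g_def exp_diff exp_minus field_simps)
      also have "\<dots> = G (z + of_real (real n)) - G z"
        by (rule integral_unique[OF has_integral_horizontal[OF G z]]) auto
      finally show ?thesis .
    qed
    ultimately show ?thesis by (simp add: fwd_def)
  qed
  \<comment> \<open>\<open>I z\<close> is the limit of \<open>G\<close> at the right end of the line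
    through \<open>z\<close>. It is the same for all lines, since \<open>g\<close> decays
    exponentially to the right, uniformly over a segment of starting points. Hence
    \<open>fwd\<close> is \<open>exp q\<close> times \<open>G\<close> shifted by a constant, and the
    product rule applies.\<close>
  define I where "I = (\<lambda>z. G z - exp (- q z) * fwd J F z)"
  have Iconst: "I w = I z" if w: "w \<in> strip r" for w
  proof -
    have sub: "closed_segment z w \<subseteq> strip r"
      using convex_strip z w closed_segment_subset by blast
    have "compact (exp ` uminus ` q ` closed_segment z w)"
      by (intro compact_continuous_image continuous_intros compact_segment
            holomorphic_on_imp_continuous_on[OF holomorphic_on_subset[OF qh sub]])
    then obtain Q where Q: "\<And>v. v \<in> closed_segment z w \<Longrightarrow> norm (exp (- q v)) \<le> Q"
      using compact_imp_bounded bounded_iff by (metis (no_types, lifting) image_eqI)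
    have gb: "norm (g (v + of_real y)) \<le> Q * (f * exp (- y * (1/2)))" if v: "v \<in> closed_segment z w" and y: "y \<ge> 0" for v y
    proof -
      have vs: "v \<in> strip r" using v sub by blast
      have "g (v + of_real y) = exp (- q v) * ?h v y"
        by (auto simp: weight_eq[OF q vs y] g_def exp_diff exp_minus field_simps)
      then show ?thesis
        using mult_mono'[OF Q[OF v] fwd_integrand(2)[OF J F vs f y]] by (simp add: norm_mult)
    qed
    have bd: "norm (G (w + of_real (real n)) - G (z + of_real (real n))) \<le> (Q * (f * exp (- real n * (1/2)))) * norm (w - z)" for n :: nat
    proof -
      have "norm ((\<lambda>v. G (v + of_real (real n))) w - (\<lambda>v. G (v + of_real (real n))) z) \<le> (Q * (f * exp (- real n * (1/2)))) * norm (w - z)"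
      proof (rule field_differentiable_bound[OF convex_closed_segment[of z w], where f'="\<lambda>v. g (v + of_real (real n))"])
        fix v assume v: "v \<in> closed_segment z w"
        then have vs: "v + of_real (real n) \<in> strip r" using sub strip_shift by blast
        have "((\<lambda>v. v + of_real (real n)) has_field_derivative 1) (at v within closed_segment z w)"
          by (auto intro!: derivative_eq_intros)
        from DERIV_chain2[where g="\<lambda>v. v + of_real (real n)", OF G[OF vs] this]
        show "((\<lambda>v. G (v + of_real (real n))) has_field_derivative g (v + of_real (real n))) (at v within closed_segment z w)"
          by simp
      qed (use gb[of _ "real n"] in auto)
      then show ?thesis by simp
    qed
    have "(\<lambda>n. (Q * (f * exp (- real n * (1/2)))) * norm (w - z)) \<longlonglongrightarrow> 0"
    proof -
      have "(\<lambda>n. exp (- real n * (1/2))) \<longlonglongrightarrow> 0" by real_asymp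
      from tendsto_mult_left[OF this, of "Q * f * norm (w - z)"] show ?thesis
        by (simp add: mult_ac)
    qed
    then have "(\<lambda>n. G (w + of_real (real n)) - G (z + of_real (real n))) \<longlonglongrightarrow> 0"
      by (rule Lim_null_comparison[OF always_eventually[OF allI[OF bd]]])
    moreover have "(\<lambda>n::nat. G (w + of_real (real n)) - G (z + of_real (real n))) \<longlonglongrightarrow> (- exp (- q w) * fwd J F w + G w) - (- exp (- q z) * fwd J F z + G z)"
      using tendsto_diff[OF tendsto_add[OF lim[OF w] tendsto_const[of "G w"]] tendsto_add[OF lim[OF z] tendsto_const[of "G z"]]]
      by simp
    ultimately show ?thesis using LIMSEQ_unique unfolding I_def by fastforce
  qed
  have fwd_eq: "fwd J F w = exp (q w) * (G w - I z)" if "w \<in> strip r" for w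
    using Iconst[OF that] by (auto simp: I_def exp_minus field_simps)
  have "((\<lambda>w. exp (q w) * (G w - I z)) has_field_derivative J z * fwd J F z + F z) (at z)"
    by (auto intro!: derivative_eq_intros q[OF z] G[OF z] simp: fwd_eq[OF z] g_def exp_minus field_simps)
  then show ?thesis
    by (rule has_field_derivative_transform_within_open[OF _ open_strip z]) (simp add: fwd_eq)
qed

text \<open>Reality on the axis has to be carried through the iteration, because the solution of the
  Cauchy problem is read off there.\<close>

lemma fwd_real:
  assumes J: "near_one r J" and F: "F holomorphic_on strip r" and r: "r > 0"
    and f: "\<And>z. z \<in> strip r \<Longrightarrow> norm (F z) \<le> f"
    and Jr: "\<And>x. J (of_real x) \<in> \<real>" and Fr: "\<And>x. F (of_real x) \<in> \<real>"
  shows "fwd J F (of_real x) \<in> \<real>"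
proof -
  have z: "complex_of_real x \<in> strip r" using r by simp
  have "weight J (of_real x) y \<in> \<real>" for y
  proof -
    have "Im (integral {0..y} (\<lambda>\<tau>. J (of_real x + of_real \<tau>))) = integral {0..y} (\<lambda>\<tau>. Im (J (of_real x + of_real \<tau>)))"
      using integral_linear[OF integrable_horizontal[OF near_one_holo[OF J] z] bounded_linear_Im, of y] by (simp add: o_def)
    also have "\<dots> = 0"
    proof -
      have "Im (J (of_real x + of_real \<tau>)) = 0" for \<tau>
        using Jr[of "x + \<tau>"] by (simp add: complex_is_Real_iff)
      then show ?thesis by simp
    qed
    finally have "integral {0..y} (\<lambda>\<tau>. J (of_real x + of_real \<tau>)) \<in> \<real>" by (simp add: complex_is_Real_iff)
    then show ?thesis by (auto simp: weight_def elim!: Reals_cases simp flip: of_real_minus exp_of_real)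
  qed
  then have "weight J (of_real x) y * F (of_real x + of_real y) \<in> \<real>" for y
    using Fr[of "x + y"] by (auto intro: Reals_mult)
  then have "Im (weight J (of_real x) y * F (of_real x + of_real y)) = 0" for y by (metis complex_is_Real_iff)
  moreover have "Im (integral {0..} (\<lambda>y. weight J (of_real x) y * F (of_real x + of_real y)))
     = integral {0..} (\<lambda>y. Im (weight J (of_real x) y * F (of_real x + of_real y)))"
    using integral_linear[OF integrable_dominated_exp(1)[OF fwd_integrand(1)[OF J F z f] _ fwd_integrand(2)[OF J F z f]] bounded_linear_Im]
    by (simp add: o_def)
  ultimately show ?thesis by (simp add: fwd_def complex_is_Real_iff)
qed

section \<open>Curves of holomorphic functions\<close>

text \<open>Bounds are asked only on the smaller strips, with a constant for each: Cauchy's estimate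
  for the derivative needs some room, so in this form the class is closed under
  \<open>deriv\<close>. It is closed under products, inverses and time integrals as well.\<close>

definition lip_hol :: "real \<Rightarrow> real \<Rightarrow> (real \<Rightarrow> complex \<Rightarrow> complex) \<Rightarrow> bool" where
  "lip_hol r T F \<longleftrightarrow> (\<forall>t\<in>{0..T}. F t holomorphic_on strip r) \<and>
     (\<forall>\<rho><r. \<exists>L. \<forall>t\<in>{0..T}. \<forall>t'\<in>{0..T}. \<forall>z\<in>strip \<rho>.
        norm (F t z) \<le> L \<and> norm (F t z - F t' z) \<le> L * \<bar>t - t'\<bar>)"

lemma lip_holD:
  assumes "lip_hol r T F"
  shows "t \<in> {0..T} \<Longrightarrow> F t holomorphic_on strip r"
    and "\<rho> < r \<Longrightarrow> \<exists>L. \<forall>t\<in>{0..T}. \<forall>t'\<in>{0..T}. \<forall>z\<in>strip \<rho>.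
        norm (F t z) \<le> L \<and> norm (F t z - F t' z) \<le> L * \<bar>t - t'\<bar>"
  using assms by (auto simp: lip_hol_def)

lemma strip_mono: "\<rho> \<le> r \<Longrightarrow> strip \<rho> \<subseteq> strip r"
  by (auto simp: strip_def)

lemma strip_smaller:
  assumes "z \<in> strip r"
  obtains \<rho> where "\<rho> < r" "z \<in> strip \<rho>" "0 < \<rho>"
proof
  show "(\<bar>Im z\<bar> + r) / 2 < r" "z \<in> strip ((\<bar>Im z\<bar> + r) / 2)" "0 < (\<bar>Im z\<bar> + r) / 2"
    using assms by (auto simp: strip_def field_simps)
qed

lemma lip_hol_global:
  assumes "\<And>t. t \<in> {0..T} \<Longrightarrow> F t holomorphic_on strip r"
    and "\<And>t z. t \<in> {0..T} \<Longrightarrow> z \<in> strip r \<Longrightarrow> norm (F t z) \<le> B"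
    and "\<And>t t' z. t \<in> {0..T} \<Longrightarrow> t' \<in> {0..T} \<Longrightarrow> z \<in> strip r \<Longrightarrow> norm (F t z - F t' z) \<le> L * \<bar>t - t'\<bar>"
  shows "lip_hol r T F"
  unfolding lip_hol_def
proof (intro conjI allI impI ballI)
  fix \<rho> assume "\<rho> < r"
  then have "strip \<rho> \<subseteq> strip r" by (intro strip_mono) auto
  moreover have "L * \<bar>t - t'\<bar> \<le> max B L * \<bar>t - t'\<bar>" for t t' by (intro mult_right_mono) auto
  ultimately show "\<exists>L. \<forall>t\<in>{0..T}. \<forall>t'\<in>{0..T}. \<forall>z\<in>strip \<rho>. norm (F t z) \<le> L \<and> norm (F t z - F t' z) \<le> L * \<bar>t - t'\<bar>"
    using assms(2,3) by (intro exI[of _ "max B L"]) (meson max.coboundedI1 order_trans subsetD)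
qed (use assms in auto)

lemma norm_mult_diff_le:
  fixes a b c d :: complex
  assumes "norm (a - c) \<le> x" "norm b \<le> y" "norm c \<le> z" "norm (b - d) \<le> w"
  shows "norm (a * b - c * d) \<le> x * y + z * w"
proof -
  have "a * b - c * d = (a - c) * b + c * (b - d)" by (simp add: algebra_simps)
  also have "norm \<dots> \<le> norm (a - c) * norm b + norm c * norm (b - d)"
    by (metis norm_mult norm_triangle_ineq)
  also have "\<dots> \<le> x * y + z * w"
    using assms norm_ge_zero order_trans by (intro add_mono mult_mono) (auto intro: order_trans[OF norm_ge_zero])
  finally show ?thesis .
qed

lemma lip_hol_mult:
  assumes "lip_hol r T F" "lip_hol r T G"
  shows "lip_hol r T (\<lambda>t z. F t z * G t z)"
  unfolding lip_hol_def
proof (intro conjI allI impI ballI)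
  fix \<rho> assume r: "\<rho> < r"
  obtain K where K: "\<And>t t' z. t\<in>{0..T} \<Longrightarrow> t'\<in>{0..T} \<Longrightarrow> z\<in>strip \<rho> \<Longrightarrow> norm (F t z) \<le> K \<and> norm (F t z - F t' z) \<le> K * \<bar>t - t'\<bar>"
    using lip_holD(2)[OF assms(1) r] by blast
  obtain L where L: "\<And>t t' z. t\<in>{0..T} \<Longrightarrow> t'\<in>{0..T} \<Longrightarrow> z\<in>strip \<rho> \<Longrightarrow> norm (G t z) \<le> L \<and> norm (G t z - G t' z) \<le> L * \<bar>t - t'\<bar>"
    using lip_holD(2)[OF assms(2) r] by blast
  show "\<exists>L. \<forall>t\<in>{0..T}. \<forall>t'\<in>{0..T}. \<forall>z\<in>strip \<rho>. norm (F t z * G t z) \<le> L \<and> norm (F t z * G t z - (F t' z * G t' z)) \<le> L * \<bar>t - t'\<bar>"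
  proof (intro exI[of _ "2 * K * L"] ballI conjI)
    fix t t' z assume t: "t\<in>{0..T}" "t'\<in>{0..T}" "z\<in>strip \<rho>"
    have nn: "0 \<le> K" "0 \<le> L" using K[OF t] L[OF t] norm_ge_zero order_trans by blast+
    have "norm (F t z * G t z) \<le> K * L"
      using K[OF t] L[OF t] nn by (auto simp: norm_mult intro!: mult_mono)
    also have "\<dots> \<le> 2 * K * L" using nn by (simp add: mult_nonneg_nonneg)
    finally show "norm (F t z * G t z) \<le> 2 * K * L" .
    have "norm (F t z * G t z - (F t' z * G t' z)) \<le> (K * \<bar>t - t'\<bar>) * L + K * (L * \<bar>t - t'\<bar>)"
      using K[OF t] L[OF t] K[OF t(2) t(1,3)] by (intro norm_mult_diff_le) auto
    then show "norm (F t z * G t z - (F t' z * G t' z)) \<le> 2 * K * L * \<bar>t - t'\<bar>"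
      by (simp add: algebra_simps)
  qed
qed (intro holomorphic_on_mult lip_holD(1)[OF assms(1)] lip_holD(1)[OF assms(2)])

lemma lip_hol_inverse:
  assumes "lip_hol r T F" and "\<And>t z. t \<in> {0..T} \<Longrightarrow> z \<in> strip r \<Longrightarrow> 1 / 2 \<le> norm (F t z)"
  shows "lip_hol r T (\<lambda>t z. inverse (F t z))"
  unfolding lip_hol_def
proof (intro conjI allI impI ballI)
  have nz: "F t z \<noteq> 0" if "t \<in> {0..T}" "z \<in> strip r" for t z using assms(2)[OF that] by auto
  show "(\<lambda>z. inverse (F t z)) holomorphic_on strip r" if "t \<in> {0..T}" for t
    using nz that by (intro holomorphic_intros lip_holD(1)[OF assms(1)]) auto
  fix \<rho> assume r: "\<rho> < r"
  obtain L where L: "\<And>t t' z. t\<in>{0..T} \<Longrightarrow> t'\<in>{0..T} \<Longrightarrow> z\<in>strip \<rho> \<Longrightarrow> norm (F t z) \<le> L \<and> norm (F t z - F t' z) \<le> L * \<bar>t - t'\<bar>"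
    using lip_holD(2)[OF assms(1) r] by blast
  show "\<exists>L. \<forall>t\<in>{0..T}. \<forall>t'\<in>{0..T}. \<forall>z\<in>strip \<rho>. norm (inverse (F t z)) \<le> L \<and> norm (inverse (F t z) - inverse (F t' z)) \<le> L * \<bar>t - t'\<bar>"
  proof (intro exI[of _ "2 + 4 * L"] ballI conjI)
    fix t t' z assume t: "t\<in>{0..T}" "t'\<in>{0..T}" "z\<in>strip \<rho>"
    have zr: "z \<in> strip r" using t(3) r strip_mono[of \<rho> r] by auto
    have nn: "0 \<le> L" using L[OF t] norm_ge_zero order_trans by blast
    have i: "norm (inverse (F t z)) \<le> 2" if "t \<in> {0..T}" for t
      using le_imp_inverse_le[OF assms(2)[OF that zr]] by (simp add: norm_inverse)
    then show "norm (inverse (F t z)) \<le> 2 + 4 * L" using nn t(1) by fastforce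
    have "norm (inverse (F t z) - inverse (F t' z)) = norm (inverse (F t z)) * norm (F t z - F t' z) * norm (inverse (F t' z))"
      by (simp add: inverse_diff_inverse nz[OF t(1) zr] nz[OF t(2) zr] norm_mult)
    also have "\<dots> \<le> 2 * (L * \<bar>t - t'\<bar>) * 2"
      using i[OF t(1)] i[OF t(2)] L[OF t] nn by (intro mult_mono) auto
    also have "\<dots> \<le> (2 + 4 * L) * \<bar>t - t'\<bar>" by (simp add: algebra_simps)
    finally show "norm (inverse (F t z) - inverse (F t' z)) \<le> (2 + 4 * L) * \<bar>t - t'\<bar>" .
  qed
qed

text \<open>Cauchy's estimate on circles of half the gap between the strips, so that the closed disc
  still lies in the open larger strip.\<close>

lemma norm_deriv_strip_le:
  assumes f: "f holomorphic_on strip r" and z: "z \<in> strip \<rho>" and r: "\<rho> < \<rho>'" "\<rho>' \<le> r"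
    and B: "\<And>w. w \<in> strip \<rho>' \<Longrightarrow> norm (f w) \<le> B"
  shows "norm (deriv f z) \<le> B / ((\<rho>' - \<rho>) / 2)"
proof -
  define d where "d = (\<rho>' - \<rho>) / 2"
  have d: "d > 0" using r by (simp add: d_def)
  have sub: "cball z d \<subseteq> strip \<rho>'"
  proof
    fix w assume "w \<in> cball z d"
    then have "norm (z - w) \<le> d" by (simp add: dist_norm)
    moreover have "\<bar>Im (z - w)\<bar> \<le> norm (z - w)" by (rule abs_Im_le_cmod)
    ultimately have "\<bar>Im z - Im w\<bar> \<le> d" by simp
    moreover have "\<bar>Im w\<bar> \<le> \<bar>Im z\<bar> + \<bar>Im z - Im w\<bar>" by linarith
    ultimately have "\<bar>Im w\<bar> < \<rho> + d" using z by (simp add: strip_def)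
    moreover have "\<rho> + d < \<rho>'" using r(1) by (simp add: d_def field_simps)
    ultimately show "w \<in> strip \<rho>'" by (simp add: strip_def)
  qed
  then have h: "f holomorphic_on cball z d"
    using strip_mono[OF r(2)] by (intro holomorphic_on_subset[OF f]) auto
  have "norm ((deriv ^^ 1) f z) \<le> fact 1 * B / d ^ 1"
  proof (rule Cauchy_inequality)
    show "f holomorphic_on ball z d" using h holomorphic_on_subset ball_subset_cball by blast
    show "continuous_on (cball z d) f" using h by (rule holomorphic_on_imp_continuous_on)
    show "norm (f w) \<le> B" if "norm (z - w) = d" for w
      using sub that by (intro B) (auto simp: dist_norm)
  qed (rule d)
  then show ?thesis by (simp add: d_def)
qed

lemma lip_hol_deriv:
  assumes "lip_hol r T F"
  shows "lip_hol r T (\<lambda>t. deriv (F t))"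
  unfolding lip_hol_def
proof (intro conjI allI impI ballI)
  show "deriv (F t) holomorphic_on strip r" if "t \<in> {0..T}" for t
    using lip_holD(1)[OF assms that] open_strip by (rule holomorphic_deriv)
  fix \<rho> assume r: "\<rho> < r"
  define \<rho>' where "\<rho>' = (\<rho> + r) / 2"
  have r': "\<rho> < \<rho>'" "\<rho>' < r" "\<rho>' \<le> r" using r by (auto simp: \<rho>'_def)
  obtain L where L: "\<And>t t' z. t\<in>{0..T} \<Longrightarrow> t'\<in>{0..T} \<Longrightarrow> z\<in>strip \<rho>' \<Longrightarrow> norm (F t z) \<le> L \<and> norm (F t z - F t' z) \<le> L * \<bar>t - t'\<bar>"
    using lip_holD(2)[OF assms r'(2)] by blast
  define M where "M = L / ((\<rho>' - \<rho>) / 2)"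
  show "\<exists>L. \<forall>t\<in>{0..T}. \<forall>t'\<in>{0..T}. \<forall>z\<in>strip \<rho>. norm (deriv (F t) z) \<le> L \<and> norm (deriv (F t) z - deriv (F t') z) \<le> L * \<bar>t - t'\<bar>"
  proof (intro exI[of _ M] ballI conjI)
    fix t t' z assume t: "t\<in>{0..T}" "t'\<in>{0..T}" and z: "z\<in>strip \<rho>"
    have zr: "z \<in> strip r" using z r strip_mono[of \<rho> r] by auto
    show "norm (deriv (F t) z) \<le> M"
      unfolding M_def using norm_deriv_strip_le[OF lip_holD(1)[OF assms t(1)] z r'(1,3)] L[OF t] by blast
    have "norm (deriv (\<lambda>z. F t z - F t' z) z) \<le> (L * \<bar>t - t'\<bar>) / ((\<rho>' - \<rho>) / 2)"
      using L[OF t] by (intro norm_deriv_strip_le[OF _ z r'(1,3)] holomorphic_intros lip_holD(1)[OF assms] t) auto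
    moreover have "deriv (\<lambda>z. F t z - F t' z) z = deriv (F t) z - deriv (F t') z"
      by (intro deriv_diff holomorphic_on_imp_differentiable_at[OF lip_holD(1)[OF assms] open_strip zr] t)
    ultimately show "norm (deriv (F t) z - deriv (F t') z) \<le> M * \<bar>t - t'\<bar>"
      by (simp add: M_def mult_ac)
  qed
qed

text \<open>Lipschitz continuity in time, uniform over a neighbourhood of the point, is combined
  with continuity in \<open>z\<close> at the fixed time. The Leibniz rule for time integrals asks
  for this joint continuity.\<close>

lemma lip_hol_continuous:
  assumes "lip_hol r T F"
  shows "continuous_on (strip r \<times> {0..T}) (\<lambda>(z, t). F t z)"
  unfolding continuous_on_iff
proof (clarify)
  fix z t e assume z: "z \<in> strip r" and t: "t \<in> {0..T}" and e: "(0::real) < e"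
  obtain \<rho> where \<rho>: "\<rho> < r" "z \<in> strip \<rho>" using strip_smaller[OF z] by metis
  obtain L where L: "\<And>t t' z. t\<in>{0..T} \<Longrightarrow> t'\<in>{0..T} \<Longrightarrow> z\<in>strip \<rho> \<Longrightarrow> norm (F t z) \<le> L \<and> norm (F t z - F t' z) \<le> L * \<bar>t - t'\<bar>"
    using lip_holD(2)[OF assms \<rho>(1)] by blast
  have L0: "L \<ge> 0" using L[OF t t \<rho>(2)] norm_ge_zero order_trans by blast
  have "isCont (F t) z"
    using lip_holD(1)[OF assms t] holomorphic_on_imp_continuous_on continuous_on_eq_continuous_at[OF open_strip] z by blast
  then obtain d1 where d1: "d1 > 0" "\<And>w. dist w z < d1 \<Longrightarrow> dist (F t w) (F t z) < e / 2"
    using e unfolding continuous_at_eps_delta by (metis half_gt_zero)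
  obtain d2 where d2: "d2 > 0" "ball z d2 \<subseteq> strip \<rho>" using open_strip \<rho>(2) open_contains_ball by metis
  show "\<exists>d>0. \<forall>x'\<in>strip r \<times> {0..T}. dist x' (z, t) < d \<longrightarrow>
     dist (case x' of (z, t) \<Rightarrow> F t z) (F t z) < e"
  proof (intro exI[of _ "min (min d1 d2) (e / (2 * (L + 1)))"] conjI ballI impI)
    show "0 < min (min d1 d2) (e / (2 * (L + 1)))" using d1 d2 e L0 by auto
    fix x' assume x': "x' \<in> strip r \<times> {0..T}" "dist x' (z, t) < min (min d1 d2) (e / (2 * (L + 1)))"
    obtain w \<tau> where x: "x' = (w, \<tau>)" by force
    have dw: "dist w z < min d1 d2" and dt: "dist \<tau> t < e / (2 * (L + 1))"
      using x' dist_fst_le[of x' "(z, t)"] dist_snd_le[of x' "(z, t)"] by (auto simp: x)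
    have ws: "w \<in> strip \<rho>" using d2 dw by (auto simp: dist_commute)
    have "norm (F \<tau> w - F t w) \<le> L * \<bar>\<tau> - t\<bar>" using L[of \<tau> t w] x' t ws by (auto simp: x)
    also have "\<dots> \<le> (L + 1) * \<bar>\<tau> - t\<bar>" by (simp add: algebra_simps)
    also have "\<dots> < (L + 1) * (e / (2 * (L + 1)))" using dt L0 by (intro mult_strict_left_mono) (auto simp: dist_real_def)
    also have "\<dots> = e / 2" using L0 by (simp add: field_simps)
    finally have "dist (F \<tau> w) (F t w) < e / 2" by (simp add: dist_norm)
    moreover have "dist (F t w) (F t z) < e / 2" using dw by (intro d1) auto
    ultimately have "dist (F \<tau> w) (F t z) < e" using dist_triangle_half_r dist_commute by (metis dist_triangle_half_l)
    then show "dist (case x' of (z, t) \<Rightarrow> F t z) (F t z) < e" by (simp add: x)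
  qed
qed

lemma lip_hol_continuous_time:
  assumes "lip_hol r T F" "z \<in> strip r"
  shows "continuous_on {0..T} (\<lambda>t. F t z)"
proof -
  have "continuous_on {0..T} (\<lambda>t. (z, t))" by (intro continuous_intros)
  from continuous_on_compose2[OF lip_hol_continuous[OF assms(1)] this] assms(2)
  show ?thesis by (auto simp: image_subset_iff)
qed

lemma lip_hol_time_integral:
  assumes F: "lip_hol r T F"
  shows "lip_hol r T (\<lambda>t z. integral {0..t} (\<lambda>\<tau>. F \<tau> z))"
    and "t \<in> {0..T} \<Longrightarrow> z \<in> strip r \<Longrightarrow>
      ((\<lambda>z. integral {0..t} (\<lambda>\<tau>. F \<tau> z)) has_field_derivative integral {0..t} (\<lambda>\<tau>. deriv (F \<tau>) z)) (at z)"
    and "t \<in> {0..T} \<Longrightarrow> z \<in> strip r \<Longrightarrow>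
      ((\<lambda>t. integral {0..t} (\<lambda>\<tau>. F \<tau> z)) has_vector_derivative F t z) (at t within {0..T})"
proof -
  show 2: "((\<lambda>z. integral {0..t} (\<lambda>\<tau>. F \<tau> z)) has_field_derivative integral {0..t} (\<lambda>\<tau>. deriv (F \<tau>) z)) (at z)"
    if t: "t \<in> {0..T}" and z: "z \<in> strip r" for t z
  proof -
    have sub: "{0..t} \<subseteq> {0..T}" using t by auto
    have "((\<lambda>z. integral (cbox 0 t) (\<lambda>\<tau>. F \<tau> z)) has_field_derivative integral (cbox 0 t) (\<lambda>\<tau>. deriv (F \<tau>) z)) (at z within strip r)"
    proof (rule leibniz_rule_field_derivative[OF _ _ _ z convex_strip])
      show "((\<lambda>z. F \<tau> z) has_field_derivative deriv (F \<tau>) z) (at z within strip r)" if "z \<in> strip r" "\<tau> \<in> cbox 0 t" for z \<tau>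
      proof -
        have "\<tau> \<in> {0..T}" using that sub by auto
        then show ?thesis
          by (rule has_field_derivative_at_within[OF holomorphic_derivI[OF lip_holD(1)[OF F] open_strip that(1)]])
      qed
      show "(\<lambda>\<tau>. F \<tau> z) integrable_on cbox 0 t" if "z \<in> strip r" for z
        using continuous_on_subset[OF lip_hol_continuous_time[OF F that] sub]
        by (auto intro: integrable_continuous_real)
      show "continuous_on (strip r \<times> cbox 0 t) (\<lambda>(z, \<tau>). deriv (F \<tau>) z)"
        using sub by (intro continuous_on_subset[OF lip_hol_continuous[OF lip_hol_deriv[OF F]]]) auto
    qed
    then show ?thesis using at_within_open[OF z open_strip] by simp
  qed
  show "((\<lambda>t. integral {0..t} (\<lambda>\<tau>. F \<tau> z)) has_vector_derivative F t z) (at t within {0..T})"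
    if "t \<in> {0..T}" "z \<in> strip r"
    using integral_has_vector_derivative[OF lip_hol_continuous_time[OF F that(2)] that(1)] .
  show "lip_hol r T (\<lambda>t z. integral {0..t} (\<lambda>\<tau>. F \<tau> z))"
    unfolding lip_hol_def
  proof (intro conjI allI impI ballI)
    show "(\<lambda>z. integral {0..t} (\<lambda>\<tau>. F \<tau> z)) holomorphic_on strip r" if "t \<in> {0..T}" for t
      using 2[OF that] open_strip field_differentiable_def field_differentiable_at_within
      by (metis (no_types, lifting) holomorphic_onI)
    fix \<rho> assume r: "\<rho> < r"
    obtain L where L: "\<And>t t' z. t\<in>{0..T} \<Longrightarrow> t'\<in>{0..T} \<Longrightarrow> z\<in>strip \<rho> \<Longrightarrow> norm (F t z) \<le> L \<and> norm (F t z - F t' z) \<le> L * \<bar>t - t'\<bar>"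
      using lip_holD(2)[OF assms r] by blast
    have b: "norm (integral {0..t} (\<lambda>\<tau>. F \<tau> z) - integral {0..t'} (\<lambda>\<tau>. F \<tau> z)) \<le> L * \<bar>t - t'\<bar>"
      if t: "t\<in>{0..T}" "t'\<in>{0..T}" and z: "z\<in>strip \<rho>" for t t' z
    proof -
      have zr: "z \<in> strip r" using z r strip_mono[of \<rho> r] by auto
      have *: "norm (integral {0..b} (\<lambda>\<tau>. F \<tau> z) - integral {0..a} (\<lambda>\<tau>. F \<tau> z)) \<le> L * (b - a)"
        if ab: "0 \<le> a" "a \<le> b" "b \<le> T" for a b
      proof -
        have c: "continuous_on S (\<lambda>\<tau>. F \<tau> z)" if "S \<subseteq> {0..T}" for S
          using lip_hol_continuous_time[OF F zr] that continuous_on_subset by blast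
        have "integral {0..a} (\<lambda>\<tau>. F \<tau> z) + integral {a..b} (\<lambda>\<tau>. F \<tau> z) = integral {0..b} (\<lambda>\<tau>. F \<tau> z)"
          using ab by (intro Henstock_Kurzweil_Integration.integral_combine integrable_continuous_real c) auto
        then have "integral {0..b} (\<lambda>\<tau>. F \<tau> z) - integral {0..a} (\<lambda>\<tau>. F \<tau> z) = integral {a..b} (\<lambda>\<tau>. F \<tau> z)"
          by (simp add: algebra_simps)
        moreover have "norm (integral {a..b} (\<lambda>\<tau>. F \<tau> z)) \<le> L * (b - a)"
        proof (rule integral_bound[OF ab(2) c])
          show "norm (F \<tau> z) \<le> L" if "\<tau> \<in> {a..b}" for \<tau> using L[of \<tau> \<tau> z] ab that z by auto
        qed (use ab in auto)
        ultimately show ?thesis by simp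
      qed
      show ?thesis
        using *[of t t'] *[of t' t] t by (cases "t \<le> t'") (auto simp: norm_minus_commute)
    qed
    show "\<exists>L. \<forall>t\<in>{0..T}. \<forall>t'\<in>{0..T}. \<forall>z\<in>strip \<rho>. norm (integral {0..t} (\<lambda>\<tau>. F \<tau> z)) \<le> L \<and>
       norm (integral {0..t} (\<lambda>\<tau>. F \<tau> z) - integral {0..t'} (\<lambda>\<tau>. F \<tau> z)) \<le> L * \<bar>t - t'\<bar>"
    proof (intro exI[of _ "max L (L * T)"] ballI conjI)
      fix t t' z assume t: "t\<in>{0..T}" "t'\<in>{0..T}" and z: "z\<in>strip \<rho>"
      have L0: "0 \<le> L" using L[OF t z] norm_ge_zero order_trans by blast
      have "norm (integral {0..t} (\<lambda>\<tau>. F \<tau> z)) \<le> L * t" using b[OF t(1) _ z, of 0] t by simp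
      also have "\<dots> \<le> L * T" using L0 t by (intro mult_left_mono) auto
      finally show "norm (integral {0..t} (\<lambda>\<tau>. F \<tau> z)) \<le> max L (L * T)" by simp
      have "L * \<bar>t - t'\<bar> \<le> max L (L * T) * \<bar>t - t'\<bar>" by (intro mult_right_mono) auto
      then show "norm (integral {0..t} (\<lambda>\<tau>. F \<tau> z) - integral {0..t'} (\<lambda>\<tau>. F \<tau> z)) \<le> max L (L * T) * \<bar>t - t'\<bar>"
        using b[OF t z] by linarith
    qed
  qed
qed

text \<open>Banach's fixed point theorem for the sup distance on \<open>S\<close>. The complete
  space is described by the predicate \<open>Q\<close>, and values off \<open>S\<close> are left
  free, so the fixed point equation is obtained on \<open>S\<close> only. The common bound
  \<open>B\<close> for all distances gives the error \<open>B / 2 ^ n\<close> at once.\<close>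

lemma uniform_contraction_fixpoint:
  fixes Q :: "('a \<Rightarrow> 'b::banach) \<Rightarrow> bool"
  assumes Q0: "Q f0" and step: "\<And>f. Q f \<Longrightarrow> Q (\<Phi> f)"
    and contr: "\<And>f g d x. Q f \<Longrightarrow> Q g \<Longrightarrow> (\<And>x. x \<in> S \<Longrightarrow> dist (f x) (g x) \<le> d) \<Longrightarrow> x \<in> S \<Longrightarrow> dist (\<Phi> f x) (\<Phi> g x) \<le> d / 2"
    and bdd: "\<And>f g x. Q f \<Longrightarrow> Q g \<Longrightarrow> x \<in> S \<Longrightarrow> dist (f x) (g x) \<le> B"
    and closed: "\<And>f g. (\<And>n::nat. Q (f n)) \<Longrightarrow> uniform_limit S f g sequentially \<Longrightarrow> Q g"
  obtains g where "Q g" "\<And>x. x \<in> S \<Longrightarrow> \<Phi> g x = g x"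
proof -
  define f where "f n = (\<Phi> ^^ n) f0" for n
  have fS: "f (Suc n) = \<Phi> (f n)" for n by (simp add: f_def)
  have "f 0 = f0" by (simp add: f_def)
  then have Qf: "Q (f n)" for n by (induction n) (auto simp: fS Q0 intro: step)
  have d: "dist (f n x) (f (n + k) x) \<le> B / 2 ^ n" if "x \<in> S" for n k x
    using that
  proof (induction n arbitrary: x)
    case 0
    then show ?case using bdd[OF Qf Qf] by simp
  next
    case (Suc n)
    then show ?case
      using contr[OF Qf[of n] Qf[of "n + k"], of "B / 2 ^ n"] by (simp add: fS mult.commute)
  qed
  have lim0: "(\<lambda>n. B / 2 ^ n) \<longlonglongrightarrow> 0" by real_asymp
  have "uniformly_Cauchy_on S f"
    unfolding uniformly_Cauchy_on_def
  proof (intro allI impI)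
    fix e :: real assume "e > 0"
    then obtain N where N: "\<And>n. n \<ge> N \<Longrightarrow> \<bar>B / 2 ^ n\<bar> < e / 2"
      using lim0 unfolding LIMSEQ_iff by (metis diff_zero half_gt_zero real_norm_def)
    have "dist (f m x) (f n x) < e" if "m \<ge> N" "n \<ge> N" "x \<in> S" for m n x
    proof -
      have "dist (f N x) (f m x) < e / 2" "dist (f N x) (f n x) < e / 2"
      proof -
        have "B / 2 ^ N < e / 2" using N[of N] by linarith
        then show "dist (f N x) (f m x) < e / 2" "dist (f N x) (f n x) < e / 2"
          using d[OF that(3), of N "m - N"] d[OF that(3), of N "n - N"] that
          by (metis le_add_diff_inverse le_less_trans)+
      qed
      then show ?thesis using dist_triangle_half_r by blast
    qed
    then show "\<exists>M. \<forall>x\<in>S. \<forall>m\<ge>M. \<forall>n\<ge>M. dist (f m x) (f n x) < e" by blast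
  qed
  then obtain g where g: "uniform_limit S f g sequentially"
    using uniformly_convergent_eq_Cauchy uniformly_convergent_on_def by blast
  have Qg: "Q g" using closed[OF Qf g] .
  have "\<Phi> g x = g x" if x: "x \<in> S" for x
  proof -
    have lim: "(\<lambda>n. f n x) \<longlonglongrightarrow> g x" if "x \<in> S" for x using tendsto_uniform_limitI[OF g that] .
    have fg: "dist (f n x) (g x) \<le> B / 2 ^ n" if "x \<in> S" for n x
    proof (rule tendsto_upperbound)
      show "(\<lambda>k. dist (f n x) (f (n + k) x)) \<longlonglongrightarrow> dist (f n x) (g x)"
        using LIMSEQ_ignore_initial_segment[OF lim[OF that], of n]
        by (intro tendsto_intros) (simp add: add.commute)
    qed (use d[OF that] in auto)
    have "dist (f (Suc n) x) (\<Phi> g x) \<le> B / 2 ^ n / 2" for n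
      unfolding fS by (rule contr[OF Qf Qg fg x])
    then have "(\<lambda>n. dist (f (Suc n) x) (\<Phi> g x)) \<longlonglongrightarrow> 0"
      using tendsto_divide[OF lim0 tendsto_const[of 2]]
      by (intro Lim_null_comparison[of "\<lambda>n. dist (f (Suc n) x) (\<Phi> g x)" "\<lambda>n. B / 2 ^ n / 2"]) auto
    then have "(\<lambda>n. f (Suc n) x) \<longlonglongrightarrow> \<Phi> g x" by (rule tendsto_dist_iff[THEN iffD2])
    moreover have "(\<lambda>n. f (Suc n) x) \<longlonglongrightarrow> g x" using lim[OF x] by (rule LIMSEQ_Suc)
    ultimately show ?thesis using LIMSEQ_unique by blast
  qed
  with Qg that show ?thesis by blast
qed

section \<open>The equation in Lagrangian coordinates\<close>

text \<open>
  On the half line \<open>y > x\<close> an integration by parts turns \<open>m = \<gamma>_x + \<gamma>\<^sup>2 / (2 \<lambda>)\<close> into \<open>\<gamma> + \<gamma>\<^sup>2 / (2 \<lambda>)\<close> with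
  boundary term \<open>\<gamma> / 2\<close>, on \<open>y < x\<close> into \<open>\<gamma>\<^sup>2 / (2 \<lambda>) - \<gamma>\<close> with boundary term \<open>- \<gamma> / 2\<close>. The boundary terms
  cancel in \<open>G\<^sup>-\<^sup>1 m = vel\<close> and add up in its derivative \<open>\<gamma> + strain\<close>.
\<close>

definition flux_up :: "real \<Rightarrow> (complex \<Rightarrow> complex) \<Rightarrow> (complex \<Rightarrow> complex) \<Rightarrow> complex \<Rightarrow> complex" where
  "flux_up lam J G z = J z * (G z + (G z)\<^sup>2 / of_real (2 * lam))"

definition flux_down :: "real \<Rightarrow> (complex \<Rightarrow> complex) \<Rightarrow> (complex \<Rightarrow> complex) \<Rightarrow> complex \<Rightarrow> complex" where
  "flux_down lam J G z = J z * (G z - (G z)\<^sup>2 / of_real (2 * lam))"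

definition nl_up :: "real \<Rightarrow> (complex \<Rightarrow> complex) \<Rightarrow> (complex \<Rightarrow> complex) \<Rightarrow> complex \<Rightarrow> complex" where
  "nl_up lam J G = fwd J (flux_up lam J G)"

text \<open>The reflection of \<open>z\<close> exchanges the two half lines, so \<open>fwd\<close>
  serves for \<open>y < x\<close> too. The outer minus sign undoes the one in \<open>fwd\<close>,
  because \<open>flux_down\<close> is the opposite of the density left by the integration by
  parts.\<close>

definition nl_down :: "real \<Rightarrow> (complex \<Rightarrow> complex) \<Rightarrow> (complex \<Rightarrow> complex) \<Rightarrow> complex \<Rightarrow> complex" where
  "nl_down lam J G z = - fwd (\<lambda>w. J (- w)) (\<lambda>w. flux_down lam J G (- w)) (- z)"

definition vel :: "real \<Rightarrow> (complex \<Rightarrow> complex) \<Rightarrow> (complex \<Rightarrow> complex) \<Rightarrow> complex \<Rightarrow> complex" where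
  "vel lam J G z = (nl_up lam J G z + nl_down lam J G z) / 2"

definition strain :: "real \<Rightarrow> (complex \<Rightarrow> complex) \<Rightarrow> (complex \<Rightarrow> complex) \<Rightarrow> complex \<Rightarrow> complex" where
  "strain lam J G z = (nl_up lam J G z - nl_down lam J G z) / 2"

definition rate_J :: "real \<Rightarrow> (complex \<Rightarrow> complex) \<Rightarrow> (complex \<Rightarrow> complex) \<Rightarrow> complex \<Rightarrow> complex" where
  "rate_J lam J G z = J z * (G z + strain lam J G z)"

text \<open>The last term of the equation is \<open>- \<gamma> (\<gamma> + strain)\<close>, which
  turns \<open>\<gamma>\<^sup>2 / 2\<close> into \<open>- \<gamma>\<^sup>2 / 2\<close>. The positive
  sign comes back in the product with \<open>J\<close>, where the strain cancels.\<close>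

definition rate_G :: "real \<Rightarrow> (complex \<Rightarrow> complex) \<Rightarrow> (complex \<Rightarrow> complex) \<Rightarrow> complex \<Rightarrow> complex" where
  "rate_G lam J G z = - (G z)\<^sup>2 / 2 + of_real lam * vel lam J G z - G z * strain lam J G z"

definition slice :: "real \<Rightarrow> real \<Rightarrow> (complex \<Rightarrow> complex) \<Rightarrow> (complex \<Rightarrow> complex) \<Rightarrow> bool" where
  "slice r e J G \<longleftrightarrow> near_one r J \<and> G holomorphic_on strip r \<and> (\<forall>z\<in>strip r. norm (G z) \<le> e) \<and>
     (\<forall>x. J (of_real x) \<in> \<real> \<and> G (of_real x) \<in> \<real>)"

text \<open>For amplitudes \<open>e \<le> 2\<close>: \<open>cA\<close> bounds the fluxes and
  \<open>cV\<close> the rates per unit of \<open>e\<close>, while \<open>cD\<close> and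
  \<open>cL\<close> are Lipschitz constants of the nonlocal terms and of the rates. All depend on
  \<open>lam\<close> alone, so the time of existence does not shrink with the width of the
  strip.\<close>

definition cK :: "real \<Rightarrow> real" where "cK lam = 1 / (2 * \<bar>lam\<bar>)"
definition cA :: "real \<Rightarrow> real" where "cA lam = 3 / 2 * (1 + 2 * cK lam)"
definition cV :: "real \<Rightarrow> real" where "cV lam = 2 + 4 * cA lam + \<bar>lam\<bar> * (2 * cA lam)"
definition cD :: "real \<Rightarrow> real" where "cD lam = 4 * (2 * cA lam + 3 / 2 * (1 + 4 * cK lam)) + 32 * cA lam"
definition cL :: "real \<Rightarrow> real" where "cL lam = 10 + 8 * cA lam + 4 * cD lam + \<bar>lam\<bar> * cD lam"

lemma cK_nonneg: "0 \<le> cK lam" by (simp add: cK_def)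
lemma cA_nonneg: "0 \<le> cA lam" by (simp add: cA_def cK_nonneg)
lemma cV_pos: "0 < cV lam" using cA_nonneg[of lam] by (simp add: cV_def add_pos_nonneg)
lemma cD_nonneg: "0 \<le> cD lam" using cA_nonneg[of lam] cK_nonneg[of lam] by (simp add: cD_def)
lemma cL_pos: "0 < cL lam" using cA_nonneg[of lam] cD_nonneg[of lam] by (simp add: cL_def add_pos_nonneg)

lemma sliceD:
  assumes "slice r e J G"
  shows "near_one r J" "G holomorphic_on strip r" "J holomorphic_on strip r"
    "z \<in> strip r \<Longrightarrow> norm (G z) \<le> e" "z \<in> strip r \<Longrightarrow> norm (J z - 1) \<le> 1 / 2" "z \<in> strip r \<Longrightarrow> norm (J z) \<le> 3 / 2"
    "z \<in> strip r \<Longrightarrow> 0 \<le> e"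
    "J (of_real x) \<in> \<real>" "G (of_real x) \<in> \<real>"
proof -
  show "z \<in> strip r \<Longrightarrow> norm (J z) \<le> 3 / 2"
    using norm_triangle_ineq[of "J z - 1" 1] assms by (fastforce simp: slice_def near_one_def)
  show "z \<in> strip r \<Longrightarrow> 0 \<le> e"
    using assms norm_ge_zero order_trans unfolding slice_def by blast
qed (use assms in \<open>auto simp: slice_def near_one_def\<close>)

lemma holomorphic_reflect:
  assumes "f holomorphic_on strip r"
  shows "(\<lambda>w. f (- w)) holomorphic_on strip r"
proof -
  have "uminus holomorphic_on strip r" using holomorphic_on_minus[OF holomorphic_on_ident] by simp
  from holomorphic_on_compose_gen[OF this assms] show ?thesis by (auto simp: o_def image_subset_iff)
qed

lemma near_one_reflect: "near_one r J \<Longrightarrow> near_one r (\<lambda>w. J (- w))"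
  by (auto simp: near_one_def intro: holomorphic_reflect)

lemma quad_bound:
  fixes g :: complex
  assumes "norm g \<le> e" "e \<le> 2"
  shows "norm (g + g\<^sup>2 / of_real (2 * lam)) \<le> (1 + 2 * cK lam) * e"
    and "norm (g - g\<^sup>2 / of_real (2 * lam)) \<le> (1 + 2 * cK lam) * e"
proof -
  have e0: "0 \<le> e" using assms norm_ge_zero order_trans by blast
  have "norm (g\<^sup>2 / of_real (2 * lam)) = norm g * norm g * cK lam"
    by (simp add: norm_divide norm_power cK_def power2_eq_square norm_mult)
  also have "\<dots> \<le> e * 2 * cK lam"
    using assms e0 by (intro mult_right_mono mult_mono cK_nonneg) auto
  finally have *: "norm (g\<^sup>2 / of_real (2 * lam)) \<le> 2 * cK lam * e" by (simp add: mult_ac)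
  show "norm (g + g\<^sup>2 / of_real (2 * lam)) \<le> (1 + 2 * cK lam) * e"
    using norm_triangle_ineq[of g "g\<^sup>2 / of_real (2 * lam)"] assms * by (simp add: distrib_right)
  show "norm (g - g\<^sup>2 / of_real (2 * lam)) \<le> (1 + 2 * cK lam) * e"
    using norm_triangle_ineq4[of g "g\<^sup>2 / of_real (2 * lam)"] assms * by (simp add: distrib_right)
qed

lemma sq_diff_bound:
  fixes g h :: complex
  assumes "norm g \<le> e" "norm h \<le> e" "e \<le> 2" "norm (g - h) \<le> d"
  shows "norm (g\<^sup>2 - h\<^sup>2) \<le> 4 * d"
proof -
  have "norm (g * g - h * h) \<le> d * e + e * d" using assms by (intro norm_mult_diff_le) auto
  also have "\<dots> \<le> 4 * d"
    using mult_left_mono[OF assms(3) order_trans[OF norm_ge_zero assms(4)]] by (simp add: mult.commute)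
  finally show ?thesis by (simp add: power2_eq_square)
qed

lemma quad_diff_bound:
  fixes g h :: complex
  assumes "norm g \<le> e" "norm h \<le> e" "e \<le> 2" "norm (g - h) \<le> d"
  shows "norm ((g + g\<^sup>2 / of_real (2 * lam)) - (h + h\<^sup>2 / of_real (2 * lam))) \<le> (1 + 4 * cK lam) * d"
    and "norm ((g - g\<^sup>2 / of_real (2 * lam)) - (h - h\<^sup>2 / of_real (2 * lam))) \<le> (1 + 4 * cK lam) * d"
proof -
  have eq: "norm (g\<^sup>2 / of_real (2 * lam) - h\<^sup>2 / of_real (2 * lam)) = norm (g\<^sup>2 - h\<^sup>2) * cK lam"
    by (simp add: norm_divide cK_def norm_mult flip: diff_divide_distrib)
  have *: "norm (g\<^sup>2 / of_real (2 * lam) - h\<^sup>2 / of_real (2 * lam)) \<le> 4 * cK lam * d"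
    unfolding eq using mult_right_mono[OF sq_diff_bound[OF assms] cK_nonneg[of lam]] by (simp add: mult_ac)
  show "norm ((g + g\<^sup>2 / of_real (2 * lam)) - (h + h\<^sup>2 / of_real (2 * lam))) \<le> (1 + 4 * cK lam) * d"
    unfolding add_diff_add distrib_right using norm_triangle_mono[OF assms(4) *] by simp
  have "norm ((g - h) - (g\<^sup>2 / of_real (2 * lam) - h\<^sup>2 / of_real (2 * lam))) \<le> (1 + 4 * cK lam) * d"
    unfolding distrib_right using order_trans[OF norm_triangle_ineq4 add_mono[OF assms(4) *]] by simp
  then show "norm ((g - g\<^sup>2 / of_real (2 * lam)) - (h - h\<^sup>2 / of_real (2 * lam))) \<le> (1 + 4 * cK lam) * d"
    by (simp add: algebra_simps)
qed

lemma flux_holo: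
  assumes "slice r e J G" "lam \<noteq> 0"
  shows "flux_up lam J G holomorphic_on strip r" "flux_down lam J G holomorphic_on strip r"
  unfolding flux_up_def[abs_def] flux_down_def[abs_def]
  using assms(2) by (auto intro!: holomorphic_intros sliceD(2,3)[OF assms(1)])

lemma flux_bound:
  assumes "slice r e J G" "e \<le> 2" "z \<in> strip r"
  shows "norm (flux_up lam J G z) \<le> cA lam * e" "norm (flux_down lam J G z) \<le> cA lam * e"
proof -
  note b = sliceD(4)[OF assms(1,3)] sliceD(6)[OF assms(1,3)] sliceD(7)[OF assms(1,3)]
  show "norm (flux_up lam J G z) \<le> cA lam * e"
    unfolding flux_up_def norm_mult cA_def mult.assoc
    by (intro mult_mono b quad_bound(1) assms) auto
  show "norm (flux_down lam J G z) \<le> cA lam * e"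
    unfolding flux_down_def norm_mult cA_def mult.assoc
    by (intro mult_mono b quad_bound(2) assms) auto
qed

lemma flux_diff:
  assumes s1: "slice r e J1 G1" and s2: "slice r e J2 G2" and e: "e \<le> 2" and z: "z \<in> strip r"
    and J: "norm (J1 z - J2 z) \<le> d" and G: "norm (G1 z - G2 z) \<le> d"
  shows "norm (flux_up lam J1 G1 z - flux_up lam J2 G2 z) \<le> (2 * cA lam + 3 / 2 * (1 + 4 * cK lam)) * d"
    and "norm (flux_down lam J1 G1 z - flux_down lam J2 G2 z) \<le> (2 * cA lam + 3 / 2 * (1 + 4 * cK lam)) * d"
proof -
  have d0: "0 \<le> d" using J norm_ge_zero order_trans by blast
  have "(1 + 2 * cK lam) * e \<le> 2 * cA lam"
    using mult_left_mono[OF e, of "1 + 2 * cK lam"] cK_nonneg[of lam] by (simp add: cA_def)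
  then have c: "d * ((1 + 2 * cK lam) * e) + 3 / 2 * ((1 + 4 * cK lam) * d) \<le> (2 * cA lam + 3 / 2 * (1 + 4 * cK lam)) * d"
    using mult_left_mono[OF _ d0, of "(1 + 2 * cK lam) * e" "2 * cA lam"] by (simp add: algebra_simps)
  note b = sliceD(4)[OF s1 z] sliceD(4)[OF s2 z]
  show "norm (flux_up lam J1 G1 z - flux_up lam J2 G2 z) \<le> (2 * cA lam + 3 / 2 * (1 + 4 * cK lam)) * d"
    unfolding flux_up_def
    by (rule order_trans[OF norm_mult_diff_le[OF J quad_bound(1)[OF b(1) e] sliceD(6)[OF s2 z] quad_diff_bound(1)[OF b e G]] c])
  show "norm (flux_down lam J1 G1 z - flux_down lam J2 G2 z) \<le> (2 * cA lam + 3 / 2 * (1 + 4 * cK lam)) * d"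
    unfolding flux_down_def
    by (rule order_trans[OF norm_mult_diff_le[OF J quad_bound(2)[OF b(1) e] sliceD(6)[OF s2 z] quad_diff_bound(2)[OF b e G]] c])
qed

lemma nl_bound:
  assumes s: "slice r e J G" and e: "e \<le> 2" and lam: "lam \<noteq> 0" and z: "z \<in> strip r"
  shows "norm (nl_up lam J G z) \<le> 2 * cA lam * e" "norm (nl_down lam J G z) \<le> 2 * cA lam * e"
proof -
  have "norm (fwd J (flux_up lam J G) z) \<le> 2 * (cA lam * e)"
    by (rule norm_fwd_le[OF sliceD(1)[OF s] flux_holo(1)[OF s lam] z flux_bound(1)[OF s e]])
  then show "norm (nl_up lam J G z) \<le> 2 * cA lam * e" by (simp add: nl_up_def)
  have "norm (fwd (\<lambda>w. J (- w)) (\<lambda>w. flux_down lam J G (- w)) (- z)) \<le> 2 * (cA lam * e)"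
    by (rule norm_fwd_le[OF near_one_reflect[OF sliceD(1)[OF s]] holomorphic_reflect[OF flux_holo(2)[OF s lam]]])
       (use z flux_bound(2)[OF s e] in auto)
  then show "norm (nl_down lam J G z) \<le> 2 * cA lam * e" by (simp add: nl_down_def)
qed

lemma nl_diff:
  assumes s1: "slice r e J1 G1" and s2: "slice r e J2 G2" and e: "e \<le> 2" and lam: "lam \<noteq> 0" and z: "z \<in> strip r"
    and J: "\<And>z. z \<in> strip r \<Longrightarrow> norm (J1 z - J2 z) \<le> d" and G: "\<And>z. z \<in> strip r \<Longrightarrow> norm (G1 z - G2 z) \<le> d"
  shows "norm (nl_up lam J1 G1 z - nl_up lam J2 G2 z) \<le> cD lam * d"
    and "norm (nl_down lam J1 G1 z - nl_down lam J2 G2 z) \<le> cD lam * d"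
proof -
  let ?c = "2 * cA lam + 3 / 2 * (1 + 4 * cK lam)"
  have d0: "0 \<le> d" using J[OF z] norm_ge_zero order_trans by blast
  have "d * (cA lam * e) \<le> d * (cA lam * 2)"
    using e d0 cA_nonneg[of lam] by (intro mult_left_mono) auto
  then have c: "4 * (?c * d) + 16 * (d * (cA lam * e)) \<le> cD lam * d"
    by (simp add: cD_def algebra_simps)
  have "norm (fwd J1 (flux_up lam J1 G1) z - fwd J2 (flux_up lam J2 G2) z) \<le> 4 * (?c * d) + 16 * (d * (cA lam * e))"
    by (rule norm_fwd_diff_le[OF sliceD(1)[OF s1] sliceD(1)[OF s2] flux_holo(1)[OF s1 lam] flux_holo(1)[OF s2 lam] z
        flux_bound(1)[OF s1 e] flux_bound(1)[OF s2 e] J flux_diff(1)[OF s1 s2 e _ J G]])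
  then show "norm (nl_up lam J1 G1 z - nl_up lam J2 G2 z) \<le> cD lam * d"
    using c by (simp add: nl_up_def)
  have "norm (fwd (\<lambda>w. J1 (- w)) (\<lambda>w. flux_down lam J1 G1 (- w)) (- z) - fwd (\<lambda>w. J2 (- w)) (\<lambda>w. flux_down lam J2 G2 (- w)) (- z))
      \<le> 4 * (?c * d) + 16 * (d * (cA lam * e))"
    by (rule norm_fwd_diff_le[OF near_one_reflect[OF sliceD(1)[OF s1]] near_one_reflect[OF sliceD(1)[OF s2]]
          holomorphic_reflect[OF flux_holo(2)[OF s1 lam]] holomorphic_reflect[OF flux_holo(2)[OF s2 lam]]])
       (use z flux_bound(2)[OF s1 e] flux_bound(2)[OF s2 e] J flux_diff(2)[OF s1 s2 e _ J G] in auto)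
  then show "norm (nl_down lam J1 G1 z - nl_down lam J2 G2 z) \<le> cD lam * d"
    using c by (simp add: nl_down_def norm_minus_commute)
qed

lemma nl_deriv:
  assumes s: "slice r e J G" and e: "e \<le> 2" and lam: "lam \<noteq> 0" and z: "z \<in> strip r"
  shows "(nl_up lam J G has_field_derivative J z * nl_up lam J G z + flux_up lam J G z) (at z)"
    and "(nl_down lam J G has_field_derivative - J z * nl_down lam J G z + flux_down lam J G z) (at z)"
proof -
  show "(nl_up lam J G has_field_derivative J z * nl_up lam J G z + flux_up lam J G z) (at z)"
    unfolding nl_up_def
    by (rule has_field_derivative_fwd[OF sliceD(1)[OF s] flux_holo(1)[OF s lam] z flux_bound(1)[OF s e]])
  let ?f = "fwd (\<lambda>w. J (- w)) (\<lambda>w. flux_down lam J G (- w))"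
  have "(?f has_field_derivative J (- (- z)) * ?f (- z) + flux_down lam J G (- (- z))) (at (- z))"
    by (rule has_field_derivative_fwd[OF near_one_reflect[OF sliceD(1)[OF s]] holomorphic_reflect[OF flux_holo(2)[OF s lam]],
          where f="cA lam * e"])
       (use z flux_bound(2)[OF s e] in auto)
  then have "((\<lambda>w. ?f (- w)) has_field_derivative (J z * ?f (- z) + flux_down lam J G z) * (- 1)) (at z)"
    by (intro DERIV_chain2[where g=uminus]) (auto intro!: derivative_eq_intros)
  from DERIV_minus[OF this]
  show "(nl_down lam J G has_field_derivative - J z * nl_down lam J G z + flux_down lam J G z) (at z)"
    unfolding nl_down_def[abs_def] by (simp add: algebra_simps)
qed

text \<open>In Eulerian terms the velocity \<open>v\<close> has derivative
  \<open>\<gamma> + strain\<close>, and the strain has derivative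
  \<open>v + \<gamma>\<^sup>2 / (2 \<lambda>)\<close>, so that
  \<open>v_xx - v = \<gamma>_x + \<gamma>\<^sup>2 / (2 \<lambda>) = m\<close>. Thus \<open>v\<close>
  solves the equation that defines \<open>G\<^sup>-\<^sup>1 m\<close>, although no derivative of
  \<open>\<gamma>\<close> enters it.\<close>

lemma vel_strain_deriv:
  assumes s: "slice r e J G" and e: "e \<le> 2" and lam: "lam \<noteq> 0" and z: "z \<in> strip r"
  shows "(vel lam J G has_field_derivative J z * (G z + strain lam J G z)) (at z)"
    and "(strain lam J G has_field_derivative J z * (vel lam J G z + (G z)\<^sup>2 / of_real (2 * lam))) (at z)"
  unfolding vel_def[abs_def] strain_def[abs_def]
  by (rule derivative_eq_intros nl_deriv[OF assms] refl | simp add: flux_up_def flux_down_def field_simps)+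

lemma vel_strain_holo:
  assumes s: "slice r e J G" and e: "e \<le> 2" and lam: "lam \<noteq> 0"
  shows "vel lam J G holomorphic_on strip r" "strain lam J G holomorphic_on strip r"
  using vel_strain_deriv[OF assms] open_strip
  by (metis field_differentiable_at_within field_differentiable_def holomorphic_onI)+

lemma norm_half_sum:
  fixes a b :: complex
  assumes "norm a \<le> c" "norm b \<le> c"
  shows "norm ((a + b) / 2) \<le> c" "norm ((a - b) / 2) \<le> c"
  using norm_triangle_ineq[of a b] norm_triangle_ineq4[of a b] assms by (auto simp: norm_divide)

lemma vel_strain_bound:
  assumes s: "slice r e J G" and e: "e \<le> 2" and lam: "lam \<noteq> 0" and z: "z \<in> strip r"
  shows "norm (vel lam J G z) \<le> 2 * cA lam * e" "norm (strain lam J G z) \<le> 2 * cA lam * e"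
  unfolding vel_def strain_def using nl_bound[OF assms] by (intro norm_half_sum; simp)+

lemma vel_strain_diff:
  assumes s1: "slice r e J1 G1" and s2: "slice r e J2 G2" and e: "e \<le> 2" and lam: "lam \<noteq> 0" and z: "z \<in> strip r"
    and J: "\<And>z. z \<in> strip r \<Longrightarrow> norm (J1 z - J2 z) \<le> d" and G: "\<And>z. z \<in> strip r \<Longrightarrow> norm (G1 z - G2 z) \<le> d"
  shows "norm (vel lam J1 G1 z - vel lam J2 G2 z) \<le> cD lam * d"
    and "norm (strain lam J1 G1 z - strain lam J2 G2 z) \<le> cD lam * d"
proof -
  note n = nl_diff[OF assms]
  have "vel lam J1 G1 z - vel lam J2 G2 z = ((nl_up lam J1 G1 z - nl_up lam J2 G2 z) + (nl_down lam J1 G1 z - nl_down lam J2 G2 z)) / 2"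
    by (simp add: vel_def field_simps)
  then show "norm (vel lam J1 G1 z - vel lam J2 G2 z) \<le> cD lam * d" using norm_half_sum(1)[OF n] by metis
  have "strain lam J1 G1 z - strain lam J2 G2 z = ((nl_up lam J1 G1 z - nl_up lam J2 G2 z) - (nl_down lam J1 G1 z - nl_down lam J2 G2 z)) / 2"
    by (simp add: strain_def field_simps)
  then show "norm (strain lam J1 G1 z - strain lam J2 G2 z) \<le> cD lam * d" using norm_half_sum(2)[OF n] by metis
qed

lemma vel_strain_real:
  assumes s: "slice r e J G" and e: "e \<le> 2" and lam: "lam \<noteq> 0" and r: "r > 0"
  shows "vel lam J G (of_real x) \<in> \<real>" "strain lam J G (of_real x) \<in> \<real>"
proof -
  have fr: "flux_up lam J G (of_real x) \<in> \<real>" "flux_down lam J G (of_real x) \<in> \<real>" for x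
    unfolding flux_up_def flux_down_def using sliceD(8,9)[OF s, of x]
    by (auto intro!: Reals_mult Reals_add Reals_diff Reals_divide Reals_power)
  have "nl_up lam J G (of_real x) \<in> \<real>"
    unfolding nl_up_def
    by (rule fwd_real[OF sliceD(1)[OF s] flux_holo(1)[OF s lam] r flux_bound(1)[OF s e] sliceD(8)[OF s] fr(1)])
  moreover have "fwd (\<lambda>w. J (- w)) (\<lambda>w. flux_down lam J G (- w)) (of_real (- x)) \<in> \<real>"
    by (rule fwd_real[OF near_one_reflect[OF sliceD(1)[OF s]] holomorphic_reflect[OF flux_holo(2)[OF s lam]] r, of "cA lam * e"])
       (use flux_bound(2)[OF s e] sliceD(8)[OF s] fr(2) in \<open>auto simp flip: of_real_minus\<close>)
  then have "nl_down lam J G (of_real x) \<in> \<real>" unfolding nl_down_def by (simp add: Reals_minus)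
  ultimately show "vel lam J G (of_real x) \<in> \<real>" "strain lam J G (of_real x) \<in> \<real>"
    unfolding vel_def strain_def by (auto intro!: Reals_divide Reals_add Reals_diff)
qed

lemma rate_holo:
  assumes s: "slice r e J G" and e: "e \<le> 2" and lam: "lam \<noteq> 0"
  shows "rate_J lam J G holomorphic_on strip r" "rate_G lam J G holomorphic_on strip r"
  unfolding rate_J_def[abs_def] rate_G_def[abs_def]
  by (auto intro!: holomorphic_intros sliceD(2,3)[OF s] vel_strain_holo[OF assms])

lemma rate_real:
  assumes s: "slice r e J G" and e: "e \<le> 2" and lam: "lam \<noteq> 0" and r: "r > 0"
  shows "rate_J lam J G (of_real x) \<in> \<real>" "rate_G lam J G (of_real x) \<in> \<real>"
  unfolding rate_J_def rate_G_def using sliceD(8,9)[OF s, of x] vel_strain_real[OF assms, of x]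
  by (auto intro!: Reals_mult Reals_add Reals_diff Reals_divide Reals_power Reals_minus)

lemma rate_bound:
  assumes s: "slice r e J G" and e: "e \<le> 2" and lam: "lam \<noteq> 0" and z: "z \<in> strip r"
  shows "norm (rate_J lam J G z) \<le> cV lam * e" "norm (rate_G lam J G z) \<le> cV lam * e"
proof -
  note b = sliceD(4)[OF s z] sliceD(6)[OF s z] sliceD(7)[OF s z] vel_strain_bound[OF assms]
  have nn: "0 \<le> cA lam * e" "0 \<le> \<bar>lam\<bar> * (cA lam * e)" using b(3) cA_nonneg[of lam] by auto
  have "norm (rate_J lam J G z) \<le> 3 / 2 * (e + 2 * cA lam * e)"
    unfolding rate_J_def norm_mult using b by (intro mult_mono norm_triangle_mono) auto
  also have "\<dots> \<le> cV lam * e" using nn b(3) by (simp add: cV_def algebra_simps)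
  finally show "norm (rate_J lam J G z) \<le> cV lam * e" .
  have "norm (G z) * norm (G z) \<le> 2 * e" using b e by (intro mult_mono) auto
  then have 1: "norm (- (G z)\<^sup>2 / 2) \<le> e" by (simp add: norm_divide norm_mult power2_eq_square)
  have 2: "norm (of_real lam * vel lam J G z) \<le> \<bar>lam\<bar> * (2 * cA lam * e)"
    unfolding norm_mult using b by (intro mult_mono) auto
  have 3: "norm (G z * strain lam J G z) \<le> 2 * (2 * cA lam * e)"
    unfolding norm_mult using b e by (intro mult_mono) auto
  have "norm (rate_G lam J G z) \<le> e + \<bar>lam\<bar> * (2 * cA lam * e) + 2 * (2 * cA lam * e)"
    unfolding rate_G_def by (rule order_trans[OF norm_triangle_ineq4 add_mono[OF norm_triangle_mono[OF 1 2] 3]])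
  also have "\<dots> \<le> cV lam * e" using nn b(3) by (simp add: cV_def algebra_simps)
  finally show "norm (rate_G lam J G z) \<le> cV lam * e" .
qed

lemma rate_diff:
  assumes s1: "slice r e J1 G1" and s2: "slice r e J2 G2" and e: "e \<le> 2" and lam: "lam \<noteq> 0" and z: "z \<in> strip r"
    and J: "\<And>z. z \<in> strip r \<Longrightarrow> norm (J1 z - J2 z) \<le> d" and G: "\<And>z. z \<in> strip r \<Longrightarrow> norm (G1 z - G2 z) \<le> d"
  shows "norm (rate_J lam J1 G1 z - rate_J lam J2 G2 z) \<le> cL lam * d"
    and "norm (rate_G lam J1 G1 z - rate_G lam J2 G2 z) \<le> cL lam * d"
proof -
  note v = vel_strain_diff[OF assms] and b1 = vel_strain_bound[OF s1 e lam z] and b2 = vel_strain_bound[OF s2 e lam z]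
  have d0: "0 \<le> d" using J[OF z] norm_ge_zero order_trans by blast
  have nn: "0 \<le> cA lam * d" "0 \<le> cD lam * d" "0 \<le> \<bar>lam\<bar> * (cD lam * d)" using d0 cA_nonneg[of lam] cD_nonneg[of lam] by auto
  have Ae: "2 * cA lam * e \<le> 4 * cA lam" using mult_left_mono[OF e, of "2 * cA lam"] cA_nonneg[of lam] by simp
  note s1b = order_trans[OF b1(2) Ae]
  have g: "norm (G1 z) \<le> 2" "norm (G2 z) \<le> 2" using sliceD(4)[OF s1 z] sliceD(4)[OF s2 z] e by auto
  have "norm (G1 z + strain lam J1 G1 z) \<le> 2 + 4 * cA lam"
    using s1b g by (intro norm_triangle_mono) auto
  moreover have "norm ((G1 z + strain lam J1 G1 z) - (G2 z + strain lam J2 G2 z)) \<le> d + cD lam * d"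
    unfolding add_diff_add using v G[OF z] by (intro norm_triangle_mono) auto
  ultimately have "norm (rate_J lam J1 G1 z - rate_J lam J2 G2 z) \<le> d * (2 + 4 * cA lam) + 3 / 2 * (d + cD lam * d)"
    unfolding rate_J_def using J[OF z] sliceD(6)[OF s2 z] by (intro norm_mult_diff_le) auto
  also have "\<dots> \<le> cL lam * d" using nn d0 by (simp add: cL_def algebra_simps)
  finally show "norm (rate_J lam J1 G1 z - rate_J lam J2 G2 z) \<le> cL lam * d" .
  have 1: "norm ((G1 z)\<^sup>2 - (G2 z)\<^sup>2) \<le> 4 * d"
    using sliceD(4)[OF s1 z] sliceD(4)[OF s2 z] e G[OF z] by (rule sq_diff_bound)
  have 2: "norm (of_real lam * (vel lam J1 G1 z - vel lam J2 G2 z)) \<le> \<bar>lam\<bar> * (cD lam * d)"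
    unfolding norm_mult using v by (intro mult_mono) auto
  have 3: "norm (G1 z * strain lam J1 G1 z - G2 z * strain lam J2 G2 z) \<le> d * (4 * cA lam) + 2 * (cD lam * d)"
    by (intro norm_mult_diff_le G[OF z] s1b g v)
  have "rate_G lam J1 G1 z - rate_G lam J2 G2 z = of_real lam * (vel lam J1 G1 z - vel lam J2 G2 z)
      - ((G1 z)\<^sup>2 - (G2 z)\<^sup>2) / 2 - (G1 z * strain lam J1 G1 z - G2 z * strain lam J2 G2 z)"
    by (simp add: rate_G_def field_simps)
  also have "norm \<dots> \<le> \<bar>lam\<bar> * (cD lam * d) + 2 * d + (d * (4 * cA lam) + 2 * (cD lam * d))"
  proof -
    have 4: "norm (((G1 z)\<^sup>2 - (G2 z)\<^sup>2) / 2) \<le> 2 * d" using 1 by (simp add: norm_divide)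
    show ?thesis
      by (rule order_trans[OF norm_triangle_ineq4 add_mono[OF order_trans[OF norm_triangle_ineq4 add_mono[OF 2 4]] 3]])
  qed
  also have "\<dots> \<le> cL lam * d" using nn d0 by (simp add: cL_def algebra_simps)
  finally show "norm (rate_G lam J1 G1 z - rate_G lam J2 G2 z) \<le> cL lam * d" .
qed

section \<open>Curves of Lagrangian states and Picard iteration\<close>

text \<open>The Lipschitz bound in time belongs to the class because it makes the rates integrable
  in time and, being a pointwise inequality with a fixed constant, passes to limits.\<close>

definition curve :: "real \<Rightarrow> real \<Rightarrow> real \<Rightarrow> real \<Rightarrow> (real \<Rightarrow> complex \<Rightarrow> complex) \<Rightarrow> (real \<Rightarrow> complex \<Rightarrow> complex) \<Rightarrow> bool" where
  "curve r e M T J G \<longleftrightarrow> (\<forall>t\<in>{0..T}. slice r e (J t) (G t)) \<and>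
     (\<forall>t\<in>{0..T}. \<forall>t'\<in>{0..T}. \<forall>z\<in>strip r. norm (J t z - J t' z) \<le> M * \<bar>t - t'\<bar> \<and> norm (G t z - G t' z) \<le> M * \<bar>t - t'\<bar>)"

lemma curveD:
  assumes "curve r e M T J G"
  shows "t \<in> {0..T} \<Longrightarrow> slice r e (J t) (G t)"
    and "t \<in> {0..T} \<Longrightarrow> t' \<in> {0..T} \<Longrightarrow> z \<in> strip r \<Longrightarrow> norm (J t z - J t' z) \<le> M * \<bar>t - t'\<bar>"
    and "t \<in> {0..T} \<Longrightarrow> t' \<in> {0..T} \<Longrightarrow> z \<in> strip r \<Longrightarrow> norm (G t z - G t' z) \<le> M * \<bar>t - t'\<bar>"
  using assms by (auto simp: curve_def)

lemma curve_lip_hol: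
  assumes c: "curve r e M T J G" and e: "e \<le> 2" and lam: "lam \<noteq> 0"
  shows "lip_hol r T J" "lip_hol r T G"
    "lip_hol r T (\<lambda>t. vel lam (J t) (G t))" "lip_hol r T (\<lambda>t. strain lam (J t) (G t))"
    "lip_hol r T (\<lambda>t. rate_J lam (J t) (G t))" "lip_hol r T (\<lambda>t. rate_G lam (J t) (G t))"
proof -
  note s = curveD(1)[OF c]
  show "lip_hol r T J"
  proof (rule lip_hol_global)
    show "norm (J t z) \<le> 3 / 2" if "t \<in> {0..T}" "z \<in> strip r" for t z
      using sliceD(6)[OF s] that by blast
  qed (auto intro: sliceD(3)[OF s] curveD(2)[OF c])
  show "lip_hol r T G"
    by (rule lip_hol_global[where B=e and L=M]) (auto intro: sliceD(2,4)[OF s] curveD(3)[OF c])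
  show "lip_hol r T (\<lambda>t. vel lam (J t) (G t))"
  proof (rule lip_hol_global)
    show "norm (vel lam (J t) (G t) z - vel lam (J t') (G t') z) \<le> cD lam * M * \<bar>t - t'\<bar>" if "t \<in> {0..T}" "t' \<in> {0..T}" "z \<in> strip r" for t t' z
      using vel_strain_diff(1)[OF s[OF that(1)] s[OF that(2)] e lam that(3) curveD(2)[OF c that(1,2)] curveD(3)[OF c that(1,2)]]
      by (simp add: mult.assoc)
  qed (auto intro: vel_strain_holo[OF s e lam] vel_strain_bound[OF s e lam])
  show "lip_hol r T (\<lambda>t. strain lam (J t) (G t))"
  proof (rule lip_hol_global)
    show "norm (strain lam (J t) (G t) z - strain lam (J t') (G t') z) \<le> cD lam * M * \<bar>t - t'\<bar>" if "t \<in> {0..T}" "t' \<in> {0..T}" "z \<in> strip r" for t t' z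
      using vel_strain_diff(2)[OF s[OF that(1)] s[OF that(2)] e lam that(3) curveD(2)[OF c that(1,2)] curveD(3)[OF c that(1,2)]]
      by (simp add: mult.assoc)
  qed (auto intro: vel_strain_holo[OF s e lam] vel_strain_bound[OF s e lam])
  show "lip_hol r T (\<lambda>t. rate_J lam (J t) (G t))"
  proof (rule lip_hol_global)
    show "norm (rate_J lam (J t) (G t) z - rate_J lam (J t') (G t') z) \<le> cL lam * M * \<bar>t - t'\<bar>" if "t \<in> {0..T}" "t' \<in> {0..T}" "z \<in> strip r" for t t' z
      using rate_diff(1)[OF s[OF that(1)] s[OF that(2)] e lam that(3) curveD(2)[OF c that(1,2)] curveD(3)[OF c that(1,2)]]
      by (simp add: mult.assoc)
  qed (auto intro: rate_holo[OF s e lam] rate_bound[OF s e lam])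
  show "lip_hol r T (\<lambda>t. rate_G lam (J t) (G t))"
  proof (rule lip_hol_global)
    show "norm (rate_G lam (J t) (G t) z - rate_G lam (J t') (G t') z) \<le> cL lam * M * \<bar>t - t'\<bar>" if "t \<in> {0..T}" "t' \<in> {0..T}" "z \<in> strip r" for t t' z
      using rate_diff(2)[OF s[OF that(1)] s[OF that(2)] e lam that(3) curveD(2)[OF c that(1,2)] curveD(3)[OF c that(1,2)]]
      by (simp add: mult.assoc)
  qed (auto intro: rate_holo[OF s e lam] rate_bound[OF s e lam])
qed

lemma integral_Reals:
  fixes f :: "real \<Rightarrow> complex"
  assumes "continuous_on {a..b} f" "\<And>x. x \<in> {a..b} \<Longrightarrow> f x \<in> \<real>"
  shows "integral {a..b} f \<in> \<real>"
proof -
  have "Im (integral {a..b} f) = integral {a..b} (\<lambda>x. Im (f x))"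
    using integral_linear[OF integrable_continuous_real[OF assms(1)] bounded_linear_Im] by (simp add: o_def)
  also have "\<dots> = integral {a..b} (\<lambda>x. 0)"
    using assms(2) by (intro integral_cong) (simp add: complex_is_Real_iff)
  finally show ?thesis by (simp add: complex_is_Real_iff)
qed

lemma time_integral_bounds:
  assumes F: "lip_hol r T F" and z: "z \<in> strip r"
    and B: "\<And>t. t \<in> {0..T} \<Longrightarrow> norm (F t z) \<le> B"
  shows "t \<in> {0..T} \<Longrightarrow> norm (integral {0..t} (\<lambda>\<tau>. F \<tau> z)) \<le> B * t"
    and "t \<in> {0..T} \<Longrightarrow> t' \<in> {0..T} \<Longrightarrow> norm (integral {0..t} (\<lambda>\<tau>. F \<tau> z) - integral {0..t'} (\<lambda>\<tau>. F \<tau> z)) \<le> B * \<bar>t - t'\<bar>"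
proof -
  have "norm (integral {0..t} (\<lambda>\<tau>. F \<tau> z) - integral {0..t'} (\<lambda>\<tau>. F \<tau> z)) \<le> B * norm (t - t')"
    if t: "t \<in> {0..T}" "t' \<in> {0..T}" for t t'
  proof (rule differentiable_bound[OF convex_real_interval(5)[of 0 T], where f'="\<lambda>\<tau> h. h *\<^sub>R F \<tau> z"])
    fix \<tau> assume \<tau>: "\<tau> \<in> {0..T}"
    show "((\<lambda>t. integral {0..t} (\<lambda>\<tau>. F \<tau> z)) has_derivative (\<lambda>h. h *\<^sub>R F \<tau> z)) (at \<tau> within {0..T})"
      using lip_hol_time_integral(3)[OF F \<tau> z] by (simp add: has_vector_derivative_def)
    show "onorm (\<lambda>h. h *\<^sub>R F \<tau> z) \<le> B"
      using B[OF \<tau>] by (intro onorm_le) (simp add: mult.commute[of B] mult_left_mono)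
  qed (use t in auto)
  then show *: "t \<in> {0..T} \<Longrightarrow> t' \<in> {0..T} \<Longrightarrow> norm (integral {0..t} (\<lambda>\<tau>. F \<tau> z) - integral {0..t'} (\<lambda>\<tau>. F \<tau> z)) \<le> B * \<bar>t - t'\<bar>" for t t'
    by simp
  show "t \<in> {0..T} \<Longrightarrow> norm (integral {0..t} (\<lambda>\<tau>. F \<tau> z)) \<le> B * t"
    using *[of t 0] by auto
qed

lemma closed_limit:
  fixes l :: "'a::t2_space"
  assumes "closed C" "\<And>n::nat. f n \<in> C" "f \<longlonglongrightarrow> l"
  shows "l \<in> C"
  using assms closed_sequentially by blast

text \<open>Holomorphy passes to the limit by Weierstrass' theorem on discs; all other conditions
  are closed and pointwise. This is the completeness that the fixed point argument needs.\<close>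

lemma curve_uniform_limit:
  assumes c: "\<And>n::nat. curve r e M T (\<lambda>t z. fst (f n (t, z))) (\<lambda>t z. snd (f n (t, z)))"
    and u: "uniform_limit ({0..T} \<times> strip r) f g sequentially" and r: "r > 0"
  shows "curve r e M T (\<lambda>t z. fst (g (t, z))) (\<lambda>t z. snd (g (t, z)))"
proof -
  have lim: "(\<lambda>n. f n (t, z)) \<longlonglongrightarrow> g (t, z)" if "t \<in> {0..T}" "z \<in> strip r" for t z
    using tendsto_uniform_limitI[OF u] that by auto
  note limf = tendsto_fst[OF lim] and lims = tendsto_snd[OF lim]
  note s = curveD(1)[OF c]
  have hol: "(\<lambda>z. h (g (t, z))) holomorphic_on strip r"
    if t: "t \<in> {0..T}" and h: "\<And>n. (\<lambda>z. h (f n (t, z))) holomorphic_on strip r" and hd: "\<And>a b. dist (h a) (h b) \<le> dist a b"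
    for t and h :: "complex \<times> complex \<Rightarrow> complex"
  proof (rule holomorphic_uniform_sequence[OF open_strip h])
    fix z assume "z \<in> strip r"
    then obtain d where d: "0 < d" "cball z d \<subseteq> strip r" using open_strip open_contains_cball by metis
    have "uniform_limit (cball z d) (\<lambda>n z. h (f n (t, z))) (\<lambda>z. h (g (t, z))) sequentially"
    proof (rule uniform_limitI)
      fix \<epsilon> :: real assume "\<epsilon> > 0"
      from uniform_limitD[OF u this] show "\<forall>\<^sub>F n in sequentially. \<forall>z\<in>cball z d. dist (h (f n (t, z))) (h (g (t, z))) < \<epsilon>"
        using d(2) t hd by (elim eventually_mono) (meson SigmaI le_less_trans subsetD)
    qed
    then show "\<exists>d>0. cball z d \<subseteq> strip r \<and> uniform_limit (cball z d) (\<lambda>n z. h (f n (t, z))) (\<lambda>z. h (g (t, z))) sequentially"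
      using d by blast
  qed
  show ?thesis
    unfolding curve_def slice_def near_one_def
  proof (intro conjI ballI allI)
    fix t assume t: "t \<in> {0..T}"
    show "(\<lambda>z. fst (g (t, z))) holomorphic_on strip r"
      by (rule hol[OF t sliceD(3)[OF s[OF t]] dist_fst_le])
    show "(\<lambda>z. snd (g (t, z))) holomorphic_on strip r"
      by (rule hol[OF t sliceD(2)[OF s[OF t]] dist_snd_le])
    fix z assume z: "z \<in> strip r"
    show "norm (fst (g (t, z)) - 1) \<le> 1 / 2"
      by (rule LIMSEQ_le_const2[OF tendsto_norm[OF tendsto_diff[OF limf[OF t z] tendsto_const]]])
         (use sliceD(5)[OF s[OF t] z] in blast)
    show "norm (snd (g (t, z))) \<le> e"
      by (rule LIMSEQ_le_const2[OF tendsto_norm[OF lims[OF t z]]]) (use sliceD(4)[OF s[OF t] z] in blast)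
    fix t' assume t': "t' \<in> {0..T}"
    show "norm (fst (g (t, z)) - fst (g (t', z))) \<le> M * \<bar>t - t'\<bar>"
      by (rule LIMSEQ_le_const2[OF tendsto_norm[OF tendsto_diff[OF limf[OF t z] limf[OF t' z]]]])
         (use curveD(2)[OF c t t' z] in blast)
    show "norm (snd (g (t, z)) - snd (g (t', z))) \<le> M * \<bar>t - t'\<bar>"
      by (rule LIMSEQ_le_const2[OF tendsto_norm[OF tendsto_diff[OF lims[OF t z] lims[OF t' z]]]])
         (use curveD(3)[OF c t t' z] in blast)
  next
    fix t x assume t: "t \<in> {0..T}"
    have z: "complex_of_real x \<in> strip r" using r by simp
    show "fst (g (t, complex_of_real x)) \<in> \<real>"
      by (rule closed_limit[OF closed_complex_Reals sliceD(8)[OF s[OF t]] limf[OF t z]])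
    show "snd (g (t, complex_of_real x)) \<in> \<real>"
      by (rule closed_limit[OF closed_complex_Reals sliceD(9)[OF s[OF t]] lims[OF t z]])
  qed
qed

text \<open>Picard iteration for the pair \<open>(J, G)\<close>. Since the rates contain no
  derivative of the unknowns, the strip does not shrink, and the smallness required of
  \<open>T\<close> depends on \<open>lam\<close> alone.\<close>

lemma lagrangian_solution:
  assumes lam: "lam \<noteq> 0" and r: "r > 0" and eps: "0 < eps" "eps \<le> 1" and T: "0 < T" "T * cV lam \<le> 1 / 4" "T * cL lam \<le> 1 / 4"
    and g0: "g0 holomorphic_on strip r" "\<And>z. z \<in> strip r \<Longrightarrow> norm (g0 z) \<le> eps" "\<And>x. g0 (of_real x) \<in> \<real>"
  obtains J G where "curve r (2 * eps) (cV lam * (2 * eps)) T J G"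
    "\<And>t z. t \<in> {0..T} \<Longrightarrow> z \<in> strip r \<Longrightarrow> J t z = 1 + integral {0..t} (\<lambda>\<tau>. rate_J lam (J \<tau>) (G \<tau>) z)"
    "\<And>t z. t \<in> {0..T} \<Longrightarrow> z \<in> strip r \<Longrightarrow> G t z = g0 z + integral {0..t} (\<lambda>\<tau>. rate_G lam (J \<tau>) (G \<tau>) z)"
proof -
  \<comment> \<open>Twice the size of the datum: the evolution adds at most
    \<open>M * T \<le> e / 4\<close>, which fits into the remaining \<open>eps\<close>.\<close>
  define e where "e = 2 * eps"
  define M where "M = cV lam * e"
  have e2: "e \<le> 2" "0 < e" "M \<ge> 0" using eps cV_pos[of lam] by (auto simp: e_def M_def)
  define PJ where "PJ f t z = 1 + integral {0..t} (\<lambda>\<tau>. rate_J lam (\<lambda>z. fst (f (\<tau>, z))) (\<lambda>z. snd (f (\<tau>, z))) z)"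
    for f :: "real \<times> complex \<Rightarrow> complex \<times> complex" and t z
  define PG where "PG f t z = g0 z + integral {0..t} (\<lambda>\<tau>. rate_G lam (\<lambda>z. fst (f (\<tau>, z))) (\<lambda>z. snd (f (\<tau>, z))) z)"
    for f :: "real \<times> complex \<Rightarrow> complex \<times> complex" and t z
  define \<Phi> where "\<Phi> f = (\<lambda>(t, z). (PJ f t z, PG f t z))" for f
  define Q where "Q f \<longleftrightarrow> curve r e M T (\<lambda>t z. fst (f (t, z))) (\<lambda>t z. snd (f (t, z)))" for f
  have Tb: "M * t \<le> 1 / 2" "M * t \<le> e / 4" if "t \<in> {0..T}" for t
  proof -
    have "M * t \<le> M * T" using that e2 by (intro mult_left_mono) auto
    also have "\<dots> = (T * cV lam) * e" by (simp add: M_def)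
    also have "\<dots> \<le> 1 / 4 * e" using T e2 by (intro mult_right_mono) auto
    finally show "M * t \<le> e / 4" by simp
    then show "M * t \<le> 1 / 2" using e2 by simp
  qed
  have Qstep: "Q (\<Phi> f)" if "Q f" for f
  proof -
    let ?J = "\<lambda>t z. fst (f (t, z))" and ?G = "\<lambda>t z. snd (f (t, z))"
    have c: "curve r e M T ?J ?G" using that by (simp add: Q_def)
    note s = curveD(1)[OF c]
    note lJ = curve_lip_hol(5)[OF c e2(1) lam] and lG = curve_lip_hol(6)[OF c e2(1) lam]
    have bJ: "norm (rate_J lam (?J t) (?G t) z) \<le> M" if "t \<in> {0..T}" "z \<in> strip r" for t z
      unfolding M_def by (rule rate_bound(1)[OF s[OF that(1)] e2(1) lam that(2)])
    have bG: "norm (rate_G lam (?J t) (?G t) z) \<le> M" if "t \<in> {0..T}" "z \<in> strip r" for t z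
      unfolding M_def by (rule rate_bound(2)[OF s[OF that(1)] e2(1) lam that(2)])
    have "curve r e M T (PJ f) (PG f)"
      unfolding curve_def slice_def near_one_def
    proof (intro conjI ballI allI)
      fix t assume t: "t \<in> {0..T}"
      show "PJ f t holomorphic_on strip r"
        unfolding PJ_def[abs_def] using lip_holD(1)[OF lip_hol_time_integral(1)[OF lJ] t]
        by (intro holomorphic_on_add holomorphic_on_const) simp
      show "PG f t holomorphic_on strip r"
        unfolding PG_def[abs_def] using lip_holD(1)[OF lip_hol_time_integral(1)[OF lG] t]
        by (intro holomorphic_on_add g0(1)) simp
      fix z assume z: "z \<in> strip r"
      show "norm (PJ f t z - 1) \<le> 1 / 2"
        using time_integral_bounds(1)[OF lJ z bJ[OF _ z] t] Tb[OF t] by (simp add: PJ_def)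
      have "norm (PG f t z) \<le> eps + M * t"
        unfolding PG_def using time_integral_bounds(1)[OF lG z bG[OF _ z] t] g0(2)[OF z] by (rule norm_triangle_mono[rotated])
      then show "norm (PG f t z) \<le> e" using Tb[OF t] eps by (simp add: e_def)
      fix t' assume t': "t' \<in> {0..T}"
      show "norm (PJ f t z - PJ f t' z) \<le> M * \<bar>t - t'\<bar>"
        using time_integral_bounds(2)[OF lJ z bJ[OF _ z] t t'] by (simp add: PJ_def)
      show "norm (PG f t z - PG f t' z) \<le> M * \<bar>t - t'\<bar>"
        using time_integral_bounds(2)[OF lG z bG[OF _ z] t t'] by (simp add: PG_def)
    next
      fix t x assume t: "t \<in> {0..T}"
      have z: "complex_of_real x \<in> strip r" using r by simp
      have sub: "{0..t} \<subseteq> {0..T}" using t by auto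
      have "integral {0..t} (\<lambda>\<tau>. rate_J lam (?J \<tau>) (?G \<tau>) (of_real x)) \<in> \<real>"
        by (rule integral_Reals[OF continuous_on_subset[OF lip_hol_continuous_time[OF lJ z] sub]])
           (use sub rate_real(1)[OF s e2(1) lam r] in auto)
      then show "PJ f t (of_real x) \<in> \<real>" by (auto simp: PJ_def intro: Reals_add)
      have "integral {0..t} (\<lambda>\<tau>. rate_G lam (?J \<tau>) (?G \<tau>) (of_real x)) \<in> \<real>"
        by (rule integral_Reals[OF continuous_on_subset[OF lip_hol_continuous_time[OF lG z] sub]])
           (use sub rate_real(2)[OF s e2(1) lam r] in auto)
      then show "PG f t (of_real x) \<in> \<real>" by (auto simp: PG_def intro: Reals_add g0)
    qed
    then show ?thesis by (simp add: Q_def \<Phi>_def)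
  qed
  have Qcontr: "dist (\<Phi> f x) (\<Phi> g x) \<le> d / 2"
    if Qf: "Q f" and Qg: "Q g" and d: "\<And>x. x \<in> {0..T} \<times> strip r \<Longrightarrow> dist (f x) (g x) \<le> d" and x: "x \<in> {0..T} \<times> strip r" for f g d x
  proof -
    let ?J = "\<lambda>f t z. fst (f (t, z))" and ?G = "\<lambda>f t z. snd (f (t, z))"
    obtain t z where tz: "x = (t, z)" "t \<in> {0..T}" "z \<in> strip r" using x by auto
    have sub: "{0..t} \<subseteq> {0..T}" using tz by auto
    have cf: "curve r e M T (?J f) (?G f)" and cg: "curve r e M T (?J g) (?G g)" using Qf Qg by (auto simp: Q_def)
    have d0: "d \<ge> 0" using d[OF x] zero_le_dist order_trans by blast
    have dJ: "norm (?J f \<tau> w - ?J g \<tau> w) \<le> d" if "\<tau> \<in> {0..T}" "w \<in> strip r" for \<tau> w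
      using dist_fst_le[of "f (\<tau>, w)" "g (\<tau>, w)"] d[of "(\<tau>, w)"] that by (simp add: dist_norm)
    have dG: "norm (?G f \<tau> w - ?G g \<tau> w) \<le> d" if "\<tau> \<in> {0..T}" "w \<in> strip r" for \<tau> w
      using dist_snd_le[of "f (\<tau>, w)" "g (\<tau>, w)"] d[of "(\<tau>, w)"] that by (simp add: dist_norm)
    note rd = rate_diff[OF curveD(1)[OF cf] curveD(1)[OF cg] e2(1) lam tz(3) dJ dG]
    have gen: "norm (integral {0..t} (\<lambda>\<tau>. F \<tau> z) - integral {0..t} (\<lambda>\<tau>. H \<tau> z)) \<le> d / 4"
      if F: "lip_hol r T F" and H: "lip_hol r T H" and b: "\<And>\<tau>. \<tau> \<in> {0..T} \<Longrightarrow> norm (F \<tau> z - H \<tau> z) \<le> cL lam * d" for F H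
    proof -
      have cF: "continuous_on {0..t} (\<lambda>\<tau>. F \<tau> z)" and cH: "continuous_on {0..t} (\<lambda>\<tau>. H \<tau> z)"
        using lip_hol_continuous_time[OF F tz(3)] lip_hol_continuous_time[OF H tz(3)] continuous_on_subset sub by blast+
      have "norm (integral {0..t} (\<lambda>\<tau>. F \<tau> z - H \<tau> z)) \<le> cL lam * d * (t - 0)"
        by (rule integral_bound) (use sub tz b cF cH in \<open>auto intro!: continuous_intros\<close>)
      also have "\<dots> \<le> cL lam * d * T" using tz d0 cL_pos[of lam] by (intro mult_left_mono) auto
      also have "\<dots> = (T * cL lam) * d" by simp
      also have "\<dots> \<le> 1 / 4 * d" using T d0 by (intro mult_right_mono) auto
      finally show ?thesis
        using Henstock_Kurzweil_Integration.integral_diff[OF integrable_continuous_real[OF cF] integrable_continuous_real[OF cH]] by simp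
    qed
    have 1: "norm (PJ f t z - PJ g t z) \<le> d / 4"
      using gen[OF curve_lip_hol(5)[OF cf e2(1) lam] curve_lip_hol(5)[OF cg e2(1) lam] rd(1)] by (simp add: PJ_def)
    have 2: "norm (PG f t z - PG g t z) \<le> d / 4"
      using gen[OF curve_lip_hol(6)[OF cf e2(1) lam] curve_lip_hol(6)[OF cg e2(1) lam] rd(2)] by (simp add: PG_def)
    have "dist (\<Phi> f x) (\<Phi> g x) \<le> dist (PJ f t z) (PJ g t z) + dist (PG f t z) (PG g t z)"
      by (simp add: \<Phi>_def tz dist_Pair_Pair sqrt_sum_squares_le_sum)
    then show ?thesis using 1 2 by (simp add: dist_norm)
  qed
  have Q0: "Q (\<lambda>(t, z). (1, g0 z))"
    unfolding Q_def curve_def slice_def near_one_def using g0 e2 eps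
    by (force simp: e_def intro: holomorphic_intros)
  have Qb: "dist (f x) (g x) \<le> 3 + 4" if Qf: "Q f" and Qg: "Q g" and x: "x \<in> {0..T} \<times> strip r" for f g x
  proof -
    obtain t z where tz: "x = (t, z)" "t \<in> {0..T}" "z \<in> strip r" using x by auto
    have *: "norm (f x) \<le> 3 / 2 + 2" if "Q f" for f
    proof -
      have s: "slice r e (\<lambda>z. fst (f (t, z))) (\<lambda>z. snd (f (t, z)))" using that curveD(1) tz(2) unfolding Q_def by blast
      have "norm (f x) \<le> norm (fst (f x)) + norm (snd (f x))"
        by (metis norm_Pair prod.collapse sqrt_sum_squares_le_sum norm_ge_zero)
      then show ?thesis using sliceD(6)[OF s tz(3)] sliceD(4)[OF s tz(3)] e2 by (simp add: tz)
    qed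
    show ?thesis using *[OF Qf] *[OF Qg] norm_triangle_ineq4[of "f x" "g x"] by (simp add: dist_norm)
  qed
  have Qcl: "Q g" if "\<And>n::nat. Q (f n)" "uniform_limit ({0..T} \<times> strip r) f g sequentially" for f g
    using curve_uniform_limit[OF _ that(2) r] that(1) unfolding Q_def by blast
  have "\<exists>g. Q g \<and> (\<forall>x\<in>{0..T} \<times> strip r. \<Phi> g x = g x)"
  proof (rule uniform_contraction_fixpoint[where Q=Q and \<Phi>=\<Phi> and S="{0..T} \<times> strip r"])
    show "Q (\<lambda>(t, z). (1, g0 z))" by (rule Q0)
    show "Q (\<Phi> f)" if "Q f" for f using that by (rule Qstep)
    show "dist (\<Phi> f x) (\<Phi> g x) \<le> d / 2"
      if "Q f" "Q g" "\<And>x. x \<in> {0..T} \<times> strip r \<Longrightarrow> dist (f x) (g x) \<le> d" "x \<in> {0..T} \<times> strip r" for f g d x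
      using that by (rule Qcontr)
    show "dist (f x) (g x) \<le> 3 + 4" if "Q f" "Q g" "x \<in> {0..T} \<times> strip r" for f g x
      using that by (rule Qb)
    show "Q g" if "\<And>n::nat. Q (f n)" "uniform_limit ({0..T} \<times> strip r) f g sequentially" for f g
      using that by (rule Qcl)
  qed blast
  then obtain g where g: "Q g" "\<And>x. x \<in> {0..T} \<times> strip r \<Longrightarrow> \<Phi> g x = g x" by blast
  show ?thesis
  proof (rule that[of "\<lambda>t z. fst (g (t, z))" "\<lambda>t z. snd (g (t, z))"])
    show "curve r (2 * eps) (cV lam * (2 * eps)) T (\<lambda>t z. fst (g (t, z))) (\<lambda>t z. snd (g (t, z)))"
      using g(1) by (simp add: Q_def M_def e_def)
    show "fst (g (t, z)) = 1 + integral {0..t} (\<lambda>\<tau>. rate_J lam (\<lambda>z. fst (g (\<tau>, z))) (\<lambda>z. snd (g (\<tau>, z))) z)"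
      if "t \<in> {0..T}" "z \<in> strip r" for t z
      using arg_cong[OF g(2)[of "(t, z)"], of fst] that by (simp add: \<Phi>_def PJ_def)
    show "snd (g (t, z)) = g0 z + integral {0..t} (\<lambda>\<tau>. rate_G lam (\<lambda>z. fst (g (\<tau>, z))) (\<lambda>z. snd (g (\<tau>, z))) z)"
      if "t \<in> {0..T}" "z \<in> strip r" for t z
      using arg_cong[OF g(2)[of "(t, z)"], of snd] that by (simp add: \<Phi>_def PG_def)
  qed
qed

section \<open>The inverse of \<open>D\<^sup>2 - 1\<close>\<close>

lemma exp_weighted_integrable:
  fixes g :: "real \<Rightarrow> real"
  assumes "continuous_on UNIV g" "\<And>x. \<bar>g x\<bar> \<le> B"
  shows "(\<lambda>s. exp (- s) * g s) integrable_on {0..}" "\<bar>integral {0..} (\<lambda>s. exp (- s) * g s)\<bar> \<le> B"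
    and "(\<lambda>s. exp (- s) * g s) absolutely_integrable_on {0..}"
    and "(\<lambda>n::nat. integral {0..real n} (\<lambda>s. exp (- s) * g s)) \<longlonglongrightarrow> integral {0..} (\<lambda>s. exp (- s) * g s)"
proof -
  have c: "continuous_on {0..} (\<lambda>s. exp (- s) * g s)"
    by (intro continuous_intros continuous_on_subset[OF assms(1)]) auto
  have b: "norm (exp (- s) * g s) \<le> B * exp (- s * 1)" for s
    using assms(2)[of s] by (simp add: abs_mult mult.commute)
  show 1: "(\<lambda>s. exp (- s) * g s) integrable_on {0..}" and "\<bar>integral {0..} (\<lambda>s. exp (- s) * g s)\<bar> \<le> B"
    using integrable_dominated_exp[OF c _ b] by auto
  show "(\<lambda>s. exp (- s) * g s) absolutely_integrable_on {0..}"
    by (rule absolutely_integrable_integrable_bound[OF b 1 exp_minus_integral(1)]) auto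
  show "(\<lambda>n::nat. integral {0..real n} (\<lambda>s. exp (- s) * g s)) \<longlonglongrightarrow> integral {0..} (\<lambda>s. exp (- s) * g s)"
    by (rule integral_tendsto_infinity[OF c _ b]) auto
qed

lemma exp_weighted_FTC:
  fixes g g' :: "real \<Rightarrow> real"
  assumes g: "\<And>x. (g has_real_derivative g' x) (at x)" and c: "continuous_on UNIV g'"
    and B: "\<And>x. \<bar>g x\<bar> \<le> B" "\<And>x. \<bar>g' x\<bar> \<le> B'"
  shows "integral {0..} (\<lambda>s. exp (- s) * (g' s - g s)) = - g 0"
proof -
  have cg: "continuous_on UNIV g" using g DERIV_continuous_on by blast
  have b: "\<bar>g' x - g x\<bar> \<le> B' + B" for x using B[of x] by linarith
  have lim: "(\<lambda>n::nat. integral {0..real n} (\<lambda>s. exp (- s) * (g' s - g s))) \<longlonglongrightarrow> integral {0..} (\<lambda>s. exp (- s) * (g' s - g s))"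
    by (rule exp_weighted_integrable(4)[OF _ b]) (intro continuous_intros c cg)
  have d: "((\<lambda>s. exp (- s) * g s) has_real_derivative exp (- s) * (g' s - g s)) (at s)" for s
    by (rule derivative_eq_intros g refl | simp add: algebra_simps)+
  have "integral {0..real n} (\<lambda>s. exp (- s) * (g' s - g s)) = exp (- real n) * g (real n) - exp (- 0) * g 0" for n
    by (rule integral_unique, rule fundamental_theorem_of_calculus)
       (use d in \<open>auto intro: has_field_derivative_at_within simp flip: has_real_derivative_iff_has_vector_derivative\<close>)
  then have lim2: "(\<lambda>n::nat. exp (- real n) * g (real n) - g 0) \<longlonglongrightarrow> integral {0..} (\<lambda>s. exp (- s) * (g' s - g s))"
    using lim by simp
  have "(\<lambda>n::nat. exp (- real n)) \<longlonglongrightarrow> 0" by real_asymp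
  from tendsto_mult_left_zero[OF this, of B] have "(\<lambda>n::nat. exp (- real n) * g (real n)) \<longlonglongrightarrow> 0"
    by (rule Lim_null_comparison[rotated]) (auto simp: abs_mult B)
  then have "(\<lambda>n::nat. exp (- real n) * g (real n) - g 0) \<longlonglongrightarrow> 0 - g 0"
    by (intro tendsto_intros)
  with lim2 show ?thesis using LIMSEQ_unique by fastforce
qed

text \<open>Splitting at the kink of the kernel leaves two one-sided exponential integrals, in each
  of which an integration by parts has a single boundary term. The Lebesgue integral of the
  definition becomes a gauge integral on the half line.\<close>

lemma Ginv_split:
  assumes c: "continuous_on UNIV h" and B: "\<And>x. \<bar>h x\<bar> \<le> B"
  shows "Ginv h x = - (1 / 2) * (integral {0..} (\<lambda>s. exp (- s) * h (x + s)) + integral {0..} (\<lambda>s. exp (- s) * h (x - s)))"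
    and "integrable lborel (\<lambda>y. exp (- \<bar>x - y\<bar>) * h y)"
proof -
  let ?f = "\<lambda>s. exp (- \<bar>s\<bar>) * h (x + s)"
  have c1: "continuous_on UNIV (\<lambda>s. h (x + s))" and c2: "continuous_on UNIV (\<lambda>s. h (x - s))"
    by (rule continuous_on_compose2[OF c]; auto intro!: continuous_intros)+
  have cf: "continuous_on UNIV ?f" by (intro continuous_intros c1)
  have m[measurable]: "?f \<in> borel_measurable borel" using cf by (rule borel_measurable_continuous_onI)
  have "(\<lambda>s. ?f (- s)) \<in> borel_measurable borel"
    by (intro borel_measurable_continuous_onI continuous_on_compose2[OF cf]) (auto intro!: continuous_intros)
  then have m2: "(\<lambda>s. indicator {0..} s *\<^sub>R ?f (- s)) \<in> borel_measurable lborel" by measurable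
  note a1 = exp_weighted_integrable(3)[OF c1 B] and a2 = exp_weighted_integrable(3)[OF c2 B]
  have s1: "set_integrable lborel {0..} ?f"
  proof -
    have "set_integrable lebesgue {0..} ?f"
      by (rule set_integrable_cong[THEN iffD1, OF refl refl _ a1]) auto
    then show ?thesis
      unfolding set_integrable_def by (subst (asm) integrable_completion) auto
  qed
  have s2: "set_integrable lborel {0..} (\<lambda>s. ?f (- s))"
  proof -
    have "set_integrable lebesgue {0..} (\<lambda>s. ?f (- s))"
      by (rule set_integrable_cong[THEN iffD1, OF refl refl _ a2]) auto
    then show ?thesis
      unfolding set_integrable_def using integrable_completion[OF m2] by simp
  qed
  have i1: "integrable lborel (\<lambda>s. indicator {0..} s * ?f s)" using s1 by (simp add: set_integrable_def)
  have i2: "integrable lborel (\<lambda>s. indicator {0..} s * ?f (- s))" using s2 by (simp add: set_integrable_def)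
  have i2': "integrable lborel (\<lambda>s. indicator {0..} (- s) * ?f s)"
    using lborel_integrable_real_affine[OF i2, of "-1" 0] by simp
  have ae: "AE s in lborel. ?f s = indicator {0..} s * ?f s + indicator {0..} (- s) * ?f s"
    by (rule AE_mp[OF AE_lborel_singleton[of 0]]) (auto intro!: AE_I2 simp: indicator_def)
  have fi: "integrable lborel ?f"
    by (rule integrable_cong_AE_imp[OF Bochner_Integration.integrable_add[OF i1 i2']]) (use ae in \<open>auto elim: eventually_mono\<close>)
  have "(LINT s|lborel. ?f s) = (LINT s|lborel. indicator {0..} s * ?f s + indicator {0..} (- s) * ?f s)"
    by (rule integral_cong_AE) (use ae in auto)
  also have "\<dots> = (LINT s|lborel. indicator {0..} s * ?f s) + (LINT s|lborel. indicator {0..} (- s) * ?f s)"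
    by (rule Bochner_Integration.integral_add[OF i1 i2'])
  also have "(LINT s|lborel. indicator {0..} (- s) * ?f s) = (LINT s|lborel. indicator {0..} s * ?f (- s))"
    using lborel_integral_real_affine[of "-1" "\<lambda>s. indicator {0..} s * ?f (- s)" 0] by simp
  also have "(LINT s|lborel. indicator {0..} s * ?f s) = integral {0..} ?f"
    using set_borel_integral_eq_integral(2)[OF s1] by (simp add: set_lebesgue_integral_def)
  also have "(LINT s|lborel. indicator {0..} s * ?f (- s)) = integral {0..} (\<lambda>s. ?f (- s))"
    using set_borel_integral_eq_integral(2)[OF s2] by (simp add: set_lebesgue_integral_def)
  also have "integral {0..} ?f = integral {0..} (\<lambda>s. exp (- s) * h (x + s))"
    by (rule integral_cong) auto
  also have "integral {0..} (\<lambda>s. ?f (- s)) = integral {0..} (\<lambda>s. exp (- s) * h (x - s))"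
    by (rule integral_cong) auto
  finally have I: "(LINT s|lborel. ?f s) = integral {0..} (\<lambda>s. exp (- s) * h (x + s)) + integral {0..} (\<lambda>s. exp (- s) * h (x - s))" .
  have "(LINT y|lborel. exp (- \<bar>x - y\<bar>) * h y) = (LINT s|lborel. ?f s)"
    using lborel_integral_real_affine[of 1 "\<lambda>y. exp (- \<bar>x - y\<bar>) * h y" x] by simp
  then show "Ginv h x = - (1 / 2) * (integral {0..} (\<lambda>s. exp (- s) * h (x + s)) + integral {0..} (\<lambda>s. exp (- s) * h (x - s)))"
    using I by (simp add: Ginv_def)
  show "integrable lborel (\<lambda>y. exp (- \<bar>x - y\<bar>) * h y)"
    using lborel_integrable_real_affine[OF fi, of 1 "-x"] by (simp add: abs_minus_commute)
qed

lemma abs_half_add_le: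
  fixes a b B :: real
  assumes "\<bar>a\<bar> \<le> B" "\<bar>b\<bar> \<le> B"
  shows "\<bar>- (1 / 2) * (a + b)\<bar> \<le> B"
  using assms by (simp add: abs_le_iff)

lemma Ginv_bound:
  assumes "continuous_on UNIV h" "\<And>x. \<bar>h x\<bar> \<le> B"
  shows "\<bar>Ginv h x\<bar> \<le> B"
proof -
  have c1: "continuous_on UNIV (\<lambda>s. h (x + s))" and c2: "continuous_on UNIV (\<lambda>s. h (x - s))"
    by (rule continuous_on_compose2[OF assms(1)]; auto intro!: continuous_intros)+
  show ?thesis
    unfolding Ginv_split(1)[OF assms]
    by (intro abs_half_add_le exp_weighted_integrable(2)[OF c1 assms(2)] exp_weighted_integrable(2)[OF c2 assms(2)])
qed

lemma Ginv_add:
  assumes "continuous_on UNIV g" "\<And>x. \<bar>g x\<bar> \<le> B" "continuous_on UNIV h" "\<And>x. \<bar>h x\<bar> \<le> B'"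
  shows "Ginv (\<lambda>y. g y + h y) x = Ginv g x + Ginv h x" "Ginv (\<lambda>y. g y - h y) x = Ginv g x - Ginv h x"
  unfolding Ginv_def
  using Bochner_Integration.integral_add[OF Ginv_split(2)[OF assms(1,2), of x] Ginv_split(2)[OF assms(3,4), of x]]
    Bochner_Integration.integral_diff[OF Ginv_split(2)[OF assms(1,2), of x] Ginv_split(2)[OF assms(3,4), of x]]
  by (auto simp: algebra_simps)

lemma Ginv_halves:
  assumes g: "\<And>x. (g has_real_derivative g' x) (at x)" and c: "continuous_on UNIV g'"
    and B: "\<And>x. \<bar>g x\<bar> \<le> B" "\<And>x. \<bar>g' x\<bar> \<le> B'"
  shows "integral {0..} (\<lambda>s. exp (- s) * g' (x + s)) = integral {0..} (\<lambda>s. exp (- s) * g (x + s)) - g x"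
    and "integral {0..} (\<lambda>s. exp (- s) * g' (x - s)) = g x - integral {0..} (\<lambda>s. exp (- s) * g (x - s))"
proof -
  have cg: "continuous_on UNIV g" using g DERIV_continuous_on by blast
  have cc: "continuous_on UNIV (\<lambda>s. g' (x + s))" "continuous_on UNIV (\<lambda>s. g' (x - s))"
    "continuous_on UNIV (\<lambda>s. g (x + s))" "continuous_on UNIV (\<lambda>s. g (x - s))"
    by (rule continuous_on_compose2[OF c] continuous_on_compose2[OF cg]; auto intro!: continuous_intros)+
  have "integral {0..} (\<lambda>s. exp (- s) * (g' (x + s) - g (x + s))) = - g (x + 0)"
    by (rule exp_weighted_FTC[of "\<lambda>s. g (x + s)" "\<lambda>s. g' (x + s)", OF _ cc(1) B])
       (auto intro!: DERIV_chain2[where f=g and g="\<lambda>s. x + s", THEN DERIV_cong] g derivative_eq_intros)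
  then show "integral {0..} (\<lambda>s. exp (- s) * g' (x + s)) = integral {0..} (\<lambda>s. exp (- s) * g (x + s)) - g x"
    using Henstock_Kurzweil_Integration.integral_diff[OF exp_weighted_integrable(1)[OF cc(1) B(2)] exp_weighted_integrable(1)[OF cc(3) B(1)]]
    by (simp add: right_diff_distrib)
  have "integral {0..} (\<lambda>s. exp (- s) * (- g' (x - s) - g (x - s))) = - g (x - 0)"
    by (rule exp_weighted_FTC[of "\<lambda>s. g (x - s)" "\<lambda>s. - g' (x - s)", OF _ continuous_on_minus[OF cc(2)] B(1)])
       (use B(2) in \<open>auto intro!: DERIV_chain2[where f=g and g="\<lambda>s. x - s", THEN DERIV_cong] g derivative_eq_intros\<close>)
  moreover have "integral {0..} (\<lambda>s. exp (- s) * (- g' (x - s) - g (x - s)))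
     = - integral {0..} (\<lambda>s. exp (- s) * g' (x - s)) - integral {0..} (\<lambda>s. exp (- s) * g (x - s))"
    using Henstock_Kurzweil_Integration.integral_diff[OF integrable_neg[OF exp_weighted_integrable(1)[OF cc(2) B(2)]] exp_weighted_integrable(1)[OF cc(4) B(1)]]
    by (simp add: right_diff_distrib)
  ultimately show "integral {0..} (\<lambda>s. exp (- s) * g' (x - s)) = g x - integral {0..} (\<lambda>s. exp (- s) * g (x - s))"
    by simp
qed

text \<open>Integration by parts in both halves leaves integrals of \<open>g\<close> and boundary
  terms \<open>g x\<close>, all bounded by \<open>B\<close>. So applying \<open>Ginv\<close> to a
  derivative loses nothing in the sup norm, which is what comparing two solutions needs.\<close>

lemma Ginv_D_bound:
  assumes g: "\<And>x. (g has_real_derivative g' x) (at x)" and c: "continuous_on UNIV g'"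
    and B: "\<And>x. \<bar>g x\<bar> \<le> B" "\<And>x. \<bar>g' x\<bar> \<le> B'"
  shows "\<bar>Ginv g' x\<bar> \<le> 2 * B"
proof -
  have cg: "continuous_on UNIV g" using g DERIV_continuous_on by blast
  have c1: "continuous_on UNIV (\<lambda>s. g (x + s))" and c2: "continuous_on UNIV (\<lambda>s. g (x - s))"
    by (rule continuous_on_compose2[OF cg]; auto intro!: continuous_intros)+
  show ?thesis
    unfolding Ginv_split(1)[OF c B(2)] Ginv_halves[OF assms]
    using exp_weighted_integrable(2)[OF c1 B(1)] exp_weighted_integrable(2)[OF c2 B(1)] B(1)[of x]
    by (intro abs_half_add_le) linarith+
qed

text \<open>Two integrations by parts in each half reduce the integrals of \<open>u2\<close> to
  those of \<open>u\<close>; the boundary terms in \<open>u1\<close> cancel and those in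
  \<open>u\<close> add up. This lets a bounded function be recognised as \<open>Ginv\<close> of the
  right-hand side of the equation that it solves.\<close>

lemma Ginv_inverse:
  assumes u: "\<And>x. (u has_real_derivative u1 x) (at x)" and u1: "\<And>x. (u1 has_real_derivative u2 x) (at x)"
    and c: "continuous_on UNIV u2"
    and B: "\<And>x. \<bar>u x\<bar> \<le> B" "\<And>x. \<bar>u1 x\<bar> \<le> B1" "\<And>x. \<bar>u2 x\<bar> \<le> B2"
  shows "Ginv (\<lambda>y. u2 y - u y) x = u x"
proof -
  have cu: "continuous_on UNIV u" using u DERIV_continuous_on by blast
  have cu1: "continuous_on UNIV u1" using u1 DERIV_continuous_on by blast
  show ?thesis
    unfolding Ginv_add(2)[OF c B(3) cu B(1)]
    unfolding Ginv_split(1)[OF c B(3)] Ginv_split(1)[OF cu B(1)] Ginv_halves[OF u1 c B(2,3)] Ginv_halves[OF u cu1 B(1,2)]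
    by (simp add: field_simps)
qed

section \<open>Real traces of holomorphic functions and curves in \<open>Cinf\<close>\<close>

lemma has_real_derivative_Re:
  assumes "(f has_field_derivative f') (at (complex_of_real x))"
  shows "((\<lambda>x. Re (f (of_real x))) has_real_derivative Re f') (at x)"
  using bounded_linear.has_vector_derivative[OF bounded_linear_Re has_vector_derivative_real_field[OF assms]]
  by (simp add: has_real_derivative_iff_has_vector_derivative)

lemma has_real_derivative_Re_time:
  assumes "(f has_vector_derivative f') (at t within S)"
  shows "((\<lambda>x. Re (f x)) has_real_derivative Re f') (at t within S)"
  using bounded_linear.has_vector_derivative[OF bounded_linear_Re assms]
  by (simp add: has_real_derivative_iff_has_vector_derivative)


lemma D_eqI:
  fixes f :: "real \<Rightarrow> real"
  assumes "\<And>x. (f has_real_derivative f' x) (at x)"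
  shows "D f = f'"
proof
  fix x
  show "D f x = f' x"
    unfolding D_def
    by (rule vector_derivative_at) (use assms in \<open>simp flip: has_real_derivative_iff_has_vector_derivative\<close>)
qed

lemma smooth_has_derivative:
  fixes f :: "real \<Rightarrow> real"
  assumes "smooth f"
  shows "((D ^^ k) f has_real_derivative (D ^^ Suc k) f x) (at x)"
  using assms vector_derivative_works[of "(D ^^ k) f" "at x"]
  by (simp add: smooth_def D_def has_real_derivative_iff_has_vector_derivative)

lemma Cinf_derivative: "f \<in> Cinf \<Longrightarrow> ((D ^^ k) f has_real_derivative (D ^^ Suc k) f x) (at x)"
  by (rule smooth_has_derivative) (simp add: Cinf_def)

lemma Cinf_continuous: "f \<in> Cinf \<Longrightarrow> continuous_on UNIV ((D ^^ k) f)"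
  using Cinf_derivative DERIV_continuous_on by blast

lemma Cinf_bounded: "f \<in> Cinf \<Longrightarrow> \<exists>B. \<forall>x. \<bar>(D ^^ k) f x\<bar> \<le> B"
  unfolding Cinf_def bounded_iff by auto

lemma continuous_into_CinfD:
  assumes "continuous_into_Cinf T g" "t \<in> {0..T}"
  shows "g t \<in> Cinf"
    and "\<epsilon> > 0 \<Longrightarrow> \<exists>d>0. \<forall>s\<in>{0..T}. \<bar>s - t\<bar> < d \<longrightarrow> (\<forall>y. \<bar>(D ^^ k) (g s) y - (D ^^ k) (g t) y\<bar> < \<epsilon>)"
proof -
  show "g t \<in> Cinf" using assms by (simp add: continuous_into_Cinf_def)
  assume e: "\<epsilon> > 0"
  have "uniform_limit UNIV (\<lambda>s. (D ^^ k) (g s)) ((D ^^ k) (g t)) (at t within {0..T})"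
    using assms by (simp add: continuous_into_Cinf_def)
  from uniform_limitD[OF this e] obtain d where d: "d > 0"
    "\<And>s. s \<in> {0..T} \<Longrightarrow> s \<noteq> t \<Longrightarrow> dist s t < d \<Longrightarrow> \<forall>y. dist ((D ^^ k) (g s) y) ((D ^^ k) (g t) y) < \<epsilon>"
    unfolding eventually_at by auto
  show "\<exists>d>0. \<forall>s\<in>{0..T}. \<bar>s - t\<bar> < d \<longrightarrow> (\<forall>y. \<bar>(D ^^ k) (g s) y - (D ^^ k) (g t) y\<bar> < \<epsilon>)"
  proof (intro exI[of _ d] conjI ballI impI allI d)
    fix s y assume "s \<in> {0..T}" "\<bar>s - t\<bar> < d"
    then show "\<bar>(D ^^ k) (g s) y - (D ^^ k) (g t) y\<bar> < \<epsilon>"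
      using d(2)[of s] e by (cases "s = t") (auto simp: dist_real_def)
  qed
qed

lemma continuous_into_Cinf_joint:
  assumes g: "continuous_into_Cinf T g"
  shows "continuous_on ({0..T} \<times> UNIV) (\<lambda>(s, y). (D ^^ k) (g s) y)"
  unfolding continuous_on_iff
proof (clarify)
  fix t y e assume t: "t \<in> {0..T}" and e: "(0::real) < e"
  obtain d1 where d1: "d1 > 0" "\<And>s y. s \<in> {0..T} \<Longrightarrow> \<bar>s - t\<bar> < d1 \<Longrightarrow> \<bar>(D ^^ k) (g s) y - (D ^^ k) (g t) y\<bar> < e / 2"
    using continuous_into_CinfD(2)[OF g t, of "e / 2" k] e by auto
  have "isCont ((D ^^ k) (g t)) y"
    using Cinf_derivative[OF continuous_into_CinfD(1)[OF g t]] DERIV_isCont by blast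
  then obtain d2 where d2: "d2 > 0" "\<And>y'. dist y' y < d2 \<Longrightarrow> dist ((D ^^ k) (g t) y') ((D ^^ k) (g t) y) < e / 2"
    using e unfolding continuous_at_eps_delta by (metis half_gt_zero)
  show "\<exists>d>0. \<forall>x'\<in>{0..T} \<times> UNIV. dist x' (t, y) < d \<longrightarrow>
     dist (case x' of (s, y) \<Rightarrow> (D ^^ k) (g s) y) ((D ^^ k) (g t) y) < e"
  proof (intro exI[of _ "min d1 d2"] conjI ballI impI)
    show "0 < min d1 d2" using d1 d2 by auto
    fix x' assume x': "x' \<in> {0..T} \<times> (UNIV::real set)" "dist x' (t, y) < min d1 d2"
    obtain s w where x: "x' = (s, w)" by force
    have "dist s t < d1" "dist w y < d2"
      using x' dist_fst_le[of x' "(t, y)"] dist_snd_le[of x' "(t, y)"] by (auto simp: x)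
    then have "\<bar>(D ^^ k) (g s) w - (D ^^ k) (g t) w\<bar> < e / 2" "\<bar>(D ^^ k) (g t) w - (D ^^ k) (g t) y\<bar> < e / 2"
      using d1(2)[of s w] d2(2)[of w] x' by (auto simp: x dist_real_def)
    then show "dist (case x' of (s, y) \<Rightarrow> (D ^^ k) (g s) y) ((D ^^ k) (g t) y) < e"
      unfolding x dist_real_def case_prod_conv by linarith
  qed
qed

text \<open>Uniform convergence gives each time a neighbourhood with a common bound, and finitely
  many of these neighbourhoods cover the compact interval.\<close>

lemma continuous_into_Cinf_bound:
  assumes g: "continuous_into_Cinf T g"
  shows "\<exists>B. \<forall>t\<in>{0..T}. \<forall>y. \<bar>(D ^^ k) (g t) y\<bar> \<le> B"
proof -
  have "\<exists>d B. d > 0 \<and> (\<forall>s\<in>{0..T}. \<bar>s - t\<bar> < d \<longrightarrow> (\<forall>y. \<bar>(D ^^ k) (g s) y\<bar> \<le> B))" if t: "t \<in> {0..T}" for t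
  proof -
    obtain d where d: "d > 0" "\<And>s y. s \<in> {0..T} \<Longrightarrow> \<bar>s - t\<bar> < d \<Longrightarrow> \<bar>(D ^^ k) (g s) y - (D ^^ k) (g t) y\<bar> < 1"
      using continuous_into_CinfD(2)[OF g t, of 1 k] by auto
    obtain B where B: "\<And>y. \<bar>(D ^^ k) (g t) y\<bar> \<le> B"
      using Cinf_bounded[OF continuous_into_CinfD(1)[OF g t], of k] by blast
    have "\<bar>(D ^^ k) (g s) y\<bar> \<le> B + 1" if "s \<in> {0..T}" "\<bar>s - t\<bar> < d" for s y
      using d(2)[OF that, of y] B[of y] by linarith
    then show ?thesis using d(1) by blast
  qed
  then obtain d B where d: "\<And>t. t \<in> {0..T} \<Longrightarrow> d t > 0"
    and B: "\<And>t s y. t \<in> {0..T} \<Longrightarrow> s \<in> {0..T} \<Longrightarrow> \<bar>s - t\<bar> < d t \<Longrightarrow> \<bar>(D ^^ k) (g s) y\<bar> \<le> B t"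
    by metis
  have "{0..T} \<subseteq> (\<Union>t\<in>{0..T}. ball t (d t))" using d by force
  from compactE_image[OF compact_Icc _ this] obtain C where C: "C \<subseteq> {0..T}" "finite C" "{0..T} \<subseteq> (\<Union>t\<in>C. ball t (d t))"
    by auto
  have "\<bar>(D ^^ k) (g s) y\<bar> \<le> (\<Sum>t\<in>C. \<bar>B t\<bar>)" if s: "s \<in> {0..T}" for s y
  proof -
    obtain t where t: "t \<in> C" "s \<in> ball t (d t)" using C(3) s by blast
    have "\<bar>(D ^^ k) (g s) y\<bar> \<le> B t" using t C(1) s by (intro B) (auto simp: dist_real_def)
    also have "\<dots> \<le> \<bar>B t\<bar>" by simp
    also have "\<dots> \<le> (\<Sum>t\<in>C. \<bar>B t\<bar>)" using t C(2) by (intro member_le_sum) auto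
    finally show ?thesis .
  qed
  then show ?thesis by blast
qed

lemma moving_point_derivative:
  fixes f :: "real \<Rightarrow> real \<Rightarrow> real"
  assumes d: "\<And>s y. s \<in> S \<Longrightarrow> (f s has_real_derivative fx s y) (at y)"
    and c: "continuous_on (S \<times> UNIV) (\<lambda>(s, y). fx s y)"
    and p: "(p has_real_derivative p') (at t within S)" and t: "t \<in> S"
  shows "((\<lambda>s. f s (p s) - f s (p t)) has_real_derivative fx t (p t) * p') (at t within S)"
proof -
  let ?h = "\<lambda>s y. f s y - f s (p t)"
  have "((\<lambda>(s, y). ?h s y) has_derivative (\<lambda>(a, b). 0 + blinfun_mult_right (fx t (p t)) b)) (at (t, p t) within S \<times> UNIV)"
  proof (rule has_derivative_partialsI)
    show "((\<lambda>s. f s (p t) - f s (p t)) has_derivative (\<lambda>_. 0)) (at t within S)" by simp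
    show "((\<lambda>y. ?h s y) has_derivative blinfun_apply (blinfun_mult_right (fx s y))) (at y within UNIV)" if "s \<in> S" for s y
      using DERIV_diff[OF d[OF that] DERIV_const] by (simp add: has_field_derivative_def blinfun_mult_right.rep_eq)
    have "continuous_on (S \<times> UNIV) (\<lambda>x. blinfun_mult_right (case x of (s, y) \<Rightarrow> fx s y))"
      by (rule bounded_linear.continuous_on[OF bounded_linear_blinfun_mult_right c])
    then have "continuous_on (S \<times> UNIV) (\<lambda>(s, y). blinfun_mult_right (fx s y))"
      by (simp add: case_prod_unfold)
    then show "continuous (at (t, p t) within S \<times> UNIV) (\<lambda>(s, y). blinfun_mult_right (fx s y))"
      using t by (simp add: continuous_on_eq_continuous_within)
  qed (auto simp: t)
  from has_derivative_subset[OF this, of "(\<lambda>s. (s, p s)) ` S"]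
  have 1: "((\<lambda>z. f (fst z) (snd z) - f (fst z) (p t)) has_derivative (\<lambda>w. fx t (p t) * snd w)) (at (t, p t) within (\<lambda>s. (s, p s)) ` S)"
    by (auto simp: case_prod_unfold blinfun_mult_right.rep_eq)
  have 2: "((\<lambda>s. (s, p s)) has_derivative (\<lambda>a. (a, p' * a))) (at t within S)"
    using p by (intro has_derivative_Pair has_derivative_ident) (simp add: has_field_derivative_def)
  have "((\<lambda>s. ?h s (p s)) has_derivative (\<lambda>a. fx t (p t) * (p' * a))) (at t within S)"
    by (rule has_derivative_in_compose[OF 2 1, simplified fst_conv snd_conv])
  moreover have "(\<lambda>a. fx t (p t) * (p' * a)) = (*) (fx t (p t) * p')" by (auto simp: mult.assoc)
  ultimately show ?thesis by (simp add: has_field_derivative_def)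
qed

section \<open>The solution and its uniqueness\<close>

locale lagrangian_flow =
  fixes lam r e M T :: real and J G :: "real \<Rightarrow> complex \<Rightarrow> complex" and g0 :: "complex \<Rightarrow> complex"
  assumes lam: "lam \<noteq> 0" and r: "0 < r" and e: "e \<le> 2" and T: "0 < T"
    and crv: "curve r e M T J G"
    and J_eq: "\<And>t z. t \<in> {0..T} \<Longrightarrow> z \<in> strip r \<Longrightarrow> J t z = 1 + integral {0..t} (\<lambda>\<tau>. rate_J lam (J \<tau>) (G \<tau>) z)"
    and G_eq: "\<And>t z. t \<in> {0..T} \<Longrightarrow> z \<in> strip r \<Longrightarrow> G t z = g0 z + integral {0..t} (\<lambda>\<tau>. rate_G lam (J \<tau>) (G \<tau>) z)"
begin

definition jac :: "real \<Rightarrow> real \<Rightarrow> real" where "jac t x = Re (J t (of_real x))"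
definition gam :: "real \<Rightarrow> real \<Rightarrow> real" where "gam t x = Re (G t (of_real x))"
definition vl :: "real \<Rightarrow> real \<Rightarrow> real" where "vl t x = Re (vel lam (J t) (G t) (of_real x))"
definition st :: "real \<Rightarrow> real \<Rightarrow> real" where "st t x = Re (strain lam (J t) (G t) (of_real x))"
text \<open>The flow map \<open>q\<close>. The velocity is already given at the moving particle, so
  a time integral takes the place of an ordinary differential equation.\<close>

definition pos :: "real \<Rightarrow> real \<Rightarrow> real" where
  "pos t x = Re (of_real x + integral {0..t} (\<lambda>\<tau>. vel lam (J \<tau>) (G \<tau>) (of_real x)))"
definition ipos :: "real \<Rightarrow> real \<Rightarrow> real" where "ipos t = inv (pos t)"
definition sol :: "real \<Rightarrow> real \<Rightarrow> real" where "sol t y = gam t (ipos t y)"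
definition c0 :: real where "c0 = 2 * cA lam * e"

text \<open>The \<open>k\<close>-th Eulerian derivative of the solution, carried along the flow.\<close>

primrec Hk :: "nat \<Rightarrow> real \<Rightarrow> complex \<Rightarrow> complex" where
  "Hk 0 = G"
| "Hk (Suc k) = (\<lambda>t z. deriv (Hk k t) z * inverse (J t z))"

lemmas sl = curveD(1)[OF crv]
lemmas lh = curve_lip_hol[OF crv e lam]

declare r [simp]

lemma on_strip: "complex_of_real x \<in> strip r" by simp

lemma e0: "0 \<le> e" using sliceD(7)[OF sl[of 0] on_strip] T by simp

lemma c0_nonneg: "0 \<le> c0" using e0 cA_nonneg by (simp add: c0_def)

lemma of_real_fields:
  assumes "t \<in> {0..T}"
  shows "J t (of_real x) = of_real (jac t x)" "G t (of_real x) = of_real (gam t x)"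
    "vel lam (J t) (G t) (of_real x) = of_real (vl t x)" "strain lam (J t) (G t) (of_real x) = of_real (st t x)"
  using sliceD(8,9)[OF sl[OF assms], of x] vel_strain_real[OF sl[OF assms] e lam r, of x]
  by (auto simp: jac_def gam_def vl_def st_def of_real_Re)

lemma bounds:
  assumes "t \<in> {0..T}"
  shows "\<bar>jac t x - 1\<bar> \<le> 1 / 2" "1 / 2 \<le> jac t x" "jac t x \<le> 3 / 2" "\<bar>gam t x\<bar> \<le> e" "\<bar>vl t x\<bar> \<le> c0" "\<bar>st t x\<bar> \<le> c0"
proof -
  have "norm (of_real (jac t x) - (1::complex)) \<le> 1 / 2"
    using sliceD(5)[OF sl[OF assms] on_strip, of x] of_real_fields(1)[OF assms] by simp
  moreover have "norm (of_real (jac t x) - (1::complex)) = \<bar>jac t x - 1\<bar>"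
    by (metis norm_of_real of_real_1 of_real_diff)
  ultimately show "\<bar>jac t x - 1\<bar> \<le> 1 / 2" by simp
  then show "1 / 2 \<le> jac t x" "jac t x \<le> 3 / 2" by linarith+
  show "\<bar>gam t x\<bar> \<le> e" using sliceD(4)[OF sl[OF assms] on_strip, of x] of_real_fields(2)[OF assms] by simp
  show "\<bar>vl t x\<bar> \<le> c0" "\<bar>st t x\<bar> \<le> c0"
    using vel_strain_bound[OF sl[OF assms] e lam on_strip, of x] of_real_fields(3,4)[OF assms] by (auto simp: c0_def)
qed

lemma jac_time:
  assumes "t \<in> {0..T}"
  shows "((\<lambda>t. jac t x) has_real_derivative jac t x * (gam t x + st t x)) (at t within {0..T})"
proof -
  have "((\<lambda>t. 1 + integral {0..t} (\<lambda>\<tau>. rate_J lam (J \<tau>) (G \<tau>) (of_real x))) has_vector_derivative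
      0 + rate_J lam (J t) (G t) (of_real x)) (at t within {0..T})"
    by (intro has_vector_derivative_add has_vector_derivative_const lip_hol_time_integral(3)[OF lh(5) assms on_strip])
  from has_real_derivative_Re_time[OF has_vector_derivative_transform[OF assms _ this]]
  have "((\<lambda>t. jac t x) has_real_derivative Re (rate_J lam (J t) (G t) (of_real x))) (at t within {0..T})"
    using J_eq[OF _ on_strip] unfolding jac_def by simp
  then show ?thesis by (simp add: rate_J_def of_real_fields[OF assms])
qed

lemma gam_time:
  assumes "t \<in> {0..T}"
  shows "((\<lambda>t. gam t x) has_real_derivative - (gam t x)\<^sup>2 / 2 + lam * vl t x - gam t x * st t x) (at t within {0..T})"
proof -
  have "((\<lambda>t. g0 (of_real x) + integral {0..t} (\<lambda>\<tau>. rate_G lam (J \<tau>) (G \<tau>) (of_real x))) has_vector_derivative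
      0 + rate_G lam (J t) (G t) (of_real x)) (at t within {0..T})"
    by (intro has_vector_derivative_add has_vector_derivative_const lip_hol_time_integral(3)[OF lh(6) assms on_strip])
  from has_real_derivative_Re_time[OF has_vector_derivative_transform[OF assms _ this]]
  have "((\<lambda>t. gam t x) has_real_derivative Re (rate_G lam (J t) (G t) (of_real x))) (at t within {0..T})"
    using G_eq[OF _ on_strip] unfolding gam_def by simp
  then show ?thesis by (simp add: rate_G_def of_real_fields[OF assms] power2_eq_square)
qed

lemma pos_time:
  assumes "t \<in> {0..T}"
  shows "((\<lambda>t. pos t x) has_real_derivative vl t x) (at t within {0..T})"
proof -
  have "((\<lambda>t. of_real x + integral {0..t} (\<lambda>\<tau>. vel lam (J \<tau>) (G \<tau>) (of_real x))) has_vector_derivative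
      0 + vel lam (J t) (G t) (of_real x)) (at t within {0..T})"
    by (intro has_vector_derivative_add has_vector_derivative_const lip_hol_time_integral(3)[OF lh(3) assms on_strip])
  from has_real_derivative_Re_time[OF this]
  show ?thesis unfolding pos_def vl_def by simp
qed

lemma init: "jac 0 x = 1" "gam 0 x = Re (g0 (of_real x))" "pos 0 x = x"
  using J_eq[OF _ on_strip, of 0 x] G_eq[OF _ on_strip, of 0 x] T by (auto simp: jac_def gam_def pos_def)

lemma vel_complex_bound: "t \<in> {0..T} \<Longrightarrow> norm (vel lam (J t) (G t) (of_real x)) \<le> c0"
  unfolding c0_def by (rule vel_strain_bound(1)[OF sl e lam on_strip])

lemma pos_lipschitz_time:
  assumes "t \<in> {0..T}" "t' \<in> {0..T}"
  shows "\<bar>pos t x - pos t' x\<bar> \<le> c0 * \<bar>t - t'\<bar>"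
proof -
  let ?I = "\<lambda>t. integral {0..t} (\<lambda>\<tau>. vel lam (J \<tau>) (G \<tau>) (of_real x))"
  have "\<bar>Re (?I t - ?I t')\<bar> \<le> c0 * \<bar>t - t'\<bar>"
    using time_integral_bounds(2)[OF lh(3) on_strip vel_complex_bound assms] abs_Re_le_cmod order_trans by blast
  then show ?thesis by (simp add: pos_def)
qed

text \<open>This ties \<open>J\<close>, so far an independent unknown, to the flow:
  \<open>rate_J\<close> is the complex derivative of the velocity, so the integral equation for
  \<open>J\<close> is the formula for \<open>pos\<close> differentiated in space.\<close>

lemma pos_space:
  assumes t: "t \<in> {0..T}"
  shows "(pos t has_real_derivative jac t x) (at x)"
proof -
  let ?V = "\<lambda>\<tau>. vel lam (J \<tau>) (G \<tau>)"
  have "deriv (?V \<tau>) z = rate_J lam (J \<tau>) (G \<tau>) z" if "\<tau> \<in> {0..t}" "z \<in> strip r" for \<tau> z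
    using vel_strain_deriv(1)[OF sl e lam that(2), of \<tau>] that(1) t by (simp add: DERIV_imp_deriv rate_J_def)
  then have "integral {0..t} (\<lambda>\<tau>. deriv (?V \<tau>) (of_real x)) = integral {0..t} (\<lambda>\<tau>. rate_J lam (J \<tau>) (G \<tau>) (of_real x))"
    by (intro integral_cong) auto
  then have "J t (of_real x) = 1 + integral {0..t} (\<lambda>\<tau>. deriv (?V \<tau>) (of_real x))"
    using J_eq[OF t on_strip, of x] by simp
  then have "((\<lambda>z. z + integral {0..t} (\<lambda>\<tau>. ?V \<tau> z)) has_field_derivative J t (of_real x)) (at (of_real x))"
    using DERIV_add[OF DERIV_ident lip_hol_time_integral(2)[OF lh(3) t on_strip]] by simp
  from has_real_derivative_Re[OF this] show ?thesis by (simp add: jac_def pos_def[abs_def])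
qed

lemma pos_expanding:
  assumes t: "t \<in> {0..T}"
  shows "\<bar>x - x'\<bar> \<le> 2 * \<bar>pos t x - pos t x'\<bar>"
proof -
  have *: "(b - a) \<le> 2 * (pos t b - pos t a)" if ab: "a < b" for a b
  proof -
    obtain \<xi> where "pos t b - pos t a = (b - a) * jac t \<xi>"
      using MVT2[OF ab, of "pos t" "jac t"] pos_space[OF t] by auto
    moreover have "(b - a) * (1 / 2) \<le> (b - a) * jac t \<xi>" using bounds(2)[OF t] ab by (intro mult_left_mono) auto
    ultimately show ?thesis by simp
  qed
  show ?thesis using *[of x x'] *[of x' x] by (cases x x' rule: linorder_cases) auto
qed

text \<open>Injectivity comes from \<open>jac \<ge> 1 / 2\<close>. Surjectivity comes from the
  intermediate value theorem, because no particle moves further than \<open>c0 * t\<close>.\<close>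

lemma bij_pos:
  assumes t: "t \<in> {0..T}"
  shows "bij (pos t)"
proof (rule bijI)
  show "inj (pos t)" using pos_expanding[OF t] by (intro injI) (metis abs_eq_0 cancel_comm_monoid_add_class.diff_cancel eq_iff_diff_eq_0 mult_zero_right abs_le_zero_iff)
  have cont: "continuous_on A (pos t)" for A using pos_space[OF t] DERIV_continuous_on has_field_derivative_at_within by blast
  show "surj (pos t)"
  proof (rule surjI)
    fix y
    have b: "\<bar>pos t x - x\<bar> \<le> c0 * t" for x using pos_lipschitz_time[OF t, of 0 x] T t init(3) by simp
    have "c0 * t \<ge> 0" using c0_nonneg t by simp
    then have "\<exists>x\<ge>y - c0 * t. x \<le> y + c0 * t \<and> pos t x = y"
      using b[of "y - c0 * t"] b[of "y + c0 * t"] by (intro IVT' cont) (auto simp: abs_le_iff)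
    then have "\<exists>x. pos t x = y" by blast
    then show "pos t (SOME x. pos t x = y) = y" by (rule someI_ex)
  qed
qed

lemma pos_ipos [simp]: "t \<in> {0..T} \<Longrightarrow> pos t (ipos t y) = y"
  unfolding ipos_def using bij_pos by (simp add: bij_is_surj surj_f_inv_f)

lemma ipos_pos [simp]: "t \<in> {0..T} \<Longrightarrow> ipos t (pos t x) = x"
  unfolding ipos_def using bij_pos by (simp add: bij_is_inj inv_f_f)

lemma ipos_derivative:
  assumes t: "t \<in> {0..T}"
  shows "(ipos t has_real_derivative inverse (jac t (ipos t y))) (at y)"
proof (rule DERIV_inverse_function[where f="pos t" and a="y - 1" and b="y + 1"])
  show "(pos t has_real_derivative jac t (ipos t y)) (at (ipos t y))" by (rule pos_space[OF t])
  show "jac t (ipos t y) \<noteq> 0" using bounds(2)[OF t, of "ipos t y"] by auto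
  have "dist (ipos t y') (ipos t y) \<le> 2 * dist y' y" for y'
    using pos_expanding[OF t, of "ipos t y'" "ipos t y"] t by (simp add: dist_real_def)
  then show "isCont (ipos t) y"
    unfolding continuous_at_eps_delta
    by (metis (no_types, opaque_lifting) half_gt_zero le_less_trans less_divide_eq_numeral1(1) mult.commute)
qed (use t in auto)

text \<open>A Lagrangian derivative of the form \<open>J * F'\<close> becomes the Eulerian
  derivative \<open>F'\<close>: the factor \<open>J\<close> cancels against the derivative of the
  inverse flow.\<close>

lemma ipos_chain:
  assumes t: "t \<in> {0..T}"
    and F: "(F has_field_derivative J t (of_real (ipos t y)) * F') (at (of_real (ipos t y)))"
  shows "((\<lambda>y. Re (F (of_real (ipos t y)))) has_real_derivative Re F') (at y)"
proof -
  have "((\<lambda>y. Re (F (of_real (ipos t y)))) has_real_derivative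
      Re (J t (of_real (ipos t y)) * F') * inverse (jac t (ipos t y))) (at y)"
    by (rule DERIV_chain2[OF has_real_derivative_Re[OF F] ipos_derivative[OF t]])
  moreover have "jac t (ipos t y) \<noteq> 0" using bounds(2)[OF t, of "ipos t y"] by auto
  then have "Re (J t (of_real (ipos t y)) * F') * inverse (jac t (ipos t y)) = Re F'"
    by (simp add: of_real_fields(1)[OF t])
  ultimately show ?thesis by metis
qed

lemma J_nonzero: "t \<in> {0..T} \<Longrightarrow> z \<in> strip r \<Longrightarrow> 1 / 2 \<le> norm (J t z)"
  using sliceD(5)[OF sl, of t z] norm_triangle_ineq2[of 1 "1 - J t z"] by (simp add: norm_minus_commute)

lemma Hk_lip_hol: "lip_hol r T (Hk k)"
proof (induction k)
  case (Suc k)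
  have "lip_hol r T (\<lambda>t z. deriv (Hk k t) z * inverse (J t z))"
    by (rule lip_hol_mult[OF lip_hol_deriv[OF Suc] lip_hol_inverse[OF lh(1) J_nonzero]])
  then show ?case by simp
qed (simp add: lh)

lemma Hk_derivative:
  assumes t: "t \<in> {0..T}"
  shows "((\<lambda>y. Re (Hk k t (of_real (ipos t y)))) has_real_derivative Re (Hk (Suc k) t (of_real (ipos t y)))) (at y)"
proof (rule ipos_chain[OF t])
  have "J t (of_real (ipos t y)) \<noteq> 0" using J_nonzero[OF t on_strip, of "ipos t y"] by auto
  then have "J t (of_real (ipos t y)) * Hk (Suc k) t (of_real (ipos t y)) = deriv (Hk k t) (of_real (ipos t y))" by simp
  then show "(Hk k t has_field_derivative J t (of_real (ipos t y)) * Hk (Suc k) t (of_real (ipos t y))) (at (of_real (ipos t y)))"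
    using holomorphic_derivI[OF lip_holD(1)[OF Hk_lip_hol t] open_strip on_strip] by metis
qed

lemma D_sol:
  assumes t: "t \<in> {0..T}"
  shows "(D ^^ k) (sol t) = (\<lambda>y. Re (Hk k t (of_real (ipos t y))))"
proof (induction k)
  case 0
  show ?case by (auto simp: sol_def gam_def)
next
  case (Suc k)
  then show ?case using D_eqI[OF Hk_derivative[OF t]] by simp
qed

lemma Hk_bound:
  "\<exists>L. \<forall>t\<in>{0..T}. \<forall>t'\<in>{0..T}. \<forall>x. norm (Hk k t (of_real x)) \<le> L \<and> norm (Hk k t (of_real x) - Hk k t' (of_real x)) \<le> L * \<bar>t - t'\<bar>"
proof -
  have "complex_of_real x \<in> strip (r / 2)" for x using r by simp
  then show ?thesis using lip_holD(2)[OF Hk_lip_hol, of "r / 2" k] r by (fastforce simp: field_simps)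
qed

lemma sol_Cinf:
  assumes t: "t \<in> {0..T}"
  shows "sol t \<in> Cinf"
proof -
  obtain L where L: "\<And>k x. norm (Hk k t (of_real x)) \<le> L k"
    using Hk_bound t by metis
  have "\<bar>Re (Hk k t (of_real x))\<bar> \<le> L k" for k x using L abs_Re_le_cmod order_trans by blast
  then have "bounded (range ((D ^^ k) (sol t)))" for k
    unfolding D_sol[OF t] bounded_iff by auto
  moreover have "smooth (sol t)"
    unfolding smooth_def D_sol[OF t] using Hk_derivative[OF t] real_differentiable_def by blast
  ultimately show ?thesis by (simp add: Cinf_def)
qed

text \<open>At a fixed particle the \<open>k\<close>-th derivative is Lipschitz in time by the
  bounds on \<open>Hk\<close>. Meanwhile the particle moves by at most
  \<open>c0 * \<bar>t - t'\<bar>\<close>, and the derivative of order \<open>k + 1\<close> bounds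
  the effect of this shift.\<close>

lemma sol_lipschitz_time:
  "\<exists>L. \<forall>t\<in>{0..T}. \<forall>t'\<in>{0..T}. \<forall>y. \<bar>(D ^^ k) (sol t) y - (D ^^ k) (sol t') y\<bar> \<le> L * \<bar>t - t'\<bar>"
proof -
  obtain L where L: "\<And>t t' x. t\<in>{0..T} \<Longrightarrow> t'\<in>{0..T} \<Longrightarrow> norm (Hk k t (of_real x) - Hk k t' (of_real x)) \<le> L * \<bar>t - t'\<bar>"
    using Hk_bound[of k] by blast
  obtain L1 where "\<forall>t\<in>{0..T}. \<forall>t'\<in>{0..T}. \<forall>x. norm (Hk (Suc k) t (of_real x)) \<le> L1 \<and>
      norm (Hk (Suc k) t (of_real x) - Hk (Suc k) t' (of_real x)) \<le> L1 * \<bar>t - t'\<bar>"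
    using Hk_bound[of "Suc k"] by (rule exE)
  then have L1: "\<And>t x. t\<in>{0..T} \<Longrightarrow> norm (Hk (Suc k) t (of_real x)) \<le> L1" by blast
  have L1_0: "L1 \<ge> 0" using order_trans[OF norm_ge_zero L1[of 0 0]] T by simp
  have b: "\<bar>(D ^^ k) (sol t) y - (D ^^ k) (sol t) y'\<bar> \<le> L1 * \<bar>y - y'\<bar>" if t: "t \<in> {0..T}" for t y y'
  proof -
    have "norm ((D ^^ k) (sol t) y - (D ^^ k) (sol t) y') \<le> L1 * norm (y - y')"
    proof (rule field_differentiable_bound[OF convex_UNIV])
      show "((D ^^ k) (sol t) has_real_derivative (D ^^ Suc k) (sol t) x) (at x within UNIV)" for x
        using Cinf_derivative[OF sol_Cinf[OF t]] by simp
      show "norm ((D ^^ Suc k) (sol t) x) \<le> L1" for x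
        unfolding D_sol[OF t] using L1[OF t] abs_Re_le_cmod order_trans real_norm_def by metis
    qed auto
    then show ?thesis by simp
  qed
  have "\<bar>(D ^^ k) (sol t) y - (D ^^ k) (sol t') y\<bar> \<le> (L + L1 * c0) * \<bar>t - t'\<bar>" if t: "t \<in> {0..T}" "t' \<in> {0..T}" for t t' y
  proof -
    let ?x = "ipos t' y"
    have 1: "\<bar>(D ^^ k) (sol t) (pos t ?x) - (D ^^ k) (sol t') y\<bar> \<le> L * \<bar>t - t'\<bar>"
    proof -
      have "(D ^^ k) (sol t) (pos t ?x) - (D ^^ k) (sol t') y = Re (Hk k t (of_real ?x) - Hk k t' (of_real ?x))"
        using t by (simp add: D_sol)
      then show ?thesis using L[OF t, of ?x] abs_Re_le_cmod order_trans by metis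
    qed
    have "\<bar>(D ^^ k) (sol t) (pos t ?x) - (D ^^ k) (sol t) (pos t' ?x)\<bar> \<le> L1 * \<bar>pos t ?x - pos t' ?x\<bar>"
      by (rule b[OF t(1)])
    also have "\<dots> \<le> L1 * (c0 * \<bar>t - t'\<bar>)" using pos_lipschitz_time[OF t] L1_0 by (intro mult_left_mono) auto
    finally have 2: "\<bar>(D ^^ k) (sol t) (pos t ?x) - (D ^^ k) (sol t) y\<bar> \<le> L1 * c0 * \<bar>t - t'\<bar>" using t by simp
    show ?thesis using 1 2 unfolding distrib_right by linarith
  qed
  then show ?thesis by blast
qed

lemma sol_continuous: "continuous_into_Cinf T sol"
  unfolding continuous_into_Cinf_def
proof (intro conjI ballI allI sol_Cinf)
  fix k t assume t: "t \<in> {0..T}"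
  obtain L where L: "\<And>s y. s\<in>{0..T} \<Longrightarrow> \<bar>(D ^^ k) (sol s) y - (D ^^ k) (sol t) y\<bar> \<le> L * \<bar>s - t\<bar>"
    using sol_lipschitz_time[of k] t by blast
  show "uniform_limit UNIV (\<lambda>s. (D ^^ k) (sol s)) ((D ^^ k) (sol t)) (at t within {0..T})"
  proof (rule uniform_limitI)
    fix \<epsilon> :: real assume \<epsilon>: "\<epsilon> > 0"
    show "\<forall>\<^sub>F s in at t within {0..T}. \<forall>y\<in>UNIV. dist ((D ^^ k) (sol s) y) ((D ^^ k) (sol t) y) < \<epsilon>"
      unfolding eventually_at
    proof (intro exI[of _ "\<epsilon> / (\<bar>L\<bar> + 1)"] conjI ballI impI)
      show "0 < \<epsilon> / (\<bar>L\<bar> + 1)" using \<epsilon> by simp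
      fix s y assume s: "s \<in> {0..T}" "s \<noteq> t \<and> dist s t < \<epsilon> / (\<bar>L\<bar> + 1)"
      have "\<bar>(D ^^ k) (sol s) y - (D ^^ k) (sol t) y\<bar> \<le> L * \<bar>s - t\<bar>" using L[OF s(1)] .
      also have "\<dots> \<le> (\<bar>L\<bar> + 1) * \<bar>s - t\<bar>" by (intro mult_right_mono) auto
      also have "\<dots> < \<epsilon>" using s(2) by (simp add: dist_real_def field_simps)
      finally show "dist ((D ^^ k) (sol s) y) ((D ^^ k) (sol t) y) < \<epsilon>" by (simp add: dist_real_def)
    qed
  qed
qed

end

section \<open>The Eulerian equation and uniqueness\<close>

lemma DERIV_half_square:
  fixes f :: "real \<Rightarrow> real"
  assumes "(f has_real_derivative d) (at x)" "lam \<noteq> 0"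
  shows "((\<lambda>x. (f x)\<^sup>2 / (2 * lam)) has_real_derivative f x * d / lam) (at x)"
  by (rule DERIV_cong[OF DERIV_cdivide[OF DERIV_power[OF assms(1), of 2]]]) (simp add: assms(2) field_simps)

lemma momentum_props:
  assumes f: "f \<in> Cinf" and lam: "lam \<noteq> 0"
  shows "\<And>x. (momentum lam f has_real_derivative (D ^^ 2) f x + f x * D f x / lam) (at x)"
    and "D (momentum lam f) = (\<lambda>x. (D ^^ 2) f x + f x * D f x / lam)"
    and "continuous_on UNIV (momentum lam f)" "continuous_on UNIV (D (momentum lam f))"
    and "\<exists>B. \<forall>x. \<bar>momentum lam f x\<bar> \<le> B" "\<exists>B. \<forall>x. \<bar>D (momentum lam f) x\<bar> \<le> B"
proof -
  have d0: "(f has_real_derivative D f x) (at x)" for x using Cinf_derivative[OF f, of 0] by simp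
  have d1: "(D f has_real_derivative (D ^^ 2) f x) (at x)" for x
    using Cinf_derivative[OF f, of 1] by (simp add: numeral_2_eq_2)
  show 1: "(momentum lam f has_real_derivative (D ^^ 2) f x + f x * D f x / lam) (at x)" for x
    unfolding momentum_def[abs_def] by (intro DERIV_add d1 DERIV_half_square d0 lam)
  show 2: "D (momentum lam f) = (\<lambda>x. (D ^^ 2) f x + f x * D f x / lam)" by (rule D_eqI[OF 1])
  show "continuous_on UNIV (momentum lam f)" by (rule DERIV_continuous_on[OF 1])
  have c: "continuous_on UNIV f" "continuous_on UNIV (D f)" "continuous_on UNIV ((D ^^ 2) f)"
    using Cinf_continuous[OF f, of 0] Cinf_continuous[OF f, of 1] Cinf_continuous[OF f, of 2] by auto
  show "continuous_on UNIV (D (momentum lam f))"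
    unfolding 2 using lam by (intro continuous_intros c) auto
  obtain B0 where B0: "\<bar>f x\<bar> \<le> B0" for x using Cinf_bounded[OF f, of 0] by auto
  obtain B1 where B1: "\<bar>D f x\<bar> \<le> B1" for x using Cinf_bounded[OF f, of 1] by auto
  obtain B2 where B2: "\<bar>(D ^^ 2) f x\<bar> \<le> B2" for x using Cinf_bounded[OF f, of 2] by auto
  have "\<bar>momentum lam f x\<bar> \<le> B1 + B0\<^sup>2 / (2 * \<bar>lam\<bar>)" for x
  proof -
    have "(f x)\<^sup>2 \<le> B0\<^sup>2" using B0[of x] by (metis abs_ge_zero power2_abs power_mono)
    then have "\<bar>(f x)\<^sup>2 / (2 * lam)\<bar> \<le> B0\<^sup>2 / (2 * \<bar>lam\<bar>)" by (simp add: abs_mult divide_right_mono)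
    then show ?thesis using B1[of x] unfolding momentum_def by linarith
  qed
  then show "\<exists>B. \<forall>x. \<bar>momentum lam f x\<bar> \<le> B" by blast
  have "\<bar>D (momentum lam f) x\<bar> \<le> B2 + B0 * B1 / \<bar>lam\<bar>" for x
  proof -
    have "\<bar>f x * D f x\<bar> \<le> B0 * B1"
      unfolding abs_mult using B0[of x] B1[of x] by (intro mult_mono) auto
    then have "\<bar>f x * D f x / lam\<bar> \<le> B0 * B1 / \<bar>lam\<bar>" by (simp add: divide_right_mono abs_mult)
    then show ?thesis using B2[of x] unfolding 2 by linarith
  qed
  then show "\<exists>B. \<forall>x. \<bar>D (momentum lam f) x\<bar> \<le> B" by blast
qed

text \<open>No derivative of \<open>w = f - g\<close> may appear on the right. The momenta differ by
  \<open>w_x\<close> and a difference of squares, and \<open>Ginv w_x\<close> is controlled by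
  \<open>Ginv_D_bound\<close>. For the differentiated momenta, \<open>Ginv w_xx = w + Ginv w\<close>
  is again of the size of \<open>w\<close>.\<close>

lemma Ginv_momentum_diff:
  assumes f: "f \<in> Cinf" and g: "g \<in> Cinf" and lam: "lam \<noteq> 0"
    and B: "\<And>x. \<bar>f x - g x\<bar> \<le> B" and F: "\<And>x. \<bar>f x\<bar> \<le> F" "\<And>x. \<bar>g x\<bar> \<le> F'"
  shows "\<bar>Ginv (momentum lam f) x - Ginv (momentum lam g) x\<bar> \<le> (2 + (F + F') / (2 * \<bar>lam\<bar>)) * B"
    and "\<bar>Ginv (D (momentum lam f)) x - Ginv (D (momentum lam g)) x\<bar> \<le> (2 + (F + F') / \<bar>lam\<bar>) * B"
proof -
  note mf = momentum_props[OF f lam] and mg = momentum_props[OF g lam]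
  define w where "w = (\<lambda>x. f x - g x)"
  define w1 where "w1 = (\<lambda>x. D f x - D g x)"
  define w2 where "w2 = (\<lambda>x. (D ^^ 2) f x - (D ^^ 2) g x)"
  define q where "q = (\<lambda>x. (f x)\<^sup>2 / (2 * lam) - (g x)\<^sup>2 / (2 * lam))"
  define q1 where "q1 = (\<lambda>x. f x * D f x / lam - g x * D g x / lam)"
  have d0: "(h has_real_derivative D h x) (at x)" if "h \<in> Cinf" for h x using Cinf_derivative[OF that, of 0] by simp
  have d1: "(D h has_real_derivative (D ^^ 2) h x) (at x)" if "h \<in> Cinf" for h x
    using Cinf_derivative[OF that, of 1] by (simp add: numeral_2_eq_2)
  have c: "continuous_on UNIV h" "continuous_on UNIV (D h)" "continuous_on UNIV ((D ^^ 2) h)" if "h \<in> Cinf" for h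
    using Cinf_continuous[OF that, of 0] Cinf_continuous[OF that, of 1] Cinf_continuous[OF that, of 2] by auto
  have w: "(w has_real_derivative w1 x) (at x)" and w1: "(w1 has_real_derivative w2 x) (at x)" for x
    unfolding w_def w1_def w2_def by (intro DERIV_diff d0 d1 f g)+
  have q: "(q has_real_derivative q1 x) (at x)" for x
    unfolding q_def q1_def by (intro DERIV_diff DERIV_half_square d0 f g lam)
  have cw: "continuous_on UNIV w" "continuous_on UNIV w1" "continuous_on UNIV w2" "continuous_on UNIV q" "continuous_on UNIV q1"
    unfolding w_def w1_def w2_def q_def q1_def by (intro continuous_intros c[OF f] c[OF g]; simp add: lam)+
  have bd: "\<exists>B. \<forall>x. \<bar>(D ^^ k) f x - (D ^^ k) g x\<bar> \<le> B" for k
  proof -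
    obtain b b' where bb: "\<bar>(D ^^ k) f x\<bar> \<le> b" "\<bar>(D ^^ k) g x\<bar> \<le> b'" for x
      using Cinf_bounded[OF f, of k] Cinf_bounded[OF g, of k] by metis
    have "\<bar>(D ^^ k) f x - (D ^^ k) g x\<bar> \<le> b + b'" for x using bb(1)[of x] bb(2)[of x] by linarith
    then show ?thesis by blast
  qed
  obtain W1 where W1: "\<bar>w1 x\<bar> \<le> W1" for x using bd[of 1] by (auto simp: w1_def)
  obtain W2 where W2: "\<bar>w2 x\<bar> \<le> W2" for x using bd[of 2] by (auto simp: w2_def)
  have qb: "\<bar>q x\<bar> \<le> (F + F') / (2 * \<bar>lam\<bar>) * B" for x
  proof -
    have "\<bar>(f x)\<^sup>2 - (g x)\<^sup>2\<bar> = \<bar>f x + g x\<bar> * \<bar>f x - g x\<bar>" by (simp add: power2_eq_square algebra_simps flip: abs_mult)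
    also have "\<dots> \<le> (F + F') * B"
      using B[of x] F(1)[of x] F(2)[of x] by (intro mult_mono) linarith+
    finally show ?thesis by (simp add: q_def abs_mult divide_right_mono flip: diff_divide_distrib)
  qed
  obtain Q1 where Q1: "\<bar>q1 x\<bar> \<le> Q1" for x
  proof -
    obtain b b' where bb: "\<bar>D (momentum lam f) x\<bar> \<le> b" "\<bar>D (momentum lam g) x\<bar> \<le> b'" for x using mf(6) mg(6) by metis
    have eq: "q1 x = D (momentum lam f) x - D (momentum lam g) x - w2 x" for x
      unfolding mf(2) mg(2) by (simp add: q1_def w2_def)
    have "\<bar>q1 x\<bar> \<le> b + b' + W2" for x using bb(1)[of x] bb(2)[of x] W2[of x] unfolding eq by linarith
    then show ?thesis using that by blast
  qed
  obtain bf where bf: "\<bar>momentum lam f x\<bar> \<le> bf" for x using mf(5) by blast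
  obtain bg where bg: "\<bar>momentum lam g x\<bar> \<le> bg" for x using mg(5) by blast
  obtain df where df: "\<bar>D (momentum lam f) x\<bar> \<le> df" for x using mf(6) by blast
  obtain dg where dg: "\<bar>D (momentum lam g) x\<bar> \<le> dg" for x using mg(6) by blast
  have Bq: "\<bar>Ginv q x\<bar> \<le> (F + F') / (2 * \<bar>lam\<bar>) * B" by (rule Ginv_bound[OF cw(4) qb])
  have Bw1: "\<bar>Ginv w1 x\<bar> \<le> 2 * B" by (rule Ginv_D_bound[OF w cw(2) _ W1]) (use B in \<open>simp add: w_def\<close>)
  have Bq1: "\<bar>Ginv q1 x\<bar> \<le> 2 * ((F + F') / (2 * \<bar>lam\<bar>) * B)" by (rule Ginv_D_bound[OF q cw(5) qb Q1])
  have Bw: "\<bar>w x\<bar> \<le> B" for x using B by (simp add: w_def)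
  have "Ginv (momentum lam f) x - Ginv (momentum lam g) x = Ginv (\<lambda>y. momentum lam f y - momentum lam g y) x"
    by (rule Ginv_add(2)[OF mf(3) bf mg(3) bg, symmetric])
  also have "(\<lambda>y. momentum lam f y - momentum lam g y) = (\<lambda>y. w1 y + q y)"
    by (auto simp: momentum_def w1_def q_def)
  also have "Ginv \<dots> x = Ginv w1 x + Ginv q x" by (rule Ginv_add(1)[OF cw(2) W1 cw(4) qb])
  finally show "\<bar>Ginv (momentum lam f) x - Ginv (momentum lam g) x\<bar> \<le> (2 + (F + F') / (2 * \<bar>lam\<bar>)) * B"
    using Bq Bw1 unfolding distrib_right by linarith
  have ww: "Ginv (\<lambda>y. w2 y - w y) x = w x" by (rule Ginv_inverse[OF w w1 cw(3) Bw W1 W2])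
  have "Ginv w2 x = Ginv (\<lambda>y. w2 y - w y) x + Ginv w x"
    unfolding Ginv_add(2)[OF cw(3) W2 cw(1) Bw] by simp
  then have Bw2: "\<bar>Ginv w2 x\<bar> \<le> 2 * B" using ww Bw[of x] Ginv_bound[OF cw(1) Bw, of x] by linarith
  have "Ginv (D (momentum lam f)) x - Ginv (D (momentum lam g)) x = Ginv (\<lambda>y. D (momentum lam f) y - D (momentum lam g) y) x"
    by (rule Ginv_add(2)[OF mf(4) df mg(4) dg, symmetric])
  also have "(\<lambda>y. D (momentum lam f) y - D (momentum lam g) y) = (\<lambda>y. w2 y + q1 y)"
    unfolding mf(2) mg(2) by (auto simp: w2_def q1_def)
  also have "Ginv \<dots> x = Ginv w2 x + Ginv q1 x" by (rule Ginv_add(1)[OF cw(3) W2 cw(5) Q1])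
  finally have "\<bar>Ginv (D (momentum lam f)) x - Ginv (D (momentum lam g)) x\<bar> \<le> 2 * B + 2 * ((F + F') / (2 * \<bar>lam\<bar>) * B)"
    using Bq1 Bw2 by linarith
  also have "\<dots> = 2 * B + (2 * ((F + F') / (2 * \<bar>lam\<bar>))) * B" by (simp only: mult.assoc)
  also have "2 * ((F + F') / (2 * \<bar>lam\<bar>)) = (F + F') / \<bar>lam\<bar>" using lam by (simp add: frac_eq_eq algebra_simps)
  also have "2 * B + (F + F') / \<bar>lam\<bar> * B = (2 + (F + F') / \<bar>lam\<bar>) * B" by (simp only: distrib_right)
  finally show "\<bar>Ginv (D (momentum lam f)) x - Ginv (D (momentum lam g)) x\<bar> \<le> (2 + (F + F') / \<bar>lam\<bar>) * B" .
qed

text \<open>Gronwall's inequality in a weighted norm: the weight \<open>exp (2 * C * s)\<close>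
  grows so fast that integrating the bound on the derivative regains a factor 1/2. With
  \<open>K\<close> the weighted sup distance of two solutions this leads to
  \<open>K \<le> K / 2\<close>.\<close>

lemma exp_gronwall:
  fixes f f' :: "real \<Rightarrow> real"
  assumes t: "0 \<le> t" and C: "0 < C" and f0: "f 0 = 0" and cont: "continuous_on {0..t} f"
    and d: "\<And>s. 0 < s \<Longrightarrow> s < t \<Longrightarrow> (f has_real_derivative f' s) (at s)"
    and b: "\<And>s. 0 < s \<Longrightarrow> s < t \<Longrightarrow> \<bar>f' s\<bar> \<le> C * (K * exp (2 * C * s))" and K: "0 \<le> K"
  shows "\<bar>f t\<bar> \<le> K / 2 * exp (2 * C * t)"
proof -
  have main: "h t \<le> K / 2 * exp (2 * C * t)"
    if h0: "h 0 = 0" and hc: "continuous_on {0..t} h" and hd: "\<And>s. 0 < s \<Longrightarrow> s < t \<Longrightarrow> (h has_real_derivative h' s) (at s)"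
      and hb: "\<And>s. 0 < s \<Longrightarrow> s < t \<Longrightarrow> h' s \<le> C * (K * exp (2 * C * s))" for h h' :: "real \<Rightarrow> real"
  proof -
    have "h t - K / 2 * exp (2 * C * t) \<le> h 0 - K / 2 * exp (2 * C * 0)"
    proof (rule DERIV_nonpos_imp_decreasing_open[OF t])
      fix s assume s: "0 < s" "s < t"
      have "((\<lambda>s. h s - K / 2 * exp (2 * C * s)) has_real_derivative h' s - C * (K * exp (2 * C * s))) (at s)"
        by (auto intro!: derivative_eq_intros hd s simp: field_simps)
      then show "\<exists>y. ((\<lambda>s. h s - K / 2 * exp (2 * C * s)) has_real_derivative y) (at s) \<and> y \<le> 0"
        using hb[OF s] by (intro exI conjI) auto
    qed (intro continuous_intros hc)
    then show ?thesis using h0 K by simp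
  qed
  have "f t \<le> K / 2 * exp (2 * C * t)"
    by (rule main[where h'=f', OF f0 cont d]) (use b in \<open>auto simp: abs_le_iff\<close>)
  moreover have "- f t \<le> K / 2 * exp (2 * C * t)"
    by (rule main[where h="\<lambda>s. - f s" and h'="\<lambda>s. - f' s"])
       (use b f0 in \<open>auto simp: abs_le_iff intro!: continuous_intros cont DERIV_minus d\<close>)
  ultimately show ?thesis by linarith
qed

context lagrangian_flow
begin

lemma vl_derivative:
  assumes t: "t \<in> {0..T}"
  shows "((\<lambda>y. vl t (ipos t y)) has_real_derivative sol t y + st t (ipos t y)) (at y)"
  using ipos_chain[OF t vel_strain_deriv(1)[OF sl[OF t] e lam on_strip]]
  by (simp add: vl_def st_def sol_def gam_def)

lemma st_derivative:
  assumes t: "t \<in> {0..T}"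
  shows "((\<lambda>y. st t (ipos t y)) has_real_derivative vl t (ipos t y) + (sol t y)\<^sup>2 / (2 * lam)) (at y)"
proof -
  have "vel lam (J t) (G t) (of_real (ipos t y)) + (G t (of_real (ipos t y)))\<^sup>2 / of_real (2 * lam)
      = of_real (vl t (ipos t y) + (sol t y)\<^sup>2 / (2 * lam))"
    by (simp add: of_real_fields[OF t] sol_def)
  from ipos_chain[where y=y, OF t vel_strain_deriv(2)[OF sl[OF t] e lam on_strip], unfolded this]
  show ?thesis by (simp only: st_def Re_complex_of_real)
qed

lemma sol_bound: "t \<in> {0..T} \<Longrightarrow> \<bar>sol t y\<bar> \<le> e"
  unfolding sol_def by (rule bounds(4))

text \<open>The velocity \<open>u\<close> and its derivative, transported to Eulerian variables, are
  bounded and satisfy \<open>u'' - u = m\<close> and \<open>u''' - u' = m_x\<close>, so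
  \<open>Ginv_inverse\<close> identifies them.\<close>

lemma Ginv_momentum_sol:
  assumes t: "t \<in> {0..T}"
  shows "Ginv (momentum lam (sol t)) x = vl t (ipos t x)"
    and "Ginv (D (momentum lam (sol t))) x = sol t x + st t (ipos t x)"
proof -
  note C = sol_Cinf[OF t]
  define u where "u = (\<lambda>y. vl t (ipos t y))"
  define u1 where "u1 = (\<lambda>y. sol t y + st t (ipos t y))"
  define u2 where "u2 = (\<lambda>y. D (sol t) y + (u y + (sol t y)\<^sup>2 / (2 * lam)))"
  define u3 where "u3 = (\<lambda>y. (D ^^ 2) (sol t) y + (u1 y + sol t y * D (sol t) y / lam))"
  have d0: "(sol t has_real_derivative D (sol t) y) (at y)" for y using Cinf_derivative[OF C, of 0] by simp
  have d1: "(D (sol t) has_real_derivative (D ^^ 2) (sol t) y) (at y)" for y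
    using Cinf_derivative[OF C, of 1] by (simp add: numeral_2_eq_2)
  have u: "(u has_real_derivative u1 y) (at y)" for y unfolding u_def u1_def by (rule vl_derivative[OF t])
  have u1: "(u1 has_real_derivative u2 y) (at y)" for y
    unfolding u1_def u2_def u_def by (intro DERIV_add d0 st_derivative[OF t])
  have u2: "(u2 has_real_derivative u3 y) (at y)" for y
    unfolding u2_def u3_def by (intro DERIV_add d1 u DERIV_half_square d0 lam)
  have bu: "\<bar>u y\<bar> \<le> c0" for y unfolding u_def by (rule bounds(5)[OF t])
  have bu1: "\<bar>u1 y\<bar> \<le> e + c0" for y
    using sol_bound[OF t, of y] bounds(6)[OF t, of "ipos t y"] unfolding u1_def by linarith
  have m: "(\<lambda>y. u2 y - u y) = momentum lam (sol t)" by (auto simp: u2_def momentum_def)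
  obtain b where b: "\<bar>momentum lam (sol t) y\<bar> \<le> b" for y using momentum_props(5)[OF C lam] by blast
  have bu2: "\<bar>u2 y\<bar> \<le> b + c0" for y
    using b[of y] bu[of y] unfolding m[symmetric] by linarith
  have Dm: "(\<lambda>y. u3 y - u1 y) = D (momentum lam (sol t))"
    unfolding momentum_props(2)[OF C lam] by (auto simp: u3_def)
  obtain b' where b': "\<bar>D (momentum lam (sol t)) y\<bar> \<le> b'" for y using momentum_props(6)[OF C lam] by blast
  have bu3: "\<bar>u3 y\<bar> \<le> b' + (e + c0)" for y
    using b'[of y] bu1[of y] unfolding Dm[symmetric] by linarith
  have cu2: "continuous_on UNIV u2" using u2 DERIV_continuous_on by blast
  have cu3: "continuous_on UNIV u3"
  proof -
    have "continuous_on UNIV (\<lambda>y. D (momentum lam (sol t)) y + u1 y)"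
      by (intro continuous_intros momentum_props(4)[OF C lam]) (use u1 DERIV_continuous_on in blast)
    then show ?thesis unfolding Dm[symmetric] by simp
  qed
  show "Ginv (momentum lam (sol t)) x = vl t (ipos t x)"
    using Ginv_inverse[OF u u1 cu2 bu bu1 bu2, of x] unfolding m by (simp add: u_def)
  show "Ginv (D (momentum lam (sol t))) x = sol t x + st t (ipos t x)"
    using Ginv_inverse[OF u1 u2 cu3 bu1 bu2 bu3, of x] unfolding Dm by (simp add: u1_def)
qed

lemma along_flow:
  assumes \<eta>: "continuous_into_Cinf T \<eta>" and t: "t \<in> {0..T}"
  shows "((\<lambda>s. \<eta> s (pos s x) - \<eta> s (pos t x)) has_real_derivative D (\<eta> t) (pos t x) * vl t x) (at t within {0..T})"
proof (rule moving_point_derivative[OF _ _ pos_time[OF t] t])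
  show "(\<eta> s has_real_derivative D (\<eta> s) y) (at y)" if "s \<in> {0..T}" for s y
    using Cinf_derivative[OF continuous_into_CinfD(1)[OF \<eta> that], of 0] by simp
  show "continuous_on ({0..T} \<times> UNIV) (\<lambda>(s, y). D (\<eta> s) y)"
    using continuous_into_Cinf_joint[OF \<eta>, of 1] by simp
qed

lemma sol_time:
  assumes t: "t \<in> {0..T}"
  shows "((\<lambda>s. sol s y) has_real_derivative
     (- (sol t y)\<^sup>2 / 2 + lam * vl t (ipos t y) - sol t y * st t (ipos t y)) - D (sol t) y * vl t (ipos t y)) (at t within {0..T})"
proof -
  define x where "x = ipos t y"
  have y: "pos t x = y" using t by (simp add: x_def)
  \<comment> \<open>Along the particle \<open>sol s (pos s x)\<close> equals \<open>gam s x\<close>,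
    so this function is \<open>sol s y\<close> at the fixed point \<open>y = pos t x\<close>.
    Differentiability of \<open>sol\<close> in time is thereby deduced from that of
    \<open>gam\<close>.\<close>
  have "((\<lambda>s. gam s x - (sol s (pos s x) - sol s (pos t x))) has_real_derivative
     (- (gam t x)\<^sup>2 / 2 + lam * vl t x - gam t x * st t x) - D (sol t) (pos t x) * vl t x) (at t within {0..T})"
    by (rule DERIV_diff[OF gam_time[OF t] along_flow[OF sol_continuous t]])
  moreover have "sol s y = gam s x - (sol s (pos s x) - sol s (pos t x))" if "s \<in> {0..T}" for s
    using that by (simp add: sol_def y)
  ultimately have "((\<lambda>s. sol s y) has_real_derivative
     (- (gam t x)\<^sup>2 / 2 + lam * vl t x - gam t x * st t x) - D (sol t) (pos t x) * vl t x) (at t within {0..T})"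
    unfolding has_field_derivative_def by (rule_tac has_derivative_transform[OF t])
  moreover have "sol t y = gam t x" by (simp add: sol_def x_def)
  ultimately show ?thesis by (simp only: y x_def[symmetric])
qed

lemma sol_solution: "is_solution lam (sol 0) T sol"
  unfolding is_solution_def
proof (intro conjI ballI allI sol_continuous)
  fix t x assume "t \<in> {0<..T}"
  then have t: "t \<in> {0..T}" by simp
  show "\<exists>gt. ((\<lambda>s. sol s x) has_real_derivative gt) (at t within {0..T}) \<and>
      gt + Ginv (momentum lam (sol t)) x * D (sol t) x =
      (sol t x)\<^sup>2 / 2 + lam * Ginv (momentum lam (sol t)) x - sol t x * Ginv (D (momentum lam (sol t))) x"
    unfolding Ginv_momentum_sol[OF t]
    by (rule exI, rule conjI, rule sol_time[OF t]) (simp add: algebra_simps power2_eq_square)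
qed simp

text \<open>The competitor is followed along the flow of \<open>sol\<close>, not along its own. Its
  transport terms then combine to \<open>D (\<eta> \<tau>)\<close> times the difference of the
  velocities, so the derivative falls on \<open>\<eta>\<close>, where it is bounded, and not on the
  difference of the solutions.\<close>

lemma uniqueness_step:
  assumes sol\<eta>: "is_solution lam (sol 0) T \<eta>"
    and H: "\<And>t y. t \<in> {0..T} \<Longrightarrow> \<bar>\<eta> t y\<bar> \<le> H" "\<And>t y. t \<in> {0..T} \<Longrightarrow> \<bar>D (\<eta> t) y\<bar> \<le> H"
    and \<tau>: "\<tau> \<in> {0<..T}" and B: "\<And>y. \<bar>\<eta> \<tau> y - sol \<tau> y\<bar> \<le> B"
  shows "\<exists>d. ((\<lambda>s. \<eta> s (pos s x) - gam s x) has_real_derivative d) (at \<tau> within {0..T}) \<and>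
     \<bar>d\<bar> \<le> ((H + \<bar>lam\<bar>) * (2 + (H + e) / (2 * \<bar>lam\<bar>)) + (H + e) / 2 + H * (2 + (H + e) / \<bar>lam\<bar>) + (e + c0)) * B"
proof -
  define y where "y = pos \<tau> x"
  have \<tau>': "\<tau> \<in> {0..T}" using \<tau> by simp
  have \<eta>: "continuous_into_Cinf T \<eta>" using sol\<eta> by (simp add: is_solution_def)
  obtain gt where gt: "((\<lambda>s. \<eta> s y) has_real_derivative gt) (at \<tau> within {0..T})"
    "gt + Ginv (momentum lam (\<eta> \<tau>)) y * D (\<eta> \<tau>) y =
      (\<eta> \<tau> y)\<^sup>2 / 2 + lam * Ginv (momentum lam (\<eta> \<tau>)) y - \<eta> \<tau> y * Ginv (D (momentum lam (\<eta> \<tau>))) y"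
    using sol\<eta> \<tau> unfolding is_solution_def by blast
  define a where "a = \<eta> \<tau> y"
  define b where "b = gam \<tau> x"
  define p where "p = D (\<eta> \<tau>) y"
  define v where "v = vl \<tau> x"
  define v1 where "v1 = gam \<tau> x + st \<tau> x"
  define V where "V = Ginv (momentum lam (\<eta> \<tau>)) y"
  define V1 where "V1 = Ginv (D (momentum lam (\<eta> \<tau>))) y"
  have iy: "ipos \<tau> y = x" and sy: "sol \<tau> y = b" using \<tau>' by (auto simp: y_def b_def sol_def)
  define c1 where "c1 = 2 + (H + e) / (2 * \<bar>lam\<bar>)"
  define c2 where "c2 = 2 + (H + e) / \<bar>lam\<bar>"
  have HB: "0 \<le> H" "0 \<le> B" using H(1)[OF \<tau>', of 0] B[of 0] by linarith+
  have d1: "\<bar>V - v\<bar> \<le> c1 * B" and d2: "\<bar>V1 - v1\<bar> \<le> c2 * B"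
    using Ginv_momentum_diff[OF continuous_into_CinfD(1)[OF \<eta> \<tau>'] sol_Cinf[OF \<tau>'] lam B H(1)[OF \<tau>'] sol_bound[OF \<tau>'], of y]
    unfolding Ginv_momentum_sol[OF \<tau>'] iy sy by (auto simp: V_def V1_def v_def v1_def c1_def c2_def b_def)
  have ab: "\<bar>a - b\<bar> \<le> B" using B[of y] by (simp add: a_def sy)
  have bb: "\<bar>a\<bar> \<le> H" "\<bar>p\<bar> \<le> H" "\<bar>b\<bar> \<le> e" "\<bar>v1\<bar> \<le> e + c0"
    using H[OF \<tau>'] bounds(4,6)[OF \<tau>', of x] by (auto simp: a_def p_def b_def v1_def)
  let ?d = "p * v + gt - (- b\<^sup>2 / 2 + lam * v - b * st \<tau> x)"
  have "((\<lambda>s. (\<eta> s (pos s x) - \<eta> s (pos \<tau> x)) + \<eta> s y - gam s x) has_real_derivative ?d) (at \<tau> within {0..T})"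
    unfolding p_def v_def b_def y_def
    by (intro DERIV_diff DERIV_add gam_time[OF \<tau>'] along_flow[OF \<eta> \<tau>'] gt(1)[unfolded y_def])
  then have der: "((\<lambda>s. \<eta> s (pos s x) - gam s x) has_real_derivative ?d) (at \<tau> within {0..T})"
    by (simp add: y_def)
  have gt': "gt = a\<^sup>2 / 2 + lam * V - a * V1 - V * p" using gt(2) by (simp add: a_def V_def V1_def p_def)
  \<comment> \<open>Every summand contains one of the differences \<open>V - v\<close>,
    \<open>a - b\<close> and \<open>V1 - v1\<close>, each of which is controlled by
    \<open>B\<close>.\<close>
  have "?d = (lam - p) * (V - v) + (a - b) * ((a + b) / 2) + (- a) * (V1 - v1) + (- (a - b)) * v1"
    unfolding gt' v1_def b_def by (simp add: power2_eq_square field_simps)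
  also have "\<bar>\<dots>\<bar> \<le> (H + \<bar>lam\<bar>) * (c1 * B) + B * ((H + e) / 2) + H * (c2 * B) + B * (e + c0)"
  proof (intro order_trans[OF abs_triangle_ineq] add_mono)
    show "\<bar>(lam - p) * (V - v)\<bar> \<le> (H + \<bar>lam\<bar>) * (c1 * B)"
      unfolding abs_mult using bb d1 HB by (intro mult_mono) auto
    show "\<bar>(a - b) * ((a + b) / 2)\<bar> \<le> B * ((H + e) / 2)"
      unfolding abs_mult using bb ab HB by (intro mult_mono) auto
    show "\<bar>- a * (V1 - v1)\<bar> \<le> H * (c2 * B)"
      unfolding abs_mult using bb d2 HB by (intro mult_mono) auto
    show "\<bar>- (a - b) * v1\<bar> \<le> B * (e + c0)"
      unfolding abs_mult using bb ab HB by (intro mult_mono) auto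
  qed
  finally have "\<bar>?d\<bar> \<le> ((H + \<bar>lam\<bar>) * c1 + (H + e) / 2 + H * c2 + (e + c0)) * B"
    by (simp add: algebra_simps)
  with der show ?thesis unfolding c1_def c2_def by blast
qed

lemma uniqueness:
  assumes sol\<eta>: "is_solution lam (sol 0) T \<eta>" and t: "t \<in> {0..T}"
  shows "\<eta> t = sol t"
proof -
  have \<eta>: "continuous_into_Cinf T \<eta>" using sol\<eta> by (simp add: is_solution_def)
  obtain H0 where H0: "\<forall>t\<in>{0..T}. \<forall>y. \<bar>(D ^^ 0) (\<eta> t) y\<bar> \<le> H0" using continuous_into_Cinf_bound[OF \<eta>, of 0] by (rule exE)
  obtain H1 where H1: "\<forall>t\<in>{0..T}. \<forall>y. \<bar>(D ^^ 1) (\<eta> t) y\<bar> \<le> H1" using continuous_into_Cinf_bound[OF \<eta>, of 1] by (rule exE)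
  define H where "H = max H0 H1"
  have H: "\<bar>\<eta> t y\<bar> \<le> H" "\<bar>D (\<eta> t) y\<bar> \<le> H" if "t \<in> {0..T}" for t y
    using bspec[OF H0 that] bspec[OF H1 that] by (auto simp: H_def intro: max.coboundedI1 max.coboundedI2)
  have Hpos: "0 \<le> H" using H(1)[OF t, of 0] by linarith
  define C where "C = ((H + \<bar>lam\<bar>) * (2 + (H + e) / (2 * \<bar>lam\<bar>)) + (H + e) / 2 + H * (2 + (H + e) / \<bar>lam\<bar>) + (e + c0)) + 1"
  have C: "C > 0"
  proof -
    have "0 \<le> (H + \<bar>lam\<bar>) * (2 + (H + e) / (2 * \<bar>lam\<bar>))" "0 \<le> H * (2 + (H + e) / \<bar>lam\<bar>)"
      by (intro mult_nonneg_nonneg add_nonneg_nonneg divide_nonneg_nonneg Hpos e0; simp)+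
    then show ?thesis using Hpos e0 c0_nonneg unfolding C_def by (intro add_nonneg_pos add_nonneg_nonneg) simp_all
  qed
  \<comment> \<open>The differences weighted by \<open>exp (- 2 * C * t)\<close>. Their supremum
    \<open>K\<close> is finite because both solutions are bounded, and halving it by the Gronwall
    estimate forces it to vanish.\<close>
  define X where "X = (\<lambda>(t, y). exp (- 2 * C * t) * \<bar>\<eta> t y - sol t y\<bar>) ` ({0..T} \<times> UNIV)"
  define K where "K = Sup X"
  have Xb: "v \<le> H + e" if v: "v \<in> X" for v
  proof -
    obtain s y where sy: "s \<in> {0..T}" "v = exp (- 2 * C * s) * \<bar>\<eta> s y - sol s y\<bar>" using v by (auto simp: X_def)
    have "exp (- 2 * C * s) \<le> 1" using C sy by simp
    moreover have "\<bar>\<eta> s y - sol s y\<bar> \<le> H + e" using H(1)[OF sy(1), of y] sol_bound[OF sy(1), of y] by linarith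
    ultimately have "v \<le> 1 * (H + e)" unfolding sy(2) by (intro mult_mono) auto
    then show ?thesis by simp
  qed
  have XK: "v \<le> K" if "v \<in> X" for v
    unfolding K_def using Xb by (intro cSup_upper that bdd_aboveI[of _ "H + e"]) auto
  have X1: "exp (- 2 * C * s) * \<bar>\<eta> s y - sol s y\<bar> \<in> X" if "s \<in> {0..T}" for s y
    using that by (auto simp: X_def)
  have wK: "\<bar>\<eta> s y - sol s y\<bar> \<le> K * exp (2 * C * s)" if "s \<in> {0..T}" for s y
    using XK[OF X1[OF that, of y]] by (simp add: exp_minus field_simps)
  have K0: "0 \<le> K" using XK[OF X1[OF t, of 0]] by (meson abs_ge_zero exp_ge_zero mult_nonneg_nonneg order_trans)
  have half: "\<bar>\<eta> s y - sol s y\<bar> \<le> K / 2 * exp (2 * C * s)" if s: "s \<in> {0..T}" for s y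
  proof -
    define x where "x = ipos s y"
    let ?f = "\<lambda>\<tau>. \<eta> \<tau> (pos \<tau> x) - gam \<tau> x"
    have "\<exists>d. (?f has_real_derivative d) (at \<tau> within {0..T}) \<and> \<bar>d\<bar> \<le> C * (K * exp (2 * C * \<tau>))" if \<tau>: "\<tau> \<in> {0<..T}" for \<tau>
    proof -
      have "\<tau> \<in> {0..T}" using \<tau> by simp
      from uniqueness_step[OF sol\<eta> H \<tau> wK[OF this], of x]
      obtain d where d: "(?f has_real_derivative d) (at \<tau> within {0..T})" "\<bar>d\<bar> \<le> (C - 1) * (K * exp (2 * C * \<tau>))"
        unfolding C_def by auto
      have "(C - 1) * (K * exp (2 * C * \<tau>)) \<le> C * (K * exp (2 * C * \<tau>))" using K0 by (intro mult_right_mono) auto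
      with d show ?thesis by fastforce
    qed
    then have "\<forall>\<tau>\<in>{0<..T}. \<exists>d. (?f has_real_derivative d) (at \<tau> within {0..T}) \<and> \<bar>d\<bar> \<le> C * (K * exp (2 * C * \<tau>))" by blast
    from bchoice[OF this] obtain d where d: "\<And>\<tau>. \<tau> \<in> {0<..T} \<Longrightarrow> (?f has_real_derivative d \<tau>) (at \<tau> within {0..T})"
      "\<And>\<tau>. \<tau> \<in> {0<..T} \<Longrightarrow> \<bar>d \<tau>\<bar> \<le> C * (K * exp (2 * C * \<tau>))" by blast
    have "\<bar>?f s\<bar> \<le> K / 2 * exp (2 * C * s)"
    proof (rule exp_gronwall[OF _ C _ _ _ _ K0, where f'=d])
      have "\<eta> 0 x = sol 0 x" using sol\<eta> unfolding is_solution_def by blast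
      moreover have "ipos 0 x = x" using ipos_pos[of 0 x] T by (simp add: init)
      ultimately show "?f 0 = 0" by (simp add: init(3) sol_def)
      have "continuous_on {0..T} (\<lambda>\<tau>. \<eta> \<tau> (pos \<tau> x))"
      proof -
        have "continuous_on {0..T} (\<lambda>\<tau>. (\<tau>, pos \<tau> x))"
          by (intro continuous_intros DERIV_continuous_on[OF pos_time])
        from continuous_on_compose2[OF continuous_into_Cinf_joint[OF \<eta>, of 0] this]
        show ?thesis by (auto simp: image_subset_iff)
      qed
      moreover have "continuous_on {0..T} (\<lambda>\<tau>. gam \<tau> x)" by (rule DERIV_continuous_on[OF gam_time])
      ultimately have "continuous_on {0..T} ?f" by (intro continuous_intros)
      then show "continuous_on {0..s} ?f" by (rule continuous_on_subset) (use s in auto)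
      show "(?f has_real_derivative d \<tau>) (at \<tau>)" if "0 < \<tau>" "\<tau> < s" for \<tau>
      proof -
        have "at \<tau> within {0..T} = at \<tau>" using that s by (intro at_within_Icc_at) auto
        then show ?thesis using d(1)[of \<tau>] that s by auto
      qed
      show "\<bar>d \<tau>\<bar> \<le> C * (K * exp (2 * C * \<tau>))" if "0 < \<tau>" "\<tau> < s" for \<tau> using d(2)[of \<tau>] that s by auto
    qed (use s in auto)
    then show ?thesis using s by (simp add: x_def sol_def)
  qed
  have "K \<le> K / 2"
    unfolding K_def
  proof (rule cSup_least)
    show "X \<noteq> {}" using X1[OF t] by blast
    fix v assume "v \<in> X"
    then obtain s y where sy: "s \<in> {0..T}" "v = exp (- 2 * C * s) * \<bar>\<eta> s y - sol s y\<bar>" by (auto simp: X_def)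
    show "v \<le> Sup X / 2"
      using half[OF sy(1), of y] unfolding sy(2) K_def by (simp add: exp_minus field_simps)
  qed
  then have "K = 0" using K0 by simp
  then have "\<eta> t y = sol t y" for y using wK[OF t, of y] by simp
  then show ?thesis by blast
qed

end

section \<open>Integrals over the line and the half line\<close>

lemma integrable_inverse_square: "integrable lborel (\<lambda>x::real. 1 / (1 + x\<^sup>2))"
  using integrable_inverse_1_plus_square
  by (simp add: set_integrable_def einterval_def inverse_eq_divide)

lemma integrable_decay:
  fixes f :: "real \<Rightarrow> 'a::{banach, second_countable_topology}"
  assumes "f \<in> borel_measurable borel" "\<And>x. norm (f x) \<le> C / (1 + x\<^sup>2)"
  shows "integrable lborel f"
proof (rule Bochner_Integration.integrable_bound[OF integrable_mult_right[OF integrable_inverse_square, of C]])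
  show "AE x in lborel. norm (f x) \<le> norm (C * (1 / (1 + x\<^sup>2)))"
  proof (intro AE_I2)
    show "norm (f x) \<le> norm (C * (1 / (1 + x\<^sup>2)))" for x
      using order_trans[OF assms(2)[of x] abs_ge_self] by simp
  qed
qed (use assms in simp)

lemma integral_FTC_line:
  fixes F f :: "real \<Rightarrow> real"
  assumes F: "\<And>x. (F has_real_derivative f x) (at x)" and c: "continuous_on UNIV f" and i: "integrable lborel f"
    and A: "(\<lambda>n::nat. F (real n)) \<longlonglongrightarrow> A" and B: "(\<lambda>n::nat. F (- real n)) \<longlonglongrightarrow> B"
  shows "(LINT x|lborel. f x) = A - B"
proof -
  have "(\<lambda>n::nat. LINT x|lborel. f x * indicator {- real n..real n} x) \<longlonglongrightarrow> (LINT x|lborel. f x)"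
  proof (rule integral_dominated_convergence[where w="\<lambda>x. \<bar>f x\<bar>"])
    show "AE x in lborel. (\<lambda>n::nat. f x * indicator {- real n..real n} x) \<longlonglongrightarrow> f x"
    proof (intro AE_I2 tendsto_eventually)
      fix x :: real
      show "\<forall>\<^sub>F n::nat in sequentially. f x * indicator {- real n..real n} x = f x"
        by (rule eventually_mono[OF eventually_ge_at_top[of "nat \<lceil>\<bar>x\<bar>\<rceil>"]])
           (auto simp: indicator_def nat_le_iff ceiling_le_iff)
    qed
  qed (use i in \<open>auto simp: indicator_def\<close>)
  moreover have "(LINT x|lborel. f x * indicator {- real n..real n} x) = F (real n) - F (- real n)" for n :: nat
    by (rule integral_FTC_Icc_real) (use F c in \<open>auto simp: continuous_on_eq_continuous_at\<close>)
  ultimately have "(\<lambda>n::nat. F (real n) - F (- real n)) \<longlonglongrightarrow> (LINT x|lborel. f x)" by simp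
  with tendsto_diff[OF A B] show ?thesis using LIMSEQ_unique by blast
qed

lemma integral_FTC_halfline:
  fixes F f :: "real \<Rightarrow> real"
  assumes F: "\<And>x. (F has_real_derivative f x) (at x)" and c: "continuous_on UNIV f" and i: "integrable lborel f"
    and A: "(\<lambda>n::nat. F (a + real n)) \<longlonglongrightarrow> A"
  shows "(LINT x|lborel. f x * indicator {a..} x) = A - F a"
proof -
  have "(\<lambda>n::nat. LINT x|lborel. f x * indicator {a..a + real n} x) \<longlonglongrightarrow> (LINT x|lborel. f x * indicator {a..} x)"
  proof (rule integral_dominated_convergence[where w="\<lambda>x. \<bar>f x\<bar>"])
    show "AE x in lborel. (\<lambda>n::nat. f x * indicator {a..a + real n} x) \<longlonglongrightarrow> f x * indicator {a..} x"
    proof (intro AE_I2 tendsto_eventually)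
      fix x :: real
      show "\<forall>\<^sub>F n::nat in sequentially. f x * indicator {a..a + real n} x = f x * indicator {a..} x"
        by (rule eventually_mono[OF eventually_ge_at_top[of "nat \<lceil>x - a\<rceil>"]])
           (auto simp: indicator_def nat_le_iff ceiling_le_iff)
    qed
  qed (use i in \<open>auto simp: indicator_def\<close>)
  moreover have "(LINT x|lborel. f x * indicator {a..a + real n} x) = F (a + real n) - F a" for n :: nat
    by (rule integral_FTC_Icc_real) (use F c in \<open>auto simp: continuous_on_eq_continuous_at\<close>)
  ultimately have "(\<lambda>n::nat. F (a + real n) - F a) \<longlonglongrightarrow> (LINT x|lborel. f x * indicator {a..} x)" by simp
  with tendsto_diff[OF A tendsto_const[of "F a"]] show ?thesis using LIMSEQ_unique by blast
qed

section \<open>Gaussian test functions\<close>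

text \<open>The polynomial factor makes the family closed under \<open>D\<close>, so that smoothness
  and all Schwartz bounds of a normal density reduce to bounds on polynomials times a
  Gaussian.\<close>

definition poly_gauss :: "real poly \<Rightarrow> real \<Rightarrow> real \<Rightarrow> real \<Rightarrow> complex" where
  "poly_gauss p m s x = of_real (poly p (x - m) * exp (- (x - m)\<^sup>2 / (2 * s\<^sup>2)))"

lemma poly_gauss_derivative:
  assumes "s > 0"
  shows "(poly_gauss p m s has_vector_derivative poly_gauss (pderiv p - smult (1 / s\<^sup>2) (pCons 0 p)) m s x) (at x)"
proof -
  have "((\<lambda>x. poly p (x - m) * exp (- (x - m)\<^sup>2 / (2 * s\<^sup>2))) has_real_derivative
     poly (pderiv p - smult (1 / s\<^sup>2) (pCons 0 p)) (x - m) * exp (- (x - m)\<^sup>2 / (2 * s\<^sup>2))) (at x)"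
  proof -
    have 1: "((\<lambda>x. poly p (x - m)) has_real_derivative poly (pderiv p) (x - m) * 1) (at x)"
      by (rule DERIV_chain2[OF poly_DERIV]) (auto intro!: derivative_eq_intros)
    have 2: "((\<lambda>x. exp (- (x - m)\<^sup>2 / (2 * s\<^sup>2))) has_real_derivative
        exp (- (x - m)\<^sup>2 / (2 * s\<^sup>2)) * (- (x - m) / s\<^sup>2)) (at x)"
      using assms by (auto intro!: derivative_eq_intros simp: field_simps power2_eq_square)
    show ?thesis
      by (rule DERIV_cong[OF DERIV_mult[OF 1 2]])
         (simp add: diff_divide_distrib add_divide_distrib algebra_simps)
  qed
  from bounded_linear.has_vector_derivative[OF bounded_linear_of_real[where 'a=complex] this[unfolded has_real_derivative_iff_has_vector_derivative]]
  show ?thesis unfolding poly_gauss_def[abs_def] .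
qed

lemma D_poly_gauss: "s > 0 \<Longrightarrow> D (poly_gauss p m s) = poly_gauss (pderiv p - smult (1 / s\<^sup>2) (pCons 0 p)) m s"
  unfolding D_def[abs_def] using vector_derivative_at[OF poly_gauss_derivative] by blast

lemma Dk_poly_gauss: "s > 0 \<Longrightarrow> \<exists>q. (D ^^ k) (poly_gauss p m s) = poly_gauss q m s"
proof (induction k)
  case (Suc k)
  then show ?case using D_poly_gauss by fastforce
qed auto

text \<open>With \<open>y = t\<^sup>2 / (2 * s\<^sup>2)\<close> the inequality
  \<open>(y / n) ^ n \<le> exp y\<close> shows that the Gaussian absorbs
  \<open>(t\<^sup>2) ^ n\<close>, and
  \<open>\<bar>t\<bar> ^ n \<le> 1 + (t\<^sup>2) ^ n\<close>.\<close>

lemma power_gauss_bounded: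
  assumes s: "s > 0"
  shows "\<bar>t\<bar> ^ n * exp (- t\<^sup>2 / (2 * s\<^sup>2)) \<le> 1 + (2 * s\<^sup>2 * real n) ^ n"
proof (cases "n = 0")
  case False
  define y where "y = t\<^sup>2 / (2 * s\<^sup>2)"
  have y0: "y \<ge> 0" by (simp add: y_def)
  have sq: "t\<^sup>2 = 2 * s\<^sup>2 * y" using s by (simp add: y_def)
  have a: "\<bar>t\<bar> ^ n \<le> 1 + (t\<^sup>2) ^ n"
  proof (cases "\<bar>t\<bar> \<le> 1")
    case True
    then have "\<bar>t\<bar> ^ n \<le> 1" by (simp add: power_le_one)
    then show ?thesis by (simp add: add_increasing2)
  next
    case False
    then have "\<bar>t\<bar> \<le> t\<^sup>2" using self_le_power[of "\<bar>t\<bar>" 2] by simp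
    then have "\<bar>t\<bar> ^ n \<le> (t\<^sup>2) ^ n" by (intro power_mono) auto
    then show ?thesis by linarith
  qed
  have "(y / n) ^ n \<le> exp (y / n) ^ n"
  proof (rule power_mono)
    show "y / n \<le> exp (y / n)" using exp_ge_add_one_self[of "y / n"] by linarith
  qed (use y0 in simp)
  also have "\<dots> = exp y" using False by (simp flip: exp_of_nat_mult)
  finally have "(y / n) ^ n \<le> exp y" .
  moreover have "(t\<^sup>2) ^ n = (2 * s\<^sup>2 * n) ^ n * (y / n) ^ n"
  proof -
    have "(2 * s\<^sup>2 * n) * (y / n) = t\<^sup>2" using False sq by simp
    then show ?thesis by (metis power_mult_distrib)
  qed
  ultimately have b: "(t\<^sup>2) ^ n \<le> (2 * s\<^sup>2 * n) ^ n * exp y"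
    by (simp add: mult_left_mono)
  have "\<bar>t\<bar> ^ n * exp (- y) \<le> (1 + (2 * s\<^sup>2 * n) ^ n * exp y) * exp (- y)"
    using a b by (intro mult_right_mono) auto
  also have "\<dots> = exp (- y) + (2 * s\<^sup>2 * n) ^ n" by (simp add: distrib_right mult.assoc flip: exp_add)
  also have "\<dots> \<le> 1 + (2 * s\<^sup>2 * n) ^ n" using y0 by simp
  finally show ?thesis by (simp add: y_def)
next
  case True
  have "exp (- t\<^sup>2 / (2 * s\<^sup>2)) \<le> 1" by simp
  then have "exp (- t\<^sup>2 / (2 * s\<^sup>2)) \<le> 2" by linarith
  then show ?thesis using True by simp
qed

lemma poly_gauss_moment_bounded:
  fixes s :: real
  assumes s: "s > 0"
  shows "\<exists>C. \<forall>t. \<bar>t\<bar> ^ n * \<bar>poly p t\<bar> * exp (- t\<^sup>2 / (2 * s\<^sup>2)) \<le> C"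
proof (induction p arbitrary: n)
  case (pCons a p)
  obtain C where C: "\<And>t. \<bar>t\<bar> ^ Suc n * \<bar>poly p t\<bar> * exp (- t\<^sup>2 / (2 * s\<^sup>2)) \<le> C" using pCons(2)[of "Suc n"] by blast
  have "\<bar>t\<bar> ^ n * \<bar>poly (pCons a p) t\<bar> * exp (- t\<^sup>2 / (2 * s\<^sup>2)) \<le> \<bar>a\<bar> * (1 + (2 * s\<^sup>2 * real n) ^ n) + C" for t
  proof -
    let ?E = "exp (- t\<^sup>2 / (2 * s\<^sup>2))"
    have "\<bar>t\<bar> ^ n * \<bar>poly (pCons a p) t\<bar> * ?E \<le> \<bar>t\<bar> ^ n * (\<bar>a\<bar> + \<bar>t\<bar> * \<bar>poly p t\<bar>) * ?E"
      using abs_triangle_ineq[of a "t * poly p t"] by (intro mult_right_mono mult_left_mono) (auto simp: abs_mult)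
    also have "\<dots> = \<bar>a\<bar> * (\<bar>t\<bar> ^ n * ?E) + \<bar>t\<bar> ^ Suc n * \<bar>poly p t\<bar> * ?E" by (simp add: algebra_simps)
    also have "\<dots> \<le> \<bar>a\<bar> * (1 + (2 * s\<^sup>2 * real n) ^ n) + C"
      by (intro add_mono mult_left_mono power_gauss_bounded s C) auto
    finally show ?thesis .
  qed
  then show ?case by blast
qed auto

lemma poly_gauss_schwartz:
  assumes s: "s > 0"
  shows "poly_gauss p m s \<in> schwartz"
  unfolding schwartz_def
proof (intro CollectI conjI allI)
  show "smooth (poly_gauss p m s)"
    unfolding smooth_def
  proof (intro allI)
    fix k x
    obtain q where "(D ^^ k) (poly_gauss p m s) = poly_gauss q m s" using Dk_poly_gauss[OF s] by blast
    then show "(D ^^ k) (poly_gauss p m s) differentiable (at x)"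
      using poly_gauss_derivative[OF s] differentiableI_vector by metis
  qed
  fix k l
  obtain q where q: "(D ^^ l) (poly_gauss p m s) = poly_gauss q m s" using Dk_poly_gauss[OF s] by blast
  define R where "R = [:m, 1:] ^ k * q"
  obtain C where C: "\<And>t. \<bar>t\<bar> ^ 0 * \<bar>poly R t\<bar> * exp (- t\<^sup>2 / (2 * s\<^sup>2)) \<le> C"
    using poly_gauss_moment_bounded[OF s, of 0 R] by blast
  have "norm (of_real (x ^ k) * poly_gauss q m s x) \<le> C" for x
  proof -
    have "poly R (x - m) = x ^ k * poly q (x - m)" by (simp add: R_def poly_power)
    then have "norm (of_real (x ^ k) * poly_gauss q m s x) = \<bar>x - m\<bar> ^ 0 * \<bar>poly R (x - m)\<bar> * exp (- (x - m)\<^sup>2 / (2 * s\<^sup>2))"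
      by (simp add: poly_gauss_def norm_mult abs_mult norm_power power_abs)
    also have "\<dots> \<le> C" by (rule C)
    finally show ?thesis .
  qed
  then show "bounded (range (\<lambda>x. of_real (x ^ k) * (D ^^ l) (poly_gauss p m s) x))"
    unfolding q bounded_iff by auto
qed

lemma normal_density_schwartz:
  assumes "s > 0"
  shows "(\<lambda>x. complex_of_real (normal_density m s x)) \<in> schwartz"
proof -
  have "(\<lambda>x. complex_of_real (normal_density m s x)) = poly_gauss [:1 / sqrt (2 * pi * s\<^sup>2):] m s"
    by (auto simp: normal_density_def poly_gauss_def)
  then show ?thesis using poly_gauss_schwartz[OF assms] by simp
qed

lemma schwartz_integrable:
  assumes "\<psi> \<in> schwartz"
  shows "integrable lborel \<psi>" "\<psi> \<in> borel_measurable borel"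
proof -
  have "\<psi> differentiable (at x)" for x
    using assms funpow_0[of D \<psi>] by (auto simp: schwartz_def smooth_def dest: spec[of _ 0])
  then have c: "continuous_on UNIV \<psi>"
    by (intro continuous_at_imp_continuous_on ballI differentiable_imp_continuous_within)
  then show m: "\<psi> \<in> borel_measurable borel" by (rule borel_measurable_continuous_onI)
  have b: "bounded (range (\<lambda>x. of_real (x ^ k) * \<psi> x))" for k
    using assms unfolding schwartz_def mem_Collect_eq by (metis funpow_0)
  obtain C0 where C0: "\<And>x. norm (\<psi> x) \<le> C0" using b[of 0] by (auto simp: bounded_iff)
  obtain C2 where C2: "\<And>x. norm (of_real (x ^ 2) * \<psi> x) \<le> C2" using b[of 2] by (auto simp: bounded_iff)
  have "norm (\<psi> x) \<le> (C0 + C2) / (1 + x\<^sup>2)" for x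
  proof -
    have "norm (\<psi> x) * (1 + x\<^sup>2) \<le> C0 + C2"
      using C0[of x] C2[of x] by (simp add: norm_mult norm_power distrib_left mult.commute)
    then show ?thesis by (simp add: pos_le_divide_eq add_pos_nonneg)
  qed
  then show "integrable lborel \<psi>" by (rule integrable_decay[OF m])
qed

lemma Linf_norm_le:
  assumes m: "v \<in> borel_measurable borel" and b: "\<And>y. \<bar>v y\<bar> \<le> S"
    and U: "\<And>\<psi>. \<psi> \<in> schwartz \<Longrightarrow> U \<psi> = regular_dist (\<lambda>x. of_real (v x)) \<psi>"
  shows "Linf_norm U \<le> ennreal S"
proof -
  have "Linf_norm U \<le> esssup lborel (\<lambda>x. ennreal (norm (complex_of_real (v x))))"
    unfolding Linf_norm_def
    by (intro Inf_lower CollectI exI[of _ "\<lambda>x. complex_of_real (v x)"] conjI ballI U refl) (use m in auto)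
  also have "\<dots> \<le> ennreal S"
    using m b by (intro esssup_I AE_I2) (auto intro: ennreal_leI)
  finally show ?thesis .
qed

text \<open>The pointwise value of a Lipschitz representative is recovered by testing against narrow Gaussians.\<close>

lemma Linf_norm_ge:
  assumes lip: "\<And>x y. \<bar>v x - v y\<bar> \<le> L * \<bar>x - y\<bar>" and bdd: "\<And>x. \<bar>v x\<bar> \<le> B"
    and U: "\<And>\<psi>. \<psi> \<in> schwartz \<Longrightarrow> U \<psi> = regular_dist (\<lambda>x. of_real (v x)) \<psi>"
  shows "ennreal \<bar>v y\<bar> \<le> Linf_norm U"
  unfolding Linf_norm_def
proof (rule Inf_greatest, clarify)
  fix g :: "real \<Rightarrow> complex"
  assume g: "g \<in> borel_measurable lborel" and gU: "\<forall>\<psi>\<in>schwartz. U \<psi> = regular_dist g \<psi>"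
  show "ennreal \<bar>v y\<bar> \<le> esssup lborel (\<lambda>x. ennreal (norm (g x)))"
  proof (cases "esssup lborel (\<lambda>x. ennreal (norm (g x)))")
    case (real m)
    have m0: "m \<ge> 0" by (rule real)
    have ae: "AE x in lborel. norm (g x) \<le> m"
      using esssup_AE[of "\<lambda>x. ennreal (norm (g x))" lborel] unfolding real(2) by (rule eventually_mono) (use m0 in simp)
    have L0: "L \<ge> 0" using lip[of 1 0] by simp
    have "continuous_on UNIV v"
      unfolding continuous_on_iff
    proof (intro ballI allI impI)
      fix x e :: real assume "e > 0"
      then show "\<exists>d>0. \<forall>x'\<in>UNIV. dist x' x < d \<longrightarrow> dist (v x') (v x) < e"
        using lip L0
        by (intro exI[of _ "e / (L + 1)"])
           (auto simp: dist_real_def field_simps intro: le_less_trans[OF lip] le_less_trans[of _ "(L + 1) * \<bar>_ - x\<bar>"])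
    qed
    then have vm[measurable]: "v \<in> borel_measurable borel" by (rule borel_measurable_continuous_onI)
    \<comment> \<open>The factor \<open>s * sqrt (2 / pi)\<close> is the mean absolute deviation of
      a normal law with standard deviation \<open>s\<close>. Averaging \<open>v\<close> instead of
      evaluating it at \<open>y\<close> costs at most \<open>L\<close> times that, and
      \<open>s\<close> tends to 0 at the end.\<close>
    have "\<bar>v y\<bar> \<le> m + L * (s * sqrt (2 / pi))" if s: "s > 0" for s
    proof -
      let ?N = "normal_density y s"
      have eq: "(LINT x|lborel. complex_of_real (v x) * of_real (?N x)) = (LINT x|lborel. g x * of_real (?N x))"
        using gU U normal_density_schwartz[OF s, of y] unfolding regular_dist_def by metis
      have iN: "integrable lborel ?N" using s by (rule integrable_normal_density)
      have ivN: "integrable lborel (\<lambda>x. v x * ?N x)"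
        by (rule Bochner_Integration.integrable_bound[OF integrable_mult_right[OF iN, of B]])
           (auto simp: abs_mult intro!: AE_I2 mult_right_mono intro: order_trans[OF bdd])
      have igN: "integrable lborel (\<lambda>x. g x * of_real (?N x))"
        by (rule Bochner_Integration.integrable_bound[OF integrable_mult_right[OF iN, of m]])
           (use ae g m0 in \<open>auto simp: norm_mult elim!: eventually_mono intro!: mult_right_mono\<close>)
      have "norm (LINT x|lborel. g x * of_real (?N x)) \<le> (LINT x|lborel. m * ?N x)"
      proof (rule order_trans[OF integral_norm_bound], rule integral_mono_AE)
        show "AE x in lborel. norm (g x * of_real (?N x)) \<le> m * ?N x"
          using ae by (rule eventually_mono) (auto simp: norm_mult intro!: mult_right_mono)
      qed (use igN iN in auto)
      also have "\<dots> = m" using s by simp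
      finally have "norm (LINT x|lborel. complex_of_real (v x * ?N x)) \<le> m" using eq by simp
      then have 1: "\<bar>LINT x|lborel. v x * ?N x\<bar> \<le> m"
        by (simp only: integral_complex_of_real norm_of_real)
      have ia: "integrable lborel (\<lambda>x. ?N x * \<bar>x - y\<bar>)" using integrable_normal_moment_abs[OF s, of y 1] by simp
      have "v y - (LINT x|lborel. v x * ?N x) = (LINT x|lborel. v y * ?N x - v x * ?N x)"
        using s ivN iN by simp
      also have "\<bar>\<dots>\<bar> \<le> (LINT x|lborel. L * (?N x * \<bar>x - y\<bar>))"
      proof (rule order_trans[OF integral_abs_bound], rule integral_mono)
        show "\<bar>v y * ?N x - v x * ?N x\<bar> \<le> L * (?N x * \<bar>x - y\<bar>)" for x
        proof -
          have "\<bar>v y * ?N x - v x * ?N x\<bar> = \<bar>v y - v x\<bar> * ?N x"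
            by (simp add: abs_mult flip: left_diff_distrib)
          also have "\<dots> \<le> (L * \<bar>y - x\<bar>) * ?N x" by (intro mult_right_mono lip) auto
          finally show ?thesis by (simp add: mult_ac abs_minus_commute)
        qed
      qed (use ivN iN ia in auto)
      also have "\<dots> = L * (s * sqrt (2 / pi))"
        using integral_normal_moment_abs_odd[OF s, of y 0] by simp
      finally show ?thesis using 1 by linarith
    qed
    then have "\<bar>v y\<bar> \<le> m + L * (inverse (real (Suc n)) * sqrt (2 / pi))" for n by simp
    moreover have "(\<lambda>n. m + L * (inverse (real (Suc n)) * sqrt (2 / pi))) \<longlonglongrightarrow> m + L * (0 * sqrt (2 / pi))"
      by (intro tendsto_intros LIMSEQ_inverse_real_of_nat)
    ultimately have "\<bar>v y\<bar> \<le> m" using LIMSEQ_le_const by fastforce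
    then show ?thesis unfolding real(2) by (rule ennreal_leI)
  qed simp
qed

section \<open>Inverse Fourier transforms of compactly supported symbols\<close>

lemma inverse_fourier_compact:
  assumes c: "continuous_on UNIV b" and R: "R > 0" and v: "\<And>\<xi>. \<bar>\<xi>\<bar> \<ge> R \<Longrightarrow> b \<xi> = 0"
  shows "inverse_fourier b x = integral {-R..R} (\<lambda>\<xi>. exp (\<i> * of_real (x * \<xi>)) * b \<xi>) / of_real (2 * pi)"
proof -
  let ?f = "\<lambda>\<xi>. exp (\<i> * of_real (x * \<xi>)) * b \<xi>"
  have cf: "continuous_on {-R..R} ?f" by (intro continuous_intros continuous_on_subset[OF c]) auto
  have "(LINT \<xi>|lborel. ?f \<xi>) = (LINT \<xi>|lborel. indicator {-R..R} \<xi> *\<^sub>R ?f \<xi>)"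
    by (rule Bochner_Integration.integral_cong) (use v in \<open>auto simp: indicator_def abs_if split: if_splits\<close>)
  also have "\<dots> = (LINT \<xi>:{-R..R}|lborel. ?f \<xi>)" by (simp add: set_lebesgue_integral_def)
  also have "\<dots> = integral {-R..R} ?f"
    using borel_integrable_compact[OF _ cf] by (intro set_borel_integral_eq_integral) (auto simp: set_integrable_def)
  finally show ?thesis by (simp add: inverse_fourier_def)
qed

lemma inverse_fourier_derivative:
  assumes c: "continuous_on UNIV b" and R: "R > 0" and v: "\<And>\<xi>. \<bar>\<xi>\<bar> \<ge> R \<Longrightarrow> b \<xi> = 0"
  shows "(inverse_fourier b has_vector_derivative inverse_fourier (\<lambda>\<xi>. \<i> * of_real \<xi> * b \<xi>) x) (at x)"
proof -
  let ?f = "\<lambda>x \<xi>. exp (\<i> * of_real (x * \<xi>)) * b \<xi>"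
  let ?g = "\<lambda>x \<xi>. exp (\<i> * of_real (x * \<xi>)) * (\<i> * of_real \<xi> * b \<xi>)"
  have c2: "continuous_on UNIV (\<lambda>\<xi>. \<i> * of_real \<xi> * b \<xi>)" by (intro continuous_intros c)
  have "((\<lambda>x. integral (cbox (-R) R) (?f x)) has_vector_derivative integral (cbox (-R) R) (?g x)) (at x within UNIV)"
  proof (rule leibniz_rule_vector_derivative)
    show "((\<lambda>x. ?f x \<xi>) has_vector_derivative ?g x \<xi>) (at x within UNIV)" for x \<xi>
    proof -
      have "((\<lambda>z. exp (\<i> * (z * of_real \<xi>)) * b \<xi>) has_field_derivative exp (\<i> * (of_real x * of_real \<xi>)) * (\<i> * of_real \<xi> * b \<xi>)) (at (of_real x))"
        by (auto intro!: derivative_eq_intros simp: algebra_simps)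
      from has_vector_derivative_real_field[OF this] show ?thesis by simp
    qed
    show "?f x integrable_on cbox (-R) R" for x
      by (rule integrable_continuous) (intro continuous_intros continuous_on_subset[OF c], auto)
    have "continuous_on (UNIV \<times> cbox (- R) R) (\<lambda>p. b (snd p))"
      by (rule continuous_on_compose2[OF c]) (auto intro!: continuous_intros)
    then show "continuous_on (UNIV \<times> cbox (-R) R) (\<lambda>(x, \<xi>). ?g x \<xi>)"
      unfolding case_prod_unfold by (intro continuous_intros)
  qed auto
  then have "((\<lambda>x. integral {-R..R} (?f x) / of_real (2 * pi)) has_vector_derivative integral {-R..R} (?g x) / of_real (2 * pi)) (at x)"
    by (intro has_vector_derivative_divide) simp
  moreover have "inverse_fourier (\<lambda>\<xi>. \<i> * of_real \<xi> * b \<xi>) x = integral {-R..R} (?g x) / of_real (2 * pi)"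
    by (rule inverse_fourier_compact[OF c2 R]) (use v in auto)
  moreover have "inverse_fourier b = (\<lambda>x. integral {-R..R} (?f x) / of_real (2 * pi))"
    using inverse_fourier_compact[OF c R v] by blast
  ultimately show ?thesis by simp
qed

text \<open>Two derivatives are carried along because two integrations by parts follow. That
  \<open>b\<close> and \<open>b1\<close> vanish at the ends of the interval removes the boundary
  terms.\<close>

definition bump :: "(real \<Rightarrow> complex) \<Rightarrow> (real \<Rightarrow> complex) \<Rightarrow> (real \<Rightarrow> complex) \<Rightarrow> real \<Rightarrow> bool" where
  "bump b b1 b2 R \<longleftrightarrow> R > 0 \<and> (\<forall>\<xi>. (b has_vector_derivative b1 \<xi>) (at \<xi>)) \<and> (\<forall>\<xi>. (b1 has_vector_derivative b2 \<xi>) (at \<xi>)) \<and>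
     continuous_on UNIV b2 \<and> (\<forall>\<xi>. \<bar>\<xi>\<bar> \<ge> R \<longrightarrow> b \<xi> = 0 \<and> b1 \<xi> = 0)"

lemma bump_continuous:
  assumes "bump b b1 b2 R"
  shows "continuous_on UNIV b" "continuous_on UNIV b1"
  using assms unfolding bump_def
  by (auto intro!: continuous_at_imp_continuous_on intro: has_vector_derivative_continuous)

text \<open>The trivial bound controls the transform itself, two integrations by parts control
  \<open>x\<^sup>2\<close> times it, and the sum of both estimates is the bound with
  \<open>1 + x\<^sup>2\<close>.\<close>

lemma inverse_fourier_decay:
  assumes b: "bump b b1 b2 R"
  shows "\<exists>C. \<forall>x. norm (inverse_fourier b x) \<le> C / (1 + x\<^sup>2)"
proof -
  have R: "R > 0" and d1: "\<And>\<xi>. (b has_vector_derivative b1 \<xi>) (at \<xi>)" and d2: "\<And>\<xi>. (b1 has_vector_derivative b2 \<xi>) (at \<xi>)"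
    and c2: "continuous_on UNIV b2" and v: "\<And>\<xi>. \<bar>\<xi>\<bar> \<ge> R \<Longrightarrow> b \<xi> = 0" "\<And>\<xi>. \<bar>\<xi>\<bar> \<ge> R \<Longrightarrow> b1 \<xi> = 0"
    using b by (auto simp: bump_def)
  note c = bump_continuous[OF b]
  let ?e = "\<lambda>x \<xi>. exp (\<i> * of_real (x * \<xi>))"
  have bdd: "\<exists>B. \<forall>\<xi>\<in>{-R..R}. norm (f \<xi>) \<le> B" if "continuous_on UNIV f" for f :: "real \<Rightarrow> complex"
    using compact_imp_bounded[OF compact_continuous_image[OF continuous_on_subset[OF that] compact_Icc]]
    by (auto simp: bounded_iff)
  obtain B0 where B0: "\<And>\<xi>. \<xi> \<in> {-R..R} \<Longrightarrow> norm (b \<xi>) \<le> B0" using bdd[OF c(1)] by blast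
  obtain B2 where B2: "\<And>\<xi>. \<xi> \<in> {-R..R} \<Longrightarrow> norm (b2 \<xi>) \<le> B2" using bdd[OF c2] by blast
  have e1: "norm (?e x \<xi>) = 1" for x \<xi> by (simp add: norm_exp_eq_Re)
  have cc: "continuous_on {-R..R} (\<lambda>\<xi>. ?e x \<xi> * f \<xi>)" if "continuous_on UNIV f" for x f
    by (intro continuous_intros continuous_on_subset[OF that]) auto
  have n0: "norm (integral {-R..R} (\<lambda>\<xi>. ?e x \<xi> * b \<xi>)) \<le> B0 * (R - (-R))" for x
  proof (rule integral_bound[OF _ cc[OF c(1)]])
    show "norm (?e x \<xi> * b \<xi>) \<le> B0" if "\<xi> \<in> {-R..R}" for \<xi> unfolding norm_mult e1 using B0[OF that] by simp
  qed (use R in simp)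
  have n2: "norm (integral {-R..R} (\<lambda>\<xi>. ?e x \<xi> * b2 \<xi>)) \<le> B2 * (R - (-R))" for x
  proof (rule integral_bound[OF _ cc[OF c2]])
    show "norm (?e x \<xi> * b2 \<xi>) \<le> B2" if "\<xi> \<in> {-R..R}" for \<xi> unfolding norm_mult e1 using B2[OF that] by simp
  qed (use R in simp)
  have parts: "integral {-R..R} (\<lambda>\<xi>. ?e x \<xi> * b2 \<xi>) = - of_real (x\<^sup>2) * integral {-R..R} (\<lambda>\<xi>. ?e x \<xi> * b \<xi>)" for x
  proof -
    \<comment> \<open>An antiderivative that performs both integrations by parts at once; it
      vanishes at both ends.\<close>
    let ?P = "\<lambda>\<xi>. ?e x \<xi> * b1 \<xi> - \<i> * of_real x * (?e x \<xi> * b \<xi>)"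
    have de: "(?e x has_vector_derivative \<i> * of_real x * ?e x \<xi>) (at \<xi>)" for \<xi>
    proof -
      have "((\<lambda>z. exp (\<i> * (of_real x * z))) has_field_derivative \<i> * of_real x * exp (\<i> * (of_real x * of_real \<xi>))) (at (of_real \<xi>))"
        by (auto intro!: derivative_eq_intros simp: algebra_simps)
      from has_vector_derivative_real_field[OF this] show ?thesis by simp
    qed
    have dP: "(?P has_vector_derivative (?e x \<xi> * b2 \<xi> + of_real (x\<^sup>2) * (?e x \<xi> * b \<xi>))) (at \<xi>)" for \<xi>
    proof -
      have "(?P has_vector_derivative (?e x \<xi> * b2 \<xi> + \<i> * of_real x * ?e x \<xi> * b1 \<xi>) - \<i> * of_real x * (?e x \<xi> * b1 \<xi> + \<i> * of_real x * ?e x \<xi> * b \<xi>)) (at \<xi>)"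
        by (intro has_vector_derivative_diff has_vector_derivative_mult has_vector_derivative_mult_right de d1 d2)
      then show ?thesis by (rule has_vector_derivative_eq_rhs) (simp add: algebra_simps power2_eq_square)
    qed
    have "((\<lambda>\<xi>. ?e x \<xi> * b2 \<xi> + of_real (x\<^sup>2) * (?e x \<xi> * b \<xi>)) has_integral ?P R - ?P (-R)) {-R..R}"
      by (rule fundamental_theorem_of_calculus) (use R dP in \<open>auto intro: has_vector_derivative_at_within\<close>)
    then have "((\<lambda>\<xi>. ?e x \<xi> * b2 \<xi> + of_real (x\<^sup>2) * (?e x \<xi> * b \<xi>)) has_integral 0) {-R..R}"
      using v R by simp
    then have "integral {-R..R} (\<lambda>\<xi>. ?e x \<xi> * b2 \<xi> + of_real (x\<^sup>2) * (?e x \<xi> * b \<xi>)) = 0"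
      by (rule integral_unique)
    moreover have "integral {-R..R} (\<lambda>\<xi>. ?e x \<xi> * b2 \<xi> + of_real (x\<^sup>2) * (?e x \<xi> * b \<xi>)) =
      integral {-R..R} (\<lambda>\<xi>. ?e x \<xi> * b2 \<xi>) + integral {-R..R} (\<lambda>\<xi>. of_real (x\<^sup>2) * (?e x \<xi> * b \<xi>))"
      by (intro Henstock_Kurzweil_Integration.integral_add integrable_continuous_real cc c2 continuous_intros c)
    moreover have "integral {-R..R} (\<lambda>\<xi>. of_real (x\<^sup>2) * (?e x \<xi> * b \<xi>)) = of_real (x\<^sup>2) * integral {-R..R} (\<lambda>\<xi>. ?e x \<xi> * b \<xi>)"
      by (rule integral_mult_right)
    ultimately show ?thesis by (simp add: eq_neg_iff_add_eq_0)
  qed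
  define C where "C = (B0 * (R - (-R)) + B2 * (R - (-R))) / (2 * pi)"
  have "norm (inverse_fourier b x) \<le> C / (1 + x\<^sup>2)" for x
  proof -
    let ?I = "integral {-R..R} (\<lambda>\<xi>. ?e x \<xi> * b \<xi>)"
    have "norm (integral {-R..R} (\<lambda>\<xi>. ?e x \<xi> * b2 \<xi>)) = x\<^sup>2 * norm ?I"
      unfolding parts by (simp add: norm_mult norm_power)
    then have "norm ?I * (1 + x\<^sup>2) \<le> B0 * (R - (-R)) + B2 * (R - (-R))"
      using n0[of x] n2[of x] by (simp add: algebra_simps)
    then have "norm ?I / (2 * pi) * (1 + x\<^sup>2) \<le> C"
      unfolding C_def times_divide_eq_left by (rule divide_right_mono) simp
    moreover have "inverse_fourier b x = ?I / of_real (2 * pi)"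
      by (rule inverse_fourier_compact[OF c(1) R v(1)])
    then have "norm (inverse_fourier b x) = norm ?I / (2 * pi)" by (simp only: norm_divide norm_of_real) simp
    ultimately show ?thesis by (simp add: pos_le_divide_eq add_pos_nonneg)
  qed
  then show ?thesis by blast
qed

lemma inverse_fourier_even_real:
  assumes "\<And>\<xi>. a (- \<xi>) = a \<xi>"
  shows "inverse_fourier (\<lambda>\<xi>. of_real (a \<xi>)) x = of_real (Re (inverse_fourier (\<lambda>\<xi>. of_real (a \<xi>)) x))"
proof -
  let ?I = "LINT \<xi>|lborel. exp (\<i> * of_real (x * \<xi>)) * of_real (a \<xi>)"
  have "cnj ?I = (LINT \<xi>|lborel. cnj (exp (\<i> * of_real (x * \<xi>)) * of_real (a \<xi>)))"
    by (rule Bochner_Integration.integral_cnj[symmetric])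
  also have "\<dots> = (LINT \<xi>|lborel. exp (\<i> * of_real (x * (0 + - 1 * \<xi>))) * of_real (a (0 + - 1 * \<xi>)))"
    by (rule Bochner_Integration.integral_cong) (auto simp: assms exp_cnj)
  also have "\<dots> = ?I"
    using lborel_integral_real_affine[of "-1" "\<lambda>\<xi>. exp (\<i> * of_real (x * \<xi>)) * of_real (a \<xi>)" 0] by simp
  finally have "?I \<in> \<real>" by (simp add: Reals_cnj_iff)
  then have "inverse_fourier (\<lambda>\<xi>. of_real (a \<xi>)) x \<in> \<real>" unfolding inverse_fourier_def by (intro Reals_divide) auto
  then show ?thesis by (simp add: of_real_Re)
qed

lemma D_vanish_open:
  fixes f :: "real \<Rightarrow> real"
  assumes "open U" "\<And>x. x \<in> U \<Longrightarrow> f x = 0" "x \<in> U"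
  shows "(D ^^ k) f x = 0"
  using assms(3)
proof (induction k arbitrary: x)
  case (Suc k)
  have "((D ^^ k) f has_vector_derivative 0) (at x)"
    by (rule has_vector_derivative_transform_within_open[OF has_vector_derivative_const assms(1) Suc(2)]) (use Suc(1) in simp)
  then have "D ((D ^^ k) f) x = 0" unfolding D_def[of "(D ^^ k) f"] by (rule vector_derivative_at)
  then show ?case by simp
qed (simp add: assms)

text \<open>The three symbols are, up to the constant \<open>c\<close>, those of a kernel, of its
  derivative and of its primitive. Since \<open>f\<close> is known to vanish only on the open set
  where \<open>\<bar>\<xi>\<bar>\<close> exceeds \<open>R\<close>, the radius is enlarged by 1 to
  obtain a closed region on which the derivatives vanish too.\<close>

lemma smooth_bump:
  assumes f: "smooth f" and R: "R > 0" and v: "\<And>\<xi>. \<bar>\<xi>\<bar> > R \<Longrightarrow> f \<xi> = 0"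
  shows "bump (\<lambda>\<xi>. c * of_real (f \<xi>)) (\<lambda>\<xi>. c * of_real (D f \<xi>)) (\<lambda>\<xi>. c * of_real ((D ^^ 2) f \<xi>)) (R + 1)"
    and "bump (\<lambda>\<xi>. c * of_real (\<xi> * f \<xi>)) (\<lambda>\<xi>. c * of_real (f \<xi> + \<xi> * D f \<xi>)) (\<lambda>\<xi>. c * of_real (2 * D f \<xi> + \<xi> * (D ^^ 2) f \<xi>)) (R + 1)"
    and "(\<And>\<xi>. \<bar>\<xi>\<bar> < d \<Longrightarrow> f \<xi> = 0) \<Longrightarrow> d > 0 \<Longrightarrow>
      bump (\<lambda>\<xi>. c * of_real (f \<xi> / \<xi>)) (\<lambda>\<xi>. c * of_real (D f \<xi> / \<xi> - f \<xi> / \<xi>\<^sup>2))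
        (\<lambda>\<xi>. c * of_real ((D ^^ 2) f \<xi> / \<xi> - 2 * D f \<xi> / \<xi>\<^sup>2 + 2 * f \<xi> / \<xi> ^ 3)) (R + 1)"
proof -
  have d0: "(f has_real_derivative D f x) (at x)" and d1: "(D f has_real_derivative (D ^^ 2) f x) (at x)"
    and d2: "((D ^^ 2) f has_real_derivative (D ^^ 3) f x) (at x)" for x
    using smooth_has_derivative[OF f, of 0] smooth_has_derivative[OF f, of 1] smooth_has_derivative[OF f, of 2]
    by (simp_all add: numeral_2_eq_2 numeral_3_eq_3)
  have "open {\<xi>. \<bar>\<xi>\<bar> > R}" by (intro open_Collect_less continuous_intros)
  then have vk: "(D ^^ k) f \<xi> = 0" if "\<bar>\<xi>\<bar> \<ge> R + 1" for k \<xi>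
    using that v by (intro D_vanish_open) auto
  note v0 = vk[of _ 0, simplified] and v1 = vk[of _ 1, simplified]
  have c: "continuous_on UNIV f" "continuous_on UNIV (D f)" "continuous_on UNIV ((D ^^ 2) f)"
    by (rule DERIV_continuous_on[OF d0] DERIV_continuous_on[OF d1] DERIV_continuous_on[OF d2])+
  have lift: "((\<lambda>\<xi>. c * of_real (g \<xi>)) has_vector_derivative c * of_real g') (at \<xi>)"
    if "(g has_real_derivative g') (at \<xi>)" for g g' \<xi>
    using that has_vector_derivative_mult_right[OF bounded_linear.has_vector_derivative[OF bounded_linear_of_real[where 'a=complex]]]
    by (simp add: has_real_derivative_iff_has_vector_derivative)
  show "bump (\<lambda>\<xi>. c * of_real (f \<xi>)) (\<lambda>\<xi>. c * of_real (D f \<xi>)) (\<lambda>\<xi>. c * of_real ((D ^^ 2) f \<xi>)) (R + 1)"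
    unfolding bump_def using R v0 v1 by (auto intro!: lift d0 d1 continuous_intros c)
  show "bump (\<lambda>\<xi>. c * of_real (\<xi> * f \<xi>)) (\<lambda>\<xi>. c * of_real (f \<xi> + \<xi> * D f \<xi>)) (\<lambda>\<xi>. c * of_real (2 * D f \<xi> + \<xi> * (D ^^ 2) f \<xi>)) (R + 1)"
    unfolding bump_def
  proof (intro conjI allI impI)
    fix \<xi>
    show "((\<lambda>\<xi>. c * of_real (\<xi> * f \<xi>)) has_vector_derivative c * of_real (f \<xi> + \<xi> * D f \<xi>)) (at \<xi>)"
      by (rule lift, rule DERIV_cong[OF DERIV_mult[OF DERIV_ident d0]]) (simp add: algebra_simps)
    show "((\<lambda>\<xi>. c * of_real (f \<xi> + \<xi> * D f \<xi>)) has_vector_derivative c * of_real (2 * D f \<xi> + \<xi> * (D ^^ 2) f \<xi>)) (at \<xi>)"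
      by (rule lift, rule DERIV_cong[OF DERIV_add[OF d0 DERIV_mult[OF DERIV_ident d1]]]) (simp add: algebra_simps)
  qed (use R v0 v1 in \<open>auto intro!: continuous_intros c\<close>)
  assume z: "\<And>\<xi>. \<bar>\<xi>\<bar> < d \<Longrightarrow> f \<xi> = 0" and d: "d > 0"
  have od: "open {\<xi>. \<bar>\<xi>\<bar> < d}" by (intro open_Collect_less continuous_intros)
  have zk: "(D ^^ k) f \<xi> = 0" if "\<bar>\<xi>\<bar> < d" for k \<xi>
    using that z by (intro D_vanish_open[OF od]) auto
  note z1 = zk[of _ 1, simplified] and z2 = zk[of _ 2]
  let ?h = "\<lambda>\<xi>. f \<xi> / \<xi>" and ?h1 = "\<lambda>\<xi>. D f \<xi> / \<xi> - f \<xi> / \<xi>\<^sup>2"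
    and ?h2 = "\<lambda>\<xi>. (D ^^ 2) f \<xi> / \<xi> - 2 * D f \<xi> / \<xi>\<^sup>2 + 2 * f \<xi> / \<xi> ^ 3"
  \<comment> \<open>Near 0, where \<open>f\<close> vanishes, all the quotients are 0, at 0 itself
    because of \<open>x / 0 = 0\<close>. The formulas for the derivatives therefore hold at 0 as
    well.\<close>
  have zero_der: "(g has_real_derivative 0) (at 0)" if "\<And>\<xi>. \<bar>\<xi>\<bar> < d \<Longrightarrow> g \<xi> = 0" for g :: "real \<Rightarrow> real"
    by (rule has_field_derivative_transform_within_open[OF DERIV_const[of 0] od]) (use d that in auto)
  have h: "(?h has_real_derivative ?h1 \<xi>) (at \<xi>)" for \<xi>
  proof (cases "\<xi> = 0")
    case False
    then show ?thesis
      by (intro DERIV_cong[OF DERIV_divide[OF d0 DERIV_ident]]) (auto simp: field_simps power2_eq_square)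
  qed (use zero_der[of ?h] z in simp)
  have h1: "(?h1 has_real_derivative ?h2 \<xi>) (at \<xi>)" for \<xi>
  proof (cases "\<xi> = 0")
    case False
    have "((\<lambda>\<xi>. \<xi>\<^sup>2) has_real_derivative 2 * \<xi>) (at \<xi>)" by (auto intro!: derivative_eq_intros)
    moreover have "\<xi>\<^sup>2 \<noteq> 0" using False by simp
    ultimately have "(?h1 has_real_derivative ((D ^^ 2) f \<xi> * \<xi> - D f \<xi> * 1) / (\<xi> * \<xi>) - (D f \<xi> * \<xi>\<^sup>2 - f \<xi> * (2 * \<xi>)) / (\<xi>\<^sup>2 * \<xi>\<^sup>2)) (at \<xi>)"
      by (intro DERIV_diff DERIV_divide d1 d0 DERIV_ident False)
    moreover have "((D ^^ 2) f \<xi> * \<xi> - D f \<xi> * 1) / (\<xi> * \<xi>) - (D f \<xi> * \<xi>\<^sup>2 - f \<xi> * (2 * \<xi>)) / (\<xi>\<^sup>2 * \<xi>\<^sup>2) = ?h2 \<xi>"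
      using False by (simp add: field_simps power2_eq_square power3_eq_cube)
    ultimately show ?thesis by metis
  qed (use zero_der[of ?h1] z z1 in simp)
  have "isCont ?h2 \<xi>" for \<xi>
  proof (cases "\<xi> = 0")
    case False
    then show ?thesis
      using c by (intro continuous_intros) (auto simp: continuous_on_eq_continuous_at)
  qed (use DERIV_isCont[OF zero_der[of ?h2]] z z1 z2 in simp)
  then have c2: "continuous_on UNIV ?h2" by (simp add: continuous_on_eq_continuous_at)
  show "bump (\<lambda>\<xi>. c * of_real (?h \<xi>)) (\<lambda>\<xi>. c * of_real (?h1 \<xi>)) (\<lambda>\<xi>. c * of_real (?h2 \<xi>)) (R + 1)"
    unfolding bump_def
  proof (intro conjI allI impI)
    show "((\<lambda>\<xi>. c * of_real (?h \<xi>)) has_vector_derivative c * of_real (?h1 \<xi>)) (at \<xi>)" for \<xi> by (rule lift[OF h])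
    show "((\<lambda>\<xi>. c * of_real (?h1 \<xi>)) has_vector_derivative c * of_real (?h2 \<xi>)) (at \<xi>)" for \<xi> by (rule lift[OF h1])
    show "continuous_on UNIV (\<lambda>\<xi>. c * of_real (?h2 \<xi>))"
      by (intro continuous_on_mult continuous_on_const continuous_on_of_real c2)
  qed (use R v0 v1 in auto)
qed

section \<open>Littlewood-Paley blocks as convolutions\<close>

definition conv :: "(real \<Rightarrow> real) \<Rightarrow> (real \<Rightarrow> real) \<Rightarrow> real \<Rightarrow> real" where
  "conv P u y = (LINT x|lborel. P (y - x) * u x)"

text \<open>One condition that makes a kernel bounded, integrable and vanishing at infinity, and
  that is stable under the dilations to higher frequencies.\<close>

definition dec :: "(real \<Rightarrow> real) \<Rightarrow> bool" where
  "dec f \<longleftrightarrow> continuous_on UNIV f \<and> (\<exists>C. \<forall>x. \<bar>f x\<bar> \<le> C / (1 + x\<^sup>2))"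

lemma dec_measurable: "dec f \<Longrightarrow> f \<in> borel_measurable borel"
  by (auto simp: dec_def intro: borel_measurable_continuous_onI)

lemma dec_integrable: "dec f \<Longrightarrow> integrable lborel f"
  using integrable_decay[OF dec_measurable] unfolding dec_def by (metis real_norm_def)

lemma dec_bounded:
  assumes "dec f"
  obtains B where "\<And>x. \<bar>f x\<bar> \<le> B"
proof -
  obtain C where C: "\<And>x. \<bar>f x\<bar> \<le> C / (1 + x\<^sup>2)" using assms by (auto simp: dec_def)
  have "0 \<le> C" using C[of 0] by simp
  then have "C / (1 + x\<^sup>2) \<le> C" for x by (simp add: divide_le_eq add_pos_nonneg mult_left_mono[of 1 "1 + x\<^sup>2" C, simplified])
  then show thesis using C by (intro that[of C]) (meson order_trans)
qed

lemma dec_tendsto: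
  assumes f: "dec f" and h: "filterlim h at_infinity F"
  shows "((\<lambda>n. f (h n)) \<longlongrightarrow> 0) F"
proof -
  obtain C where C: "\<And>x. \<bar>f x\<bar> \<le> C / (1 + x\<^sup>2)" using f by (auto simp: dec_def)
  have "((\<lambda>x::real. C / (1 + x\<^sup>2)) \<longlongrightarrow> 0) at_top" by real_asymp
  moreover have "((\<lambda>x::real. C / (1 + x\<^sup>2)) \<longlongrightarrow> 0) at_bot" by real_asymp
  ultimately have "((\<lambda>x::real. C / (1 + x\<^sup>2)) \<longlongrightarrow> 0) at_infinity"
    by (simp add: at_infinity_eq_at_top_bot filterlim_sup)
  then have "((\<lambda>n. C / (1 + (h n)\<^sup>2)) \<longlongrightarrow> 0) F" using h by (rule filterlim_compose)
  then show ?thesis by (rule Lim_null_comparison[rotated]) (use C in auto)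
qed

lemma dec_scale:
  assumes f: "dec f" and q: "q \<ge> 1"
  shows "dec (\<lambda>x. c * f (q * x))"
proof -
  obtain C where C: "\<And>x. \<bar>f x\<bar> \<le> C / (1 + x\<^sup>2)" and cf: "continuous_on UNIV f" using f by (auto simp: dec_def)
  have C0: "C \<ge> 0" using C[of 0] by simp
  have "\<bar>c * f (q * x)\<bar> \<le> (\<bar>c\<bar> * C) / (1 + x\<^sup>2)" for x
  proof -
    have "1 * x\<^sup>2 \<le> q\<^sup>2 * x\<^sup>2" using q by (intro mult_right_mono) (auto simp: one_le_power)
    then have "C / (1 + (q * x)\<^sup>2) \<le> C / (1 + x\<^sup>2)"
      using C0 by (intro divide_left_mono) (auto simp: power_mult_distrib add_pos_nonneg)
    then have "\<bar>f (q * x)\<bar> \<le> C / (1 + x\<^sup>2)" using C[of "q * x"] by linarith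
    then show ?thesis using mult_left_mono[of "\<bar>f (q * x)\<bar>" "C / (1 + x\<^sup>2)" "\<bar>c\<bar>"] by (simp add: abs_mult)
  qed
  moreover have "continuous_on UNIV (\<lambda>x. c * f (q * x))"
    by (intro continuous_intros continuous_on_compose2[OF cf]) auto
  ultimately show ?thesis unfolding dec_def by blast
qed

lemma integral_abs_scale:
  fixes f :: "real \<Rightarrow> real"
  assumes "q > 0"
  shows "(LINT x|lborel. \<bar>c * f (q * x)\<bar>) = \<bar>c\<bar> / q * (LINT x|lborel. \<bar>f x\<bar>)"
  using lborel_integral_real_affine[of q "\<lambda>x. \<bar>f x\<bar>" 0] assms by (simp add: abs_mult)

lemma integrable_reflect_shift:
  fixes P :: "real \<Rightarrow> real"
  assumes "integrable lborel P"
  shows "integrable lborel (\<lambda>x. P (y - x))"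
  using lborel_integrable_real_affine[OF assms, of "-1" y] by simp

lemma integral_reflect_shift:
  fixes P :: "real \<Rightarrow> real"
  shows "(LINT x|lborel. P (y - x)) = (LINT x|lborel. P x)"
  using lborel_integral_real_affine[of "-1" P y] by simp

lemma conv_integrable:
  assumes P: "dec P" and u: "u \<in> borel_measurable borel" and B: "\<And>x. \<bar>u x\<bar> \<le> B"
  shows "integrable lborel (\<lambda>x. P (y - x) * u x)" and "\<bar>conv P u y\<bar> \<le> B * (LINT x|lborel. \<bar>P x\<bar>)"
proof -
  have m[measurable]: "P \<in> borel_measurable borel" "u \<in> borel_measurable borel" using dec_measurable[OF P] u by auto
  have iP: "integrable lborel (\<lambda>x. \<bar>P (y - x)\<bar>)"
    using integrable_reflect_shift[OF integrable_abs[OF dec_integrable[OF P]]] .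
  show 1: "integrable lborel (\<lambda>x. P (y - x) * u x)"
    by (rule Bochner_Integration.integrable_bound[OF integrable_mult_right[OF iP, of B]])
       (auto simp: abs_mult mult.commute[of _ "\<bar>u _\<bar>"] intro!: AE_I2 mult_right_mono order_trans[OF B])
  have "\<bar>conv P u y\<bar> \<le> (LINT x|lborel. \<bar>P (y - x) * u x\<bar>)"
    unfolding conv_def by (rule integral_abs_bound)
  also have "\<dots> \<le> (LINT x|lborel. B * \<bar>P (y - x)\<bar>)"
    by (rule integral_mono[OF integrable_abs[OF 1] integrable_mult_right[OF iP]])
       (use B in \<open>auto simp: abs_mult mult.commute[of B] intro!: mult_left_mono\<close>)
  also have "\<dots> = B * (LINT x|lborel. \<bar>P x\<bar>)" using integral_reflect_shift[of "\<lambda>x. \<bar>P x\<bar>" y] by simp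
  finally show "\<bar>conv P u y\<bar> \<le> B * (LINT x|lborel. \<bar>P x\<bar>)" .
qed

text \<open>This provides the Lipschitz representative of a block that \<open>Linf_norm_ge\<close>
  asks for.\<close>

lemma conv_lipschitz:
  assumes P: "dec P" and u: "u \<in> borel_measurable borel" and B: "\<And>x. \<bar>u x\<bar> \<le> B"
    and L: "\<And>x y. \<bar>u x - u y\<bar> \<le> L * \<bar>x - y\<bar>"
  shows "\<bar>conv P u y - conv P u y'\<bar> \<le> L * (LINT x|lborel. \<bar>P x\<bar>) * \<bar>y - y'\<bar>"
proof -
  have m[measurable]: "P \<in> borel_measurable borel" "u \<in> borel_measurable borel" using dec_measurable[OF P] u by auto
  have iP: "integrable lborel (\<lambda>x. \<bar>P x\<bar>)" using integrable_abs[OF dec_integrable[OF P]] .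
  have eq: "conv P u y = (LINT s|lborel. P s * u (y - s))" for y
    unfolding conv_def using integral_reflect_shift[of "\<lambda>s. P s * u (y - s)" y] by simp
  have i: "integrable lborel (\<lambda>s. P s * u (y - s))" for y
    using integrable_reflect_shift[OF conv_integrable(1)[OF P u B, of y], of y] by simp
  have "conv P u y - conv P u y' = (LINT s|lborel. P s * u (y - s) - P s * u (y' - s))"
    unfolding eq using i by simp
  also have "\<bar>\<dots>\<bar> \<le> (LINT s|lborel. \<bar>P s * u (y - s) - P s * u (y' - s)\<bar>)" by (rule integral_abs_bound)
  also have "\<dots> \<le> (LINT s|lborel. (L * \<bar>y - y'\<bar>) * \<bar>P s\<bar>)"
  proof (rule integral_mono)
    show "\<bar>P s * u (y - s) - P s * u (y' - s)\<bar> \<le> L * \<bar>y - y'\<bar> * \<bar>P s\<bar>" for s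
      using mult_left_mono[OF L[of "y - s" "y' - s"], of "\<bar>P s\<bar>"]
      by (simp add: abs_mult mult.commute flip: right_diff_distrib)
  qed (use i iP in auto)
  also have "\<dots> = L * (LINT x|lborel. \<bar>P x\<bar>) * \<bar>y - y'\<bar>" by simp
  finally show ?thesis .
qed

text \<open>Used in both directions: moving a derivative from the kernel to the function gives decay
  at high frequencies, moving it from the function to the kernel gives smallness at low
  ones.\<close>

lemma conv_by_parts:
  assumes p: "\<And>x. (p has_real_derivative P x) (at x)" "dec p" "dec P"
    and g: "\<And>x. (g has_real_derivative g' x) (at x)" "continuous_on UNIV g'"
    and B: "\<And>x. \<bar>g x\<bar> \<le> B" "\<And>x. \<bar>g' x\<bar> \<le> B'"
  shows "conv p g' y = conv P g y"
proof -
  have cg: "continuous_on UNIV g" by (rule DERIV_continuous_on[OF g(1)])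
  have mg: "g \<in> borel_measurable borel" "g' \<in> borel_measurable borel"
    using cg g(2) by (auto intro: borel_measurable_continuous_onI)
  have i1: "integrable lborel (\<lambda>x. p (y - x) * g' x)" by (rule conv_integrable(1)[OF p(2) mg(2) B(2)])
  have i2: "integrable lborel (\<lambda>x. P (y - x) * g x)" by (rule conv_integrable(1)[OF p(3) mg(1) B(1)])
  have cp: "continuous_on UNIV p" "continuous_on UNIV P" using p by (auto simp: dec_def)
  have pg: "((\<lambda>n. p (h n) * g (k n)) \<longlongrightarrow> 0) F" if "filterlim h at_infinity F" for h k and F :: "nat filter"
  proof (rule Lim_null_comparison)
    show "\<forall>\<^sub>F n in F. norm (p (h n) * g (k n)) \<le> B * \<bar>p (h n)\<bar>"
      using B(1) by (intro always_eventually allI) (auto simp: abs_mult mult.commute[of B] intro!: mult_left_mono)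
    show "((\<lambda>n. B * \<bar>p (h n)\<bar>) \<longlongrightarrow> 0) F"
      using tendsto_mult_right_zero[OF tendsto_rabs_zero[OF dec_tendsto[OF p(2) that]], of B] by simp
  qed
  have "(LINT x|lborel. p (y - x) * g' x - P (y - x) * g x) = 0 - 0"
  proof (rule integral_FTC_line[where F="\<lambda>x. p (y - x) * g x"])
    fix x
    have "((\<lambda>x. p (y - x)) has_real_derivative P (y - x) * (- 1)) (at x)"
      by (rule DERIV_chain2[OF p(1)]) (auto intro!: derivative_eq_intros)
    from DERIV_mult[OF this g(1)]
    show "((\<lambda>x. p (y - x) * g x) has_real_derivative p (y - x) * g' x - P (y - x) * g x) (at x)"
      by (rule DERIV_cong) (simp add: algebra_simps)
  next
    show "continuous_on UNIV (\<lambda>x. p (y - x) * g' x - P (y - x) * g x)"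
      by (intro continuous_intros g(2) cg continuous_on_compose2[OF cp(1)] continuous_on_compose2[OF cp(2)]) auto
    show "integrable lborel (\<lambda>x. p (y - x) * g' x - P (y - x) * g x)" using i1 i2 by simp
    have "filterlim (\<lambda>n. y - real n) at_bot sequentially" by real_asymp
    then show "(\<lambda>n. p (y - real n) * g (real n)) \<longlonglongrightarrow> 0"
      by (intro pg filterlim_mono[OF _ at_bot_le_at_infinity order_refl])
    have "filterlim (\<lambda>n. y - (- real n)) at_top sequentially" by real_asymp
    then show "(\<lambda>n. p (y - (- real n)) * g (- real n)) \<longlonglongrightarrow> 0"
      by (intro pg filterlim_mono[OF _ at_top_le_at_infinity order_refl])
  qed
  then show ?thesis using i1 i2 by (simp add: conv_def)
qed

text \<open>A jump is seen through the primitive of the kernel. For the dilated kernels this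
  primitive is \<open>\<kappa> (2 ^ n * x)\<close>, whose size does not depend on \<open>n\<close>:
  this is why every block records the height of a jump.\<close>

lemma conv_halfline:
  assumes p: "\<And>x. (p has_real_derivative P x) (at x)" "dec p" "dec P"
  shows "conv P (indicator {a..}) y = p (y - a)"
proof -
  have cp: "continuous_on UNIV P" using p by (auto simp: dec_def)
  have "(LINT x|lborel. P (y - x) * indicator {a..} x) = - 0 - (- p (y - a))"
  proof (rule integral_FTC_halfline[where F="\<lambda>x. - p (y - x)"])
    fix x
    have "((\<lambda>x. p (y - x)) has_real_derivative P (y - x) * (- 1)) (at x)"
      by (rule DERIV_chain2[OF p(1)]) (auto intro!: derivative_eq_intros)
    from DERIV_minus[OF this] show "((\<lambda>x. - p (y - x)) has_real_derivative P (y - x)) (at x)" by simp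
  next
    show "continuous_on UNIV (\<lambda>x. P (y - x))" by (intro continuous_on_compose2[OF cp]) (auto intro!: continuous_intros)
    show "integrable lborel (\<lambda>x. P (y - x))" by (rule integrable_reflect_shift[OF dec_integrable[OF p(3)]])
    have "filterlim (\<lambda>n. y - (a + real n)) at_bot sequentially" by real_asymp
    then have "(\<lambda>n. p (y - (a + real n))) \<longlonglongrightarrow> 0"
      by (intro dec_tendsto[OF p(2)] filterlim_mono[OF _ at_bot_le_at_infinity order_refl])
    then show "(\<lambda>n. - p (y - (a + real n))) \<longlonglongrightarrow> - 0" by (rule tendsto_minus)
  qed
  then show ?thesis by (simp add: conv_def)
qed

lemma integrable_pair_mult:
  fixes f g :: "real \<Rightarrow> real"
  assumes f: "integrable lborel f" and g: "integrable lborel g"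
  shows "integrable (lborel \<Otimes>\<^sub>M lborel) (\<lambda>(x, y). f x * g y)"
proof (rule lborel_pair.Fubini_integrable)
  have [measurable]: "f \<in> borel_measurable borel" "g \<in> borel_measurable borel" using f g by auto
  show "(\<lambda>(x, y). f x * g y) \<in> borel_measurable (lborel \<Otimes>\<^sub>M lborel)" by measurable
qed (use f g in \<open>auto simp: abs_mult\<close>)

text \<open>Fubini's theorem is applied twice. The first exchange produces \<open>P (y - x)\<close>,
  the inverse transform of \<open>a\<close> at \<open>y - x\<close>; the second moves it from the
  test function to \<open>u\<close>. The transforms act on test functions only, as in the definition
  by duality, so none is formed of the merely bounded \<open>u\<close>.\<close>

lemma LP_action:
  assumes a: "integrable lborel a" and Pa: "\<And>x. inverse_fourier (\<lambda>\<xi>. of_real (a \<xi>)) x = of_real (P x)"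
    and P: "dec P" and u: "u \<in> borel_measurable borel" and B: "\<And>x. \<bar>u x\<bar> \<le> B" and \<psi>: "\<psi> \<in> schwartz"
  shows "regular_dist (\<lambda>x. of_real (u x)) (fourier (\<lambda>\<xi>. of_real (a \<xi>) * inverse_fourier \<psi> \<xi>))
    = regular_dist (\<lambda>y. of_real (conv P u y)) \<psi>"
proof -
  note i\<psi> = schwartz_integrable(1)[OF \<psi>]
  have [measurable]: "a \<in> borel_measurable borel" "P \<in> borel_measurable borel" "u \<in> borel_measurable borel" "\<psi> \<in> borel_measurable borel"
    using a dec_measurable[OF P] u schwartz_integrable(2)[OF \<psi>] by auto
  have F: "fourier (\<lambda>\<xi>. of_real (a \<xi>) * inverse_fourier \<psi> \<xi>) x = (LINT y|lborel. \<psi> y * of_real (P (y - x)))" for x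
  proof -
    define f where "f = (\<lambda>\<xi> y. exp (- \<i> * of_real (\<xi> * x)) * of_real (a \<xi>) * (exp (\<i> * of_real (\<xi> * y)) * \<psi> y) / of_real (2 * pi))"
    have nf: "norm (f \<xi> y) = \<bar>a \<xi>\<bar> * norm (\<psi> y) / (2 * pi)" for \<xi> y
      by (simp add: f_def norm_mult norm_divide norm_exp_eq_Re)
    have "integrable (lborel \<Otimes>\<^sub>M lborel) (\<lambda>p. (1 / (2 * pi)) * (case p of (\<xi>, y) \<Rightarrow> \<bar>a \<xi>\<bar> * norm (\<psi> y)))"
      by (intro integrable_mult_right integrable_pair_mult integrable_abs integrable_norm a i\<psi>)
    then have fi: "integrable (lborel \<Otimes>\<^sub>M lborel) (case_prod f)"
    proof (rule Bochner_Integration.integrable_bound)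
      show "case_prod f \<in> borel_measurable (lborel \<Otimes>\<^sub>M lborel)" unfolding f_def by measurable
      show "AE p in lborel \<Otimes>\<^sub>M lborel. norm (case_prod f p) \<le> norm ((1 / (2 * pi)) * (case p of (\<xi>, y) \<Rightarrow> \<bar>a \<xi>\<bar> * norm (\<psi> y)))"
        by (intro AE_I2) (auto simp: nf abs_mult)
    qed
    have "fourier (\<lambda>\<xi>. of_real (a \<xi>) * inverse_fourier \<psi> \<xi>) x = (LINT \<xi>|lborel. LINT y|lborel. f \<xi> y)"
      unfolding fourier_def inverse_fourier_def f_def
      by (rule Bochner_Integration.integral_cong) (simp_all add: mult.assoc)
    also have "\<dots> = (LINT y|lborel. LINT \<xi>|lborel. f \<xi> y)"
      by (rule lborel_pair.Fubini_integral[OF fi, symmetric])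
    also have "\<dots> = (LINT y|lborel. \<psi> y * of_real (P (y - x)))"
    proof (rule Bochner_Integration.integral_cong)
      fix y
      have "f \<xi> y = \<psi> y * (exp (\<i> * of_real ((y - x) * \<xi>)) * of_real (a \<xi>)) / of_real (2 * pi)" for \<xi>
      proof -
        have "exp (- \<i> * of_real (\<xi> * x)) * exp (\<i> * of_real (\<xi> * y)) = exp (\<i> * of_real ((y - x) * \<xi>))"
          by (simp add: algebra_simps flip: exp_add)
        then show ?thesis by (simp add: f_def mult_ac)
      qed
      then show "(LINT \<xi>|lborel. f \<xi> y) = \<psi> y * of_real (P (y - x))"
        unfolding Pa[symmetric] inverse_fourier_def by simp
    qed simp
    finally show ?thesis .
  qed
  define h where "h = (\<lambda>y x. of_real (u x) * (\<psi> y * of_real (P (y - x))))"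
  have nh: "norm (h y x) = norm (\<psi> y) * \<bar>P (y - x) * u x\<bar>" for y x
    by (simp add: h_def norm_mult abs_mult)
  have iPu: "integrable lborel (\<lambda>x. P (y - x) * u x)" for y by (rule conv_integrable(1)[OF P u B])
  have mh[measurable]: "case_prod h \<in> borel_measurable (lborel \<Otimes>\<^sub>M lborel)" unfolding h_def by measurable
  have ih: "integrable (lborel \<Otimes>\<^sub>M lborel) (case_prod h)"
  proof (rule lborel_pair.Fubini_integrable[OF mh])
    have "(LINT x|lborel. norm (case_prod h (y, x))) = norm (\<psi> y) * (LINT x|lborel. \<bar>P (y - x) * u x\<bar>)" for y
      by (simp add: nh)
    moreover have "integrable lborel (\<lambda>y. norm (\<psi> y) * (LINT x|lborel. \<bar>P (y - x) * u x\<bar>))"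
    proof (rule Bochner_Integration.integrable_bound[OF integrable_mult_left[OF integrable_norm[OF i\<psi>], of "B * (LINT x|lborel. \<bar>P x\<bar>)"]])
      have "(LINT x|lborel. \<bar>P (y - x) * u x\<bar>) \<le> B * (LINT x|lborel. \<bar>P x\<bar>)" for y
      proof -
        have "(LINT x|lborel. \<bar>P (y - x) * u x\<bar>) \<le> (LINT x|lborel. B * \<bar>P (y - x)\<bar>)"
          by (rule integral_mono[OF integrable_abs[OF iPu] integrable_mult_right[OF integrable_reflect_shift[OF integrable_abs[OF dec_integrable[OF P]]]]])
             (use B in \<open>auto simp: abs_mult mult.commute[of B] intro!: mult_left_mono\<close>)
        also have "\<dots> = B * (LINT x|lborel. \<bar>P x\<bar>)" using integral_reflect_shift[of "\<lambda>x. \<bar>P x\<bar>" y] by simp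
        finally show ?thesis .
      qed
      then have "\<bar>LINT x|lborel. \<bar>P (y - x) * u x\<bar>\<bar> \<le> \<bar>B * (LINT x|lborel. \<bar>P x\<bar>)\<bar>" for y
        by (metis (no_types, lifting) abs_ge_zero abs_of_nonneg Bochner_Integration.integral_nonneg abs_ge_self order_trans)
      then show "AE y in lborel. norm (norm (\<psi> y) * (LINT x|lborel. \<bar>P (y - x) * u x\<bar>)) \<le> norm (norm (\<psi> y) * (B * (LINT x|lborel. \<bar>P x\<bar>)))"
        unfolding real_norm_def abs_mult[of "norm _"] by (intro AE_I2 mult_left_mono) auto
    qed measurable
    ultimately show "integrable lborel (\<lambda>y. LINT x|lborel. norm (case_prod h (y, x)))" by simp
    show "AE y in lborel. integrable lborel (\<lambda>x. case_prod h (y, x))"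
    proof (intro AE_I2)
      fix y
      have "integrable lborel (\<lambda>x. \<psi> y * of_real (P (y - x) * u x))" by (intro integrable_mult_right integrable_of_real iPu)
      then show "integrable lborel (\<lambda>x. case_prod h (y, x))" by (simp add: h_def mult_ac)
    qed
  qed
  have "regular_dist (\<lambda>x. of_real (u x)) (fourier (\<lambda>\<xi>. of_real (a \<xi>) * inverse_fourier \<psi> \<xi>)) = (LINT x|lborel. LINT y|lborel. h y x)"
    unfolding regular_dist_def F h_def by simp
  also have "\<dots> = (LINT y|lborel. LINT x|lborel. h y x)" by (rule lborel_pair.Fubini_integral[OF ih])
  also have "\<dots> = regular_dist (\<lambda>y. of_real (conv P u y)) \<psi>"
    unfolding regular_dist_def
  proof (rule Bochner_Integration.integral_cong)
    fix y
    have "(LINT x|lborel. h y x) = (LINT x|lborel. \<psi> y * of_real (P (y - x) * u x))"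
      by (rule Bochner_Integration.integral_cong) (auto simp: h_def mult_ac)
    also have "\<dots> = \<psi> y * of_real (conv P u y)" unfolding conv_def integral_complex_of_real[symmetric] by (rule integral_mult_right_zero)
    finally show "(LINT x|lborel. h y x) = of_real (conv P u y) * \<psi> y" by (simp add: mult.commute)
  qed simp
  finally show ?thesis .
qed

lemma closure_support: "closure {\<xi>. f \<xi> \<noteq> 0} \<subseteq> S \<Longrightarrow> \<xi> \<notin> S \<Longrightarrow> f \<xi> = 0"
  using closure_subset[of "{\<xi>. f \<xi> \<noteq> 0}"] by blast

lemma littlewood_paleyD:
  assumes "littlewood_paley chi phi"
  shows "smooth chi" "smooth phi" "\<And>\<xi>. chi (- \<xi>) = chi \<xi>" "\<And>\<xi>. phi (- \<xi>) = phi \<xi>"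
    "\<And>\<xi>. 0 \<le> phi \<xi>" "\<And>\<xi>. \<bar>\<xi>\<bar> > 4 / 3 \<Longrightarrow> chi \<xi> = 0" "\<And>\<xi>. \<bar>\<xi>\<bar> > 8 / 3 \<Longrightarrow> phi \<xi> = 0"
    "\<And>\<xi>. \<bar>\<xi>\<bar> < 3 / 4 \<Longrightarrow> phi \<xi> = 0" "phi (7 / 5) = 1"
proof -
  show *: "smooth chi" "smooth phi" "\<And>\<xi>. chi (- \<xi>) = chi \<xi>" "\<And>\<xi>. phi (- \<xi>) = phi \<xi>"
    "\<And>\<xi>. 0 \<le> phi \<xi>"
    using assms by (auto simp: littlewood_paley_def image_subset_iff)
  have c: "closure {\<xi>. chi \<xi> \<noteq> 0} \<subseteq> {\<xi>. \<bar>\<xi>\<bar> \<le> 4 / 3}"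
    and p: "closure {\<xi>. phi \<xi> \<noteq> 0} \<subseteq> {\<xi>. 3 / 4 \<le> \<bar>\<xi>\<bar> \<and> \<bar>\<xi>\<bar> \<le> 8 / 3}"
    and s: "\<And>\<xi>. (\<lambda>j::nat. phi (\<xi> / 2 ^ j)) sums (1 - chi \<xi>)"
    using assms by (auto simp: littlewood_paley_def)
  show **: "\<And>\<xi>. \<bar>\<xi>\<bar> > 4 / 3 \<Longrightarrow> chi \<xi> = 0" "\<And>\<xi>. \<bar>\<xi>\<bar> > 8 / 3 \<Longrightarrow> phi \<xi> = 0" "\<And>\<xi>. \<bar>\<xi>\<bar> < 3 / 4 \<Longrightarrow> phi \<xi> = 0"
    using closure_support[OF c] closure_support[OF p] by auto
  \<comment> \<open>The point 7/5 lies outside the support of \<open>chi\<close>, and its halvings,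
    being at most 7/10, lie inside the hole of the annulus that supports \<open>phi\<close>. So only
    \<open>j = 0\<close> is left in the partition of unity.\<close>
  have "phi (7 / 5 / 2 ^ j) = 0" if "j \<noteq> 0" for j
  proof (rule **(3))
    have "(2::real) ^ 1 \<le> 2 ^ j" using that by (intro power_increasing) auto
    then show "\<bar>7 / 5 / 2 ^ j\<bar> < (3 / 4 :: real)" by (simp add: field_simps)
  qed
  then have "(\<lambda>j::nat. phi (7 / 5 / 2 ^ j)) sums phi (7 / 5 / 2 ^ 0)" by (intro sums_single[of 0 "\<lambda>j. phi (7 / 5 / 2 ^ j)", THEN sums_cong[THEN iffD1, rotated]]) auto
  then have "phi (7 / 5) = 1 - chi (7 / 5)" using s[of "7 / 5"] sums_unique2 by fastforce
  then show "phi (7 / 5) = 1" using **(1)[of "7 / 5"] by simp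
qed

lemma Re_inverse_fourier_derivative:
  assumes b: "bump b b1 b2 R"
  shows "((\<lambda>x. Re (inverse_fourier b x)) has_real_derivative Re (inverse_fourier (\<lambda>\<xi>. \<i> * of_real \<xi> * b \<xi>) x)) (at x)"
proof -
  have "(inverse_fourier b has_vector_derivative inverse_fourier (\<lambda>\<xi>. \<i> * of_real \<xi> * b \<xi>) x) (at x)"
    using b by (intro inverse_fourier_derivative[OF bump_continuous(1)[OF b], of R]) (auto simp: bump_def)
  from bounded_linear.has_vector_derivative[OF bounded_linear_Re this]
  show ?thesis by (simp add: has_real_derivative_iff_has_vector_derivative)
qed

lemma dec_Re_inverse_fourier:
  assumes b: "bump b b1 b2 R"
  shows "dec (\<lambda>x. Re (inverse_fourier b x))"
proof -
  obtain C where C: "\<And>x. norm (inverse_fourier b x) \<le> C / (1 + x\<^sup>2)" using inverse_fourier_decay[OF b] by blast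
  have "\<bar>Re (inverse_fourier b x)\<bar> \<le> C / (1 + x\<^sup>2)" for x using C[of x] abs_Re_le_cmod order_trans by blast
  moreover have "continuous_on UNIV (\<lambda>x. Re (inverse_fourier b x))"
    by (rule DERIV_continuous_on[OF Re_inverse_fourier_derivative[OF b]])
  ultimately show ?thesis unfolding dec_def by blast
qed

text \<open>The primitive \<open>\<kappa>\<close> of \<open>K\<close> decays because \<open>phi\<close> vanishes near the origin.\<close>

lemma kernels_exist:
  assumes lp: "littlewood_paley chi phi"
  obtains \<kappa> K K' X X' b0 where
    "\<And>x. (\<kappa> has_real_derivative K x) (at x)" "\<And>x. (K has_real_derivative K' x) (at x)" "\<And>x. (X has_real_derivative X' x) (at x)"
    "dec \<kappa>" "dec K" "dec K'" "dec X" "dec X'"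
    "\<And>x. inverse_fourier (\<lambda>\<xi>. of_real (phi \<xi>)) x = of_real (K x)"
    "\<And>x. inverse_fourier (\<lambda>\<xi>. of_real (chi \<xi>)) x = of_real (X x)"
    "\<kappa> b0 \<noteq> 0"
proof -
  note L = littlewood_paleyD[OF lp]
  have b\<kappa>: "bump (\<lambda>\<xi>. (- \<i>) * of_real (phi \<xi> / \<xi>)) (\<lambda>\<xi>. (- \<i>) * of_real (D phi \<xi> / \<xi> - phi \<xi> / \<xi>\<^sup>2))
      (\<lambda>\<xi>. (- \<i>) * of_real ((D ^^ 2) phi \<xi> / \<xi> - 2 * D phi \<xi> / \<xi>\<^sup>2 + 2 * phi \<xi> / \<xi> ^ 3)) (8 / 3 + 1)"
    by (rule smooth_bump(3)[where d="3/4"]) (use L in auto)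
  have bK: "bump (\<lambda>\<xi>. 1 * of_real (phi \<xi>)) (\<lambda>\<xi>. 1 * of_real (D phi \<xi>)) (\<lambda>\<xi>. 1 * of_real ((D ^^ 2) phi \<xi>)) (8 / 3 + 1)"
    by (rule smooth_bump(1)) (use L in auto)
  have bK': "bump (\<lambda>\<xi>. \<i> * of_real (\<xi> * phi \<xi>)) (\<lambda>\<xi>. \<i> * of_real (phi \<xi> + \<xi> * D phi \<xi>))
      (\<lambda>\<xi>. \<i> * of_real (2 * D phi \<xi> + \<xi> * (D ^^ 2) phi \<xi>)) (8 / 3 + 1)"
    by (rule smooth_bump(2)) (use L in auto)
  have bX: "bump (\<lambda>\<xi>. 1 * of_real (chi \<xi>)) (\<lambda>\<xi>. 1 * of_real (D chi \<xi>)) (\<lambda>\<xi>. 1 * of_real ((D ^^ 2) chi \<xi>)) (4 / 3 + 1)"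
    by (rule smooth_bump(1)) (use L in auto)
  have bX': "bump (\<lambda>\<xi>. \<i> * of_real (\<xi> * chi \<xi>)) (\<lambda>\<xi>. \<i> * of_real (chi \<xi> + \<xi> * D chi \<xi>))
      (\<lambda>\<xi>. \<i> * of_real (2 * D chi \<xi> + \<xi> * (D ^^ 2) chi \<xi>)) (4 / 3 + 1)"
    by (rule smooth_bump(2)) (use L in auto)
  define \<kappa> where "\<kappa> = (\<lambda>x. Re (inverse_fourier (\<lambda>\<xi>. (- \<i>) * of_real (phi \<xi> / \<xi>)) x))"
  define K where "K = (\<lambda>x. Re (inverse_fourier (\<lambda>\<xi>. 1 * of_real (phi \<xi>)) x))"
  define K' where "K' = (\<lambda>x. Re (inverse_fourier (\<lambda>\<xi>. \<i> * of_real (\<xi> * phi \<xi>)) x))"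
  define X where "X = (\<lambda>x. Re (inverse_fourier (\<lambda>\<xi>. 1 * of_real (chi \<xi>)) x))"
  define X' where "X' = (\<lambda>x. Re (inverse_fourier (\<lambda>\<xi>. \<i> * of_real (\<xi> * chi \<xi>)) x))"
  have "(\<lambda>\<xi>. \<i> * of_real \<xi> * ((- \<i>) * of_real (phi \<xi> / \<xi>))) = (\<lambda>\<xi>. 1 * complex_of_real (phi \<xi>))"
  proof
    show "\<i> * of_real \<xi> * ((- \<i>) * of_real (phi \<xi> / \<xi>)) = 1 * complex_of_real (phi \<xi>)" for \<xi>
      using L(8)[of 0] by (cases "\<xi> = 0") (auto simp: field_simps)
  qed
  then have d\<kappa>: "(\<kappa> has_real_derivative K x) (at x)" for x
    using Re_inverse_fourier_derivative[OF b\<kappa>, of x] by (simp only: \<kappa>_def K_def)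
  have "(\<lambda>\<xi>. \<i> * of_real \<xi> * (1 * complex_of_real (f \<xi>))) = (\<lambda>\<xi>. \<i> * of_real (\<xi> * f \<xi>))" for f by auto
  then have dK: "(K has_real_derivative K' x) (at x)" and dX: "(X has_real_derivative X' x) (at x)" for x
    using Re_inverse_fourier_derivative[OF bK, of x] Re_inverse_fourier_derivative[OF bX, of x]
    by (simp_all only: X_def X'_def K_def K'_def)
  \<comment> \<open>Otherwise \<open>K\<close>, the derivative of \<open>\<kappa>\<close>, would
    vanish. But \<open>K 0\<close> is the integral of \<open>phi\<close> divided by
    \<open>2 * pi\<close>, and \<open>phi\<close> is continuous, nonnegative and equal to 1 at
    7/5.\<close>
  have "\<exists>b0. \<kappa> b0 \<noteq> 0"
  proof (rule ccontr)
    assume "\<not> ?thesis"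
    then have "\<kappa> = (\<lambda>x. 0)" by auto
    then have "K 0 = 0" using d\<kappa>[of 0] DERIV_unique[OF _ DERIV_const] by metis
    have cphi: "continuous_on UNIV phi" using smooth_has_derivative[OF L(2), of 0] by (intro DERIV_continuous_on) simp
    have cb: "continuous_on UNIV (\<lambda>\<xi>. 1 * complex_of_real (phi \<xi>))" by (intro continuous_intros cphi)
    have "inverse_fourier (\<lambda>\<xi>. 1 * complex_of_real (phi \<xi>)) 0 = integral {-3..3} (\<lambda>\<xi>. exp (\<i> * of_real (0 * \<xi>)) * (1 * complex_of_real (phi \<xi>))) / of_real (2 * pi)"
      by (rule inverse_fourier_compact[OF cb]) (use L(7) in auto)
    then have "K 0 = Re (integral {-3..3} (\<lambda>\<xi>. complex_of_real (phi \<xi>))) / (2 * pi)" by (simp add: K_def Re_divide_of_real)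
    also have "integral {-3..3} (\<lambda>\<xi>. complex_of_real (phi \<xi>)) = of_real (integral {-3..3} phi)"
      using integral_linear[OF integrable_continuous_real[OF continuous_on_subset[OF cphi]] bounded_linear_of_real[where 'a=complex], of "-3" 3]
      by (simp add: o_def)
    finally have "integral {-3..3} phi = 0" using \<open>K 0 = 0\<close> by simp
    then have "(phi has_integral 0) (cbox (-3) 3)"
      using integrable_integral[OF integrable_continuous_real[OF continuous_on_subset[OF cphi]], of "-3" 3] by simp
    from has_integral_0_cbox_imp_0[OF continuous_on_subset[OF cphi] L(5) this, of "7 / 5"]
    show False using L(9) by (auto simp: box_ne_empty)
  qed
  then obtain b0 where "\<kappa> b0 \<noteq> 0" by blast
  moreover have "inverse_fourier (\<lambda>\<xi>. of_real (phi \<xi>)) x = of_real (K x)" "inverse_fourier (\<lambda>\<xi>. of_real (chi \<xi>)) x = of_real (X x)" for x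
    using inverse_fourier_even_real[of phi x, OF L(4)] inverse_fourier_even_real[of chi x, OF L(3)] by (simp_all add: K_def X_def)
  moreover have "dec \<kappa>" "dec K" "dec K'" "dec X" "dec X'"
    unfolding \<kappa>_def K_def K'_def X_def X'_def
    by (rule dec_Re_inverse_fourier[OF b\<kappa>] dec_Re_inverse_fourier[OF bK] dec_Re_inverse_fourier[OF bK']
        dec_Re_inverse_fourier[OF bX] dec_Re_inverse_fourier[OF bX'])+
  ultimately show ?thesis using that d\<kappa> dK dX by blast
qed

section \<open>Besov norms through the kernels of the blocks\<close>

locale lp_kernels =
  fixes chi phi :: "real \<Rightarrow> real" and \<kappa> K K' X X' :: "real \<Rightarrow> real"
  assumes lp: "littlewood_paley chi phi"
    and d\<kappa>: "\<And>x. (\<kappa> has_real_derivative K x) (at x)" and dK: "\<And>x. (K has_real_derivative K' x) (at x)"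
    and dX: "\<And>x. (X has_real_derivative X' x) (at x)"
    and decs: "dec \<kappa>" "dec K" "dec K'" "dec X" "dec X'"
    and FK: "\<And>x. inverse_fourier (\<lambda>\<xi>. of_real (phi \<xi>)) x = of_real (K x)"
    and FX: "\<And>x. inverse_fourier (\<lambda>\<xi>. of_real (chi \<xi>)) x = of_real (X x)"
begin

text \<open>The kernel of the block of index \<open>n - 1\<close>, numbered as in the sum of
  \<open>besov_norm\<close>: 0 is the low-frequency block, and \<open>Suc k\<close> is the block at
  frequency \<open>2 ^ k\<close>. Its symbol is \<open>symb n\<close>.\<close>

definition blk :: "nat \<Rightarrow> real \<Rightarrow> real" where
  "blk n x = (if n = 0 then X x else 2 ^ (n - 1) * K (2 ^ (n - 1) * x))"

definition symb :: "nat \<Rightarrow> real \<Rightarrow> real" where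
  "symb n = (if n = 0 then chi else (\<lambda>\<xi>. phi (\<xi> / 2 ^ (n - 1))))"

lemma dec_blk: "dec (blk n)"
proof (cases "n = 0")
  case True
  then have "blk n = X" by (auto simp: blk_def)
  then show ?thesis using decs by simp
next
  case False
  then have "blk n = (\<lambda>x. 2 ^ (n - 1) * K (2 ^ (n - 1) * x))" by (auto simp: blk_def)
  moreover have "dec \<dots>" by (rule dec_scale[OF decs(2)]) simp
  ultimately show ?thesis by simp
qed

lemma symb_integrable: "integrable lborel (symb n)"
proof -
  have i: "integrable lborel f" if f: "smooth f" and v: "\<And>\<xi>. \<bar>\<xi>\<bar> > 3 \<Longrightarrow> f \<xi> = 0" for f :: "real \<Rightarrow> real"
  proof -
    have c: "continuous_on UNIV f" using smooth_has_derivative[OF f, of 0] by (intro DERIV_continuous_on) simp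
    have "integrable lborel (\<lambda>\<xi>. indicator {-3..3} \<xi> *\<^sub>R f \<xi>)"
      by (rule borel_integrable_compact) (auto intro: continuous_on_subset[OF c])
    moreover have "(\<lambda>\<xi>. indicator {-3..3} \<xi> *\<^sub>R f \<xi>) = f"
    proof
      fix \<xi>
      show "indicator {-3..3} \<xi> *\<^sub>R f \<xi> = f \<xi>" using v[of \<xi>] by (cases "\<xi> \<in> {-3..3}") auto
    qed
    ultimately show ?thesis by simp
  qed
  note L = littlewood_paleyD[OF lp]
  have ic: "integrable lborel chi" and ip: "integrable lborel phi" using i[of chi] i[of phi] L by auto
  show ?thesis
    using ic lborel_integrable_real_affine[OF ip, of "1 / 2 ^ (n - 1)" 0] by (auto simp: symb_def)
qed

lemma symb_fourier: "inverse_fourier (\<lambda>\<xi>. of_real (symb n \<xi>)) x = of_real (blk n x)"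
proof (cases "n = 0")
  case True
  then show ?thesis using FX by (simp add: symb_def blk_def)
next
  case False
  define q :: real where "q = 2 ^ (n - 1)"
  have q: "q > 0" by (simp add: q_def)
  let ?f = "\<lambda>\<xi>. exp (\<i> * of_real (x * \<xi>)) * complex_of_real (phi (\<xi> / q))"
  have "(LINT \<xi>|lborel. ?f \<xi>) = q *\<^sub>R (LINT \<eta>|lborel. ?f (0 + q * \<eta>))"
    using lborel_integral_real_affine[of q ?f 0] q by simp
  also have "(LINT \<eta>|lborel. ?f (0 + q * \<eta>)) = (LINT \<eta>|lborel. exp (\<i> * of_real ((q * x) * \<eta>)) * of_real (phi \<eta>))"
    by (rule Bochner_Integration.integral_cong) (use q in \<open>auto simp: mult_ac\<close>)
  finally have "inverse_fourier (\<lambda>\<xi>. of_real (phi (\<xi> / q))) x = of_real q * inverse_fourier (\<lambda>\<xi>. of_real (phi \<xi>)) (q * x)"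
    by (simp add: inverse_fourier_def scaleR_conv_of_real)
  then show ?thesis using False by (simp add: symb_def blk_def FK q_def)
qed

lemma LP_block_eq:
  "LP_block chi phi (int n - 1) U \<psi> = U (fourier (\<lambda>\<xi>. of_real (symb n \<xi>) * inverse_fourier \<psi> \<xi>))"
proof -
  have "(if int n - 1 = -1 then chi else (\<lambda>\<xi>. phi (2 powi (- (int n - 1)) * \<xi>))) = symb n"
  proof (cases n)
    case (Suc k)
    have "2 powi (- int k) = (1 / 2 ^ k :: real)"
      by (simp add: power_int_minus inverse_eq_divide)
    then show ?thesis using Suc by (auto simp: symb_def)
  qed (simp add: symb_def)
  then show ?thesis
    by (simp add: LP_block_def inverse_fourier_dist_def mult_dist_def fourier_dist_def)
qed

lemma Cinf_lipschitz:
  assumes u: "u \<in> Cinf"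
  obtains L where "\<And>x y. \<bar>u x - u y\<bar> \<le> L * \<bar>x - y\<bar>"
proof -
  obtain L where L: "\<And>x. \<bar>D u x\<bar> \<le> L" using Cinf_bounded[OF u, of 1] by auto
  have "norm (u x - u y) \<le> L * norm (x - y)" for x y
  proof (rule field_differentiable_bound[OF convex_UNIV])
    show "(u has_real_derivative D u x) (at x within UNIV)" for x using Cinf_derivative[OF u, of 0 x] by simp
  qed (use L in auto)
  then have "\<bar>u x - u y\<bar> \<le> L * \<bar>x - y\<bar>" for x y by simp
  then show ?thesis by (rule that)
qed

lemma Cinf_measurable: "u \<in> Cinf \<Longrightarrow> u \<in> borel_measurable borel"
  using Cinf_continuous[of u 0] by (auto intro: borel_measurable_continuous_onI)

lemma block_action:
  assumes u: "u \<in> Cinf" and \<psi>: "\<psi> \<in> schwartz"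
  shows "LP_block chi phi (int n - 1) (regular_dist (\<lambda>x. of_real (u x))) \<psi> = regular_dist (\<lambda>y. of_real (conv (blk n) u y)) \<psi>"
proof -
  obtain B where B: "\<And>x. \<bar>u x\<bar> \<le> B" using Cinf_bounded[OF u, of 0] by auto
  show ?thesis unfolding LP_block_eq
    by (rule LP_action[OF symb_integrable symb_fourier dec_blk Cinf_measurable[OF u] B \<psi>])
qed

lemma block_norm_le:
  assumes u: "u \<in> Cinf" and S: "\<And>y. \<bar>conv (blk n) u y\<bar> \<le> S"
  shows "Linf_norm (LP_block chi phi (int n - 1) (regular_dist (\<lambda>x. of_real (u x)))) \<le> ennreal S"
proof (rule Linf_norm_le[OF _ S block_action[OF u]])
  have [measurable]: "blk n \<in> borel_measurable borel" "u \<in> borel_measurable borel"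
    using dec_measurable[OF dec_blk] Cinf_measurable[OF u] by auto
  show "conv (blk n) u \<in> borel_measurable borel" unfolding conv_def by measurable
qed

lemma block_norm_ge:
  assumes u: "u \<in> Cinf"
  shows "ennreal \<bar>conv (blk n) u y\<bar> \<le> Linf_norm (LP_block chi phi (int n - 1) (regular_dist (\<lambda>x. of_real (u x))))"
proof -
  obtain B where B: "\<And>x. \<bar>u x\<bar> \<le> B" using Cinf_bounded[OF u, of 0] by auto
  obtain L where L: "\<And>x y. \<bar>u x - u y\<bar> \<le> L * \<bar>x - y\<bar>" using Cinf_lipschitz[OF u] by metis
  show ?thesis
    by (rule Linf_norm_ge[OF conv_lipschitz[OF dec_blk Cinf_measurable[OF u] B L]
          conv_integrable(2)[OF dec_blk Cinf_measurable[OF u] B] block_action[OF u]])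
qed

definition k0 where "k0 = (LINT x|lborel. \<bar>\<kappa> x\<bar>)"
definition k1 where "k1 = (LINT x|lborel. \<bar>K x\<bar>)"
definition k2 where "k2 = (LINT x|lborel. \<bar>K' x\<bar>)"
definition x1 where "x1 = (LINT x|lborel. \<bar>X' x\<bar>)"

lemma k_nonneg: "0 \<le> k0" "0 \<le> k1" "0 \<le> k2" "0 \<le> x1"
  unfolding k0_def k1_def k2_def x1_def by (auto intro: Bochner_Integration.integral_nonneg)

lemma blk_Suc: "blk (Suc n) = (\<lambda>x. 2 ^ n * K (2 ^ n * x))"
  by (auto simp: blk_def)

lemma scaled:
  "((\<lambda>x. \<kappa> (2 ^ n * x)) has_real_derivative blk (Suc n) x) (at x)"
  "(blk (Suc n) has_real_derivative (2 ^ n)\<^sup>2 * K' (2 ^ n * x)) (at x)"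
  "dec (\<lambda>x. \<kappa> (2 ^ n * x))" "dec (\<lambda>x. (2 ^ n)\<^sup>2 * K' (2 ^ n * x))"
proof -
  have lin: "((\<lambda>x. 2 ^ n * x) has_real_derivative 2 ^ n) (at x)"
    by (auto intro!: derivative_eq_intros)
  show "((\<lambda>x. \<kappa> (2 ^ n * x)) has_real_derivative blk (Suc n) x) (at x)"
    unfolding blk_Suc by (rule DERIV_cong[OF DERIV_chain2[OF d\<kappa> lin]]) simp
  show "(blk (Suc n) has_real_derivative (2 ^ n)\<^sup>2 * K' (2 ^ n * x)) (at x)"
    unfolding blk_Suc by (rule DERIV_cong[OF DERIV_cmult[OF DERIV_chain2[OF dK lin]]]) (simp add: power2_eq_square)
  show "dec (\<lambda>x. \<kappa> (2 ^ n * x))" using dec_scale[OF decs(1), of "2 ^ n" 1] by simp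
  show "dec (\<lambda>x. (2 ^ n)\<^sup>2 * K' (2 ^ n * x))" by (rule dec_scale[OF decs(3)]) simp
qed

lemma blk_L1: "(LINT x|lborel. \<bar>blk (Suc n) x\<bar>) = k1"
  unfolding blk_Suc k1_def by (subst integral_abs_scale) auto

text \<open>The kernel is the derivative of \<open>\<kappa> (2 ^ n * x)\<close>, whose absolute
  value has integral \<open>k0 / 2 ^ n\<close>; this derivative is moved to
  \<open>g\<close>.\<close>

lemma conv_blk_high:
  assumes g: "\<And>x. (g has_real_derivative g' x) (at x)" "continuous_on UNIV g'"
    and B: "\<And>x. \<bar>g x\<bar> \<le> B" "\<And>x. \<bar>g' x\<bar> \<le> B'"
  shows "\<bar>conv (blk (Suc n)) g y\<bar> \<le> B' * k0 / 2 ^ n"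
proof -
  have "conv (blk (Suc n)) g y = conv (\<lambda>x. \<kappa> (2 ^ n * x)) g' y"
    by (rule conv_by_parts[OF scaled(1,3) dec_blk g B, symmetric])
  moreover have "g' \<in> borel_measurable borel" by (rule borel_measurable_continuous_onI[OF g(2)])
  from conv_integrable(2)[OF scaled(3) this B(2), of n y]
  have "\<bar>conv (\<lambda>x. \<kappa> (2 ^ n * x)) g' y\<bar> \<le> B' * (LINT x|lborel. \<bar>1 * \<kappa> (2 ^ n * x)\<bar>)" by simp
  then have "\<bar>conv (\<lambda>x. \<kappa> (2 ^ n * x)) g' y\<bar> \<le> B' * k0 / 2 ^ n"
    by (subst (asm) integral_abs_scale) (auto simp: k0_def)
  ultimately show ?thesis by simp
qed

text \<open>Here the derivative is moved from \<open>g\<close> to the kernel, at the cost of a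
  factor \<open>2 ^ n\<close>, or of a constant for the low-frequency block.\<close>

lemma conv_blk_low:
  assumes g: "\<And>x. (g has_real_derivative g' x) (at x)" "continuous_on UNIV g'"
    and B: "\<And>x. \<bar>g x\<bar> \<le> B" "\<And>x. \<bar>g' x\<bar> \<le> B'"
  shows "\<bar>conv (blk (Suc n)) g' y\<bar> \<le> B * k2 * 2 ^ n" "\<bar>conv (blk 0) g' y\<bar> \<le> B * x1"
proof -
  have mg: "g \<in> borel_measurable borel" by (rule borel_measurable_continuous_onI[OF DERIV_continuous_on[OF g(1)]])
  have "conv (blk (Suc n)) g' y = conv (\<lambda>x. (2 ^ n)\<^sup>2 * K' (2 ^ n * x)) g y"
    by (rule conv_by_parts[OF scaled(2) dec_blk scaled(4) g B])
  moreover have "\<bar>conv (\<lambda>x. (2 ^ n)\<^sup>2 * K' (2 ^ n * x)) g y\<bar> \<le> B * ((2 ^ n)\<^sup>2 / 2 ^ n * k2)"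
    using conv_integrable(2)[OF scaled(4) mg B(1), of n y] by (subst (asm) integral_abs_scale) (auto simp: k2_def)
  ultimately show "\<bar>conv (blk (Suc n)) g' y\<bar> \<le> B * k2 * 2 ^ n" by (simp add: power2_eq_square mult_ac)
  have "blk 0 = X" by (auto simp: blk_def)
  then have "conv (blk 0) g' y = conv X' g y"
    using conv_by_parts[OF dX decs(4,5) g B] by simp
  then show "\<bar>conv (blk 0) g' y\<bar> \<le> B * x1"
    using conv_integrable(2)[OF decs(5) mg B(1), of y] by (simp add: x1_def)
qed

lemma dyadic_sum_le: "(\<Sum>n<k. (if n \<le> m then 2 ^ n / 2 ^ m else 2 ^ m / 2 ^ n :: real)) \<le> 3"
proof -
  \<comment> \<open>A closed form strong enough for induction: the terms up to \<open>m\<close> sum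
    to at most 2, the later ones to at most 1.\<close>
  have "(\<Sum>n<k. (if n \<le> m then 2 ^ n / 2 ^ m else 2 ^ m / 2 ^ n :: real)) \<le> (if k \<le> m + 1 then 2 ^ k / 2 ^ m else 3 - 2 ^ m * 2 / 2 ^ k)"
  proof (induction k)
    case (Suc k)
    consider "k + 1 \<le> m + 1" | "k = m + 1" | "k > m + 1" by linarith
    then show ?case
    proof cases
      case 1
      then show ?thesis using Suc by (auto simp: field_simps)
    next
      case 2
      then show ?thesis using Suc by (auto simp: field_simps)
    next
      case 3
      then have "\<not> k \<le> m" "\<not> k \<le> m + 1" "\<not> Suc k \<le> m + 1" by auto
      then show ?thesis using Suc by simp
    qed
  qed simp
  also have "\<dots> \<le> 3"
  proof (cases "k \<le> m + 1")
    case True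
    then have "(2::real) ^ k \<le> 2 ^ (m + 1)" by (intro power_increasing) auto
    moreover have "(2::real) ^ m > 0" by simp
    ultimately have "(2::real) ^ k \<le> 3 * 2 ^ m" unfolding power_add power_one_right by linarith
    then show ?thesis using True by (simp add: divide_le_eq)
  qed simp
  finally show ?thesis .
qed

text \<open>A function of size \<open>A\<close> concentrated at frequency \<open>2 ^ m\<close> has a
  primitive of size \<open>A / 2 ^ m\<close> and a derivative of size \<open>A * 2 ^ m\<close>. The
  blocks below that frequency are estimated through the primitive, those above through the
  derivative, and both families sum geometrically.\<close>

lemma besov_norm_le:
  assumes u: "u \<in> Cinf" and g: "\<And>x. (g has_real_derivative u x) (at x)"
    and gb: "\<And>x. \<bar>g x\<bar> \<le> A / 2 ^ m" and ub: "\<And>x. \<bar>D u x\<bar> \<le> A * 2 ^ m"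
  shows "besov_norm chi phi u \<le> ennreal (6 * (k0 + k2 + x1) * A)"
proof -
  obtain B where B: "\<And>x. \<bar>u x\<bar> \<le> B" using Cinf_bounded[OF u, of 0] by auto
  have "0 \<le> A / 2 ^ m * 2 ^ m" using order_trans[OF abs_ge_zero gb[of 0]] by (rule mult_nonneg_nonneg) simp
  then have A: "A \<ge> 0" by simp
  have cu: "continuous_on UNIV u" "continuous_on UNIV (D u)" using Cinf_continuous[OF u, of 0] Cinf_continuous[OF u, of 1] by auto
  have du: "(u has_real_derivative D u x) (at x)" for x using Cinf_derivative[OF u, of 0] by simp
  define c where "c = k0 + k2 + x1"
  have c: "k0 \<le> c" "k2 \<le> c" "x1 \<le> c" "0 \<le> c" using k_nonneg by (auto simp: c_def)
  \<comment> \<open>The 2 that accompanies \<open>\<beta>\<close> below comes from the shifted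
    index, since block \<open>Suc k\<close> has frequency \<open>2 ^ k\<close>. Together with the
    dyadic sum 3 it makes the 6 of the claim.\<close>
  define \<beta> where "\<beta> n = (if n \<le> m then 2 ^ n / 2 ^ m else 2 ^ m / 2 ^ n :: real)" for n
  have blk: "Linf_norm (LP_block chi phi (int n - 1) (regular_dist (\<lambda>x. of_real (u x)))) \<le> ennreal (2 * c * A * \<beta> n)" for n
  proof (rule block_norm_le[OF u])
    fix y
    show "\<bar>conv (blk n) u y\<bar> \<le> 2 * c * A * \<beta> n"
    proof (cases n)
      case 0
      have "\<bar>conv (blk 0) u y\<bar> \<le> A / 2 ^ m * x1" by (rule conv_blk_low(2)[OF g cu(1) gb B])
      also have "\<dots> \<le> A / 2 ^ m * (2 * c)" using A c by (intro mult_left_mono) auto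
      finally show ?thesis using 0 by (simp add: \<beta>_def mult_ac)
    next
      case (Suc k)
      show ?thesis
      proof (cases "n \<le> m")
        case True
        have "\<bar>conv (blk n) u y\<bar> \<le> A / 2 ^ m * k2 * 2 ^ k" unfolding Suc by (rule conv_blk_low(1)[OF g cu(1) gb B])
        also have "\<dots> \<le> A / 2 ^ m * c * 2 ^ k" using A c by (intro mult_right_mono mult_left_mono) auto
        also have "\<dots> \<le> 2 * c * A * \<beta> n" using True A c Suc by (simp add: \<beta>_def field_simps)
        finally show ?thesis .
      next
        case False
        have "\<bar>conv (blk n) u y\<bar> \<le> A * 2 ^ m * k0 / 2 ^ k" unfolding Suc by (rule conv_blk_high[OF du cu(2) B ub])
        also have "\<dots> \<le> A * 2 ^ m * c / 2 ^ k" using A c by (intro divide_right_mono mult_left_mono) auto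
        also have "\<dots> = 2 * c * A * \<beta> n" using False Suc by (simp add: \<beta>_def)
        finally show ?thesis .
      qed
    qed
  qed
  have "besov_norm chi phi u \<le> (\<Sum>n. ennreal (2 * c * A * \<beta> n))"
    unfolding besov_norm_def by (intro suminf_le blk summableI)
  also have "\<dots> \<le> ennreal (6 * c * A)"
  proof (rule suminf_le_const[OF summableI])
    fix k
    have "(\<Sum>n<k. ennreal (2 * c * A * \<beta> n)) = ennreal (\<Sum>n<k. 2 * c * A * \<beta> n)"
      using A c by (intro sum_ennreal) (auto simp: \<beta>_def)
    also have "(\<Sum>n<k. 2 * c * A * \<beta> n) = 2 * c * A * (\<Sum>n<k. \<beta> n)" by (simp add: sum_distrib_left)
    also have "ennreal \<dots> \<le> ennreal (2 * c * A * 3)"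
      using A c dyadic_sum_le[of m k] by (intro ennreal_leI mult_left_mono) (auto simp: \<beta>_def)
    finally show "(\<Sum>n<k. ennreal (2 * c * A * \<beta> n)) \<le> ennreal (6 * c * A)" by (simp add: mult_ac)
  qed
  finally show ?thesis by (simp add: c_def)
qed

lemma besov_norm_ge:
  assumes u: "u \<in> Cinf" and fin: "finite I" and y: "\<And>n. n \<in> I \<Longrightarrow> c \<le> \<bar>conv (blk n) u (y n)\<bar>" and c: "0 \<le> c"
  shows "ennreal (real (card I) * c) \<le> besov_norm chi phi u"
proof -
  have "ennreal (real (card I) * c) = (\<Sum>n\<in>I. ennreal c)" using c by (simp add: ennreal_mult ennreal_of_nat_eq_real_of_nat)
  also have "\<dots> \<le> (\<Sum>n\<in>I. Linf_norm (LP_block chi phi (int n - 1) (regular_dist (\<lambda>x. of_real (u x)))))"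
    by (intro sum_mono order_trans[OF ennreal_leI[OF y] block_norm_ge[OF u]])
  also have "\<dots> \<le> besov_norm chi phi u"
    unfolding besov_norm_def by (intro sum_le_suminf summableI fin) auto
  finally show ?thesis .
qed

text \<open>A jump of height \<open>c\<close> at \<open>y0\<close>, probed at distance
  \<open>b / 2 ^ n\<close>, answers with \<open>c * \<kappa> b\<close> in every block. The rest is
  measured as the block sees it: \<open>w'\<close> through its primitive, \<open>g\<close> through
  its derivative, the layer \<open>s'\<close> by its integral against the supremum of the kernel,
  and \<open>E\<close> uniformly against the integral of the kernel.\<close>

lemma block_lower_bound:
  assumes v: "v \<in> Cinf"
    and w: "\<And>x. (w has_real_derivative w' x) (at x)" "continuous_on UNIV w'" "\<And>x. \<bar>w x\<bar> \<le> W" "\<And>x. \<bar>w' x\<bar> \<le> W'"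
    and g: "\<And>x. (g has_real_derivative g' x) (at x)" "continuous_on UNIV g'" "\<And>x. \<bar>g x\<bar> \<le> G" "\<And>x. \<bar>g' x\<bar> \<le> G'"
    and s: "\<And>x. (s has_real_derivative s' x) (at x)" "continuous_on UNIV s'" "\<And>x. 0 \<le> s' x" "\<And>x. \<bar>s x\<bar> \<le> S" "\<And>x. s' x \<le> S'"
    and dec: "\<And>x. \<bar>v x - w' x - g x - c * indicator {y0..} x\<bar> \<le> s' x + E"
    and Kb: "\<And>x. \<bar>K x\<bar> \<le> Km"
  shows "\<bar>conv (blk (Suc n)) v (y0 + b / 2 ^ n)\<bar> \<ge>
    \<bar>c\<bar> * \<bar>\<kappa> b\<bar> - (W * k2 * 2 ^ n + G' * k0 / 2 ^ n + 2 * S * Km * 2 ^ n + E * k1)"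
proof -
  define y where "y = y0 + b / 2 ^ n"
  let ?P = "blk (Suc n)"
  have mP[measurable]: "?P \<in> borel_measurable borel" by (rule dec_measurable[OF dec_blk])
  have mm: "v \<in> borel_measurable borel" "w' \<in> borel_measurable borel" "g \<in> borel_measurable borel" "s' \<in> borel_measurable borel"
    using Cinf_measurable[OF v] w(2) s(2) DERIV_continuous_on[OF g(1)] by (auto intro: borel_measurable_continuous_onI)
  note mm[measurable]
  obtain B where B: "\<And>x. \<bar>v x\<bar> \<le> B" using Cinf_bounded[OF v, of 0] by auto
  have iv: "integrable lborel (\<lambda>x. ?P (y - x) * v x)" by (rule conv_integrable(1)[OF dec_blk mm(1) B])
  have iw: "integrable lborel (\<lambda>x. ?P (y - x) * w' x)" by (rule conv_integrable(1)[OF dec_blk mm(2) w(4)])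
  have ig: "integrable lborel (\<lambda>x. ?P (y - x) * g x)" by (rule conv_integrable(1)[OF dec_blk mm(3) g(3)])
  have ii: "integrable lborel (\<lambda>x. ?P (y - x) * (c * indicator {y0..} x))"
    by (rule conv_integrable(1)[OF dec_blk, where B="\<bar>c\<bar>"]) (auto simp: indicator_def)
  have iP: "integrable lborel (\<lambda>x. \<bar>?P (y - x)\<bar>)" by (intro integrable_reflect_shift integrable_abs dec_integrable[OF dec_blk])
  have bs: "integrable lborel s'" and Is: "(LINT x|lborel. s' x) \<le> 2 * S"
  proof -
    \<comment> \<open>The function \<open>s'\<close> is nonnegative with a bounded primitive, so its
      integrals over growing intervals increase and stay below \<open>2 * S\<close>. Monotone
      convergence then gives integrability as well as the bound.\<close>
    have nn: "(\<integral>\<^sup>+x. ennreal (s' x) \<partial>lborel) \<le> ennreal (2 * S)"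
    proof -
      have "(\<integral>\<^sup>+x. ennreal (s' x) * indicator {-real k..real k} x \<partial>lborel) \<le> ennreal (2 * S)" for k
      proof -
        have "(\<integral>\<^sup>+x. ennreal (s' x) * indicator {-real k..real k} x \<partial>lborel) = ennreal (s (real k) - s (- real k))"
          by (rule nn_integral_FTC_Icc) (use s in auto)
        also have "\<dots> \<le> ennreal (2 * S)"
          using s(4)[of "real k"] s(4)[of "- real k"] by (intro ennreal_leI) linarith
        finally show ?thesis .
      qed
      moreover have "(\<lambda>k. \<integral>\<^sup>+x. ennreal (s' x) * indicator {-real k..real k} x \<partial>lborel) \<longlonglongrightarrow> (\<integral>\<^sup>+x. ennreal (s' x) \<partial>lborel)"
      proof (rule nn_integral_LIMSEQ)
        show "incseq (\<lambda>k x. ennreal (s' x) * indicator {-real k..real k} x)"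
          by (auto simp: incseq_def le_fun_def indicator_def)
        show "(\<lambda>k. ennreal (s' x) * indicator {-real k..real k} x) \<longlonglongrightarrow> ennreal (s' x)" for x
        proof (rule tendsto_eventually)
          show "\<forall>\<^sub>F k in sequentially. ennreal (s' x) * indicator {-real k..real k} x = ennreal (s' x)"
            by (rule eventually_mono[OF eventually_ge_at_top[of "nat \<lceil>\<bar>x\<bar>\<rceil>"]])
               (auto simp: indicator_def nat_le_iff ceiling_le_iff)
        qed
      qed measurable
      ultimately show ?thesis by (intro LIMSEQ_le_const2) auto
    qed
    show i: "integrable lborel s'"
      by (rule integrableI_nonneg) (use mm s(3) nn in \<open>auto intro: le_less_trans\<close>)
    have "ennreal (LINT x|lborel. s' x) \<le> ennreal (2 * S)"
      using nn nn_integral_eq_integral[OF i] s(3) by simp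
    moreover have "0 \<le> S" using order_trans[OF abs_ge_zero s(4)] .
    ultimately show "(LINT x|lborel. s' x) \<le> 2 * S" by simp
  qed
  have Km: "0 \<le> Km" using order_trans[OF abs_ge_zero Kb] .
  have Pb: "\<bar>?P x\<bar> \<le> 2 ^ n * Km" for x unfolding blk_Suc abs_mult using Kb by (simp add: mult_left_mono)
  have cw: "\<bar>conv ?P w' y\<bar> \<le> W * k2 * 2 ^ n" by (rule conv_blk_low(1)[OF w])
  have cg: "\<bar>conv ?P g y\<bar> \<le> G' * k0 / 2 ^ n" by (rule conv_blk_high[OF g])
  have ci: "(LINT x|lborel. ?P (y - x) * (c * indicator {y0..} x)) = c * \<kappa> b"
  proof -
    have "conv ?P (indicator {y0..}) y = \<kappa> (2 ^ n * (y - y0))"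
      by (rule conv_halfline[OF scaled(1,3) dec_blk])
    also have "2 ^ n * (y - y0) = b" by (simp add: y_def)
    finally have "(LINT x|lborel. c * (?P (y - x) * indicator {y0..} x)) = c * \<kappa> b" by (simp add: conv_def)
    then show ?thesis by (simp add: mult_ac)
  qed
  let ?R = "\<lambda>x. v x - w' x - g x - c * indicator {y0..} x"
  have eqR: "?P (y - x) * ?R x = ?P (y - x) * v x - ?P (y - x) * w' x - ?P (y - x) * g x - ?P (y - x) * (c * indicator {y0..} x)" for x
    by (simp add: right_diff_distrib)
  have iR: "integrable lborel (\<lambda>x. ?P (y - x) * ?R x)"
    unfolding eqR by (intro Bochner_Integration.integrable_diff iv iw ig ii)
  have "(LINT x|lborel. ?P (y - x) * ?R x) = conv ?P v y - conv ?P w' y - conv ?P g y - c * \<kappa> b"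
    unfolding eqR conv_def ci[symmetric] using iv iw ig ii by simp
  moreover have "\<bar>LINT x|lborel. ?P (y - x) * ?R x\<bar> \<le> 2 * S * Km * 2 ^ n + E * k1"
  proof -
    have "\<bar>LINT x|lborel. ?P (y - x) * ?R x\<bar> \<le> (LINT x|lborel. \<bar>?P (y - x) * ?R x\<bar>)" by (rule integral_abs_bound)
    also have "\<dots> \<le> (LINT x|lborel. 2 ^ n * Km * s' x + E * \<bar>?P (y - x)\<bar>)"
    proof (rule integral_mono[OF integrable_abs[OF iR]])
      show "integrable lborel (\<lambda>x. 2 ^ n * Km * s' x + E * \<bar>?P (y - x)\<bar>)"
        by (intro Bochner_Integration.integrable_add integrable_mult_right bs iP)
      fix x
      have "\<bar>?P (y - x) * ?R x\<bar> \<le> \<bar>?P (y - x)\<bar> * (s' x + E)"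
        unfolding abs_mult using dec by (intro mult_left_mono) auto
      also have "\<dots> \<le> 2 ^ n * Km * s' x + E * \<bar>?P (y - x)\<bar>"
        using mult_right_mono[OF Pb[of "y - x"] s(3)[of x]] by (simp add: algebra_simps)
      finally show "\<bar>?P (y - x) * ?R x\<bar> \<le> 2 ^ n * Km * s' x + E * \<bar>?P (y - x)\<bar>" .
    qed
    also have "\<dots> = 2 ^ n * Km * (LINT x|lborel. s' x) + E * (LINT x|lborel. \<bar>?P (y - x)\<bar>)"
      by (subst Bochner_Integration.integral_add) (use bs iP in auto)
    also have "(LINT x|lborel. \<bar>?P (y - x)\<bar>) = k1"
      using integral_reflect_shift[of "\<lambda>x. \<bar>?P x\<bar>" y] blk_L1[of n] by simp
    also have "2 ^ n * Km * (LINT x|lborel. s' x) \<le> 2 ^ n * Km * (2 * S)"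
      using Is Km by (intro mult_left_mono) auto
    finally show ?thesis by (simp add: mult_ac)
  qed
  moreover have "\<bar>c * \<kappa> b\<bar> = \<bar>c\<bar> * \<bar>\<kappa> b\<bar>" by (rule abs_mult)
  ultimately show ?thesis using cw cg unfolding y_def by linarith
qed

end

section \<open>Norm inflation\<close>

text \<open>A smoothed Heaviside function that is holomorphic near the real axis, as the strip
  requires; its nearest poles are at distance \<open>pi\<close>. The type is generic because it is
  used both on the strip and on the line.\<close>

definition logistic :: "'a::{real_normed_field,banach} \<Rightarrow> 'a" where
  "logistic w = 1 / (1 + exp (- w))"

text \<open>The derivative of \<open>a (1 + logistic (\<Delta> z)) sin (Q z) / Q\<close>.\<close>

definition wave :: "real \<Rightarrow> real \<Rightarrow> real \<Rightarrow> complex \<Rightarrow> complex" where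
  "wave a \<Delta> Q z = of_real a * ((1 + logistic (of_real \<Delta> * z)) * cos (of_real Q * z)
     + of_real (\<Delta> / Q) * (logistic (of_real \<Delta> * z) * (1 - logistic (of_real \<Delta> * z))) * sin (of_real Q * z))"

text \<open>Since 1 is less than \<open>pi / 2\<close>, the number \<open>v = exp (- w)\<close> has
  nonnegative real part, so \<open>norm (1 + v)\<close> is at least 1 and at least
  \<open>norm v\<close>.\<close>

lemma logistic_complex:
  fixes w :: complex
  assumes "\<bar>Im w\<bar> \<le> 1"
  shows "1 + exp (- w) \<noteq> 0" "norm (logistic w) \<le> 1" "norm (1 - logistic w) \<le> 1"
proof -
  define v where "v = exp (- w)"
  have "cos (Im w) \<ge> 0" using assms pi_gt3 by (intro cos_ge_zero) auto
  then have Rv: "Re v \<ge> 0" by (simp add: v_def Re_exp)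
  have sq: "norm (1 + v) ^ 2 = 1 + 2 * Re v + norm v ^ 2"
    unfolding cmod_power2 by (simp add: power2_eq_square algebra_simps)
  have n1: "1 \<le> norm (1 + v)" by (rule power2_le_imp_le) (use sq Rv in auto)
  have nv: "norm v \<le> norm (1 + v)" by (rule power2_le_imp_le) (use sq Rv in auto)
  show nz: "1 + exp (- w) \<noteq> 0" using n1 unfolding v_def[symmetric] by auto
  show "norm (logistic w) \<le> 1" using n1 by (simp add: logistic_def norm_divide v_def[symmetric] divide_le_eq)
  have "1 - logistic w = v / (1 + v)" using nz by (simp add: logistic_def v_def[symmetric] field_simps)
  then show "norm (1 - logistic w) \<le> 1" using nv n1 by (simp add: norm_divide divide_le_eq)
qed

lemma norm_cos_sin_le:
  fixes w :: complex
  assumes "\<bar>Im w\<bar> \<le> 1"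
  shows "norm (cos w) \<le> 3" "norm (sin w) \<le> 3"
proof -
  have "exp (- Im w) \<le> exp 1" "exp (Im w) \<le> exp 1" using assms by auto
  from this[THEN order_trans, OF exp_le] have e: "exp (- Im w) \<le> 3" "exp (Im w) \<le> 3" .
  have n: "norm (exp (\<i> * w)) \<le> 3" "norm (exp (- (\<i> * w))) \<le> 3" using e by auto
  show "norm (cos w) \<le> 3"
    unfolding cos_exp_eq using norm_triangle_ineq[of "exp (\<i> * w)" "exp (- (\<i> * w))"] n by (simp add: norm_divide)
  show "norm (sin w) \<le> 3"
    unfolding sin_exp_eq using norm_triangle_ineq4[of "exp (\<i> * w)" "exp (- (\<i> * w))"] n by (simp add: norm_divide norm_mult)
qed

text \<open>On a strip of width \<open>1 / Q\<close> the argument \<open>Q z\<close> keeps its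
  imaginary part below 1, so the trigonometric factors are bounded by 3 whatever \<open>Q\<close>
  is, and \<open>\<Delta> \<le> Q\<close> does the same for the logistic factors. The 9 is
  \<open>2 * 3\<close> from the first summand plus 3 from the second.\<close>

lemma wave_strip:
  assumes a: "0 \<le> a" and \<Delta>: "0 < \<Delta>" "\<Delta> \<le> Q"
  shows "wave a \<Delta> Q holomorphic_on strip (1 / Q)" "z \<in> strip (1 / Q) \<Longrightarrow> norm (wave a \<Delta> Q z) \<le> 9 * a"
proof -
  have im: "\<bar>Im (of_real \<Delta> * z)\<bar> \<le> 1" "\<bar>Im (of_real Q * z)\<bar> \<le> 1" if "z \<in> strip (1 / Q)" for z
  proof -
    have "\<bar>Im z\<bar> * Q < 1" using that \<Delta> by (simp add: strip_def field_simps)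
    moreover have "\<bar>Im z\<bar> * \<Delta> \<le> \<bar>Im z\<bar> * Q" using \<Delta> by (intro mult_left_mono) auto
    ultimately show "\<bar>Im (of_real \<Delta> * z)\<bar> \<le> 1" "\<bar>Im (of_real Q * z)\<bar> \<le> 1"
      using \<Delta> by (auto simp: abs_mult mult.commute)
  qed
  show "wave a \<Delta> Q holomorphic_on strip (1 / Q)"
    unfolding wave_def[abs_def] logistic_def using logistic_complex(1)[OF im(1)] \<Delta>
    by (intro holomorphic_intros) auto
  assume z: "z \<in> strip (1 / Q)"
  note l = logistic_complex(2,3)[OF im(1)[OF z]] and c = norm_cos_sin_le[OF im(2)[OF z]]
  let ?l = "logistic (of_real \<Delta> * z)"
  have "norm (1 + ?l) \<le> 2" using norm_triangle_ineq[of 1 ?l] l by simp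
  then have 1: "norm ((1 + ?l) * cos (of_real Q * z)) \<le> 2 * 3" unfolding norm_mult using c by (intro mult_mono) auto
  have "norm (of_real (\<Delta> / Q) :: complex) \<le> 1" using \<Delta> by (simp add: norm_divide)
  then have 2: "norm (of_real (\<Delta> / Q) * (?l * (1 - ?l)) * sin (of_real Q * z)) \<le> 1 * (1 * 1) * 3"
    unfolding norm_mult using c l by (intro mult_mono) auto
  have "norm (wave a \<Delta> Q z) \<le> a * (2 * 3 + 1 * (1 * 1) * 3)"
    unfolding wave_def norm_mult[of "of_real a"] using a norm_triangle_mono[OF 1 2] by (intro mult_mono) auto
  then show "norm (wave a \<Delta> Q z) \<le> 9 * a" by simp
qed

lemma logistic_of_real: "logistic (complex_of_real x) = of_real (logistic x)"
  by (simp add: logistic_def exp_of_real flip: of_real_minus)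

lemma wave_of_real:
  "wave a \<Delta> Q (of_real x) = of_real (a * ((1 + logistic (\<Delta> * x)) * cos (Q * x)
     + \<Delta> / Q * (logistic (\<Delta> * x) * (1 - logistic (\<Delta> * x))) * sin (Q * x)))"
  unfolding wave_def of_real_mult[symmetric] logistic_of_real cos_of_real sin_of_real by simp

text \<open>On the fourth claim: with \<open>l = logistic x\<close> the square
  \<open>(1 + l)\<^sup>2\<close> rises from 1 to 4, which makes a step of height 3. Its distance
  from the step is \<open>(1 - l) * (3 + l)\<close> on the right, where
  \<open>l \<ge> 1 / 2\<close>, and \<open>l * (2 + l)\<close> on the left, where
  \<open>l \<le> 1 / 2\<close>. The bound is a multiple of the derivative of
  \<open>logistic\<close>, hence has a finite integral.\<close>

lemma logistic_real:
  fixes x :: real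
  shows "0 < logistic x" "logistic x < 1" "(logistic has_real_derivative logistic x * (1 - logistic x)) (at x)"
    "\<bar>(1 + logistic x)\<^sup>2 - 1 - 3 * indicator {0..} x\<bar> \<le> 7 * (logistic x * (1 - logistic x))"
    "logistic x * (1 - logistic x) \<le> 1"
proof -
  have p: "1 + exp (- x) > 0" by (simp add: add_pos_pos)
  show l: "0 < logistic x" "logistic x < 1" using p by (auto simp: logistic_def)
  show "(logistic has_real_derivative logistic x * (1 - logistic x)) (at x)"
  proof -
    have "((\<lambda>x. 1 / (1 + exp (- x))) has_real_derivative (0 * (1 + exp (- x)) - 1 * (exp (- x) * - 1)) / ((1 + exp (- x)) * (1 + exp (- x)))) (at x)"
      using p by (intro DERIV_divide) (auto intro!: derivative_eq_intros)
    moreover have "(0 * (1 + exp (- x)) - 1 * (exp (- x) * - 1)) / ((1 + exp (- x)) * (1 + exp (- x))) = logistic x * (1 - logistic x)"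
      using p by (simp add: logistic_def field_simps)
    ultimately show ?thesis by (simp add: logistic_def[abs_def])
  qed
  show "logistic x * (1 - logistic x) \<le> 1" using l mult_mono[of "logistic x" 1 "1 - logistic x" 1] by simp
  show "\<bar>(1 + logistic x)\<^sup>2 - 1 - 3 * indicator {0..} x\<bar> \<le> 7 * (logistic x * (1 - logistic x))"
  proof (cases "x \<ge> 0")
    case True
    then have "exp (- x) \<le> 1" by simp
    then have h: "1 / 2 \<le> logistic x" unfolding logistic_def using p by (simp add: le_divide_eq)
    have "(1 + logistic x)\<^sup>2 - 1 - 3 = - ((1 - logistic x) * (3 + logistic x))"
      by (simp add: power2_eq_square algebra_simps)
    moreover have "(1 - logistic x) * (3 + logistic x) \<le> (1 - logistic x) * (7 * logistic x)"
      using l h by (intro mult_left_mono) auto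
    ultimately show ?thesis using True l by (simp add: mult_ac abs_mult)
  next
    case False
    then have "exp (- x) \<ge> 1" by simp
    then have h: "logistic x \<le> 1 / 2" unfolding logistic_def using p by (simp add: divide_le_eq)
    have "(1 + logistic x)\<^sup>2 - 1 = logistic x * (2 + logistic x)" by (simp add: power2_eq_square algebra_simps)
    moreover have "logistic x * (2 + logistic x) \<le> logistic x * (7 * (1 - logistic x))"
      using l h by (intro mult_left_mono) auto
    ultimately show ?thesis using False l by (simp add: mult_ac abs_mult)
  qed
qed

text \<open>Here \<open>e = 18 * a\<close> is twice the bound \<open>9 * a\<close> of the datum on
  the strip, the factor 2 being the room that \<open>lagrangian_solution\<close> takes.\<close>

locale inflation = lagrangian_flow +
  fixes a \<Delta> Q :: real
  assumes a: "0 < a" "a \<le> 1" and \<Delta>: "0 < \<Delta>" "\<Delta> \<le> Q" and e_eq: "e = 18 * a" and T1: "T \<le> 1"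
    and g0: "\<And>x. g0 (of_real x) = wave a \<Delta> Q (of_real x)"
begin

lemma T_in: "T \<in> {0..T}" "0 \<in> {0..T}" using T by auto

text \<open>These constants depend on \<open>lam\<close> alone. Per unit of \<open>e\<close>,
  \<open>c1\<close> and \<open>c3\<close> bound the rates of \<open>jac\<close> and
  \<open>gam\<close>, and \<open>c2\<close> the forcing
  \<open>\<Gamma>\<^sup>2 / 2 + \<lambda> q_t\<close>; \<open>c4\<close> belongs to the remainder of
  the product, and \<open>cE\<close> collects all errors quadratic in \<open>e * T\<close>.\<close>

definition c1 where "c1 = 3 / 2 * (1 + 2 * cA lam)"
definition c2 where "c2 = 1 + 2 * \<bar>lam\<bar> * cA lam"
definition c3 where "c3 = 1 + 2 * \<bar>lam\<bar> * cA lam + 4 * cA lam"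
definition c4 where "c4 = c1 * c2 + c3"
definition cE where "cE = 4 * c1 + 4 * \<bar>lam\<bar> * cA lam * c1 + 2 * c4"

lemma c_nonneg: "0 \<le> c1" "0 \<le> c2" "0 \<le> c3" "0 \<le> c4"
  using cA_nonneg[of lam] by (auto simp: c1_def c2_def c3_def c4_def)

lemma time_diff_bound:
  assumes d: "\<And>s. s \<in> {0..T} \<Longrightarrow> (f has_real_derivative f' s) (at s within {0..T})"
    and b: "\<And>s. s \<in> {0..T} \<Longrightarrow> \<bar>f' s\<bar> \<le> B" and t: "t \<in> {0..T}"
  shows "\<bar>f t - f 0\<bar> \<le> B * t"
  using field_differentiable_bound[OF convex_real_interval(5)[of 0 T] d, of B 0 t] b t by auto

lemma gam0: "gam 0 x = a * ((1 + logistic (\<Delta> * x)) * cos (Q * x)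
     + \<Delta> / Q * (logistic (\<Delta> * x) * (1 - logistic (\<Delta> * x))) * sin (Q * x))"
  unfolding init(2) g0 wave_of_real by simp

lemma e_small: "e\<^sup>2 / 2 \<le> e" "e * e \<le> 2 * e"
  using mult_left_mono[OF e e0] by (auto simp: power2_eq_square)

lemma jac_dev:
  assumes t: "t \<in> {0..T}"
  shows "\<bar>jac t x - 1\<bar> \<le> c1 * e * T"
proof -
  have "\<bar>jac s x * (gam s x + st s x)\<bar> \<le> c1 * e" if s: "s \<in> {0..T}" for s
  proof -
    have "\<bar>jac s x\<bar> * \<bar>gam s x + st s x\<bar> \<le> 3 / 2 * (e + c0)"
      using bounds[OF s, of x] by (intro mult_mono) linarith+
    also have "3 / 2 * (e + c0) = c1 * e" by (simp add: c1_def c0_def algebra_simps)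
    finally show ?thesis unfolding abs_mult .
  qed
  from time_diff_bound[OF jac_time this t] have "\<bar>jac t x - 1\<bar> \<le> c1 * e * t" by (simp add: init)
  also have "\<dots> \<le> c1 * e * T" using t c_nonneg e0 by (intro mult_left_mono) auto
  finally show ?thesis .
qed

lemma lam_vl: "t \<in> {0..T} \<Longrightarrow> \<bar>lam * vl t x\<bar> \<le> 2 * \<bar>lam\<bar> * cA lam * e"
  using mult_left_mono[OF bounds(5)[of t x], of "\<bar>lam\<bar>"] by (simp add: abs_mult c0_def mult_ac)

lemma gam_sq: "t \<in> {0..T} \<Longrightarrow> (gam t x)\<^sup>2 / 2 \<le> e"
proof -
  assume t: "t \<in> {0..T}"
  have "(gam t x)\<^sup>2 \<le> e\<^sup>2" using power_mono[OF bounds(4)[OF t, of x], of 2] by simp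
  then show ?thesis using e_small by simp
qed

lemma gam_dev:
  assumes t: "t \<in> {0..T}"
  shows "\<bar>gam t x - gam 0 x\<bar> \<le> c3 * e * T"
proof -
  have "\<bar>- (gam s x)\<^sup>2 / 2 + lam * vl s x - gam s x * st s x\<bar> \<le> c3 * e" if s: "s \<in> {0..T}" for s
  proof -
    have "\<bar>gam s x * st s x\<bar> \<le> 2 * c0"
      unfolding abs_mult using bounds(4,6)[OF s, of x] e c0_nonneg by (intro mult_mono) auto
    moreover have "0 \<le> (gam s x)\<^sup>2 / 2" by simp
    ultimately have "\<bar>- (gam s x)\<^sup>2 / 2 + lam * vl s x - gam s x * st s x\<bar> \<le> e + 2 * \<bar>lam\<bar> * cA lam * e + 2 * c0"
      using gam_sq[OF s, of x] lam_vl[OF s, of x] by linarith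
    then show ?thesis by (simp add: c3_def c0_def algebra_simps)
  qed
  from time_diff_bound[OF gam_time this t] have "\<bar>gam t x - gam 0 x\<bar> \<le> c3 * e * t" .
  also have "\<dots> \<le> c3 * e * T" using t c_nonneg e0 by (intro mult_left_mono) auto
  finally show ?thesis .
qed

text \<open>
  The terms removed from \<open>J \<Gamma>\<close> are its first-order growth, which leaves a remainder quadratic in \<open>T\<close> and the amplitude.
\<close>

definition rem :: "real \<Rightarrow> real \<Rightarrow> real" where
  "rem t x = jac t x * gam t x - t / 2 * (gam 0 x)\<^sup>2 - lam * pos t x"

lemma rem_dev: "\<bar>rem T x - rem 0 x\<bar> \<le> c4 * e\<^sup>2 * T\<^sup>2"
proof -
  have "\<bar>rem T x - rem 0 x\<bar> \<le> c4 * e\<^sup>2 * T * T"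
  proof (rule time_diff_bound[OF _ _ T_in(1)])
    fix s assume s: "s \<in> {0..T}"
    \<comment> \<open>The derivative of the remainder, arranged in products of a deviation from the
      initial value, of order \<open>e * T\<close>, and a factor of order \<open>e\<close>.\<close>
    let ?d = "(jac s x - 1) * ((gam s x)\<^sup>2 / 2 + lam * vl s x) + (gam s x - gam 0 x) * ((gam s x + gam 0 x) / 2)"
    have 1: "((\<lambda>t. t / 2 * (gam 0 x)\<^sup>2) has_real_derivative (gam 0 x)\<^sup>2 / 2) (at s within {0..T})"
      by (auto intro!: derivative_eq_intros)
    have "((\<lambda>t. rem t x) has_real_derivative
      (jac s x * (gam s x + st s x)) * gam s x + (- (gam s x)\<^sup>2 / 2 + lam * vl s x - gam s x * st s x) * jac s x
       - (gam 0 x)\<^sup>2 / 2 - lam * vl s x) (at s within {0..T})"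
      unfolding rem_def by (intro DERIV_diff DERIV_mult DERIV_cmult jac_time gam_time pos_time s 1)
    then show "((\<lambda>t. rem t x) has_real_derivative ?d) (at s within {0..T})"
      by (rule DERIV_cong) (simp add: power2_eq_square field_simps)
    have 2: "\<bar>(gam s x)\<^sup>2 / 2 + lam * vl s x\<bar> \<le> c2 * e"
    proof -
      have "0 \<le> (gam s x)\<^sup>2 / 2" by simp
      then have "\<bar>(gam s x)\<^sup>2 / 2 + lam * vl s x\<bar> \<le> e + 2 * \<bar>lam\<bar> * cA lam * e"
        using gam_sq[OF s, of x] lam_vl[OF s, of x] by linarith
      then show ?thesis by (simp add: c2_def algebra_simps)
    qed
    have "\<bar>?d\<bar> \<le> (c1 * e * T) * (c2 * e) + (c3 * e * T) * e"
    proof (rule order_trans[OF abs_triangle_ineq], rule add_mono)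
      show "\<bar>(jac s x - 1) * ((gam s x)\<^sup>2 / 2 + lam * vl s x)\<bar> \<le> (c1 * e * T) * (c2 * e)"
        unfolding abs_mult using jac_dev[OF s, of x] 2 T e0 c_nonneg by (intro mult_mono) auto
      have "\<bar>(gam s x + gam 0 x) / 2\<bar> \<le> e" using bounds(4)[OF s, of x] bounds(4)[OF T_in(2), of x] by simp
      then show "\<bar>(gam s x - gam 0 x) * ((gam s x + gam 0 x) / 2)\<bar> \<le> (c3 * e * T) * e"
        unfolding abs_mult using gam_dev[OF s, of x] T e0 c_nonneg by (intro mult_mono) auto
    qed
    also have "\<dots> = c4 * e\<^sup>2 * T" by (simp add: c4_def power2_eq_square algebra_simps)
    finally show "\<bar>?d\<bar> \<le> c4 * e\<^sup>2 * T" .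
  qed
  then show ?thesis by (simp add: power2_eq_square mult_ac)
qed

section \<open>The shape of the solution at time \<open>T\<close>\<close>

definition lg where "lg x = logistic (\<Delta> * x)"
definition prim where "prim x = a * (1 + lg x) * sin (Q * x) / Q"
text \<open>The squared cosine in \<open>\<gamma>\<^sub>0\<^sup>2\<close> is 1/2 plus half the
  cosine of \<open>2 * Q * x\<close>. The second part oscillates, and \<open>osc\<close>, of size
  \<open>1 / Q\<close>, is its primitive up to the term that comes from differentiating the
  amplitude, which is of order \<open>\<Delta> / Q\<close>.\<close>

definition osc where "osc x = (1 + lg x)\<^sup>2 * sin (2 * Q * x) / (4 * Q)"
definition osc' where "osc' x = 2 * (1 + lg x) * (\<Delta> * (lg x * (1 - lg x))) * sin (2 * Q * x) / (4 * Q) + (1 + lg x)\<^sup>2 * cos (2 * Q * x) / 2"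

lemma lg: "0 < lg x" "lg x < 1" "0 \<le> lg x * (1 - lg x)" "lg x * (1 - lg x) \<le> 1"
    "(lg has_real_derivative \<Delta> * (lg x * (1 - lg x))) (at x)"
    "\<bar>(1 + lg x)\<^sup>2 - 1 - 3 * indicator {0..} x\<bar> \<le> 7 * (lg x * (1 - lg x))"
proof -
  show l: "0 < lg x" "lg x < 1" unfolding lg_def using logistic_real by auto
  then show "0 \<le> lg x * (1 - lg x)" by simp
  show "lg x * (1 - lg x) \<le> 1" unfolding lg_def by (rule logistic_real(5))
  have "((\<lambda>x. \<Delta> * x) has_real_derivative \<Delta>) (at x)" by (auto intro!: derivative_eq_intros)
  from DERIV_chain2[OF logistic_real(3) this]
  show "(lg has_real_derivative \<Delta> * (lg x * (1 - lg x))) (at x)" by (simp add: lg_def[abs_def] mult_ac)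
  have "indicator {0..} (\<Delta> * x) = (indicator {0..} x :: real)" using \<Delta> by (auto simp: indicator_def zero_le_mult_iff)
  then show "\<bar>(1 + lg x)\<^sup>2 - 1 - 3 * indicator {0..} x\<bar> \<le> 7 * (lg x * (1 - lg x))"
    using logistic_real(4)[of "\<Delta> * x"] by (simp add: lg_def)
qed

lemma Q_pos: "0 < Q" "\<Delta> / Q \<le> 1" "0 < \<Delta> / Q" using \<Delta> by auto

lemma gam0_lg: "gam 0 x = a * ((1 + lg x) * cos (Q * x) + \<Delta> / Q * (lg x * (1 - lg x)) * sin (Q * x))"
  unfolding gam0 lg_def ..

lemma prim_derivative: "(prim has_real_derivative gam 0 x) (at x)"
proof -
  have s: "((\<lambda>x. sin (Q * x)) has_real_derivative cos (Q * x) * Q) (at x)" by (auto intro!: derivative_eq_intros)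
  have "((\<lambda>x. a * (1 + lg x) * sin (Q * x) / Q) has_real_derivative
     ((a * (0 + \<Delta> * (lg x * (1 - lg x)))) * sin (Q * x) + (cos (Q * x) * Q) * (a * (1 + lg x))) / Q) (at x)"
    by (intro DERIV_cdivide DERIV_mult DERIV_cmult DERIV_add DERIV_const lg(5) s)
  then show ?thesis
    unfolding prim_def[abs_def] by (rule DERIV_cong) (use Q_pos in \<open>simp add: gam0_lg field_simps\<close>)
qed

lemma osc_derivative: "(osc has_real_derivative osc' x) (at x)"
proof -
  have s: "((\<lambda>x. sin (2 * Q * x)) has_real_derivative cos (2 * Q * x) * (2 * Q)) (at x)" by (auto intro!: derivative_eq_intros)
  have l: "((\<lambda>x. (1 + lg x)\<^sup>2) has_real_derivative real 2 * ((0 + \<Delta> * (lg x * (1 - lg x))) * (1 + lg x) ^ (2 - Suc 0))) (at x)"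
    by (intro DERIV_power DERIV_add DERIV_const lg(5))
  have "((\<lambda>x. (1 + lg x)\<^sup>2 * sin (2 * Q * x) / (4 * Q)) has_real_derivative
     ((real 2 * ((0 + \<Delta> * (lg x * (1 - lg x))) * (1 + lg x) ^ (2 - Suc 0))) * sin (2 * Q * x) + (cos (2 * Q * x) * (2 * Q)) * (1 + lg x)\<^sup>2) / (4 * Q)) (at x)"
    by (intro DERIV_cdivide DERIV_mult l s)
  then show ?thesis
    unfolding osc_def[abs_def] by (rule DERIV_cong) (use Q_pos in \<open>simp add: osc'_def field_simps\<close>)
qed

lemma lg_sq: "0 \<le> (1 + lg x)\<^sup>2" "(1 + lg x)\<^sup>2 \<le> 4"
  using power_mono[of "1 + lg x" 2 2] lg(1,2)[of x] by auto

lemma mult_abs_le: "\<bar>u\<bar> \<le> U \<Longrightarrow> \<bar>v\<bar> \<le> V \<Longrightarrow> \<bar>u * v\<bar> \<le> U * V" for u v U V :: real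
  unfolding abs_mult by (intro mult_mono) auto

lemma osc_correction: "\<bar>2 * (1 + lg x) * (\<Delta> * (lg x * (1 - lg x))) * sin (2 * Q * x) / (4 * Q)\<bar> \<le> \<Delta> / Q"
proof -
  have "\<bar>((1 + lg x) * (lg x * (1 - lg x))) * sin (2 * Q * x)\<bar> \<le> (2 * 1) * 1"
    using lg(1-4)[of x] by (intro mult_abs_le abs_sin_le_one) linarith+
  then have "\<bar>(\<Delta> / (2 * Q)) * (((1 + lg x) * (lg x * (1 - lg x))) * sin (2 * Q * x))\<bar> \<le> (\<Delta> / (2 * Q)) * ((2 * 1) * 1)"
    by (rule mult_abs_le[rotated]) (use \<Delta> in simp)
  moreover have "(\<Delta> / (2 * Q)) * ((A * l) * s) = 2 * A * (\<Delta> * l) * s / (4 * Q)" for A l s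
    by simp
  moreover have "(\<Delta> / (2 * Q)) * ((2 * 1) * 1) = \<Delta> / Q" by simp
  ultimately show ?thesis by (simp only:)
qed

lemma osc_bounds: "\<bar>osc x\<bar> \<le> 1 / Q" "\<bar>osc' x\<bar> \<le> 3"
proof -
  have "\<bar>(1 + lg x)\<^sup>2 * sin (2 * Q * x)\<bar> \<le> 4 * 1" by (intro mult_abs_le) (use lg_sq[of x] in auto)
  then have "\<bar>(1 + lg x)\<^sup>2 * sin (2 * Q * x)\<bar> / (4 * Q) \<le> 4 * 1 / (4 * Q)" by (rule divide_right_mono) (use Q_pos in simp)
  then show "\<bar>osc x\<bar> \<le> 1 / Q" using Q_pos by (simp add: osc_def)
  have "\<bar>(1 + lg x)\<^sup>2 * cos (2 * Q * x)\<bar> \<le> 4 * 1" by (intro mult_abs_le) (use lg_sq[of x] in auto)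
  then show "\<bar>osc' x\<bar> \<le> 3" using osc_correction[of x] Q_pos(2) unfolding osc'_def by linarith
qed

lemma prim_bound: "\<bar>prim x\<bar> \<le> 2 * a / Q"
proof -
  have "\<bar>(a * (1 + lg x)) * sin (Q * x)\<bar> \<le> (a * 2) * 1" by (intro mult_abs_le) (use lg(1,2)[of x] a in auto)
  then have "\<bar>(a * (1 + lg x)) * sin (Q * x)\<bar> / Q \<le> (a * 2) * 1 / Q" by (rule divide_right_mono) (use Q_pos in simp)
  then show ?thesis using Q_pos by (simp add: prim_def mult_ac)
qed

lemma gam0_sq: "\<bar>(gam 0 x)\<^sup>2 - a\<^sup>2 * osc' x - a\<^sup>2 * (1 + lg x)\<^sup>2 / 2\<bar> \<le> 6 * a\<^sup>2 * (\<Delta> / Q)"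
proof -
  let ?c = "cos (Q * x)" and ?n = "sin (Q * x)" and ?s = "\<Delta> / Q * (lg x * (1 - lg x))"
  let ?o = "2 * (1 + lg x) * (\<Delta> * (lg x * (1 - lg x))) * sin (2 * Q * x) / (4 * Q)"
  have s: "0 \<le> ?s" "?s \<le> \<Delta> / Q"
    using mult_nonneg_nonneg[OF less_imp_le[OF Q_pos(3)] lg(3)[of x]] mult_left_mono[OF lg(4)[of x], of "\<Delta> / Q"] Q_pos(3)
    by linarith+
  have "cos (2 * Q * x) = 2 * ?c\<^sup>2 - 1" using cos_double_cos[of "Q * x"] by (simp add: mult.assoc)
  then have o: "osc' x = ?o + (1 + lg x)\<^sup>2 * (2 * ?c\<^sup>2 - 1) / 2" by (simp add: osc'_def)
  have "(gam 0 x)\<^sup>2 - a\<^sup>2 * osc' x - a\<^sup>2 * (1 + lg x)\<^sup>2 / 2 = a\<^sup>2 * (2 * ((1 + lg x) * ?s * (?c * ?n)) + ?s * ?s * (?n * ?n) - ?o)"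
  proof -
    have "(a * (A * c + s * n))\<^sup>2 - a\<^sup>2 * (o1 + A\<^sup>2 * (2 * c\<^sup>2 - 1) / 2) - a\<^sup>2 * A\<^sup>2 / 2
      = a\<^sup>2 * (2 * (A * s * (c * n)) + s * s * (n * n) - o1)" for A c s n o1
      by (simp add: power2_eq_square field_simps)
    then show ?thesis unfolding o gam0_lg .
  qed
  \<comment> \<open>Of the 6, the mixed product of the two summands of \<open>gam 0\<close> gives 4,
    the square of the small summand 1, and the correction in \<open>osc'\<close> 1.\<close>
  also have "\<bar>\<dots>\<bar> \<le> a\<^sup>2 * (6 * (\<Delta> / Q))"
  proof (rule mult_abs_le)
    have A: "\<bar>1 + lg x\<bar> \<le> 2" using lg(1,2)[of x] by linarith
    have s': "\<bar>?s\<bar> \<le> \<Delta> / Q" "\<bar>?s\<bar> \<le> 1" using s Q_pos by linarith+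
    have "\<bar>(1 + lg x) * ?s * (?c * ?n)\<bar> \<le> 2 * (\<Delta> / Q) * (1 * 1)"
      by (intro mult_abs_le A s' abs_sin_le_one abs_cos_le_one)
    moreover have "\<bar>?s * ?s * (?n * ?n)\<bar> \<le> (\<Delta> / Q) * 1 * (1 * 1)"
      by (intro mult_abs_le s' abs_sin_le_one)
    moreover have "\<bar>2 * u + v - w\<bar> \<le> 6 * d" if "\<bar>u\<bar> \<le> 2 * d * (1 * 1)" "\<bar>v\<bar> \<le> d * 1 * (1 * 1)" "\<bar>w\<bar> \<le> d" for u v w d :: real
      using that by linarith
    ultimately show "\<bar>2 * ((1 + lg x) * ?s * (?c * ?n)) + ?s * ?s * (?n * ?n) - ?o\<bar> \<le> 6 * (\<Delta> / Q)"
      using osc_correction[of x] by blast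
  qed simp
  finally show ?thesis by (simp add: mult_ac)
qed

lemma inverse_jac: "\<bar>1 / jac T x - 1\<bar> \<le> 2 * (c1 * e * T)" "\<bar>1 / jac T x - 1\<bar> \<le> 1" "\<bar>1 / jac T x\<bar> \<le> 2"
proof -
  have j: "1 / 2 \<le> jac T x" by (rule bounds(2)[OF T_in(1)])
  then show i: "\<bar>1 / jac T x\<bar> \<le> 2" by (simp add: field_simps)
  have eq: "1 / jac T x - 1 = (1 / jac T x) * (1 - jac T x)" using j by (simp add: field_simps)
  show "\<bar>1 / jac T x - 1\<bar> \<le> 2 * (c1 * e * T)"
    unfolding eq by (rule mult_abs_le[OF i]) (use jac_dev[OF T_in(1), of x] in \<open>simp add: abs_minus_commute\<close>)
  have "\<bar>(1 / jac T x) * (1 - jac T x)\<bar> \<le> 2 * (1 / 2)"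
    by (rule mult_abs_le[OF i]) (use bounds(1)[OF T_in(1), of x] in \<open>simp add: abs_minus_commute\<close>)
  then show "\<bar>1 / jac T x - 1\<bar> \<le> 1" unfolding eq by simp
qed

text \<open>
  Four components of the solution at time \<open>T\<close>, separated by how a dyadic block sees them: \<open>main\<close> varies slowly,
  \<open>fast\<close> is a small primitive of the oscillating part, and the step of height \<open>3 / 4 T a\<^sup>2\<close> differs from its
  smoothing by at most \<open>layer'\<close>, which has a small integral.
\<close>

definition main where "main y = T / 4 * a\<^sup>2 + lam * (y - ipos T y)"
definition fast where "fast y = prim (ipos T y) + T / 2 * a\<^sup>2 * osc (ipos T y)"
definition fast' where "fast' y = (gam 0 (ipos T y) + T / 2 * a\<^sup>2 * osc' (ipos T y)) * (1 / jac T (ipos T y))"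
definition layer where "layer y = 3 * T * a\<^sup>2 / \<Delta> * lg (ipos T y)"
definition layer' where "layer' y = 3 * T * a\<^sup>2 * (lg (ipos T y) * (1 - lg (ipos T y))) * (1 / jac T (ipos T y))"

text \<open>The flow is increasing, so it carries the jump from the origin to
  \<open>pos T 0\<close>.\<close>

lemma indicator_ipos: "indicator {pos T 0..} y = (indicator {0..} (ipos T y) :: real)"
proof -
  have mono: "pos T x \<le> pos T x'" if "x \<le> x'" for x x'
  proof (rule DERIV_nonneg_imp_nondecreasing[OF that], intro exI conjI)
    show "(pos T has_real_derivative jac T u) (at u)" for u by (rule pos_space[OF T_in(1)])
    show "0 \<le> jac T u" for u using bounds(2)[OF T_in(1), of u] by linarith
  qed
  have "pos T 0 \<le> y \<longleftrightarrow> 0 \<le> ipos T y"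
    using mono[of 0 "ipos T y"] mono[of "ipos T y" 0] ipos_pos[OF T_in(1), of 0] pos_ipos[OF T_in(1), of y]
    by (metis linorder_not_le nle_le)
  then show ?thesis by (simp add: indicator_def)
qed

text \<open>The solution is \<open>J \<Gamma>\<close> divided by \<open>J\<close>, with
  \<open>J \<Gamma>\<close> written as its first-order growth plus a remainder. The height 3/4 is
  the time factor \<open>T / 2\<close>, without its \<open>T\<close>, times the mean 1/2 of the
  squared cosine times the step 3 of the squared amplitude.\<close>

lemma sol_decomposition:
  "\<bar>sol T y - fast' y - main y - 3 / 4 * T * a\<^sup>2 * indicator {pos T 0..} y\<bar> \<le> layer' y + (cE * e\<^sup>2 * T\<^sup>2 + 6 * T * a\<^sup>2 * (\<Delta> / Q))"
proof -
  define x where "x = ipos T y"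
  define i where "i = 1 / jac T x"
  define \<gamma> where "\<gamma> = gam 0 x"
  define h where "h = rem T x - rem 0 x"
  define \<rho> where "\<rho> = \<gamma>\<^sup>2 - a\<^sup>2 * osc' x - a\<^sup>2 * (1 + lg x)\<^sup>2 / 2"
  define I where "I = (indicator {0..} x :: real)"
  have y: "pos T x = y" by (simp add: x_def T less_imp_le)
  have j: "jac T x > 0" using bounds(2)[OF T_in(1), of x] by linarith
  have ji: "jac T x * i = 1" using j by (simp add: i_def)
  have hh: "jac T x * gam T x = \<gamma> + T / 2 * \<gamma>\<^sup>2 + lam * (y - x) + h"
    by (simp add: h_def rem_def \<gamma>_def y init algebra_simps)
  have "sol T y = gam T x" by (simp add: sol_def x_def)
  also have "\<dots> = (jac T x * gam T x) * i" using ji by (metis mult.assoc mult.commute mult_1)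
  also have "\<dots> = (\<gamma> + T / 2 * (a\<^sup>2 * osc' x + a\<^sup>2 * (1 + lg x)\<^sup>2 / 2 + \<rho>) + lam * (y - x) + h) * i"
    unfolding hh \<rho>_def by simp
  finally have sol: "sol T y = (\<gamma> + T / 2 * (a\<^sup>2 * osc' x + a\<^sup>2 * (1 + lg x)\<^sup>2 / 2 + \<rho>) + lam * (y - x) + h) * i" .
  \<comment> \<open>Only \<open>fast'\<close> keeps the factor \<open>i = 1 / J\<close>, which makes
    it an exact derivative. In the slow part and in the step \<open>i\<close> is replaced by 1, and
    the terms with \<open>i - 1\<close> are the price, quadratic in \<open>e * T\<close>.\<close>
  have eq: "sol T y - fast' y - main y - 3 / 4 * T * a\<^sup>2 * I =
     T / 4 * a\<^sup>2 * ((1 + lg x)\<^sup>2 - 1 - 3 * I) + T / 4 * a\<^sup>2 * ((1 + lg x)\<^sup>2 * (i - 1)) + T / 2 * (\<rho> * i) + lam * ((y - x) * (i - 1)) + h * i"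
    unfolding sol fast'_def main_def x_def[symmetric] i_def[symmetric] \<gamma>_def[symmetric]
    by (simp add: field_simps)
  have b1: "\<bar>T / 4 * a\<^sup>2 * ((1 + lg x)\<^sup>2 - 1 - 3 * I)\<bar> \<le> layer' y"
  proof -
    have "\<bar>T / 4 * a\<^sup>2 * ((1 + lg x)\<^sup>2 - 1 - 3 * I)\<bar> \<le> T / 4 * a\<^sup>2 * (7 * (lg x * (1 - lg x)))"
      unfolding I_def by (rule mult_abs_le[OF _ lg(6)]) (use T in simp)
    also have "\<dots> = (T * a\<^sup>2 * (lg x * (1 - lg x))) * (7 / 4)" by simp
    \<comment> \<open>The 3 in \<open>layer'\<close> is large enough for this:
      \<open>J \<le> 3 / 2\<close> gives \<open>3 / J \<ge> 2\<close>, which exceeds the 7/4 left by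
      the logistic bound. The factor \<open>i\<close> makes \<open>layer'\<close> the derivative of
      \<open>layer\<close>.\<close>
    also have "\<dots> \<le> (T * a\<^sup>2 * (lg x * (1 - lg x))) * (3 * i)"
    proof (rule mult_left_mono)
      show "7 / 4 \<le> 3 * i" using bounds(3)[OF T_in(1), of x] j by (simp add: i_def field_simps)
      show "0 \<le> T * a\<^sup>2 * (lg x * (1 - lg x))" by (rule mult_nonneg_nonneg[OF _ lg(3)]) (use T in simp)
    qed
    also have "\<dots> = layer' y" by (simp add: layer'_def x_def i_def)
    finally show ?thesis .
  qed
  have b2: "\<bar>T / 4 * a\<^sup>2 * ((1 + lg x)\<^sup>2 * (i - 1))\<bar> \<le> 4 * c1 * e\<^sup>2 * T\<^sup>2"
  proof -
    have "\<bar>T / 4 * a\<^sup>2 * ((1 + lg x)\<^sup>2 * (i - 1))\<bar> \<le> T / 4 * a\<^sup>2 * (4 * (2 * (c1 * e * T)))"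
      using lg_sq[of x] inverse_jac(1)[of x] T by (intro mult_abs_le) (auto simp: i_def)
    also have "\<dots> = (2 * c1 * e * T\<^sup>2) * a\<^sup>2" by (simp add: power2_eq_square)
    also have "\<dots> \<le> (2 * c1 * e * T\<^sup>2) * (2 * e)"
    proof (rule mult_left_mono)
      have "a\<^sup>2 \<le> a" using a by (simp add: power2_eq_square mult_left_le)
      then show "a\<^sup>2 \<le> 2 * e" using e_eq a by linarith
      show "0 \<le> 2 * c1 * e * T\<^sup>2" using c_nonneg e0 by simp
    qed
    finally show ?thesis by (simp add: power2_eq_square mult_ac)
  qed
  have b3: "\<bar>T / 2 * (\<rho> * i)\<bar> \<le> 6 * T * a\<^sup>2 * (\<Delta> / Q)"
  proof -
    have "\<bar>T / 2 * (\<rho> * i)\<bar> \<le> T / 2 * ((6 * a\<^sup>2 * (\<Delta> / Q)) * 2)"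
      using gam0_sq[of x] inverse_jac(3)[of x] T unfolding \<rho>_def \<gamma>_def i_def by (intro mult_abs_le) auto
    then show ?thesis by (simp add: mult_ac)
  qed
  have b4: "\<bar>lam * ((y - x) * (i - 1))\<bar> \<le> 4 * \<bar>lam\<bar> * cA lam * c1 * e\<^sup>2 * T\<^sup>2"
  proof -
    have "\<bar>y - x\<bar> \<le> c0 * T" using pos_lipschitz_time[OF T_in, of x] T by (simp add: y init)
    then have "\<bar>lam * ((y - x) * (i - 1))\<bar> \<le> \<bar>lam\<bar> * ((c0 * T) * (2 * (c1 * e * T)))"
      using inverse_jac(1)[of x] unfolding i_def by (intro mult_abs_le) auto
    also have "\<dots> = 4 * \<bar>lam\<bar> * cA lam * c1 * e\<^sup>2 * T\<^sup>2" by (simp add: c0_def power2_eq_square)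
    finally show ?thesis .
  qed
  have b5: "\<bar>h * i\<bar> \<le> 2 * c4 * e\<^sup>2 * T\<^sup>2"
  proof -
    have "\<bar>h * i\<bar> \<le> (c4 * e\<^sup>2 * T\<^sup>2) * 2"
      using rem_dev[of x] inverse_jac(3)[of x] unfolding h_def i_def by (rule mult_abs_le)
    then show ?thesis by (simp add: mult_ac)
  qed
  have cE: "cE * e\<^sup>2 * T\<^sup>2 = 4 * c1 * e\<^sup>2 * T\<^sup>2 + 4 * \<bar>lam\<bar> * cA lam * c1 * e\<^sup>2 * T\<^sup>2 + 2 * c4 * e\<^sup>2 * T\<^sup>2"
    by (simp add: cE_def algebra_simps)
  have "\<bar>u1 + u2 + u3 + u4 + u5\<bar> \<le> v1 + (v2 + v4 + v5 + v3)"
    if "\<bar>u1\<bar> \<le> v1" "\<bar>u2\<bar> \<le> v2" "\<bar>u3\<bar> \<le> v3" "\<bar>u4\<bar> \<le> v4" "\<bar>u5\<bar> \<le> v5" for u1 u2 u3 u4 u5 v1 v2 v3 v4 v5 :: real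
    using that by linarith
  from this[OF b1 b2 b3 b4 b5] show ?thesis
    unfolding indicator_ipos x_def[symmetric] I_def[symmetric] eq cE .
qed

lemma ipos_T: "(ipos T has_real_derivative 1 / jac T (ipos T y)) (at y)"
  using ipos_derivative[OF T_in(1)] by (simp add: inverse_eq_divide)

lemma continuous_ipos: "continuous_on UNIV (ipos T)"
  by (rule DERIV_continuous_on[OF ipos_T])

lemma continuous_inverse_jac: "continuous_on UNIV (\<lambda>y. 1 / jac T (ipos T y))"
proof -
  have "continuous_on UNIV (jac T)"
  proof -
    have "((\<lambda>x. Re (J T (of_real x))) has_real_derivative Re (deriv (J T) (of_real x))) (at x)" for x
      by (rule has_real_derivative_Re[OF holomorphic_derivI[OF sliceD(3)[OF sl[OF T_in(1)]] open_strip on_strip]])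
    then show ?thesis unfolding jac_def[abs_def] by (rule DERIV_continuous_on)
  qed
  then have "continuous_on UNIV (\<lambda>y. jac T (ipos T y))" by (rule continuous_on_compose2[OF _ continuous_ipos]) auto
  moreover have "jac T x \<noteq> 0" for x using bounds(2)[OF T_in(1), of x] by auto
  ultimately show ?thesis by (intro continuous_intros) auto
qed

lemma continuous_lg: "continuous_on UNIV (\<lambda>y. lg (ipos T y))"
  by (rule continuous_on_compose2[OF DERIV_continuous_on[OF lg(5)] continuous_ipos]) auto

lemma main_derivative: "(main has_real_derivative lam * (1 - 1 / jac T (ipos T y))) (at y)"
  unfolding main_def[abs_def]
  by (rule DERIV_cong[OF DERIV_add[OF DERIV_const DERIV_cmult[OF DERIV_diff[OF DERIV_ident ipos_T]]]]) simp

text \<open>The bound on the slope of \<open>main\<close> is not small, but the block at frequency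
  \<open>2 ^ n\<close> divides it by \<open>2 ^ n\<close>, which suffices for
  \<open>n \<ge> N\<close>.\<close>

lemma main_bounds: "\<bar>main y\<bar> \<le> T / 4 * a\<^sup>2 + \<bar>lam\<bar> * (c0 * T)" "\<bar>lam * (1 - 1 / jac T (ipos T y))\<bar> \<le> \<bar>lam\<bar>"
proof -
  have "\<bar>y - ipos T y\<bar> \<le> c0 * T"
    using pos_lipschitz_time[OF T_in, of "ipos T y"] T by (simp add: init)
  then have "\<bar>lam * (y - ipos T y)\<bar> \<le> \<bar>lam\<bar> * (c0 * T)" by (intro mult_abs_le) auto
  moreover have "\<bar>T / 4 * a\<^sup>2\<bar> = T / 4 * a\<^sup>2" using T by simp
  ultimately show "\<bar>main y\<bar> \<le> T / 4 * a\<^sup>2 + \<bar>lam\<bar> * (c0 * T)" unfolding main_def by linarith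
  have "\<bar>lam * (1 - 1 / jac T (ipos T y))\<bar> \<le> \<bar>lam\<bar> * 1"
    by (rule mult_abs_le) (use inverse_jac(2)[of "ipos T y"] in \<open>auto simp: abs_minus_commute\<close>)
  then show "\<bar>lam * (1 - 1 / jac T (ipos T y))\<bar> \<le> \<bar>lam\<bar>" by simp
qed

lemma fast_derivative: "(fast has_real_derivative fast' y) (at y)"
  unfolding fast_def[abs_def] fast'_def
  by (rule DERIV_cong[OF DERIV_add[OF DERIV_chain2[OF prim_derivative ipos_T] DERIV_cmult[OF DERIV_chain2[OF osc_derivative ipos_T]]]])
     (simp add: algebra_simps)

lemma fast_bounds: "\<bar>fast y\<bar> \<le> 3 * a / Q" "\<bar>fast' y\<bar> \<le> (e + 3) * 2"
proof -
  have Ta: "0 \<le> T / 2 * a\<^sup>2" "T / 2 * a\<^sup>2 \<le> a" "T / 2 * a\<^sup>2 \<le> 1"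
  proof -
    have "a\<^sup>2 \<le> a" using a by (simp add: power2_eq_square mult_left_le)
    moreover have "T / 2 * a\<^sup>2 \<le> 1 * a\<^sup>2" using T1 by (intro mult_right_mono) auto
    ultimately show "T / 2 * a\<^sup>2 \<le> a" "T / 2 * a\<^sup>2 \<le> 1" using a by linarith+
  qed (use T in simp)
  have "\<bar>T / 2 * a\<^sup>2 * osc (ipos T y)\<bar> \<le> a * (1 / Q)"
    using Ta osc_bounds(1) by (intro mult_abs_le) auto
  moreover have "3 * a / Q = 2 * a / Q + a * (1 / Q)" by simp
  ultimately show "\<bar>fast y\<bar> \<le> 3 * a / Q" using prim_bound[of "ipos T y"] unfolding fast_def by linarith
  have "\<bar>T / 2 * a\<^sup>2 * osc' (ipos T y)\<bar> \<le> 1 * 3"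
    using Ta osc_bounds(2) by (intro mult_abs_le) auto
  then have "\<bar>gam 0 (ipos T y) + T / 2 * a\<^sup>2 * osc' (ipos T y)\<bar> \<le> e + 3"
    using bounds(4)[OF T_in(2), of "ipos T y"] by linarith
  then show "\<bar>fast' y\<bar> \<le> (e + 3) * 2" unfolding fast'_def by (rule mult_abs_le[OF _ inverse_jac(3)])
qed

lemma layer_derivative: "(layer has_real_derivative layer' y) (at y)"
  unfolding layer_def[abs_def] layer'_def
  by (rule DERIV_cong[OF DERIV_cmult[OF DERIV_chain2[OF lg(5) ipos_T]]]) (use \<Delta> in simp)

lemma layer_bounds: "0 \<le> layer' y" "\<bar>layer y\<bar> \<le> 3 * T * a\<^sup>2 / \<Delta>" "layer' y \<le> 3 * T * a\<^sup>2 * 1 * 2"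
proof -
  have c: "0 \<le> 3 * T * a\<^sup>2" "0 \<le> 3 * T * a\<^sup>2 / \<Delta>" using T \<Delta> by auto
  have j: "0 \<le> 1 / jac T (ipos T y)" using bounds(2)[OF T_in(1), of "ipos T y"] by simp
  show "0 \<le> layer' y" unfolding layer'_def by (rule mult_nonneg_nonneg[OF mult_nonneg_nonneg[OF c(1) lg(3)] j])
  have "\<bar>layer y\<bar> \<le> 3 * T * a\<^sup>2 / \<Delta> * 1"
    unfolding layer_def using c lg(1,2)[of "ipos T y"] by (intro mult_abs_le) auto
  then show "\<bar>layer y\<bar> \<le> 3 * T * a\<^sup>2 / \<Delta>" by simp
  have "\<bar>layer' y\<bar> \<le> 3 * T * a\<^sup>2 * 1 * 2"
    unfolding layer'_def
  proof (rule mult_abs_le[OF mult_abs_le inverse_jac(3)])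
    show "\<bar>3 * T * a\<^sup>2\<bar> \<le> 3 * T * a\<^sup>2" using c(1) by simp
    show "\<bar>lg (ipos T y) * (1 - lg (ipos T y))\<bar> \<le> 1" using lg(3,4)[of "ipos T y"] by linarith
  qed
  then show "layer' y \<le> 3 * T * a\<^sup>2 * 1 * 2" by linarith
qed

lemma continuous_parts:
  "continuous_on UNIV fast'" "continuous_on UNIV layer'" "continuous_on UNIV (\<lambda>y. lam * (1 - 1 / jac T (ipos T y)))"
proof -
  have "continuous_on UNIV (\<lambda>y. gam 0 (ipos T y))" "continuous_on UNIV (\<lambda>y. osc' (ipos T y))"
    unfolding gam0_lg osc'_def using Q_pos by (intro continuous_intros continuous_lg continuous_ipos; simp)+
  then show "continuous_on UNIV fast'"
    unfolding fast'_def[abs_def] by (intro continuous_intros continuous_inverse_jac)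
  show "continuous_on UNIV layer'"
    unfolding layer'_def[abs_def] by (intro continuous_intros continuous_inverse_jac continuous_lg)
  show "continuous_on UNIV (\<lambda>y. lam * (1 - 1 / jac T (ipos T y)))"
    by (intro continuous_intros continuous_inverse_jac)
qed

end

section \<open>Besov norms of the datum and of the solution\<close>

locale inflation_blocks = inflation + lp_kernels +
  fixes Km b0 :: real
  assumes Kb: "\<And>x. \<bar>K x\<bar> \<le> Km"
begin

lemma Km_nonneg: "0 \<le> Km"
  using order_trans[OF abs_ge_zero Kb[of 0]] .

lemma sol_0: "sol 0 = gam 0"
proof -
  have "ipos 0 x = x" for x using ipos_pos[OF T_in(2), of x] by (simp add: init(3))
  then show ?thesis by (simp add: sol_def[abs_def])
qed

lemma gam0_derivative_bound: "\<bar>D (gam 0) x\<bar> \<le> 5 * a * Q"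
proof -
  define L where "L = lg x * (1 - lg x)"
  define l where "l = lg x"
  define c where "c = cos (Q * x)"
  define s where "s = sin (Q * x)"
  let ?d = "a * ((0 + \<Delta> * L) * c + (- s * Q) * (1 + l) + ((\<Delta> / Q * ((\<Delta> * L) * (1 - l) + (0 - \<Delta> * L) * l)) * s + (c * Q) * (\<Delta> / Q * L)))"
  have cs: "((\<lambda>x. cos (Q * x)) has_real_derivative - s * Q) (at x)" "((\<lambda>x. sin (Q * x)) has_real_derivative c * Q) (at x)"
    unfolding s_def c_def by (auto intro!: derivative_eq_intros)
  have "(gam 0 has_real_derivative ?d) (at x)"
    unfolding gam0_lg[abs_def] L_def l_def c_def s_def
    by (intro DERIV_cmult DERIV_add DERIV_mult DERIV_diff DERIV_const lg(5) cs[unfolded s_def c_def])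
  moreover have "?d = a * (2 * ((\<Delta> * L) * c) - (Q * (1 + l)) * s + (\<Delta> / Q) * (\<Delta> * L) * ((1 - 2 * l) * s))"
    using Q_pos(1) by (simp add: field_simps)
  ultimately have "D (gam 0) x = a * (2 * ((\<Delta> * L) * c) - (Q * (1 + l)) * s + (\<Delta> / Q) * (\<Delta> * L) * ((1 - 2 * l) * s))"
    unfolding D_def by (simp add: has_real_derivative_iff_has_vector_derivative vector_derivative_at)
  moreover have "\<bar>\<dots>\<bar> \<le> a * (5 * Q)"
  proof (rule mult_abs_le)
    have L: "\<bar>\<Delta> * L\<bar> \<le> Q * 1" using lg(3,4)[of x] \<Delta> unfolding L_def by (intro mult_abs_le) linarith+
    have l: "\<bar>1 + l\<bar> \<le> 2" "\<bar>1 - 2 * l\<bar> \<le> 1" "\<bar>\<Delta> / Q\<bar> \<le> 1" "\<bar>Q\<bar> \<le> Q"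
      using lg(1,2)[of x] Q_pos unfolding l_def by linarith+
    have "\<bar>(\<Delta> * L) * c\<bar> \<le> (Q * 1) * 1" "\<bar>(Q * (1 + l)) * s\<bar> \<le> (Q * 2) * 1"
      "\<bar>(\<Delta> / Q) * (\<Delta> * L) * ((1 - 2 * l) * s)\<bar> \<le> 1 * (Q * 1) * (1 * 1)"
      unfolding c_def s_def by (intro mult_abs_le[OF mult_abs_le mult_abs_le] mult_abs_le[OF L] mult_abs_le[OF mult_abs_le] L l abs_sin_le_one abs_cos_le_one)+
    then show "\<bar>2 * ((\<Delta> * L) * c) - (Q * (1 + l)) * s + (\<Delta> / Q) * (\<Delta> * L) * ((1 - 2 * l) * s)\<bar> \<le> 5 * Q"
      unfolding mult_1_right mult_1_left by linarith
  qed (use a in simp)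
  ultimately show ?thesis by (simp only: mult_ac)
qed

text \<open>The primitive \<open>prim\<close> is at most \<open>2 * a / Q\<close> and the derivative
  of the datum at most \<open>5 * a * Q\<close>, so the estimate for functions concentrated at
  frequency \<open>Q = 2 ^ m\<close> applies with \<open>A = 5 * a\<close>.\<close>

lemma besov_initial:
  assumes "Q = 2 ^ m"
  shows "besov_norm chi phi (sol 0) \<le> ennreal (6 * (k0 + k2 + x1) * (5 * a))"
proof (rule besov_norm_le[OF sol_Cinf[OF T_in(2)]])
  show "(prim has_real_derivative sol 0 x) (at x)" for x unfolding sol_0 by (rule prim_derivative)
  have "2 * a / Q \<le> 5 * a / Q" using a Q_pos by (intro divide_right_mono) auto
  then show "\<bar>prim x\<bar> \<le> 5 * a / 2 ^ m" for x using prim_bound[of x] unfolding assms by linarith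
  show "\<bar>D (sol 0) x\<bar> \<le> 5 * a * 2 ^ m" for x using gam0_derivative_bound[of x] unfolding sol_0 assms .
qed

lemma block_sol_ge:
  "3 / 4 * T * a\<^sup>2 * \<bar>\<kappa> b0\<bar> - (3 * a / Q * k2 * 2 ^ n + \<bar>lam\<bar> * k0 / 2 ^ n + 2 * (3 * T * a\<^sup>2 / \<Delta>) * Km * 2 ^ n
     + (cE * e\<^sup>2 * T\<^sup>2 + 6 * T * a\<^sup>2 * (\<Delta> / Q)) * k1)
   \<le> \<bar>conv (blk (Suc n)) (sol T) (pos T 0 + b0 / 2 ^ n)\<bar>"
proof -
  have "\<bar>3 / 4 * T * a\<^sup>2\<bar> = 3 / 4 * T * a\<^sup>2" using T by simp
  with block_lower_bound[OF sol_Cinf[OF T_in(1)] fast_derivative continuous_parts(1) fast_bounds main_derivative continuous_parts(3) main_bounds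
      layer_derivative continuous_parts(2) layer_bounds sol_decomposition Kb, of b0 n]
  show ?thesis by (simp only:)
qed

text \<open>For the \<open>N\<close> blocks \<open>N \<le> k < 2 * N\<close> and
  \<open>p = 2 ^ N\<close> the frequency \<open>2 ^ k\<close> lies between \<open>p\<close> and
  \<open>p\<^sup>2\<close>, while \<open>\<Delta> = p ^ 3\<close> and \<open>Q = p ^ 6\<close>. Up
  to constants the oscillation contributes at most \<open>p\<^sup>2 / Q\<close>, the slow part
  \<open>1 / p\<close>, the layer \<open>p\<^sup>2 / \<Delta>\<close> and the varying amplitude
  \<open>\<Delta> / Q\<close>, none of them above \<open>1 / p\<close>. The error quadratic in
  \<open>a * T\<close> remains, with \<open>324 = 18\<^sup>2\<close> from
  \<open>e = 18 * a\<close>.\<close>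

lemma besov_sol_ge:
  assumes Q: "Q = 2 ^ (6 * N)" and \<Delta>: "\<Delta> = 2 ^ (3 * N)"
    and c: "c \<le> 3 / 4 * T * a\<^sup>2 * \<bar>\<kappa> b0\<bar> - 324 * cE * k1 * (a\<^sup>2 * T\<^sup>2) - (3 * k2 + \<bar>lam\<bar> * k0 + 6 * Km + 6 * k1) / 2 ^ N"
    and c0: "0 \<le> c"
  shows "ennreal (real N * c) \<le> besov_norm chi phi (sol T)"
proof -
  define p :: real where "p = 2 ^ N"
  have p: "1 \<le> p" "0 < p" by (simp_all add: p_def)
  have Qp: "Q = p ^ 6" "\<Delta> = p ^ 3" by (simp_all add: Q \<Delta> p_def power_mult[symmetric] mult.commute)
  have pp: "x / p ^ Suc k \<le> x / p" if "0 \<le> x" for x k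
    using that p by (intro divide_left_mono) (auto simp: one_le_power)
  have Ta: "0 \<le> T * a\<^sup>2" "T * a\<^sup>2 \<le> 1" using a T T1 mult_mono[of T 1 "a\<^sup>2" 1] by (auto simp: power_le_one)
  have low: "c \<le> \<bar>conv (blk n) (sol T) (pos T 0 + b0 / 2 ^ (n - 1))\<bar>" if n: "n \<in> Suc ` {N..<2 * N}" for n
  proof -
    from n obtain k where k: "n = Suc k" "N \<le> k" "k \<le> 2 * N" by (auto simp del: image_Suc_atLeastLessThan)
    have "(2::real) ^ N \<le> 2 ^ k" "(2::real) ^ k \<le> 2 ^ (2 * N)" using k by (auto intro: power_increasing)
    then have b: "p \<le> 2 ^ k" "2 ^ k \<le> p\<^sup>2" by (simp_all add: p_def power_mult[symmetric] mult.commute)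
    have "3 * a / Q * k2 * 2 ^ k \<le> 3 * 1 / Q * k2 * p\<^sup>2"
      using a b k_nonneg p Q_pos by (intro mult_mono divide_right_mono) auto
    also have "\<dots> = (3 * k2) / p ^ Suc 3" using p by (simp add: Qp field_simps flip: power_Suc power_add)
    also have "\<dots> \<le> 3 * k2 / p" using k_nonneg by (intro pp) auto
    finally have 1: "3 * a / Q * k2 * 2 ^ k \<le> 3 * k2 / p" .
    have 2: "\<bar>lam\<bar> * k0 / 2 ^ k \<le> \<bar>lam\<bar> * k0 / p" using b p k_nonneg by (intro divide_left_mono) auto
    have "2 * (3 * T * a\<^sup>2 / \<Delta>) * Km * 2 ^ k = (T * a\<^sup>2) * (6 / \<Delta> * Km * 2 ^ k)" by simp
    also have "\<dots> \<le> 1 * (6 / \<Delta> * Km * p\<^sup>2)"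
      using Ta b p Km_nonneg by (intro mult_mono) (auto simp: Qp)
    also have "\<dots> = 6 * Km / p" using p by (simp add: Qp field_simps power2_eq_square power3_eq_cube)
    finally have 3: "2 * (3 * T * a\<^sup>2 / \<Delta>) * Km * 2 ^ k \<le> 6 * Km / p" .
    have "6 * T * a\<^sup>2 * (\<Delta> / Q) * k1 = (T * a\<^sup>2) * (6 * k1 / p ^ Suc 2)"
      using p by (simp add: Qp field_simps flip: power_Suc power_add)
    also have "\<dots> \<le> 1 * (6 * k1 / p)" using Ta k_nonneg p by (intro mult_mono pp) auto
    finally have 4: "6 * T * a\<^sup>2 * (\<Delta> / Q) * k1 \<le> 6 * k1 / p" by simp
    have 5: "(cE * e\<^sup>2 * T\<^sup>2 + 6 * T * a\<^sup>2 * (\<Delta> / Q)) * k1 = 324 * cE * k1 * (a\<^sup>2 * T\<^sup>2) + 6 * T * a\<^sup>2 * (\<Delta> / Q) * k1"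
      by (simp add: e_eq algebra_simps)
    have 6: "(3 * k2 + \<bar>lam\<bar> * k0 + 6 * Km + 6 * k1) / 2 ^ N = 3 * k2 / p + \<bar>lam\<bar> * k0 / p + 6 * Km / p + 6 * k1 / p"
      by (simp add: p_def add_divide_distrib)
    have "c \<le> 3 / 4 * T * a\<^sup>2 * \<bar>\<kappa> b0\<bar> - (3 * a / Q * k2 * 2 ^ k + \<bar>lam\<bar> * k0 / 2 ^ k + 2 * (3 * T * a\<^sup>2 / \<Delta>) * Km * 2 ^ k
     + (cE * e\<^sup>2 * T\<^sup>2 + 6 * T * a\<^sup>2 * (\<Delta> / Q)) * k1)"
      using c unfolding 5 6 using 1 2 3 4 by linarith
    also have "\<dots> \<le> \<bar>conv (blk (Suc k)) (sol T) (pos T 0 + b0 / 2 ^ k)\<bar>" by (rule block_sol_ge)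
    finally show ?thesis using k by simp
  qed
  have "ennreal (real (card (Suc ` {N..<2 * N})) * c) \<le> besov_norm chi phi (sol T)"
    by (rule besov_norm_ge[OF sol_Cinf[OF T_in(1)] finite_imageI[OF finite_atLeastLessThan] _ c0]) (erule low)
  then show ?thesis by (simp add: card_image del: image_Suc_atLeastLessThan)
qed

end

theorem theorem1p2:
  fixes lam :: real and chi phi :: "real \<Rightarrow> real"
  assumes "lam \<noteq> 0"
    and "littlewood_paley chi phi"
  shows "\<exists>C>0. \<exists>N0::nat. \<forall>N::nat. N > 10 \<and> N \<ge> N0 \<longrightarrow>
    (\<exists>\<gamma>0 \<in> Cinf.
       besov_norm chi phi \<gamma>0 \<le> ennreal (C * real N powr (- (1 / 10))) \<and>
       (\<exists>T \<gamma>.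
          0 < T \<and> T \<le> real N powr (- (1 / 2)) \<and>
          is_solution lam \<gamma>0 T \<gamma> \<and>
          (\<forall>\<eta>. is_solution lam \<gamma>0 T \<eta> \<longrightarrow> (\<forall>t\<in>{0..T}. \<eta> t = \<gamma> t)) \<and>
          (\<exists>t0\<in>{0..T}. besov_norm chi phi (\<gamma> t0) \<ge> ennreal (ln (real N)))))"
proof -
  obtain \<kappa> K K' X X' b0 where ker:
    "\<And>x. (\<kappa> has_real_derivative K x) (at x)" "\<And>x. (K has_real_derivative K' x) (at x)" "\<And>x. (X has_real_derivative X' x) (at x)"
    "dec \<kappa>" "dec K" "dec K'" "dec X" "dec X'"
    "\<And>x. inverse_fourier (\<lambda>\<xi>. of_real (phi \<xi>)) x = of_real (K x)"
    "\<And>x. inverse_fourier (\<lambda>\<xi>. of_real (chi \<xi>)) x = of_real (X x)" "\<kappa> b0 \<noteq> 0"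
    by (rule kernels_exist[OF assms(2)]) blast
  interpret lp_kernels chi phi \<kappa> K K' X X'
    by unfold_locales (rule assms ker)+
  obtain Km where Km: "\<And>x. \<bar>K x\<bar> \<le> Km" by (rule dec_bounded[OF ker(5)]) blast
  \<comment> \<open>Since \<open>cE\<close> depends on \<open>lam\<close> alone, it is available
    before the solution exists, and the threshold for \<open>N\<close> can be chosen in terms of
    it.\<close>
  define c\<^sub>1 where "c\<^sub>1 = 324 * inflation.cE lam * k1"
  define c\<^sub>2 where "c\<^sub>2 = 3 * k2 + \<bar>lam\<bar> * k0 + 6 * Km + 6 * k1"
  define low where "low N = 3 / 4 * real N powr (- (1 / 2)) * (real N powr (- (1 / 10)))\<^sup>2 * \<bar>\<kappa> b0\<bar>
    - c\<^sub>1 * ((real N powr (- (1 / 10)))\<^sup>2 * (real N powr (- (1 / 2)))\<^sup>2) - c\<^sub>2 / 2 ^ N" for N :: nat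
  have ev: "\<forall>\<^sub>F N in sequentially. 9 * real N powr (- (1 / 10)) \<le> 1"
    "\<forall>\<^sub>F N in sequentially. real N powr (- (1 / 2)) * c \<le> 1 / 4" for c :: real
    by real_asymp+
  \<comment> \<open>After multiplication by \<open>N\<close> the first term is of order
    \<open>N powr (3 / 10)\<close>, the second of order \<open>N powr (- 1 / 5)\<close> and the
    third exponentially small, so the logarithm is overtaken.\<close>
  have "\<forall>\<^sub>F N in sequentially. ln (real N) \<le> real N * (3 / 4 * real N powr (- (1 / 2)) * (real N powr (- (1 / 10)))\<^sup>2 * q
    - c * ((real N powr (- (1 / 10)))\<^sup>2 * (real N powr (- (1 / 2)))\<^sup>2) - c' / 2 ^ N)" if "q > 0" for q c c' :: real
    using that by real_asymp
  then have ev_low: "\<forall>\<^sub>F N in sequentially. ln (real N) \<le> real N * low N"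
    unfolding low_def using ker(11) by simp
  have "\<forall>\<^sub>F N in sequentially. 9 * real N powr (- (1 / 10)) \<le> 1 \<and> real N powr (- (1 / 2)) * cV lam \<le> 1 / 4
      \<and> real N powr (- (1 / 2)) * cL lam \<le> 1 / 4 \<and> ln (real N) \<le> real N * low N"
    by (intro eventually_conj ev ev_low)
  then obtain N0 where N0: "\<And>N. N \<ge> N0 \<Longrightarrow> 9 * real N powr (- (1 / 10)) \<le> 1 \<and> real N powr (- (1 / 2)) * cV lam \<le> 1 / 4
      \<and> real N powr (- (1 / 2)) * cL lam \<le> 1 / 4 \<and> ln (real N) \<le> real N * low N"
    unfolding eventually_sequentially by blast
  \<comment> \<open>The 30 is the 6 of \<open>besov_norm_le\<close> times the 5 of
    \<open>besov_initial\<close>; the added 1 makes \<open>C\<close> positive.\<close>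
  define C where "C = 30 * (k0 + k2 + x1) + 1"
  have "C > 0" using k_nonneg by (simp add: C_def)
  moreover have "\<exists>\<gamma>0 \<in> Cinf.
       besov_norm chi phi \<gamma>0 \<le> ennreal (C * real N powr (- (1 / 10))) \<and>
       (\<exists>T \<gamma>. 0 < T \<and> T \<le> real N powr (- (1 / 2)) \<and> is_solution lam \<gamma>0 T \<gamma> \<and>
          (\<forall>\<eta>. is_solution lam \<gamma>0 T \<eta> \<longrightarrow> (\<forall>t\<in>{0..T}. \<eta> t = \<gamma> t)) \<and>
          (\<exists>t0\<in>{0..T}. besov_norm chi phi (\<gamma> t0) \<ge> ennreal (ln (real N))))"
    if N: "N > 10" "N \<ge> N0" for N :: nat
  proof -
    define a where "a = real N powr (- (1 / 10))"
    define T where "T = real N powr (- (1 / 2))"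
    define Q :: real where "Q = 2 ^ (6 * N)"
    define \<Delta> :: real where "\<Delta> = 2 ^ (3 * N)"
    note N' = N0[OF N(2), folded a_def T_def]
    have aT: "0 < a" "9 * a \<le> 1" "0 < T" "T \<le> 1"
      using N N' powr_mono[of "- (1 / 2)" 0 "real N"] by (auto simp: a_def T_def)
    have Q: "0 < \<Delta>" "\<Delta> \<le> Q" "0 < 1 / Q" by (auto simp: Q_def \<Delta>_def intro: power_increasing)
    obtain J G where JG: "curve (1 / Q) (2 * (9 * a)) (cV lam * (2 * (9 * a))) T J G"
      "\<And>t z. t \<in> {0..T} \<Longrightarrow> z \<in> strip (1 / Q) \<Longrightarrow> J t z = 1 + integral {0..t} (\<lambda>\<tau>. rate_J lam (J \<tau>) (G \<tau>) z)"
      "\<And>t z. t \<in> {0..T} \<Longrightarrow> z \<in> strip (1 / Q) \<Longrightarrow> G t z = wave a \<Delta> Q z + integral {0..t} (\<lambda>\<tau>. rate_G lam (J \<tau>) (G \<tau>) z)"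
    proof (rule lagrangian_solution[OF assms(1) Q(3), of "9 * a" T "wave a \<Delta> Q"])
      show "wave a \<Delta> Q holomorphic_on strip (1 / Q)" "\<And>z. z \<in> strip (1 / Q) \<Longrightarrow> norm (wave a \<Delta> Q z) \<le> 9 * a"
        using wave_strip[OF less_imp_le[OF aT(1)] Q(1,2)] by auto
      show "\<And>x. wave a \<Delta> Q (of_real x) \<in> \<real>" unfolding wave_of_real by (rule Reals_of_real)
    qed (use aT N' in auto)
    interpret inflation_blocks lam "1 / Q" "2 * (9 * a)" "cV lam * (2 * (9 * a))" T J G "wave a \<Delta> Q" a \<Delta> Q chi phi \<kappa> K K' X X' Km b0
      by unfold_locales (use assms(1) Q aT JG Km in auto)
    have lowN: "low N = 3 / 4 * T * a\<^sup>2 * \<bar>\<kappa> b0\<bar> - 324 * cE * k1 * (a\<^sup>2 * T\<^sup>2) - (3 * k2 + \<bar>lam\<bar> * k0 + 6 * Km + 6 * k1) / 2 ^ N"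
      by (simp only: low_def a_def T_def c\<^sub>1_def c\<^sub>2_def)
    have "0 < ln (real N)" using N by simp
    \<comment> \<open>Summing over the blocks requires a nonnegative bound for each of them;
      positivity of the logarithm supplies it.\<close>
    then have "0 < real N * low N" using N' by linarith
    then have "0 \<le> low N" by (simp add: zero_less_mult_iff)
    from besov_sol_ge[OF Q_def \<Delta>_def eq_refl[OF lowN] this]
    have low: "ennreal (ln (real N)) \<le> besov_norm chi phi (sol T)"
      by (rule order_trans[rotated]) (use N' in \<open>simp add: ennreal_leI\<close>)
    have "30 * (k0 + k2 + x1) * a \<le> C * a" using aT by (intro mult_right_mono) (auto simp: C_def)
    then have "besov_norm chi phi (sol 0) \<le> ennreal (C * a)"
      using order_trans[OF besov_initial[OF Q_def] ennreal_leI] by (simp add: mult_ac)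
    then show ?thesis
      using sol_Cinf[OF T_in(2)] aT sol_solution uniqueness low T_in(1) unfolding a_def[symmetric] T_def[symmetric] by blast
  qed
  ultimately show ?thesis by blast
qed

end
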